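(* $V_{\tilde{\mathcal{A}}}$ is an irreducible quantum vertex algebra; that is, $V_{\tilde{\mathcal{A}}}$ is a quantum vertex algebra and is irreducible as a module over itself.
   Context: All spaces are over $\mathbb{C}$; $\delta(z)=\sum_{n\in\mathbb{Z}}z^n$; expressions $(x_1-x_2)^n$ are expanded in nonnegative powers of the second variable. Construction of $V_{\tilde{\mathcal{A}}}$: let $T$ be the free unital associative algebra on $\bar{Y}_n,\bar{Y}_n^{*}$ ($n\in\mathbb{Z}$), $T_+$ the span of the words $a^{(1)}_{n_1}\cdots a^{(r)}_{n_r}$ with $r\ge1$, $a^{(i)}\in\{\bar{Y},\bar{Y}^{*}\}$, $n_1+\cdots+n_r\ge0$, and $V_T=T/TT_+$, a left $T$-module on each vector of which $\bar{Y}_n,\bar{Y}^{*}_n$ vanish for $n$ large. $V_{\tilde{\mathcal{A}}}$ is the quotient $T$-module of $V_T$ by the following relations imposed on all vectors, where $\tilde{Y}_n,\tilde{Y}_n^{*}$ denote the actions of $\bar{Y}_n,\bar{Y}_n^{*}$, $m,n\in\mathbb{Z}$: $$\tilde{Y}_{m}\tilde{Y}_{n}+\sum_{k,i\ge0}\tfrac{1}{k!}\tbinom{k}{i}(-1)^{i}\tilde{Y}_{n+k-i}\tilde{Y}_{m+i}=0,\quad \tilde{Y}^{*}_{m}\tilde{Y}^{*}_{n}+\sum_{k,i\ge0}\tfrac{1}{k!}\tbinom{k}{i}(-1)^{i}\tilde{Y}^{*}_{n+k-i}\tilde{Y}^{*}_{m+i}=0,$$ $$\tilde{Y}_{m}\tilde{Y}^{*}_{n}+\sum_{k,i\ge0}\tfrac{1}{k!}\tbinom{k}{i}(-1)^{i}\tilde{Y}^{*}_{n+i}\tilde{Y}_{m+k-i}=\delta_{m+n+1,0}.$$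 With $\tilde{Y}(z)=\sum_n\tilde{Y}_nz^{-n-1}$, $\tilde{Y}^{*}(z)=\sum_n\tilde{Y}_n^{*}z^{-n-1}$ these say $\tilde{Y}(z)\tilde{Y}(w)+e^{w-z}\tilde{Y}(w)\tilde{Y}(z)=0$, $\tilde{Y}^{*}(z)\tilde{Y}^{*}(w)+e^{w-z}\tilde{Y}^{*}(w)\tilde{Y}^{*}(z)=0$, $\tilde{Y}(z)\tilde{Y}^{*}(w)+e^{z-w}\tilde{Y}^{*}(w)\tilde{Y}(z)=w^{-1}\delta(z/w)$. Let ${\bf 1}$ be the image of $1$, $\tilde{a}=\tilde{Y}_{-1}{\bf 1}$, $\tilde{b}=\tilde{Y}_{-1}^{*}{\bf 1}$. There is a weak quantum vertex algebra structure on $V_{\tilde{\mathcal{A}}}$, uniquely determined by the condition that ${\bf 1}$ is the vacuum vector and $Y(\tilde{a},z)=\tilde{Y}(z)$, $Y(\tilde{b},z)=\tilde{Y}^{*}(z)$; this is the structure considered. A weak quantum vertex algebra is a vector space $V$ with a linear map $Y(\cdot,x):V\to\mathrm{Hom}(V,V((x)))$, $v\mapsto Y(v,x)=\sum_nv_nx^{-n-1}$, and a vector ${\bf 1}\in V$ such that $Y({\bf 1},x)v=v$, $Y(v,x){\bf 1}\in V[[x]]$, $\lim_{x\to0}Y(v,x){\bf 1}=v$ for $v\in V$, and for $u,v\in V$ there exists $\sum_{i=1}^rv^{(i)}\otimes u^{(i)}\otimes f_i(x)\in V\otimes V\otimes\mathbb{C}((x))$ with $$(\ast)\quad x_0^{-1}\delta\left(\tfrac{x_1-x_2}{x_0}\right)Y(u,x_1)Y(v,x_2)-x_0^{-1}\delta\left(\tfrac{x_2-x_1}{-x_0}\right)\sum_{i=1}^rf_i(-x_0)Y(v^{(i)},x_2)Y(u^{(i)},x_1)=x_2^{-1}\delta\left(\tfrac{x_1-x_0}{x_2}\right)Y(Y(u,x_0)v,x_2).$$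 A rational quantum Yang-Baxter operator on a vector space $U$ is a linear map $S(x):U\otimes U\to U\otimes U\otimes\mathbb{C}((x))$ with $S^{12}(x)S^{13}(x+z)S^{23}(z)=S^{23}(z)S^{13}(x+z)S^{12}(x)$ (where $S^{ij}(x):U^{\otimes3}\to U^{\otimes3}\otimes\mathbb{C}((x))$ are the canonical extensions); it is unitary if $S(x)S^{21}(-x)=1$, where $S^{21}(x)=\sigma S(x)\sigma$ with $\sigma$ the flip on $U\otimes U$. A quantum vertex algebra is a weak quantum vertex algebra $V$ equipped with a unitary rational quantum Yang-Baxter operator $S(x)$ on $V$ such that for $u,v\in V$, $(\ast)$ holds with $\sum_iv^{(i)}\otimes u^{(i)}\otimes f_i(x)=S(x)(v\otimes u)$. $V$ is irreducible as a module over itself if the only subspaces stable under all $v_n$ ($v\in V$, $n\in\mathbb{Z}$) are $0$ and $V\neq0$. *)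

theory Defs
  imports
    Complex_Main
    "HOL-Library.Poly_Mapping"
    "HOL-Computational_Algebra.Formal_Laurent_Series"
begin

notation fls_nth (infixl \<open>$$\<close> 75)

section \<open>Complex vector spaces\<close>

class complex_vector = ab_group_add +
  fixes scaleC :: "complex \<Rightarrow> 'a \<Rightarrow> 'a"  (infixr \<open>*\<^sub>C\<close> 75)
  assumes scaleC_add_right: "a *\<^sub>C (x + y) = a *\<^sub>C x + a *\<^sub>C y"
    and scaleC_add_left: "(a + b) *\<^sub>C x = a *\<^sub>C x + b *\<^sub>C x"
    and scaleC_scaleC: "a *\<^sub>C b *\<^sub>C x = (a * b) *\<^sub>C x"
    and scaleC_one: "1 *\<^sub>C x = x"

global_interpretation complex_vector:
    vector_space "scaleC :: complex \<Rightarrow> 'a \<Rightarrow> 'a :: complex_vector"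
  by unfold_locales (simp_all add: scaleC_add_right scaleC_add_left scaleC_scaleC scaleC_one)

abbreviation clinear :: "('a::complex_vector \<Rightarrow> 'b::complex_vector) \<Rightarrow> bool"
  where "clinear \<equiv> Vector_Spaces.linear scaleC scaleC"

instantiation complex :: complex_vector
begin
definition scaleC_complex :: "complex \<Rightarrow> complex \<Rightarrow> complex"
  where "scaleC_complex c x = c * x"
instance
  by standard (simp_all add: scaleC_complex_def algebra_simps)
end

instantiation poly_mapping :: (type, complex_vector) complex_vector
begin
lift_definition scaleC_poly_mapping :: "complex \<Rightarrow> ('a \<Rightarrow>\<^sub>0 'b) \<Rightarrow> ('a \<Rightarrow>\<^sub>0 'b)"
  is "\<lambda>c f k. c *\<^sub>C f k"
  by (erule rev_finite_subset) auto
instance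
  by standard (transfer; simp add: fun_eq_iff complex_vector.scale_right_distrib
      complex_vector.scale_left_distrib)+
end

lemma lookup_scaleC: "Poly_Mapping.lookup (c *\<^sub>C p) k = c *\<^sub>C Poly_Mapping.lookup p k"
  by transfer simp

instantiation fls :: (complex_vector) complex_vector
begin
definition scaleC_fls :: "complex \<Rightarrow> 'a fls \<Rightarrow> 'a fls"
  where "scaleC_fls c f = Abs_fls (\<lambda>n. c *\<^sub>C (f $$ n))"
lemma scaleC_fls_nth [simp]: "(c *\<^sub>C f) $$ n = c *\<^sub>C (f $$ n)" for f :: "'a fls"
proof -
  have "\<forall>\<^sub>\<infinity>n::nat. c *\<^sub>C (f $$ (- int n)) = 0"
    using MOST_fls_neg_nth_eq_0[of f] by (rule MOST_mono) simp
  then show ?thesis by (simp add: scaleC_fls_def)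
qed
instance
  by standard (simp_all add: fls_eq_iff complex_vector.scale_right_distrib
      complex_vector.scale_left_distrib)
end


section \<open>Tensor products\<close>

text \<open>The free vector space on pairs modulo the bilinearity relations.\<close>

definition pair_gen :: "'a \<Rightarrow> 'b \<Rightarrow> ('a \<times> 'b) \<Rightarrow>\<^sub>0 complex"
  where "pair_gen a b = Poly_Mapping.single (a, b) 1"

definition bilinearity_relations ::
    "(('a::complex_vector \<times> 'b::complex_vector) \<Rightarrow>\<^sub>0 complex) set" where
  "bilinearity_relations =
     {pair_gen (a + a') b - pair_gen a b - pair_gen a' b | a a' b. True}
   \<union> {pair_gen a (b + b') - pair_gen a b - pair_gen a b' | a b b'. True}
   \<union> {pair_gen (c *\<^sub>C a) b - c *\<^sub>C pair_gen a b | c a b. True}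
   \<union> {pair_gen a (c *\<^sub>C b) - c *\<^sub>C pair_gen a b | c a b. True}"

definition tensor_rel :: "(('a::complex_vector \<times> 'b::complex_vector) \<Rightarrow>\<^sub>0 complex) \<Rightarrow>
    (('a \<times> 'b) \<Rightarrow>\<^sub>0 complex) \<Rightarrow> bool"
  where "tensor_rel x y \<longleftrightarrow> x - y \<in> complex_vector.span bilinearity_relations"

lemma equivp_diff_in_span: "equivp (\<lambda>x y :: 'a::complex_vector. x - y \<in> complex_vector.span R)"
proof (rule equivpI)
  show "reflp (\<lambda>x y. x - y \<in> complex_vector.span R)"
    by (rule reflpI) (simp add: complex_vector.span_zero)
  show "symp (\<lambda>x y. x - y \<in> complex_vector.span R)"
  proof (rule sympI)
    fix x y :: 'a
    assume "x - y \<in> complex_vector.span R"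
    then have "- (x - y) \<in> complex_vector.span R" by (rule complex_vector.span_neg)
    then show "y - x \<in> complex_vector.span R" by simp
  qed
  show "transp (\<lambda>x y. x - y \<in> complex_vector.span R)"
  proof (rule transpI)
    fix x y z :: 'a
    assume "x - y \<in> complex_vector.span R" "y - z \<in> complex_vector.span R"
    then have "(x - y) + (y - z) \<in> complex_vector.span R" by (rule complex_vector.span_add)
    then show "x - z \<in> complex_vector.span R" by simp
  qed
qed

lemma span_diff_add:
  assumes "x - x' \<in> complex_vector.span R" "y - y' \<in> complex_vector.span R"
  shows "(x + y) - (x' + y') \<in> complex_vector.span R"
proof -
  have "(x + y) - (x' + y') = (x - x') + (y - y')" by simp
  then show ?thesis using complex_vector.span_add[OF assms] by (simp only:)
qed

lemma span_diff_diff: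
  assumes "x - x' \<in> complex_vector.span R" "y - y' \<in> complex_vector.span R"
  shows "(x - y) - (x' - y') \<in> complex_vector.span R"
proof -
  have "(x - y) - (x' - y') = (x - x') - (y - y')" by simp
  then show ?thesis using complex_vector.span_diff[OF assms] by (simp only:)
qed

lemma span_diff_uminus:
  assumes "x - x' \<in> complex_vector.span R"
  shows "(- x) - (- x') \<in> complex_vector.span R"
proof -
  have "(- x) - (- x') = - (x - x')" by simp
  then show ?thesis using complex_vector.span_neg[OF assms] by (simp only:)
qed

lemma span_diff_scaleC:
  assumes "x - x' \<in> complex_vector.span R"
  shows "c *\<^sub>C x - c *\<^sub>C x' \<in> complex_vector.span R"
  using complex_vector.span_scale[OF assms, of c]
  by (simp add: complex_vector.scale_right_diff_distrib)

quotient_type (overloaded) ('a, 'b) tensor =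
    "('a::complex_vector \<times> 'b::complex_vector) \<Rightarrow>\<^sub>0 complex" / tensor_rel
  morphisms rep_tensor abs_tensor
  unfolding tensor_rel_def[abs_def] by (rule equivp_diff_in_span)

instantiation tensor :: (complex_vector, complex_vector) complex_vector
begin
lift_definition zero_tensor :: "('a, 'b) tensor" is 0 .
lift_definition plus_tensor :: "('a, 'b) tensor \<Rightarrow> ('a, 'b) tensor \<Rightarrow> ('a, 'b) tensor" is "(+)"
  unfolding tensor_rel_def by (rule span_diff_add)
lift_definition minus_tensor :: "('a, 'b) tensor \<Rightarrow> ('a, 'b) tensor \<Rightarrow> ('a, 'b) tensor" is "(-)"
  unfolding tensor_rel_def by (rule span_diff_diff)
lift_definition uminus_tensor :: "('a, 'b) tensor \<Rightarrow> ('a, 'b) tensor" is "uminus"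
  unfolding tensor_rel_def by (rule span_diff_uminus)
lift_definition scaleC_tensor :: "complex \<Rightarrow> ('a, 'b) tensor \<Rightarrow> ('a, 'b) tensor" is "scaleC"
  unfolding tensor_rel_def by (rule span_diff_scaleC)
instance
  by standard (transfer; simp add: tensor_rel_def complex_vector.span_zero algebra_simps
      complex_vector.scale_right_distrib complex_vector.scale_left_distrib)+
end

lift_definition tensor :: "'a::complex_vector \<Rightarrow> 'b::complex_vector \<Rightarrow> ('a, 'b) tensor"
  (infixr \<open>\<otimes>\<^sub>t\<close> 70) is pair_gen .

text \<open>
  The linear map \<^term>\<open>tensor_lift f\<close> induced by a bilinear map \<open>f\<close>.  It is computed on a
  chosen representative, which is harmless only because \<open>f\<close> is bilinear wherever it is used.
\<close>

definition free_lift :: "('a \<Rightarrow> 'b \<Rightarrow> 'c::complex_vector) \<Rightarrow> (('a \<times> 'b) \<Rightarrow>\<^sub>0 complex) \<Rightarrow> 'c"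
  where "free_lift f p =
    (\<Sum>ab\<in>Poly_Mapping.keys p. Poly_Mapping.lookup p ab *\<^sub>C f (fst ab) (snd ab))"

definition tensor_lift ::
    "('a::complex_vector \<Rightarrow> 'b::complex_vector \<Rightarrow> 'c::complex_vector) \<Rightarrow> ('a, 'b) tensor \<Rightarrow> 'c"
  where "tensor_lift f t = free_lift f (rep_tensor t)"

definition cbilinear ::
    "('a::complex_vector \<Rightarrow> 'b::complex_vector \<Rightarrow> 'c::complex_vector) \<Rightarrow> bool"
  where "cbilinear f \<longleftrightarrow> (\<forall>a. clinear (f a)) \<and> (\<forall>b. clinear (\<lambda>a. f a b))"

lemma clinearI:
  assumes "\<And>x y. f (x + y) = f x + f y" "\<And>c x. f (c *\<^sub>C x) = c *\<^sub>C f x"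
  shows "clinear f"
  by unfold_locales (use assms in auto)

lemma free_lift_superset:
  assumes "finite A" "Poly_Mapping.keys p \<subseteq> A"
  shows "free_lift f p = (\<Sum>ab\<in>A. Poly_Mapping.lookup p ab *\<^sub>C f (fst ab) (snd ab))"
  unfolding free_lift_def
  by (rule sum.mono_neutral_left) (use assms in \<open>auto simp: in_keys_iff\<close>)

lemma clinear_free_lift: "clinear (free_lift f)"
proof (rule clinearI)
  fix p q :: "('a \<times> 'b) \<Rightarrow>\<^sub>0 complex" and c
  let ?A = "Poly_Mapping.keys p \<union> Poly_Mapping.keys q"
  have "Poly_Mapping.keys (p + q) \<subseteq> ?A" by (rule keys_add)
  then show "free_lift f (p + q) = free_lift f p + free_lift f q"
    by (simp add: free_lift_superset[of ?A] lookup_add complex_vector.scale_left_distrib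
        sum.distrib)
  have "Poly_Mapping.keys (c *\<^sub>C p) \<subseteq> Poly_Mapping.keys p"
    by (auto simp: in_keys_iff lookup_scaleC)
  then show "free_lift f (c *\<^sub>C p) = c *\<^sub>C free_lift f p"
    by (simp add: free_lift_superset[of "Poly_Mapping.keys p"] lookup_scaleC
        complex_vector.scale_sum_right scaleC_complex_def)
qed

lemma free_lift_pair_gen [simp]: "free_lift f (pair_gen a b) = f a b"
  by (simp add: free_lift_def pair_gen_def)

lemma free_lift_cong_tensor_rel:
  assumes f: "cbilinear f" and "tensor_rel p q"
  shows "free_lift f p = free_lift f q"
proof -
  interpret L: Vector_Spaces.linear scaleC scaleC "free_lift f" by (rule clinear_free_lift)
  have lin1: "Vector_Spaces.linear scaleC scaleC (f a)" for a
    using f by (simp add: cbilinear_def)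
  have lin2: "Vector_Spaces.linear scaleC scaleC (\<lambda>a. f a b)" for b
    using f by (simp add: cbilinear_def)
  note add1 = module_hom.add[OF Vector_Spaces.linear.axioms(3)[OF lin1]]
    and scale1 = module_hom.scale[OF Vector_Spaces.linear.axioms(3)[OF lin1]]
    and add2 = module_hom.add[OF Vector_Spaces.linear.axioms(3)[OF lin2]]
    and scale2 = module_hom.scale[OF Vector_Spaces.linear.axioms(3)[OF lin2]]
  have "free_lift f r = 0" if "r \<in> bilinearity_relations" for r
    using that by (auto simp: bilinearity_relations_def L.diff L.scale add1 add2 scale1 scale2)
  then have "free_lift f r = 0" if "r \<in> complex_vector.span bilinearity_relations" for r
    using L.eq_0_on_span that by blast
  with \<open>tensor_rel p q\<close> have "free_lift f (p - q) = 0" by (simp add: tensor_rel_def)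
  then show ?thesis by (simp add: L.diff)
qed

lemma tensor_lift_abs:
  assumes "cbilinear f"
  shows "tensor_lift f (abs_tensor p) = free_lift f p"
proof -
  have "tensor_rel (rep_tensor (abs_tensor p)) p"
    using Quotient3_abs_rep[OF Quotient3_tensor, of "abs_tensor p"]
    by (simp add: tensor.abs_eq_iff)
  then show ?thesis
    unfolding tensor_lift_def by (rule free_lift_cong_tensor_rel[OF assms])
qed

lemma tensor_lift_tensor:
  assumes "cbilinear f"
  shows "tensor_lift f (a \<otimes>\<^sub>t b) = f a b"
  by (simp add: tensor.abs_eq tensor_lift_abs[OF assms])

lemma clinear_tensor_lift:
  assumes "cbilinear f"
  shows "clinear (tensor_lift f)"
proof (rule clinearI)
  interpret L: Vector_Spaces.linear scaleC scaleC "free_lift f" by (rule clinear_free_lift)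
  fix s t :: "('a, 'b) tensor" and c
  obtain p q where s: "s = abs_tensor p" and t: "t = abs_tensor q"
    by (metis Quotient3_abs_rep Quotient3_tensor)
  show "tensor_lift f (s + t) = tensor_lift f s + tensor_lift f t"
    unfolding s t plus_tensor.abs_eq tensor_lift_abs[OF assms] by (rule L.add)
  show "tensor_lift f (c *\<^sub>C s) = c *\<^sub>C tensor_lift f s"
    unfolding s scaleC_tensor.abs_eq tensor_lift_abs[OF assms] by (rule L.scale)
qed


section \<open>Weak quantum vertex algebras\<close>

text \<open>
  A formal distribution in \<open>x\<^sub>0, x\<^sub>1, x\<^sub>2\<close> is its coefficient function: \<open>(a, b, c)\<close> is sent to
  the coefficient of \<open>x\<^sub>0\<^sup>a x\<^sub>1\<^sup>b x\<^sub>2\<^sup>c\<close>.  In the products formed below every coefficient is a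
  finite sum.
\<close>

type_synonym 'a dist3 = "int \<times> int \<times> int \<Rightarrow> 'a"

definition dist_mult :: "complex dist3 \<Rightarrow> 'v::complex_vector dist3 \<Rightarrow> 'v dist3" where
  "dist_mult A B = (\<lambda>(a, b, c). Sum_any (\<lambda>(i, j, k). A (i, j, k) *\<^sub>C B (a - i, b - j, c - k)))"

text \<open>Coefficient of \<open>s\<^sup>p t\<^sup>q\<close> in \<open>(s - t)\<^sup>n\<close>, expanded in nonnegative powers of \<open>t\<close>.\<close>

definition diff_pow :: "int \<Rightarrow> int \<Rightarrow> int \<Rightarrow> complex" where
  "diff_pow n p q =
    (if 0 \<le> q \<and> p + q = n then (- 1) ^ nat q * (of_int n gchoose nat q) else 0)"

text \<open>
  \<open>x\<^sub>0\<^sup>-\<^sup>1 \<delta>((x\<^sub>1 - x\<^sub>2)/x\<^sub>0)\<close>, \<open>x\<^sub>0\<^sup>-\<^sup>1 \<delta>((x\<^sub>2 - x\<^sub>1)/(-x\<^sub>0))\<close> and \<open>x\<^sub>2\<^sup>-\<^sup>1 \<delta>((x\<^sub>1 - x\<^sub>0)/x\<^sub>2)\<close>.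
\<close>

definition delta_12_0 :: "complex dist3"
  where "delta_12_0 = (\<lambda>(a, b, c). diff_pow (- a - 1) b c)"

definition delta_21_0 :: "complex dist3"
  where "delta_21_0 = (\<lambda>(a, b, c). (- 1) powi (- a - 1) * diff_pow (- a - 1) c b)"

definition delta_10_2 :: "complex dist3"
  where "delta_10_2 = (\<lambda>(a, b, c). diff_pow (- c - 1) b a)"

text \<open>\<open>f(-x)\<close> for \<open>f(x) \<in> \<complex>((x))\<close>.\<close>

definition fls_reflect :: "complex fls \<Rightarrow> complex fls"
  where "fls_reflect f = Abs_fls (\<lambda>n. (- 1) powi n * f $$ n)"

lemma fls_reflect_nth [simp]: "fls_reflect f $$ n = (- 1) powi n * f $$ n"
proof -
  have "\<forall>\<^sub>\<infinity>n::nat. (- 1) powi (- int n) * f $$ (- int n) = 0"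
    using MOST_fls_neg_nth_eq_0[of f] by (rule MOST_mono) simp
  then show ?thesis by (simp add: fls_reflect_def)
qed

text \<open>
  A vertex operator map is given by its modes: \<open>Y v n\<close> is \<open>v\<^sub>n\<close>, where
  \<open>Y(v, x) = \<Sum>\<^sub>n v\<^sub>n x\<^sup>-\<^sup>n\<^sup>-\<^sup>1\<close>; so the coefficient of \<open>x\<^sup>b\<close> in \<open>Y(v, x)\<close> is \<open>v\<close> with mode \<open>-b-1\<close>.
  A list of triples \<open>(v\<^sup>i, u\<^sup>i, f\<^sub>i)\<close> stands for \<open>\<Sum>\<^sub>i v\<^sup>i \<otimes> u\<^sup>i \<otimes> f\<^sub>i(x)\<close>; identities between
  operators are stated on each vector \<open>w\<close>.
\<close>

definition S_jacobi_identity :: "('v::complex_vector \<Rightarrow> int \<Rightarrow> 'v \<Rightarrow> 'v) \<Rightarrow> 'v \<Rightarrow> 'v \<Rightarrow>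
    ('v \<times> 'v \<times> complex fls) list \<Rightarrow> bool" where
  "S_jacobi_identity Y u v vufs \<longleftrightarrow> (\<forall>w a b c.
     dist_mult delta_12_0
       (\<lambda>(a, b, c). if a = 0 then Y u (- b - 1) (Y v (- c - 1) w) else 0) (a, b, c)
     - dist_mult delta_21_0
       (\<lambda>(a, b, c). \<Sum>(v', u', f)\<leftarrow>vufs.
          (fls_reflect f $$ a) *\<^sub>C Y v' (- c - 1) (Y u' (- b - 1) w)) (a, b, c)
     = dist_mult delta_10_2
       (\<lambda>(a, b, c). if b = 0 then Y (Y u (- a - 1) v) (- c - 1) w else 0) (a, b, c))"

locale weak_quantum_vertex_algebra =
  fixes Y :: "'v::complex_vector \<Rightarrow> int \<Rightarrow> 'v \<Rightarrow> 'v" and vac :: 'v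
  assumes linear_state: "clinear (\<lambda>u. Y u n v)"
    and linear_mode: "clinear (Y u n)"
    and lower_truncation: "\<exists>N. \<forall>n\<ge>N. Y u n v = 0"
    and vacuum: "Y vac n v = (if n = - 1 then v else 0)"
    and creation_regular: "n \<ge> 0 \<Longrightarrow> Y v n vac = 0"
    and creation: "Y v (- 1) vac = v"
    and S_jacobi: "\<exists>vufs. S_jacobi_identity Y u v vufs"


section \<open>Quantum Yang--Baxter operators and quantum vertex algebras\<close>

text \<open>
  \<open>\<complex>((x))((z))\<close> is \<^typ>\<open>complex fls fls\<close>, the outer variable being \<open>z\<close>.  The three maps below
  send \<open>f(x)\<close> to \<open>f(x)\<close>, \<open>f(z)\<close> and \<open>f(x + z)\<close> respectively, the last one being expanded in
  nonnegative powers of \<open>z\<close>.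
\<close>

definition fls_in_x :: "complex fls \<Rightarrow> complex fls fls"
  where "fls_in_x f = fls_const f"

definition fls_in_z :: "complex fls \<Rightarrow> complex fls fls"
  where "fls_in_z f = Abs_fls (\<lambda>n. fls_const (f $$ n))"

definition fls_in_x_plus_z :: "complex fls \<Rightarrow> complex fls fls"
  where "fls_in_x_plus_z f = fps_to_fls (Abs_fps (\<lambda>j.
    Abs_fls (\<lambda>m. (of_int (m + int j) gchoose j) * f $$ (m + int j))))"

lemma fls_in_x_nth: "fls_in_x f $$ j $$ m = (if j = 0 then f $$ m else 0)"
  by (simp add: fls_in_x_def)

lemma fls_in_z_nth: "fls_in_z f $$ j $$ m = (if m = 0 then f $$ j else 0)"
proof -
  have "\<forall>\<^sub>\<infinity>n::nat. fls_const (f $$ (- int n)) = 0"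
    using MOST_fls_neg_nth_eq_0[of f] by (rule MOST_mono) simp
  then show ?thesis by (simp add: fls_in_z_def)
qed

lemma fls_in_x_plus_z_nth:
  "fls_in_x_plus_z f $$ j $$ m =
    (if j < 0 then 0 else (of_int (m + j) gchoose nat j) * f $$ (m + j))"
proof -
  obtain N where N: "\<forall>n<N. f $$ n = 0" by (rule fls_nth_vanishes_belowE)
  have "\<exists>M. \<forall>m<M. (of_int (m + int i) gchoose i :: complex) * f $$ (m + int i) = 0" for i
    by (rule exI[of _ "N - int i"]) (use N in auto)
  from nth_Abs_fls_ex_lower_bound[OF this[of "nat j"]] show ?thesis
    by (cases "j < 0") (simp_all add: fls_in_x_plus_z_def)
qed

text \<open>
  For \<open>S(x) : W \<rightarrow> W \<otimes> \<complex>((x))\<close> and an algebra map \<open>\<phi> : \<complex>((x)) \<rightarrow> K\<close>, the \<open>K\<close>-linear operator on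
  \<open>W \<otimes> K\<close> obtained by substituting along \<open>\<phi>\<close>.
\<close>

definition series_op :: "(complex fls \<Rightarrow> 'k::{complex_vector, comm_ring_1}) \<Rightarrow>
    ('w::complex_vector \<Rightarrow> ('w, complex fls) tensor) \<Rightarrow> ('w, 'k) tensor \<Rightarrow> ('w, 'k) tensor" where
  "series_op \<phi> S =
    tensor_lift (\<lambda>w g. tensor_lift (\<lambda>w' f. w' \<otimes>\<^sub>t (\<phi> f * g)) (S w))"

definition flip :: "('u::complex_vector, 'u) tensor \<Rightarrow> ('u, 'u) tensor"
  where "flip = tensor_lift (\<lambda>u v. v \<otimes>\<^sub>t u)"

text \<open>\<open>U \<otimes> U \<otimes> U\<close> is bracketed to the right.\<close>

type_synonym 'u tensor3 = "('u, ('u, 'u) tensor) tensor"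

type_synonym 'u rational_op = "('u, 'u) tensor \<Rightarrow> (('u, 'u) tensor, complex fls) tensor"

definition op21 :: "'u::complex_vector rational_op \<Rightarrow> 'u rational_op" where
  "op21 S t = tensor_lift (\<lambda>ab f. flip ab \<otimes>\<^sub>t f) (S (flip t))"

definition op12 :: "'u::complex_vector rational_op \<Rightarrow>
    'u tensor3 \<Rightarrow> ('u tensor3, complex fls) tensor" where
  "op12 S = tensor_lift (\<lambda>u. tensor_lift (\<lambda>v w.
     tensor_lift (\<lambda>ab f. tensor_lift (\<lambda>a b. a \<otimes>\<^sub>t (b \<otimes>\<^sub>t w)) ab \<otimes>\<^sub>t f) (S (u \<otimes>\<^sub>t v))))"

definition op13 :: "'u::complex_vector rational_op \<Rightarrow>
    'u tensor3 \<Rightarrow> ('u tensor3, complex fls) tensor" where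
  "op13 S = tensor_lift (\<lambda>u. tensor_lift (\<lambda>v w.
     tensor_lift (\<lambda>ac f. tensor_lift (\<lambda>a c. a \<otimes>\<^sub>t (v \<otimes>\<^sub>t c)) ac \<otimes>\<^sub>t f) (S (u \<otimes>\<^sub>t w))))"

definition op23 :: "'u::complex_vector rational_op \<Rightarrow>
    'u tensor3 \<Rightarrow> ('u tensor3, complex fls) tensor" where
  "op23 S = tensor_lift (\<lambda>u vw. tensor_lift (\<lambda>bc f. (u \<otimes>\<^sub>t bc) \<otimes>\<^sub>t f) (S vw))"

definition rational_quantum_Yang_Baxter_operator :: "'u::complex_vector rational_op \<Rightarrow> bool" where
  "rational_quantum_Yang_Baxter_operator S \<longleftrightarrow> clinear S \<and>
     series_op fls_in_x (op12 S) \<circ> series_op fls_in_x_plus_z (op13 S) \<circ> series_op fls_in_z (op23 S)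
   = series_op fls_in_z (op23 S) \<circ> series_op fls_in_x_plus_z (op13 S) \<circ> series_op fls_in_x (op12 S)"

definition unitary_op :: "'u::complex_vector rational_op \<Rightarrow> bool" where
  "unitary_op S \<longleftrightarrow> series_op (\<lambda>f. f) S \<circ> series_op fls_reflect (op21 S) = id"

locale quantum_vertex_algebra = weak_quantum_vertex_algebra Y vac
  for Y :: "'v::complex_vector \<Rightarrow> int \<Rightarrow> 'v \<Rightarrow> 'v" and vac :: 'v +
  fixes S :: "'v rational_op"
  assumes Yang_Baxter: "rational_quantum_Yang_Baxter_operator S"
    and unitary: "unitary_op S"
    and S_jacobi_S: "\<exists>vufs. S (v \<otimes>\<^sub>t u) = (\<Sum>(v', u', f)\<leftarrow>vufs. (v' \<otimes>\<^sub>t u') \<otimes>\<^sub>t f) \<and>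
           S_jacobi_identity Y u v vufs"

definition irreducible_over_itself :: "('v::complex_vector \<Rightarrow> int \<Rightarrow> 'v \<Rightarrow> 'v) \<Rightarrow> bool" where
  "irreducible_over_itself Y \<longleftrightarrow> (UNIV :: 'v set) \<noteq> {0} \<and>
     (\<forall>W. complex_vector.subspace W \<and> (\<forall>v n. \<forall>w\<in>W. Y v n w \<in> W) \<longrightarrow> W = {0} \<or> W = UNIV)"


section \<open>The free algebra $T$ and the module $V_T$\<close>

datatype gen = Y_gen | Ystar_gen

text \<open>A wrapper around lists, so that concatenation can serve as the addition of a monoid.\<close>

datatype word = Word (letters: "(gen \<times> int) list")

instantiation word :: monoid_add
begin
definition "0 = Word []"
definition "w + w' = Word (letters w @ letters w')"
instance by standard (simp_all add: zero_word_def plus_word_def)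
end

text \<open>As an algebra, \<open>T\<close> is the monoid algebra of the words.\<close>

type_synonym T = "word \<Rightarrow>\<^sub>0 complex"

definition letter :: "gen \<Rightarrow> int \<Rightarrow> T"
  where "letter g n = Poly_Mapping.single (Word [(g, n)]) 1"

definition T_plus :: "T set" where
  "T_plus = complex_vector.span
     {Poly_Mapping.single (Word ls) 1 | ls. ls \<noteq> [] \<and> 0 \<le> sum_list (map snd ls)}"

definition TT_plus :: "T set"
  where "TT_plus = complex_vector.span {t * p | t p. p \<in> T_plus}"

definition VT_rel :: "T \<Rightarrow> T \<Rightarrow> bool"
  where "VT_rel x y \<longleftrightarrow> x - y \<in> TT_plus"

quotient_type VT = T / VT_rel
  unfolding VT_rel_def[abs_def] TT_plus_def by (rule equivp_diff_in_span)

instantiation VT :: complex_vector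
begin
lift_definition zero_VT :: VT is 0 .
lift_definition plus_VT :: "VT \<Rightarrow> VT \<Rightarrow> VT" is "(+)"
  unfolding VT_rel_def TT_plus_def by (rule span_diff_add)
lift_definition minus_VT :: "VT \<Rightarrow> VT \<Rightarrow> VT" is "(-)"
  unfolding VT_rel_def TT_plus_def by (rule span_diff_diff)
lift_definition uminus_VT :: "VT \<Rightarrow> VT" is "uminus"
  unfolding VT_rel_def TT_plus_def by (rule span_diff_uminus)
lift_definition scaleC_VT :: "complex \<Rightarrow> VT \<Rightarrow> VT" is "scaleC"
  unfolding VT_rel_def TT_plus_def by (rule span_diff_scaleC)
instance
  by standard (transfer; simp add: VT_rel_def TT_plus_def complex_vector.span_zero algebra_simps
      complex_vector.scale_right_distrib complex_vector.scale_left_distrib)+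
end

lemma scaleC_T_conv: "c *\<^sub>C p = Poly_Mapping.single 0 c * p" for p :: T
proof -
  have "c *\<^sub>C p = Poly_Mapping.map ((*) c) p"
    by (rule poly_mapping_eqI)
      (simp add: lookup_scaleC Poly_Mapping.map.rep_eq scaleC_complex_def when_def)
  then show ?thesis by (simp add: mult_map_scale_conv_mult)
qed

lemma single_0_commute: "Poly_Mapping.single 0 c * t = t * Poly_Mapping.single 0 c" for t :: T
proof (induction t rule: update_induct)
  case const
  then show ?case by simp
next
  case (update f a b)
  have "Poly_Mapping.update a b f = f + Poly_Mapping.single a b"
    by (rule poly_mapping_eqI)
      (use update in \<open>auto simp: lookup_update lookup_add lookup_single when_def in_keys_iff\<close>)
  then show ?case
    using update by (simp add: distrib_left distrib_right mult_single mult.commute)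
qed

lemma T_mult_scaleC_right: "t * (c *\<^sub>C p) = c *\<^sub>C (t * p)" for p t :: T
  by (metis scaleC_T_conv single_0_commute mult.assoc)

lemma T_mult_scaleC_left: "(c *\<^sub>C p) * t = c *\<^sub>C (p * t)" for p t :: T
  by (metis scaleC_T_conv mult.assoc)

lemma TT_plus_mult:
  assumes "x \<in> TT_plus"
  shows "t * x \<in> TT_plus"
  using assms unfolding TT_plus_def
proof (induction rule: complex_vector.span_induct_alt)
  case base
  then show ?case by (simp add: complex_vector.span_zero)
next
  case (step c x y)
  from step(1) obtain s p where x: "x = s * p" and p: "p \<in> T_plus" by blast
  have "t * x = (t * s) * p" using x by (simp add: mult.assoc)
  then have "t * x \<in> complex_vector.span {t * p | t p. p \<in> T_plus}"
    using p by (intro complex_vector.span_base) blast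
  with step show ?case
    by (simp add: distrib_left T_mult_scaleC_right complex_vector.span_add
        complex_vector.span_scale)
qed

context
  fixes t :: T
begin

lift_definition T_act_VT :: "VT \<Rightarrow> VT" is "\<lambda>x. t * x"
  unfolding VT_rel_def using TT_plus_mult by (simp add: right_diff_distrib[symmetric])

end

lift_definition VT_vac :: VT is "1 :: T" .

definition VT_mode :: "gen \<Rightarrow> int \<Rightarrow> VT \<Rightarrow> VT"
  where "VT_mode g n = T_act_VT (letter g n)"

lemma T_word_expand: "(p :: T) = (\<Sum>w\<in>Poly_Mapping.keys p.
    Poly_Mapping.lookup p w *\<^sub>C Poly_Mapping.single w 1)"
proof (rule poly_mapping_eqI)
  fix k
  show "Poly_Mapping.lookup p k = Poly_Mapping.lookup (\<Sum>w\<in>Poly_Mapping.keys p.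
      Poly_Mapping.lookup p w *\<^sub>C Poly_Mapping.single w 1) k"
    by (simp add: lookup_sum lookup_scaleC lookup_single scaleC_complex_def when_def
        if_distrib[of "\<lambda>x. _ * x"] in_keys_iff cong: if_cong)
qed

lemma VT_truncation: "\<exists>N. \<forall>n\<ge>N. VT_mode g n v = 0"
proof -
  obtain p where v: "v = abs_VT p"
    by (metis Quotient3_abs_rep Quotient3_VT)
  define d where "d w = sum_list (map snd (letters w))" for w
  define N where "N = (\<Sum>w\<in>Poly_Mapping.keys p. \<bar>d w\<bar>)"
  have "letter g n * p \<in> TT_plus" if n: "n \<ge> N" for n
  proof -
    have "letter g n * Poly_Mapping.single w 1 \<in> TT_plus" if w: "w \<in> Poly_Mapping.keys p" for w
    proof -
      have "\<bar>d w\<bar> \<le> N"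
        unfolding N_def by (rule member_le_sum) (use w in auto)
      then have "0 \<le> n + d w" using n by linarith
      then have "Poly_Mapping.single (Word ((g, n) # letters w)) 1 \<in> T_plus"
        unfolding T_plus_def d_def by (intro complex_vector.span_base) force
      moreover have "letter g n * Poly_Mapping.single w 1 =
          1 * Poly_Mapping.single (Word ((g, n) # letters w)) 1"
        by (simp add: letter_def mult_single plus_word_def)
      ultimately show ?thesis
        unfolding TT_plus_def by (intro complex_vector.span_base) blast
    qed
    then have "(\<Sum>w\<in>Poly_Mapping.keys p. Poly_Mapping.lookup p w *\<^sub>C
        (letter g n * Poly_Mapping.single w 1)) \<in> TT_plus"
      unfolding TT_plus_def
      by (intro complex_vector.span_sum complex_vector.span_scale) auto
    then show ?thesis
      using arg_cong[OF T_word_expand[of p], of "\<lambda>x. letter g n * x"]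
    by (simp only: sum_distrib_left T_mult_scaleC_right)
  qed
  then have "\<forall>n\<ge>N. VT_mode g n v = 0"
    unfolding VT_mode_def v
    by (simp add: T_act_VT.abs_eq zero_VT_def VT.abs_eq_iff VT_rel_def)
  then show ?thesis by blast
qed


section \<open>The quotient module $V_{\tilde{A}}$\<close>

text \<open>
  The coefficient of \<open>s\<^sup>k\<^sup>-\<^sup>i t\<^sup>i\<close> in \<open>e\<^sup>s\<^sup>-\<^sup>t\<close>; it vanishes for \<open>i > k\<close>.  The index types force
  \<open>k, i \<ge> 0\<close>.  By truncation in \<^typ>\<open>VT\<close> all the sums have finite support.
\<close>

definition exp_coeff :: "nat \<Rightarrow> nat \<Rightarrow> complex"
  where "exp_coeff k i = (1 / fact k) * of_nat (k choose i) * (- 1) ^ i"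

definition same_relation :: "gen \<Rightarrow> int \<Rightarrow> int \<Rightarrow> VT \<Rightarrow> VT" where
  "same_relation g m n v = VT_mode g m (VT_mode g n v) +
     Sum_any (\<lambda>(k, i). exp_coeff k i *\<^sub>C
       VT_mode g (n + int k - int i) (VT_mode g (m + int i) v))"

definition mixed_relation :: "int \<Rightarrow> int \<Rightarrow> VT \<Rightarrow> VT" where
  "mixed_relation m n v = VT_mode Y_gen m (VT_mode Ystar_gen n v) +
     Sum_any (\<lambda>(k, i). exp_coeff k i *\<^sub>C
       VT_mode Ystar_gen (n + int i) (VT_mode Y_gen (m + int k - int i) v))
     - (if m + n + 1 = 0 then v else 0)"

lemma VT_mode_zero [simp]: "VT_mode g n 0 = 0"
  by (simp add: VT_mode_def zero_VT_def T_act_VT.abs_eq)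

lemma same_relation_finite:
  "finite {(k, i). exp_coeff k i *\<^sub>C
      VT_mode g (n + int k - int i) (VT_mode g (m + int i) v) \<noteq> 0}" (is "finite ?A")
proof -
  obtain N where N: "\<forall>n\<ge>N. VT_mode g n v = 0" using VT_truncation by blast
  define I where "I = nat (N - m)"
  have "\<forall>i. \<exists>K. \<forall>n'\<ge>K. VT_mode g n' (VT_mode g (m + int i) v) = 0"
    using VT_truncation by blast
  then obtain K where K: "\<And>i n'. n' \<ge> K i \<Longrightarrow> VT_mode g n' (VT_mode g (m + int i) v) = 0"
    by metis
  have "?A \<subseteq> (\<Union>i<I. {..< nat (K i - n + int i)} \<times> {i})"
  proof clarify
    fix k i assume *: "exp_coeff k i *\<^sub>C
      VT_mode g (n + int k - int i) (VT_mode g (m + int i) v) \<noteq> 0"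
    have "\<not> N \<le> m + int i" using * N by force
    moreover have "\<not> K i \<le> n + int k - int i" using * K by force
    ultimately show "(k, i) \<in> (\<Union>i<I. {..< nat (K i - n + int i)} \<times> {i})"
      unfolding I_def by auto
  qed
  then show ?thesis by (rule finite_subset) auto
qed

lemma mixed_relation_finite:
  "finite {(k, i). exp_coeff k i *\<^sub>C
      VT_mode Ystar_gen (n + int i) (VT_mode Y_gen (m + int k - int i) v) \<noteq> 0}" (is "finite ?A")
proof -
  obtain N where N: "\<forall>n\<ge>N. VT_mode Y_gen n v = 0" using VT_truncation by blast
  define D where "D = nat (N - m)"
  have "\<forall>d. \<exists>K. \<forall>n'\<ge>K. VT_mode Ystar_gen n' (VT_mode Y_gen (m + int d) v) = 0"
    using VT_truncation by blast
  then obtain K where K: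
    "\<And>d n'. n' \<ge> K d \<Longrightarrow> VT_mode Ystar_gen n' (VT_mode Y_gen (m + int d) v) = 0"
    by metis
  have "?A \<subseteq> (\<Union>d<D. (\<lambda>i. (i + d, i)) ` {..< nat (K d - n)})"
  proof clarify
    fix k i assume *: "exp_coeff k i *\<^sub>C
      VT_mode Ystar_gen (n + int i) (VT_mode Y_gen (m + int k - int i) v) \<noteq> 0"
    have "i \<le> k"
    proof (rule ccontr)
      assume "\<not> i \<le> k"
      then show False using * by (simp add: exp_coeff_def binomial_eq_0)
    qed
    then obtain d where d: "k = i + d" using le_Suc_ex by blast
    have **: "VT_mode Ystar_gen (n + int i) (VT_mode Y_gen (m + int d) v) \<noteq> 0"
      using * d by (auto simp: algebra_simps)
    have "\<not> N \<le> m + int d" using ** N by force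
    moreover have "\<not> K d \<le> n + int i" using ** K by force
    ultimately have "d < D" "i \<in> {..< nat (K d - n)}"
      unfolding D_def by auto
    then show "(k, i) \<in> (\<Union>d<D. (\<lambda>i. (i + d, i)) ` {..< nat (K d - n)})"
      unfolding d by blast
  qed
  then show ?thesis by (rule finite_subset) auto
qed

definition VA_relations :: "VT set" where
  "VA_relations =
     {same_relation g m n v | g m n v. True} \<union> {mixed_relation m n v | m n v. True}"

definition VA_submodule :: "VT set" where
  "VA_submodule = complex_vector.span {T_act_VT t r | t r. r \<in> VA_relations}"

definition VA_rel :: "VT \<Rightarrow> VT \<Rightarrow> bool"
  where "VA_rel x y \<longleftrightarrow> x - y \<in> VA_submodule"

quotient_type VA = VT / VA_rel
  unfolding VA_rel_def[abs_def] VA_submodule_def by (rule equivp_diff_in_span)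

instantiation VA :: complex_vector
begin
lift_definition zero_VA :: VA is 0 .
lift_definition plus_VA :: "VA \<Rightarrow> VA \<Rightarrow> VA" is "(+)"
  unfolding VA_rel_def VA_submodule_def by (rule span_diff_add)
lift_definition minus_VA :: "VA \<Rightarrow> VA \<Rightarrow> VA" is "(-)"
  unfolding VA_rel_def VA_submodule_def by (rule span_diff_diff)
lift_definition uminus_VA :: "VA \<Rightarrow> VA" is "uminus"
  unfolding VA_rel_def VA_submodule_def by (rule span_diff_uminus)
lift_definition scaleC_VA :: "complex \<Rightarrow> VA \<Rightarrow> VA" is "scaleC"
  unfolding VA_rel_def VA_submodule_def by (rule span_diff_scaleC)
instance
  by standard (transfer; simp add: VA_rel_def VA_submodule_def complex_vector.span_zero
      algebra_simps complex_vector.scale_right_distrib complex_vector.scale_left_distrib)+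
end

lemma T_act_VT_mult: "T_act_VT s (T_act_VT t v) = T_act_VT (s * t) v"
  by (induction v rule: VT.abs_induct) (simp add: T_act_VT.abs_eq mult.assoc)

lemma clinear_T_act_VT: "clinear (T_act_VT t)"
proof (rule clinearI)
  show "T_act_VT t (x + y) = T_act_VT t x + T_act_VT t y" for x y
    by (induction x rule: VT.abs_induct, induction y rule: VT.abs_induct)
      (simp add: T_act_VT.abs_eq plus_VT.abs_eq distrib_left)
  show "T_act_VT t (c *\<^sub>C x) = c *\<^sub>C T_act_VT t x" for c x
    by (induction x rule: VT.abs_induct)
      (simp add: T_act_VT.abs_eq scaleC_VT.abs_eq T_mult_scaleC_right)
qed

lemma VA_submodule_act:
  assumes "x \<in> VA_submodule"
  shows "T_act_VT t x \<in> VA_submodule"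
proof -
  interpret L: Vector_Spaces.linear scaleC scaleC "T_act_VT t" by (rule clinear_T_act_VT)
  show ?thesis
    using assms unfolding VA_submodule_def
  proof (induction rule: complex_vector.span_induct_alt)
    case base
    then show ?case by (simp add: complex_vector.span_zero L.zero)
  next
    case (step c x y)
    from step(1) obtain s r where x: "x = T_act_VT s r" and r: "r \<in> VA_relations" by blast
    have "T_act_VT t x = T_act_VT (t * s) r" using x by (simp add: T_act_VT_mult)
    then have "T_act_VT t x \<in> complex_vector.span {T_act_VT t r | t r. r \<in> VA_relations}"
      using r by (intro complex_vector.span_base) blast
    with step show ?case
      by (simp add: L.add L.scale complex_vector.span_add complex_vector.span_scale)
  qed
qed

context
  fixes t :: T
begin

lift_definition T_act_VA :: "VA \<Rightarrow> VA" is "T_act_VT t"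
proof -
  fix x y :: VT
  interpret L: Vector_Spaces.linear scaleC scaleC "T_act_VT t" by (rule clinear_T_act_VT)
  assume "VA_rel x y"
  then show "VA_rel (T_act_VT t x) (T_act_VT t y)"
    unfolding VA_rel_def L.diff[symmetric] by (rule VA_submodule_act)
qed

end

lift_definition VA_vac :: VA is VT_vac .

definition Y_tilde :: "int \<Rightarrow> VA \<Rightarrow> VA"
  where "Y_tilde n = T_act_VA (letter Y_gen n)"

definition Ystar_tilde :: "int \<Rightarrow> VA \<Rightarrow> VA"
  where "Ystar_tilde n = T_act_VA (letter Ystar_gen n)"

definition a_tilde :: VA
  where "a_tilde = Y_tilde (- 1) VA_vac"

definition b_tilde :: VA
  where "b_tilde = Ystar_tilde (- 1) VA_vac"

definition VA_Y :: "VA \<Rightarrow> int \<Rightarrow> VA \<Rightarrow> VA" where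
  "VA_Y = (THE Y. weak_quantum_vertex_algebra Y VA_vac \<and>
     Y a_tilde = Y_tilde \<and> Y b_tilde = Ystar_tilde)"

end

theory Submission
  imports Defs "HOL-Library.FSet"
begin

text \<open>
  Grade \<open>V\<^sub>A\<close> by charge, \<open>Y\<close> having charge \<open>1\<close> and \<open>Y\<^sup>*\<close> charge \<open>-1\<close>.  Multiplying \<open>Y(z)\<close> and \<open>Y\<^sup>*(z)\<close>
  by \<open>e\<^bsup>rz\<^esup>\<close> and \<open>e\<^bsup>(1-r)z\<^esup>\<close> on vectors of charge \<open>r\<close> cancels the exponentials in the defining
  relations and yields free fermions \<open>\<psi>\<close>, \<open>\<psi>\<^sup>*\<close>.  Conversely, twisting the fermionic Fock space gives a
  model of the relations in which every word of \<open>T\<^sub>+\<close> kills the vacuum, so that \<open>V\<^sub>A\<close> is nonzero.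

  Let \<open>F(u, x)\<close> be the vertex operators of the vertex superalgebra of free fermions and \<open>J\<^sub>1\<close> the mode
  of the current \<open>:\<psi>\<psi>\<^sup>*:\<close> with \<open>[J\<^sub>1, \<psi>(z)] = z\<psi>(z)\<close>.  Conjugation by \<open>e\<^bsup>sJ\<^sub>1\<^esup>\<close> multiplies the field of a
  vector of charge \<open>c\<close> by \<open>e\<^bsup>scx\<^esup>\<close>; hence for \<open>u\<close> of charge \<open>c\<close> and \<open>w\<close> of charge \<open>r\<close> the operators
  \<open>Y(u, x)w = e\<^bsup>\<kappa>x\<^esup> F(e\<^bsup>-rJ\<^sub>1\<^esup> u, x)w\<close> with \<open>\<kappa> = -cr - c(c-1)/2\<close> inherit a Jacobi identity from \<open>F\<close>, with
  \<open>S(x)(v \<otimes> u) = \<plusminus> e\<^bsup>cdx\<^esup> e\<^bsup>cJ\<^sub>1\<^esup> v \<otimes> e\<^bsup>-dJ\<^sub>1\<^esup> u\<close> for \<open>v\<close> of charge \<open>d\<close>.  The factors of \<open>S\<close> commute with each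
  other, which gives the Yang-Baxter equation.  The annihilation modes of
  \<open>Y\<close> and \<open>Y\<^sup>*\<close> carry any nonzero vector of an invariant subspace to a nonzero multiple of the vacuum.
\<close>

text \<open>The constant -c(c-1)/2 in the exponent is not a normalization. Writing kappa(c, r) for
  the exponent, associativity of the twisted operators requires kappa(c + d, r) = kappa(c, d + r) +
  kappa(d, r); the term quadratic in c makes the bilinear term -cr satisfy this, and at c = 1 and c
  = -1 the sum is -r and r - 1, the exponents of the generators. The factor exp(kappa_1 x_1 +
  kappa_2 x_2) is then the same for both orders of a product, so locality survives the twist. Two
  obstacles shape the argument. V_A is a quotient of unknown size, so even its charge grading has to
  be extracted from the universal property; after that the fermionic construction runs inside V_A
  itself, and the Fock space is consulted for one fact only. Moreover, the structure on V_A is a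
  definite description among weak quantum vertex algebras with unspecified braidings, so uniqueness
  has to be derived without access to the braiding. Products of fields are defined by substituting
  x_1 = x_2 + x_0, an operation that exponential factors pass through.\<close>

lemma clinear_add: "clinear f \<Longrightarrow> f (x + y) = f x + f y"
  by (rule module_hom.add[OF Vector_Spaces.linear.axioms(3)])

lemma clinear_scale: "clinear f \<Longrightarrow> f (c *\<^sub>C x) = c *\<^sub>C f x"
  by (rule module_hom.scale[OF Vector_Spaces.linear.axioms(3)])

lemma clinear_zero: "clinear f \<Longrightarrow> f 0 = 0"
  by (rule module_hom.zero[OF Vector_Spaces.linear.axioms(3)])

lemma clinear_diff: "clinear f \<Longrightarrow> f (x - y) = f x - f y"
  by (rule module_hom.diff[OF Vector_Spaces.linear.axioms(3)])

lemma clinear_neg: "clinear f \<Longrightarrow> f (- x) = - f x"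
  by (rule module_hom.neg[OF Vector_Spaces.linear.axioms(3)])

lemma clinear_sum: "clinear f \<Longrightarrow> f (sum g A) = (\<Sum>i\<in>A. f (g i))"
  by (rule module_hom.sum[OF Vector_Spaces.linear.axioms(3)])

lemma clinear_comp: "clinear f \<Longrightarrow> clinear g \<Longrightarrow> clinear (\<lambda>x. f (g x))"
  by (rule clinearI) (simp_all add: clinear_add clinear_scale)

lemma clinear_ident: "clinear (\<lambda>x. x)"
  by (rule clinearI) simp_all

lemma clinear_const_zero: "clinear (\<lambda>x. 0)"
  by (rule clinearI) simp_all

lemma clinear_plus: "clinear f \<Longrightarrow> clinear g \<Longrightarrow> clinear (\<lambda>x. f x + g x)"
  by (rule clinearI) (simp_all add: clinear_add clinear_scale complex_vector.scale_right_distrib)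

lemma clinear_minus: "clinear f \<Longrightarrow> clinear g \<Longrightarrow> clinear (\<lambda>x. f x - g x)"
  by (rule clinearI)
    (simp_all add: clinear_add clinear_scale complex_vector.scale_right_diff_distrib)

lemma clinear_scaleC: "clinear f \<Longrightarrow> clinear (\<lambda>x. c *\<^sub>C f x)"
  by (rule clinearI)
    (simp_all add: clinear_add clinear_scale complex_vector.scale_right_distrib mult.commute)

section \<open>Finitely supported sums of vectors\<close>

lemma Sum_any_eq_sum:
  assumes "finite A" "\<And>x. x \<notin> A \<Longrightarrow> g x = 0"
  shows "Sum_any g = sum g A"
  using assms by (intro Sum_any.expand_superset) auto

lemma clinear_Sum_any:
  assumes "clinear f" "finite {x. g x \<noteq> 0}"
  shows "f (Sum_any g) = Sum_any (\<lambda>x. f (g x))"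
proof -
  have "Sum_any (\<lambda>x. f (g x)) = (\<Sum>x\<in>{x. g x \<noteq> 0}. f (g x))"
    using assms by (intro Sum_any_eq_sum) (auto simp: clinear_zero)
  then show ?thesis
    by (simp add: Sum_any.expand_set clinear_sum[OF assms(1)])
qed

lemma clinear_Sum_any_fun:
  assumes lin: "\<And>i. clinear (f i)" and fin: "\<And>v. finite {i. f i v \<noteq> 0}"
  shows "clinear (\<lambda>v. Sum_any (\<lambda>i. f i v))"
proof (rule clinearI)
  show "Sum_any (\<lambda>i. f i (x + y)) = Sum_any (\<lambda>i. f i x) + Sum_any (\<lambda>i. f i y)" for x y
    by (simp add: clinear_add[OF lin] Sum_any.distrib[OF fin fin])
  show "Sum_any (\<lambda>i. f i (c *\<^sub>C x)) = c *\<^sub>C Sum_any (\<lambda>i. f i x)" for c x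
    using clinear_Sum_any[OF clinear_scaleC[OF clinear_ident], OF fin]
    by (simp add: clinear_scale[OF lin])
qed


section \<open>Formal arrays\<close>

text \<open>A formal series is given by its array of coefficients: \<open>act f a\<close> is \<open>f(x) a(x)\<close>, \<open>act2 f g G\<close> is
  \<open>f(x\<^sub>1) g(x\<^sub>2) G(x\<^sub>1, x\<^sub>2)\<close> and \<open>mult_diff G\<close> is \<open>(x\<^sub>1 - x\<^sub>2) G(x\<^sub>1, x\<^sub>2)\<close>.\<close>

definition lower_trunc :: "(int \<Rightarrow> 'v::zero) \<Rightarrow> bool"
  where "lower_trunc a \<longleftrightarrow> (\<exists>N. \<forall>p<N. a p = 0)"

definition act :: "complex fps \<Rightarrow> (int \<Rightarrow> 'v::complex_vector) \<Rightarrow> int \<Rightarrow> 'v"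
  where "act f a p = Sum_any (\<lambda>i::nat. fps_nth f i *\<^sub>C a (p - int i))"

definition act2 :: "complex fps \<Rightarrow> complex fps \<Rightarrow> (int \<Rightarrow> int \<Rightarrow> 'v::complex_vector) \<Rightarrow>
    int \<Rightarrow> int \<Rightarrow> 'v"
  where "act2 f g G p q =
    Sum_any (\<lambda>(i::nat, j::nat). (fps_nth f i * fps_nth g j) *\<^sub>C G (p - int i) (q - int j))"

text \<open>Exactly the condition under which every sum in \<open>act2\<close> is finite for
  arbitrary series. A common lower bound on both exponents would be too strong: in A(x_1)B(x_2)w the
  powers of x_1 are bounded below only for each fixed power of x_2.\<close>

definition bounded_below2 :: "(int \<Rightarrow> int \<Rightarrow> 'v::zero) \<Rightarrow> bool"
  where "bounded_below2 G \<longleftrightarrow>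
    (\<forall>p q. \<exists>M. \<forall>i j::nat. G (p - int i) (q - int j) \<noteq> 0 \<longrightarrow> i \<le> M \<and> j \<le> M)"

lemma act_eq_sum:
  assumes "\<And>i. i > M \<Longrightarrow> a (p - int i) = 0"
  shows "act f a p = (\<Sum>i\<le>M. fps_nth f i *\<^sub>C a (p - int i))"
  unfolding act_def by (rule Sum_any_eq_sum) (use assms in auto)

lemma act2_eq_sum:
  assumes "\<And>i j. i > M \<or> j > M \<Longrightarrow> G (p - int i) (q - int j) = 0"
  shows "act2 f g G p q =
    (\<Sum>i\<le>M. \<Sum>j\<le>M. (fps_nth f i * fps_nth g j) *\<^sub>C G (p - int i) (q - int j))"
proof -
  have "act2 f g G p q = (\<Sum>(i, j)\<in>{..M} \<times> {..M}.
      (fps_nth f i * fps_nth g j) *\<^sub>C G (p - int i) (q - int j))"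
    unfolding act2_def by (rule Sum_any_eq_sum) (use assms in \<open>auto simp flip: not_le, (meson not_le)+\<close>)
  then show ?thesis by (simp add: sum.cartesian_product)
qed

lemma lower_trunc_bound:
  assumes "lower_trunc a"
  obtains M :: nat where "\<And>i. i > M \<Longrightarrow> a (p - int i) = 0"
proof -
  obtain N where N: "\<forall>p<N. a p = 0" using assms by (auto simp: lower_trunc_def)
  show thesis
    by (rule that[of "nat (p - N)"]) (use N in auto)
qed

lemma bounded_below2_bound:
  assumes "bounded_below2 G"
  obtains M :: nat where "\<And>i j. i > M \<or> j > M \<Longrightarrow> G (p - int i) (q - int j) = 0"
proof -
  obtain M where "\<forall>i j::nat. G (p - int i) (q - int j) \<noteq> 0 \<longrightarrow> i \<le> M \<and> j \<le> M"
    using assms unfolding bounded_below2_def by blast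
  then show thesis by (intro that[of M]) (auto simp: not_le[symmetric])
qed

text \<open>The Cauchy product in finite form: pairs of the square with i + j > M contribute
  nothing, and the rest is regrouped along i + j = a.\<close>

lemma convolution_sum:
  fixes h :: "nat \<Rightarrow> 'v::complex_vector"
  assumes "\<And>a. a > M \<Longrightarrow> h a = 0"
  shows "(\<Sum>i\<le>M. \<Sum>j\<le>M. (f i * g j) *\<^sub>C h (i + j)) =
    (\<Sum>a\<le>M. (\<Sum>i\<le>a. f i * g (a - i)) *\<^sub>C h a)"
proof -
  have "(\<Sum>i\<le>M. \<Sum>j\<le>M. (f i * g j) *\<^sub>C h (i + j)) =
      (\<Sum>(i, j)\<in>{..M} \<times> {..M}. (f i * g j) *\<^sub>C h (i + j))"
    by (simp add: sum.cartesian_product)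
  also have "\<dots> = (\<Sum>(i, j)\<in>{(i, j). i + j \<le> M}. (f i * g j) *\<^sub>C h (i + j))"
    by (rule sum.mono_neutral_right) (use assms in \<open>auto simp: not_le intro!: assms dest: leI\<close>)
  also have "\<dots> = (\<Sum>a\<le>M. \<Sum>i\<le>a. (f i * g (a - i)) *\<^sub>C h a)"
    by (subst sum.triangle_reindex_eq) simp
  finally show ?thesis by (simp add: complex_vector.scale_sum_left)
qed

lemma lower_trunc_act:
  assumes "lower_trunc a"
  shows "lower_trunc (act f a)"
proof -
  obtain N where N: "\<forall>p<N. a p = 0" using assms by (auto simp: lower_trunc_def)
  have "act f a p = 0" if "p < N" for p
    using N that by (simp add: act_def)
  then show ?thesis unfolding lower_trunc_def by blast
qed

lemma act_mult:
  assumes "lower_trunc a"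
  shows "act f (act g a) = act (f * g) a"
proof
  fix p
  obtain M where M: "\<And>i. i > M \<Longrightarrow> a (p - int i) = 0"
    using lower_trunc_bound[OF assms, of p] by blast
  have *: "act g a (p - int i) = (\<Sum>j\<le>M. fps_nth g j *\<^sub>C a (p - int (i + j)))" for i
    by (subst act_eq_sum[of M]) (use M[of "i + _"] in \<open>auto simp: algebra_simps\<close>)
  have "act g a (p - int i) = 0" if "i > M" for i
    unfolding * by (rule sum.neutral) (use M[of "i + _"] that in auto)
  then have "act f (act g a) p =
      (\<Sum>i\<le>M. \<Sum>j\<le>M. (fps_nth f i * fps_nth g j) *\<^sub>C a (p - int (i + j)))"
    by (subst act_eq_sum[of M]) (simp_all add: * complex_vector.scale_sum_right)
  also have "\<dots> = (\<Sum>i\<le>M. fps_nth (f * g) i *\<^sub>C a (p - int i))"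
    by (subst convolution_sum[of M "\<lambda>i. a (p - int i)"]) (use M in \<open>auto simp: fps_mult_nth atLeast0AtMost\<close>)
  also have "\<dots> = act (f * g) a p"
    by (rule act_eq_sum[symmetric]) (use M in auto)
  finally show "act f (act g a) p = act (f * g) a p" .
qed

lemma act_one [simp]: "act 1 a = a"
proof
  fix p
  have "act 1 a p = (\<Sum>i\<in>{0::nat}. fps_nth 1 i *\<^sub>C a (p - int i))"
    unfolding act_def by (rule Sum_any_eq_sum) auto
  then show "act 1 a p = a p" by simp
qed

lemma act_clinear:
  assumes "clinear T" "lower_trunc a"
  shows "T (act f a p) = act f (\<lambda>p. T (a p)) p"
proof -
  obtain M where M: "\<And>i. i > M \<Longrightarrow> a (p - int i) = 0"
    using lower_trunc_bound[OF assms(2), of p] by blast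
  have "T (act f a p) = (\<Sum>i\<le>M. fps_nth f i *\<^sub>C T (a (p - int i)))"
    by (subst act_eq_sum[of M]) (simp_all add: M clinear_sum[OF assms(1)] clinear_scale[OF assms(1)])
  also have "\<dots> = act f (\<lambda>p. T (a p)) p"
    by (rule act_eq_sum[symmetric]) (simp add: M clinear_zero[OF assms(1)])
  finally show ?thesis .
qed

lemma act_add:
  assumes "lower_trunc a" "lower_trunc b"
  shows "act f (\<lambda>p. a p + b p) p = act f a p + act f b p"
proof -
  obtain M where M: "\<And>i. i > M \<Longrightarrow> a (p - int i) = 0"
    using lower_trunc_bound[OF assms(1), of p] by blast
  obtain M' where M': "\<And>i. i > M' \<Longrightarrow> b (p - int i) = 0"
    using lower_trunc_bound[OF assms(2), of p] by blast
  show ?thesis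
    by (subst (1 2 3) act_eq_sum[of "max M M'"])
      (simp_all add: M M' complex_vector.scale_right_distrib sum.distrib)
qed

lemma act_scaleC:
  assumes "lower_trunc a"
  shows "act f (\<lambda>p. c *\<^sub>C a p) p = c *\<^sub>C act f a p"
  by (rule act_clinear[OF clinear_scaleC[OF clinear_ident] assms, symmetric])

lemma clinear_act:
  assumes "\<And>p. clinear (a p)" "\<And>v. lower_trunc (\<lambda>p. a p v)"
  shows "clinear (\<lambda>v. act f (\<lambda>p. a p v) p)"
  by (rule clinearI)
    (simp_all add: clinear_add[OF assms(1)] clinear_scale[OF assms(1)] act_add act_scaleC assms(2))

lemma act2_act:
  assumes tr: "\<And>q. lower_trunc (\<lambda>p. G p q)" "\<exists>N. \<forall>p. \<forall>q<N. G p q = 0"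
  shows "act f (\<lambda>p. act g (\<lambda>q. G p q) q) p = act2 f g G p q"
    and "bounded_below2 G"
proof -
  obtain N where N: "\<And>p q. q < N \<Longrightarrow> G p q = 0" using tr(2) by blast
  show *: "bounded_below2 G"
    unfolding bounded_below2_def
  proof (intro allI)
    fix p q
    have "\<exists>M. \<forall>i>M. G (p - int i) (q - int j) = 0" for j
      using lower_trunc_bound[OF tr(1)[of "q - int j"], of p] by metis
    then obtain M where M: "\<And>i j. i > M j \<Longrightarrow> G (p - int i) (q - int j) = 0" by metis
    \<comment> \<open>Only the finitely many columns q - j \<ge> N can be nonzero, so the bounds
      \<open>M j\<close>, which depend on the column, have a common maximum.\<close>
    define K where "K = Max (insert (nat (q - N)) (M ` {..nat (q - N)}))"
    have "M j \<le> K" if "j \<le> nat (q - N)" for j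
      unfolding K_def by (rule Max_ge) (use that in auto)
    moreover have "nat (q - N) \<le> K" unfolding K_def by (rule Max_ge) auto
    moreover have "j \<le> nat (q - N)" if "G (p - int i) (q - int j) \<noteq> 0" for i j
      using N[of "q - int j" "p - int i"] that by (cases "q - int j < N") auto
    ultimately have "\<forall>i j. G (p - int i) (q - int j) \<noteq> 0 \<longrightarrow> i \<le> K \<and> j \<le> K"
      by (metis M le_trans not_le)
    then show "\<exists>M. \<forall>i j. G (p - int i) (q - int j) \<noteq> 0 \<longrightarrow> i \<le> M \<and> j \<le> M" by blast
  qed
  obtain M where M: "\<And>i j. i > M \<or> j > M \<Longrightarrow> G (p - int i) (q - int j) = 0"
    using bounded_below2_bound[OF *] by metis
  define K where "K = max M (nat (q - N))"
  have 1: "act g (\<lambda>q. G p' q) q = (\<Sum>j\<le>K. fps_nth g j *\<^sub>C G p' (q - int j))" for p'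
    by (rule act_eq_sum) (rule N, auto simp: K_def)
  have "act f (\<lambda>p. act g (\<lambda>q. G p q) q) p =
      (\<Sum>i\<le>K. fps_nth f i *\<^sub>C (\<Sum>j\<le>K. fps_nth g j *\<^sub>C G (p - int i) (q - int j)))"
    by (subst act_eq_sum[of K]) (use M in \<open>auto simp: 1 K_def intro!: sum.neutral\<close>)
  also have "\<dots> = act2 f g G p q"
    by (subst act2_eq_sum[of K]) (use M in \<open>auto simp: complex_vector.scale_sum_right K_def\<close>)
  finally show "act f (\<lambda>p. act g (\<lambda>q. G p q) q) p = act2 f g G p q" .
qed

lemma act2_swap: "act2 f g G p q = act2 g f (\<lambda>q p. G p q) q p"
proof -
  have "Sum_any (\<lambda>(i::nat, j::nat). (fps_nth f i * fps_nth g j) *\<^sub>C G (p - int i) (q - int j)) =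
    Sum_any (\<lambda>(j::nat, i::nat). (fps_nth g j * fps_nth f i) *\<^sub>C G (p - int i) (q - int j))"
    by (rule Sum_any.reindex_cong[of prod.swap]) (auto simp: fun_eq_iff mult.commute)
  then show ?thesis by (simp add: act2_def)
qed

lemma bounded_below2_swap: "bounded_below2 (\<lambda>q p. G p q) \<longleftrightarrow> bounded_below2 G"
  unfolding bounded_below2_def by meson

lemma act2_mult:
  assumes "bounded_below2 G"
  shows "act2 f g (act2 f' g' G) = act2 (f * f') (g * g') G"
proof (intro ext)
  fix p q
  obtain M where M: "\<And>i j. i > M \<or> j > M \<Longrightarrow> G (p - int i) (q - int j) = 0"
    using bounded_below2_bound[OF assms, of p q] by metis
  have M': "G (p - int i - int i') (q - int j - int j') = 0" if "i + i' > M \<or> j + j' > M" for i i' j j'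
    using M[of "i + i'" "j + j'"] that by (simp add: algebra_simps)
  have *: "act2 f' g' G (p - int i) (q - int j) = (\<Sum>i'\<le>M. \<Sum>j'\<le>M.
      (fps_nth f' i' * fps_nth g' j') *\<^sub>C G (p - int (i + i')) (q - int (j + j')))" for i j
    by (subst act2_eq_sum[of M]) (use M' in \<open>auto simp: algebra_simps\<close>)
  have **: "act2 f' g' G (p - int i) (q - int j) = 0" if "i > M \<or> j > M" for i j
    unfolding * by (intro sum.neutral ballI) (use M[of "i + _" "j + _"] that in auto)
  have "act2 f g (act2 f' g' G) p q = (\<Sum>i\<le>M. \<Sum>j\<le>M. (fps_nth f i * fps_nth g j) *\<^sub>C
      (\<Sum>i'\<le>M. \<Sum>j'\<le>M. (fps_nth f' i' * fps_nth g' j') *\<^sub>C G (p - int (i + i')) (q - int (j + j'))))"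
    by (subst act2_eq_sum[of M]) (auto simp: ** simp flip: * simp del: of_nat_add)
  also have "\<dots> = (\<Sum>i\<le>M. \<Sum>j\<le>M. \<Sum>i'\<le>M. \<Sum>j'\<le>M. ((fps_nth f i * fps_nth f' i') *
      (fps_nth g j * fps_nth g' j')) *\<^sub>C G (p - int (i + i')) (q - int (j + j')))"
    by (simp add: complex_vector.scale_sum_right mult_ac)
  also have "\<dots> = (\<Sum>i\<le>M. \<Sum>i'\<le>M. (fps_nth f i * fps_nth f' i') *\<^sub>C (\<Sum>j\<le>M. \<Sum>j'\<le>M.
      (fps_nth g j * fps_nth g' j') *\<^sub>C G (p - int (i + i')) (q - int (j + j'))))"
    by (subst sum.swap) (simp add: complex_vector.scale_sum_right)
  also have "\<dots> = (\<Sum>i\<le>M. \<Sum>i'\<le>M. (fps_nth f i * fps_nth f' i') *\<^sub>C (\<Sum>b\<le>M.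
      fps_nth (g * g') b *\<^sub>C G (p - int (i + i')) (q - int b)))"
    by (subst convolution_sum[of M "\<lambda>j. G _ (q - int j)"])
      (use M in \<open>auto simp: fps_mult_nth atLeast0AtMost simp del: of_nat_add\<close>)
  also have "\<dots> = (\<Sum>a\<le>M. fps_nth (f * f') a *\<^sub>C (\<Sum>b\<le>M.
      fps_nth (g * g') b *\<^sub>C G (p - int a) (q - int b)))"
    by (subst convolution_sum[of M "\<lambda>a. \<Sum>b\<le>M. fps_nth (g * g') b *\<^sub>C G (p - int a) (q - int b)"])
      (use M in \<open>auto simp: fps_mult_nth atLeast0AtMost intro!: sum.neutral\<close>)
  also have "\<dots> = act2 (f * f') (g * g') G p q"
    by (subst act2_eq_sum[of M]) (use M in \<open>auto simp: complex_vector.scale_sum_right\<close>)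
  finally show "act2 f g (act2 f' g' G) p q = act2 (f * f') (g * g') G p q" .
qed

lemma act2_one [simp]: "act2 1 1 G = G"
proof (intro ext)
  fix p q
  have "act2 1 1 G p q = (\<Sum>(i, j)\<in>{(0::nat, 0::nat)}.
      (fps_nth 1 i * fps_nth 1 j) *\<^sub>C G (p - int i) (q - int j))"
    unfolding act2_def by (rule Sum_any_eq_sum) (auto split: if_splits)
  then show "act2 1 1 G p q = G p q" by simp
qed

lemma act2_add:
  assumes "bounded_below2 G" "bounded_below2 H"
  shows "act2 f g (\<lambda>p q. G p q + H p q) p q = act2 f g G p q + act2 f g H p q"
proof -
  obtain M where M: "\<And>i j. i > M \<or> j > M \<Longrightarrow> G (p - int i) (q - int j) = 0"
    using bounded_below2_bound[OF assms(1), of p q] by metis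
  obtain M' where M': "\<And>i j. i > M' \<or> j > M' \<Longrightarrow> H (p - int i) (q - int j) = 0"
    using bounded_below2_bound[OF assms(2), of p q] by metis
  show ?thesis
    by (subst (1 2 3) act2_eq_sum[of "max M M'"])
      (use M M' in \<open>auto simp: complex_vector.scale_right_distrib sum.distrib\<close>)
qed

lemma act2_clinear:
  assumes "clinear T" "bounded_below2 G"
  shows "T (act2 f g G p q) = act2 f g (\<lambda>p q. T (G p q)) p q"
proof -
  obtain M where M: "\<And>i j. i > M \<or> j > M \<Longrightarrow> G (p - int i) (q - int j) = 0"
    using bounded_below2_bound[OF assms(2), of p q] by metis
  show ?thesis
    by (subst (1 2) act2_eq_sum[of M])
      (use M in \<open>auto simp: clinear_sum[OF assms(1)] clinear_scale[OF assms(1)] clinear_zero[OF assms(1)]\<close>)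
qed

text \<open>Any operation whose coefficient at (p, q) depends only on coefficients weakly below (p,
  q) preserves the condition. Multiplication by series and by x_1 - x_2, shifts and linear maps are
  all handled through this.\<close>

lemma bounded_below2_mono:
  assumes "bounded_below2 G" "\<And>p q. H p q \<noteq> 0 \<Longrightarrow> \<exists>i j::nat. G (p - int i) (q - int j) \<noteq> 0"
  shows "bounded_below2 H"
  unfolding bounded_below2_def
proof (intro allI)
  fix p q
  obtain M where M: "\<And>i j. i > M \<or> j > M \<Longrightarrow> G (p - int i) (q - int j) = 0"
    using bounded_below2_bound[OF assms(1), of p q] by metis
  have "i \<le> M \<and> j \<le> M" if nz: "H (p - int i) (q - int j) \<noteq> 0" for i j
  proof -
    obtain i' j' where "G (p - int i - int i') (q - int j - int j') \<noteq> 0"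
      using assms(2)[OF nz] by blast
    then have "G (p - int (i + i')) (q - int (j + j')) \<noteq> 0" by (simp add: algebra_simps)
    then have "\<not> (i + i' > M \<or> j + j' > M)" using M by blast
    then show ?thesis by linarith
  qed
  then show "\<exists>M. \<forall>i j. H (p - int i) (q - int j) \<noteq> 0 \<longrightarrow> i \<le> M \<and> j \<le> M" by blast
qed

lemma bounded_below2_act2:
  assumes "bounded_below2 G"
  shows "bounded_below2 (act2 f g G)"
proof (rule bounded_below2_mono[OF assms])
  fix p q assume "act2 f g G p q \<noteq> 0"
  then obtain ij where "(case ij of (i, j) \<Rightarrow> (fps_nth f i * fps_nth g j) *\<^sub>C G (p - int i) (q - int j)) \<noteq> 0"
    unfolding act2_def by (rule Sum_any.not_neutral_obtains_not_neutral)
  then show "\<exists>i j::nat. G (p - int i) (q - int j) \<noteq> 0"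
    by (cases ij) auto
qed

lemma bounded_below2_clinear:
  assumes "bounded_below2 G" "clinear T"
  shows "bounded_below2 (\<lambda>p q. T (G p q))"
proof (rule bounded_below2_mono[OF assms(1)])
  fix p q assume "T (G p q) \<noteq> 0"
  then have "G (p - int 0) (q - int 0) \<noteq> 0" using clinear_zero[OF assms(2)] by auto
  then show "\<exists>i j::nat. G (p - int i) (q - int j) \<noteq> 0" by blast
qed

lemma Sum_any_reindex_inj:
  assumes "inj h" "\<And>y. y \<notin> range h \<Longrightarrow> g y = 0"
  shows "Sum_any g = Sum_any (\<lambda>x. g (h x))"
proof -
  have eq: "{y. g y \<noteq> 0} = h ` {x. g (h x) \<noteq> 0}"
  proof (intro equalityI subsetI)
    fix y assume "y \<in> {y. g y \<noteq> 0}"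
    moreover from this obtain x where "y = h x" using assms(2) by auto
    ultimately show "y \<in> h ` {x. g (h x) \<noteq> 0}" by simp
  qed auto
  have "sum g {y. g y \<noteq> 0} = (\<Sum>x | g (h x) \<noteq> 0. g (h x))"
    unfolding eq by (subst sum.reindex) (use assms(1) in \<open>auto intro: inj_on_subset[OF _ subset_UNIV]\<close>)
  then show ?thesis by (simp add: Sum_any.expand_set)
qed

lemma Sum_any_int_shift: "Sum_any g = Sum_any (\<lambda>p::int. g (p + c))"
proof (rule Sum_any_reindex_inj)
  show "inj (\<lambda>p::int. p + c)" by (rule injI) simp
  have "y = (y - c) + c" for y by simp
  then show "g y = 0" if "y \<notin> range (\<lambda>p. p + c)" for y using that by blast
qed

lemma Sum_any_diff:
  assumes "finite {a. g a \<noteq> 0}" "finite {a. h a \<noteq> 0}"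
  shows "Sum_any (\<lambda>a. g a - h a :: 'v::ab_group_add) = Sum_any g - Sum_any h"
proof -
  let ?A = "{a. g a \<noteq> 0} \<union> {a. h a \<noteq> 0}"
  have fin: "finite ?A" using assms by simp
  have "Sum_any (\<lambda>a. g a - h a) = (\<Sum>a\<in>?A. g a - h a)" "Sum_any g = sum g ?A" "Sum_any h = sum h ?A"
    by (rule Sum_any_eq_sum[OF fin], auto)+
  then show ?thesis by (simp add: sum_subtractf)
qed

lemma Sum_any_Suc:
  assumes "finite {i::nat. h i \<noteq> 0}"
  shows "Sum_any h = h 0 + Sum_any (\<lambda>i. h (Suc i))"
proof -
  obtain M where "\<forall>i\<in>{i. h i \<noteq> 0}. i \<le> M"
    using assms unfolding finite_nat_set_iff_bounded_le by blast
  then have M: "h i = 0" if "i > M" for i using that by (meson mem_Collect_eq not_less)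
  have "Sum_any h = sum h {..Suc M}"
    by (rule Sum_any_eq_sum) (simp_all add: M)
  moreover have "Sum_any (\<lambda>i. h (Suc i)) = (\<Sum>i\<le>M. h (Suc i))"
    by (rule Sum_any_eq_sum) (simp_all add: M)
  ultimately show ?thesis by (simp add: sum.atMost_Suc_shift del: sum.atMost_Suc)
qed

section \<open>Multiplication by powers of x_1 - x_2\<close>

definition mult_diff :: "(int \<Rightarrow> int \<Rightarrow> 'v::ab_group_add) \<Rightarrow> int \<Rightarrow> int \<Rightarrow> 'v"
  where "mult_diff G = (\<lambda>p q. G (p - 1) q - G p (q - 1))"

lemma mult_diff_pow_clinear:
  assumes "clinear T"
  shows "(mult_diff ^^ k) (\<lambda>p q. T (G p q)) = (\<lambda>p q. T ((mult_diff ^^ k) G p q))"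
  by (induction k) (simp_all add: mult_diff_def clinear_diff[OF assms])

lemma mult_diff_pow_diff:
  "(mult_diff ^^ k) (\<lambda>p q. G p q - H p q) =
    (\<lambda>p q. (mult_diff ^^ k) G p q - (mult_diff ^^ k) H p q)"
  by (induction k) (simp_all add: mult_diff_def algebra_simps)

lemma mult_diff_pow_add:
  "(mult_diff ^^ k) (\<lambda>p q. G p q + H p q) =
    (\<lambda>p q. (mult_diff ^^ k) G p q + (mult_diff ^^ k) H p q)"
  by (induction k) (simp_all add: mult_diff_def algebra_simps)

lemma mult_diff_pow_zero [simp]: "(mult_diff ^^ k) (\<lambda>p q. 0) = (\<lambda>p q. 0)"
  by (induction k) (simp_all add: mult_diff_def)

lemma mult_diff_pow_swap:
  "(mult_diff ^^ k) (\<lambda>q p. G p q) = (\<lambda>q p. (- 1) ^ k *\<^sub>C (mult_diff ^^ k) G p q)"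
  by (induction k)
    (simp_all add: mult_diff_def complex_vector.scale_right_diff_distrib)

lemma mult_diff_pow_plus: "(mult_diff ^^ (k + l)) G = (mult_diff ^^ k) ((mult_diff ^^ l) G)"
  by (simp add: funpow_add)

lemma mult_diff_pow_zero_mono:
  assumes "(mult_diff ^^ k) G = (\<lambda>p q. 0)" "k \<le> l"
  shows "(mult_diff ^^ l) G = (\<lambda>p q. 0)"
proof -
  obtain d where "l = d + k" using assms(2) by (metis add.commute le_Suc_ex)
  then show ?thesis by (simp add: mult_diff_pow_plus assms(1))
qed

lemma bounded_below2_mult_diff:
  assumes "bounded_below2 G"
  shows "bounded_below2 ((mult_diff ^^ k) G)"
proof (induction k)
  case (Suc k)
  show ?case
  proof (rule bounded_below2_mono[OF Suc])
    fix p q assume nz: "(mult_diff ^^ Suc k) G p q \<noteq> 0"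
    have "(mult_diff ^^ Suc k) G p q = (mult_diff ^^ k) G (p - int 1) (q - int 0) -
        (mult_diff ^^ k) G (p - int 0) (q - int 1)"
      by (simp add: mult_diff_def)
    with nz show "\<exists>i j::nat. (mult_diff ^^ k) G (p - int i) (q - int j) \<noteq> 0"
      by (metis diff_self)
  qed
qed (simp add: assms)

lemma act2_diff:
  assumes "bounded_below2 G" "bounded_below2 H"
  shows "act2 f g (\<lambda>p q. G p q - H p q) p q = act2 f g G p q - act2 f g H p q"
proof -
  obtain M where M: "\<And>i j. i > M \<or> j > M \<Longrightarrow> G (p - int i) (q - int j) = 0"
    using bounded_below2_bound[OF assms(1), of p q] by metis
  obtain M' where M': "\<And>i j. i > M' \<or> j > M' \<Longrightarrow> H (p - int i) (q - int j) = 0"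
    using bounded_below2_bound[OF assms(2), of p q] by metis
  show ?thesis
    by (subst (1 2 3) act2_eq_sum[of "max M M'"])
      (use M M' in \<open>auto simp: complex_vector.scale_right_diff_distrib sum_subtractf\<close>)
qed

lemma bounded_below2_shift:
  assumes "bounded_below2 G"
  shows "bounded_below2 (\<lambda>p q. G (p - 1) q)" "bounded_below2 (\<lambda>p q. G p (q - 1))"
proof -
  show "bounded_below2 (\<lambda>p q. G (p - 1) q)"
  proof (rule bounded_below2_mono[OF assms])
    fix p q assume "G (p - 1) q \<noteq> 0"
    then have "G (p - int 1) (q - int 0) \<noteq> 0" by simp
    then show "\<exists>i j::nat. G (p - int i) (q - int j) \<noteq> 0" by blast
  qed
  show "bounded_below2 (\<lambda>p q. G p (q - 1))"
  proof (rule bounded_below2_mono[OF assms])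
    fix p q assume "G p (q - 1) \<noteq> 0"
    then have "G (p - int 0) (q - int 1) \<noteq> 0" by simp
    then show "\<exists>i j::nat. G (p - int i) (q - int j) \<noteq> 0" by blast
  qed
qed

lemma mult_diff_pow_act2:
  assumes "bounded_below2 G"
  shows "(mult_diff ^^ k) (act2 f g G) = act2 f g ((mult_diff ^^ k) G)"
proof (induction k)
  case (Suc k)
  have shift: "act2 f g (\<lambda>p q. H (p - 1) q) p q = act2 f g H (p - 1) q"
    "act2 f g (\<lambda>p q. H p (q - 1)) p q = act2 f g H p (q - 1)" for H :: "int \<Rightarrow> int \<Rightarrow> 'a" and p q
    by (simp_all add: act2_def algebra_simps)
  let ?H = "(mult_diff ^^ k) G"
  have "act2 f g (mult_diff ?H) p q = mult_diff (act2 f g ?H) p q" for p q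
    using act2_diff[OF bounded_below2_shift[OF bounded_below2_mult_diff[OF assms, of k]], of f g p q]
    by (simp add: mult_diff_def shift)
  then show ?case by (simp add: Suc fun_eq_iff)
qed simp

section \<open>Truncation in one variable and cancellation of x_1 - x_2\<close>

definition fst_trunc :: "(int \<Rightarrow> int \<Rightarrow> 'v::zero) \<Rightarrow> bool"
  where "fst_trunc G \<longleftrightarrow> (\<exists>N. \<forall>p q. p < N \<longrightarrow> G p q = 0)"

definition snd_trunc :: "(int \<Rightarrow> int \<Rightarrow> 'v::zero) \<Rightarrow> bool"
  where "snd_trunc G \<longleftrightarrow> (\<exists>N. \<forall>p q. q < N \<longrightarrow> G p q = 0)"

lemma fst_trunc_mult_diff: "fst_trunc G \<Longrightarrow> fst_trunc ((mult_diff ^^ k) G)"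
proof (induction k)
  case (Suc k)
  then obtain N where "\<And>p q. p < N \<Longrightarrow> (mult_diff ^^ k) G p q = 0" by (auto simp: fst_trunc_def)
  then show ?case unfolding fst_trunc_def by (intro exI[of _ N]) (simp add: mult_diff_def)
qed simp

lemma snd_trunc_mult_diff: "snd_trunc G \<Longrightarrow> snd_trunc ((mult_diff ^^ k) G)"
proof (induction k)
  case (Suc k)
  then obtain N where "\<And>p q. q < N \<Longrightarrow> (mult_diff ^^ k) G p q = 0" by (auto simp: snd_trunc_def)
  then show ?case unfolding snd_trunc_def by (intro exI[of _ N]) (simp add: mult_diff_def)
qed simp

text \<open>The coefficients of a series killed by x_1 - x_2 are constant along each line p + q = m,
  and truncation in x_2 makes this constant zero. The delta function shows what goes wrong for
  series unbounded in both directions.\<close>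

lemma mult_diff_inj:
  assumes "snd_trunc G" "mult_diff G = (\<lambda>p q. 0)"
  shows "G = (\<lambda>p q. 0)"
proof (intro ext)
  fix p q
  obtain N where N: "\<And>p q. q < N \<Longrightarrow> G p q = 0" using assms(1) by (auto simp: snd_trunc_def)
  have "G p (N + int n) = 0" for n p
  proof (induction n arbitrary: p)
    case 0
    have "G p N = G (p + 1) (N - 1)" using fun_cong[OF fun_cong[OF assms(2)], of "p + 1" N]
      by (simp add: mult_diff_def)
    then show ?case by (simp add: N)
  next
    case (Suc n)
    have "G p (N + int (Suc n)) = G (p + 1) (N + int n)"
      using fun_cong[OF fun_cong[OF assms(2)], of "p + 1" "N + int (Suc n)"]
      by (simp add: mult_diff_def algebra_simps)
    then show ?case by (simp add: Suc)
  qed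
  note * = this[of p "nat (q - N)"]
  show "G p q = 0"
  proof (cases "q < N")
    case False
    then have "N + int (nat (q - N)) = q" by simp
    then show ?thesis using * by (simp only:)
  qed (rule N)
qed

lemma mult_diff_pow_inj:
  assumes "snd_trunc G" "(mult_diff ^^ k) G = (\<lambda>p q. 0)"
  shows "G = (\<lambda>p q. 0)"
  using assms(2)
proof (induction k)
  case (Suc k)
  then have "mult_diff ((mult_diff ^^ k) G) = (\<lambda>p q. 0)" by (simp only: funpow.simps o_apply)
  then show ?case by (intro Suc.IH mult_diff_inj[OF snd_trunc_mult_diff[OF assms(1)]])
qed simp

lemma box_line_finite:
  assumes "fst_trunc f" "snd_trunc f"
  shows "finite {p. f p (m - p) \<noteq> 0}"
proof -
  obtain N N' where N: "\<And>p q. p < N \<Longrightarrow> f p q = 0" and N': "\<And>p q. q < N' \<Longrightarrow> f p q = 0"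
    using assms unfolding fst_trunc_def snd_trunc_def by blast
  have "{p. f p (m - p) \<noteq> 0} \<subseteq> {N..m - N'}"
  proof clarify
    fix p assume nz: "f p (m - p) \<noteq> 0"
    then have "\<not> p < N" "\<not> m - p < N'" using N N' by blast+
    then show "p \<in> {N..m - N'}" by simp
  qed
  then show ?thesis by (rule finite_subset) simp
qed

section \<open>Taylor expansion and the delta function\<close>

text \<open>
  \<open>taylor j f n\<close> is the coefficient of \<open>x\<^sub>0\<^sup>j x\<^sub>2\<^sup>n\<close> in \<open>f(x\<^sub>2 + x\<^sub>0, x\<^sub>2)\<close>.
\<close>

definition taylor :: "int \<Rightarrow> (int \<Rightarrow> int \<Rightarrow> 'v::complex_vector) \<Rightarrow> int \<Rightarrow> 'v"
  where "taylor j f n = (if j < 0 then 0 else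
    Sum_any (\<lambda>p. (of_int p gchoose nat j) *\<^sub>C f p (n + j - p)))"

lemma finite_scaleC: "finite {p. f p \<noteq> 0} \<Longrightarrow> finite {p. c p *\<^sub>C (f p :: 'v::complex_vector) \<noteq> 0}"
  by (erule rev_finite_subset) auto

text \<open>Pascal's rule: multiplication by x_1 becomes multiplication by x_2 + x_0 after the
  substitution.\<close>

lemma taylor_fst_shift:
  assumes "fst_trunc f" "snd_trunc f"
  shows "taylor j (\<lambda>p q. f (p - 1) q) n = taylor j f (n - 1) + taylor (j - 1) f n"
proof (cases "j < 0")
  case False
  have fin: "finite {p. f p (m - p) \<noteq> 0}" for m by (rule box_line_finite[OF assms])
  have "taylor j (\<lambda>p q. f (p - 1) q) n =
      Sum_any (\<lambda>p. (of_int p + 1 gchoose nat j) *\<^sub>C f p (n - 1 + j - p))"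
    unfolding taylor_def using False by (subst Sum_any_int_shift[of _ 1]) (simp add: algebra_simps)
  also have "\<dots> = taylor j f (n - 1) + taylor (j - 1) f n"
  proof (cases "j = 0")
    case True
    then show ?thesis by (simp add: taylor_def)
  next
    case j: False
    then have j': "nat j = Suc (nat (j - 1))" using False by simp
    have "(of_int p + 1 gchoose nat j) *\<^sub>C f p (n - 1 + j - p) =
      (of_int p gchoose nat j) *\<^sub>C f p (n - 1 + j - p) +
      (of_int p gchoose nat (j - 1)) *\<^sub>C f p (n + (j - 1) - p)" for p
      unfolding j' gbinomial_Suc_Suc by (simp add: complex_vector.scale_left_distrib algebra_simps)
    then have "Sum_any (\<lambda>p. (of_int p + 1 gchoose nat j) *\<^sub>C f p (n - 1 + j - p)) =
        Sum_any (\<lambda>p. (of_int p gchoose nat j) *\<^sub>C f p (n - 1 + j - p)) +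
        Sum_any (\<lambda>p. (of_int p gchoose nat (j - 1)) *\<^sub>C f p (n + (j - 1) - p))"
      by (simp only: Sum_any.distrib[OF finite_scaleC[OF fin] finite_scaleC[OF fin]])
    then show ?thesis using j False by (simp add: taylor_def)
  qed
  finally show ?thesis .
qed (simp add: taylor_def)

lemma taylor_snd_shift: "taylor j (\<lambda>p q. f p (q - 1)) n = taylor j f (n - 1)"
  by (simp add: taylor_def algebra_simps)

lemma taylor_add:
  assumes "fst_trunc f" "snd_trunc f" "fst_trunc g" "snd_trunc g"
  shows "taylor j (\<lambda>p q. f p q + g p q) n = taylor j f n + taylor j g n"
  by (simp add: taylor_def complex_vector.scale_right_distrib Sum_any.distrib
      finite_scaleC box_line_finite assms)

lemma taylor_diff:
  assumes "fst_trunc f" "snd_trunc f" "fst_trunc g" "snd_trunc g"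
  shows "taylor j (\<lambda>p q. f p q - g p q) n = taylor j f n - taylor j g n"
  by (simp add: taylor_def complex_vector.scale_right_diff_distrib Sum_any_diff
      finite_scaleC box_line_finite assms)

lemma taylor_clinear:
  assumes "fst_trunc f" "snd_trunc f" "clinear T"
  shows "T (taylor j f n) = taylor j (\<lambda>p q. T (f p q)) n"
  by (simp add: taylor_def clinear_Sum_any[OF assms(3)] finite_scaleC box_line_finite assms(1,2)
      clinear_scale[OF assms(3)] clinear_zero[OF assms(3)])

lemma trunc_shift:
  "fst_trunc f \<Longrightarrow> fst_trunc (\<lambda>p q. f (p - 1) q)" "snd_trunc f \<Longrightarrow> snd_trunc (\<lambda>p q. f (p - 1) q)"
  "fst_trunc f \<Longrightarrow> fst_trunc (\<lambda>p q. f p (q - 1))" "snd_trunc f \<Longrightarrow> snd_trunc (\<lambda>p q. f p (q - 1))"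
proof -
  show "fst_trunc f \<Longrightarrow> fst_trunc (\<lambda>p q. f (p - 1) q)"
    unfolding fst_trunc_def by (erule exE, rule_tac x = N in exI) simp
  show "snd_trunc f \<Longrightarrow> snd_trunc (\<lambda>p q. f (p - 1) q)"
    unfolding snd_trunc_def by (erule exE, rule_tac x = N in exI) simp
  show "fst_trunc f \<Longrightarrow> fst_trunc (\<lambda>p q. f p (q - 1))"
    unfolding fst_trunc_def by (erule exE, rule_tac x = N in exI) simp
  show "snd_trunc f \<Longrightarrow> snd_trunc (\<lambda>p q. f p (q - 1))"
    unfolding snd_trunc_def by (erule exE, rule_tac x = N in exI) simp
qed

lemma lower_trunc_taylor:
  assumes "fst_trunc f" "snd_trunc f"
  shows "lower_trunc (taylor j f)"
proof -
  obtain N N' where N: "\<And>p q. p < N \<Longrightarrow> f p q = 0" and N': "\<And>p q. q < N' \<Longrightarrow> f p q = 0"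
    using assms unfolding fst_trunc_def snd_trunc_def by blast
  have "f p (n + j - p) = 0" if "n < N + N' - j" for n p
    using N[of p] N'[of "n + j - p"] that by (cases "p < N") auto
  then have "\<forall>n<N + N' - j. taylor j f n = 0"
    by (simp add: taylor_def)
  then show ?thesis unfolding lower_trunc_def by blast
qed

lemma minus_one_power_cancel: "(- 1) ^ i * ((- 1) ^ i * x) = (x :: 'a::ring_1)"
  by (induction i) simp_all

lemma minus_one_power_square: "(- 1) ^ i * (- 1) ^ i = (1 :: 'a::ring_1)"
  using minus_one_power_cancel[of i 1] by simp

text \<open>Coefficients of \<open>(x\<^sub>1 - x\<^sub>2)\<^sup>r G\<close>, expanded in nonnegative powers of \<open>x\<^sub>2\<close>,
  respectively of \<open>x\<^sub>1\<close>.\<close>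

definition expand12 :: "int \<Rightarrow> (int \<Rightarrow> int \<Rightarrow> 'v::complex_vector) \<Rightarrow> int \<Rightarrow> int \<Rightarrow> 'v"
  where "expand12 r G p q =
    Sum_any (\<lambda>i::nat. ((- 1) ^ i * (of_int r gchoose i)) *\<^sub>C G (p - r + int i) (q - int i))"

definition expand21 :: "int \<Rightarrow> (int \<Rightarrow> int \<Rightarrow> 'v::complex_vector) \<Rightarrow> int \<Rightarrow> int \<Rightarrow> 'v"
  where "expand21 r G p q = (- 1) powi r *\<^sub>C expand12 r (\<lambda>q p. G p q) q p"

lemma finite_snd_trunc:
  assumes "snd_trunc G"
  shows "finite {i::nat. G (a i) (q - int i) \<noteq> 0}"
proof -
  obtain N where N: "\<And>p q. q < N \<Longrightarrow> G p q = 0" using assms by (auto simp: snd_trunc_def)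
  have "{i::nat. G (a i) (q - int i) \<noteq> 0} \<subseteq> {..nat (q - N)}"
  proof (intro subsetI)
    fix i :: nat assume "i \<in> {i. G (a i) (q - int i) \<noteq> 0}"
    then have "G (a i) (q - int i) \<noteq> 0" by simp
    then have "\<not> q - int i < N" using N by blast
    then show "i \<in> {..nat (q - N)}" by simp
  qed
  then show ?thesis by (rule finite_subset) simp
qed

text \<open>Pascal's rule again, for (x_1 - x_2)^r (x_1 - x_2). Truncation in x_2 makes the sums
  finite, which legitimates this reassociation.\<close>

lemma expand12_mult_diff:
  assumes "snd_trunc G"
  shows "expand12 r (mult_diff G) p q = expand12 (r + 1) G p q"
proof -
  define c where "c r i = (- 1) ^ i * (of_int r gchoose i :: complex)" for r i
  note fin = finite_scaleC[OF finite_snd_trunc[OF assms]]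
  have fin': "finite {i. c s i *\<^sub>C G (p - s + int i) (q - int i) \<noteq> 0}"
    "finite {i. c r i *\<^sub>C G (p - r - 1 + int i) (q - int i) \<noteq> 0}"
    "finite {i. c r i *\<^sub>C G (p - r + int i) (q - 1 - int i) \<noteq> 0}"
    "finite {i. c r i *\<^sub>C G (p - r + int i) (q - int (Suc i)) \<noteq> 0}"
    "finite {i. c r (Suc i) *\<^sub>C G (p - r + int i) (q - int (Suc i)) \<noteq> 0}" for s
    using fin[of _ _ q] fin[of _ _ "q - 1"] by (simp_all add: algebra_simps)
  have cS: "c (r + 1) (Suc i) = c r (Suc i) - c r i" for i
    using gbinomial_Suc_Suc[of "of_int r :: complex" i] by (simp add: c_def algebra_simps)
  have "expand12 (r + 1) G p q = G (p - r - 1) q +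
      Sum_any (\<lambda>i. c (r + 1) (Suc i) *\<^sub>C G (p - r + int i) (q - int (Suc i)))"
    unfolding expand12_def c_def[symmetric] using fin'(1)[of "r + 1"]
    by (subst Sum_any_Suc) (simp_all add: c_def algebra_simps)
  also have "Sum_any (\<lambda>i. c (r + 1) (Suc i) *\<^sub>C G (p - r + int i) (q - int (Suc i))) =
      Sum_any (\<lambda>i. c r (Suc i) *\<^sub>C G (p - r + int i) (q - int (Suc i))) -
      Sum_any (\<lambda>i. c r i *\<^sub>C G (p - r + int i) (q - int (Suc i)))"
    unfolding cS complex_vector.scale_left_diff_distrib
    by (rule Sum_any_diff[OF fin'(5) fin'(4)])
  also have "G (p - r - 1) q + (Sum_any (\<lambda>i. c r (Suc i) *\<^sub>C G (p - r + int i) (q - int (Suc i))) -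
      Sum_any (\<lambda>i. c r i *\<^sub>C G (p - r + int i) (q - int (Suc i)))) =
    Sum_any (\<lambda>i. c r i *\<^sub>C G (p - r - 1 + int i) (q - int i)) -
      Sum_any (\<lambda>i. c r i *\<^sub>C G (p - r + int i) (q - 1 - int i))"
    using fin'(2) by (subst (3) Sum_any_Suc) (simp_all add: c_def algebra_simps)
  also have "\<dots> = Sum_any (\<lambda>i. c r i *\<^sub>C G (p - r - 1 + int i) (q - int i) -
      c r i *\<^sub>C G (p - r + int i) (q - 1 - int i))"
    by (rule Sum_any_diff[OF fin'(2,3), symmetric])
  also have "\<dots> = expand12 r (mult_diff G) p q"
    unfolding expand12_def c_def mult_diff_def
    by (simp add: complex_vector.scale_right_diff_distrib algebra_simps)
  finally show ?thesis ..
qed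

lemma expand12_mult_diff_pow:
  assumes "snd_trunc G"
  shows "expand12 r ((mult_diff ^^ k) G) p q = expand12 (r + int k) G p q"
  by (induction k arbitrary: r)
    (simp_all add: expand12_mult_diff snd_trunc_mult_diff assms algebra_simps)

lemma expand12_scaleC:
  assumes "snd_trunc G"
  shows "expand12 r (\<lambda>p q. c *\<^sub>C G p q) p q = c *\<^sub>C expand12 r G p q"
  unfolding expand12_def
  using clinear_Sum_any[OF clinear_scaleC[OF clinear_ident] finite_scaleC[OF finite_snd_trunc[OF assms]]]
  by (simp add: mult.commute)

lemma snd_trunc_swap: "snd_trunc (\<lambda>q p. G p q) \<longleftrightarrow> fst_trunc G"
  unfolding snd_trunc_def fst_trunc_def by meson

lemma expand21_mult_diff_pow:
  assumes "fst_trunc G"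
  shows "expand21 r ((mult_diff ^^ k) G) p q = expand21 (r + int k) G p q"
proof -
  have tr: "snd_trunc (\<lambda>q p. G p q)" using assms by (simp add: snd_trunc_swap)
  define H where "H = (mult_diff ^^ k) (\<lambda>q p. G p q)"
  have "(\<lambda>q p. (mult_diff ^^ k) G p q) = (\<lambda>q p. (- 1) ^ k *\<^sub>C H q p)"
    using mult_diff_pow_swap[of k G] by (simp add: H_def minus_one_power_square)
  then have "expand21 r ((mult_diff ^^ k) G) p q =
      (- 1) powi r *\<^sub>C expand12 r (\<lambda>q p. (- 1) ^ k *\<^sub>C H q p) q p"
    by (simp add: expand21_def)
  also have "\<dots> = (- 1) powi r *\<^sub>C (- 1) ^ k *\<^sub>C expand12 r H q p"
    by (subst expand12_scaleC) (simp_all add: H_def snd_trunc_mult_diff tr)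
  also have "\<dots> = expand21 (r + int k) G p q"
    by (simp add: H_def expand21_def expand12_mult_diff_pow[OF tr] power_int_add)
  finally show ?thesis .
qed

text \<open>The two expansions of \<open>(x\<^sub>1 - x\<^sub>2)\<^sup>-\<^sup>n\<^sup>-\<^sup>1\<close> differ by \<open>\<partial>\<^sub>2\<^sup>n/n!\<close> of the delta function, whose
  coefficients on both sides of the gap are given by the same binomial coefficient.\<close>

lemma expand_diff_neg:
  assumes "fst_trunc f" "snd_trunc f"
  shows "expand12 (- int n - 1) f p q - expand21 (- int n - 1) f p q =
    Sum_any (\<lambda>s. (of_int (s - p - 1) gchoose n) *\<^sub>C f s (p + q + int n + 1 - s))"
proof -
  define g where "g s = (of_int (s - p - 1) gchoose n :: complex) *\<^sub>C f s (p + q + int n + 1 - s)" for s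
  have fin: "finite {s. g s \<noteq> 0}" unfolding g_def
    by (rule finite_scaleC[OF box_line_finite[OF assms]])
  \<comment> \<open>In the gap the upper argument s - p - 1 is a natural number below n, so the
    binomial coefficient vanishes; hence the ranges of the two expansions account for the whole
    sum.\<close>
  have gap: "g s = 0" if "p < s" "s < p + int n + 1" for s
  proof -
    have "of_int (s - p - 1) = (of_nat (nat (s - p - 1)) :: complex)" using that by simp
    moreover have "nat (s - p - 1) < n" using that by linarith
    ultimately show ?thesis by (simp add: g_def flip: binomial_gbinomial)
  qed
  have 12: "expand12 (- int n - 1) f p q = Sum_any (\<lambda>s. if s \<ge> p + int n + 1 then g s else 0)"
  proof -
    have "Sum_any (\<lambda>s. if s \<ge> p + int n + 1 then g s else 0) =
      Sum_any (\<lambda>i::nat. if p + int n + 1 + int i \<ge> p + int n + 1 then g (p + int n + 1 + int i) else 0)"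
    proof (rule Sum_any_reindex_inj)
      show "inj (\<lambda>i::nat. p + int n + 1 + int i)" by (rule injI) simp
      fix s assume "s \<notin> range (\<lambda>i::nat. p + int n + 1 + int i)"
      moreover have "s = p + int n + 1 + int (nat (s - (p + int n + 1)))" if "s \<ge> p + int n + 1"
        using that by simp
      ultimately have "\<not> s \<ge> p + int n + 1" by blast
      then show "(if s \<ge> p + int n + 1 then g s else 0) = 0" by simp
    qed
    moreover have "(- 1) ^ i * (of_int (- int n - 1) gchoose i) = (of_nat (n + i) gchoose n :: complex)" for i
    proof -
      have "(- 1) ^ i * (of_int (- int n - 1) gchoose i) = (of_nat (n + i) gchoose i :: complex)"
      proof -
        have "(of_int (- int n - 1) :: complex) = - (of_nat n + 1)" by simp
        then show ?thesis
          by (simp only: gbinomial_minus minus_one_power_cancel) (simp add: algebra_simps)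
      qed
      also have "\<dots> = of_nat (n + i) gchoose n"
        by (subst gbinomial_of_nat_symmetric) simp_all
      finally show ?thesis .
    qed
    ultimately show ?thesis
      unfolding expand12_def g_def by (simp add: algebra_simps)
  qed
  have 21: "expand21 (- int n - 1) f p q = Sum_any (\<lambda>s. if s \<le> p then - g s else 0)"
  proof -
    have "Sum_any (\<lambda>s. if s \<le> p then - g s else 0) =
      Sum_any (\<lambda>i::nat. if p - int i \<le> p then - g (p - int i) else 0)"
    proof (rule Sum_any_reindex_inj)
      show "inj (\<lambda>i::nat. p - int i)" by (rule injI) simp
      fix s assume "s \<notin> range (\<lambda>i::nat. p - int i)"
      moreover have "s = p - int (nat (p - s))" if "s \<le> p"
        using that by simp
      ultimately have "\<not> s \<le> p" by blast
      then show "(if s \<le> p then - g s else 0) = 0" by simp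
    qed
    moreover have "(- 1) powi (- int n - 1) * ((- 1) ^ i * (of_int (- int n - 1) gchoose i)) =
        - (of_int (- int i - 1) gchoose n :: complex)" for i
      using gbinomial_index_swap[of i n, where ?'a = complex]
      by (simp add: power_int_diff power_int_minus minus_one_power_cancel flip: power_inverse)
    moreover have "expand21 (- int n - 1) f p q = Sum_any (\<lambda>i::nat.
        ((- 1) powi (- int n - 1) * ((- 1) ^ i * (of_int (- int n - 1) gchoose i))) *\<^sub>C
          f (p - int i) (q + int n + 1 + int i))"
    proof -
      have "snd_trunc (\<lambda>q p. f p q)" using assms(1) by (simp add: snd_trunc_swap)
      from finite_scaleC[OF finite_snd_trunc[OF this]] show ?thesis
        unfolding expand21_def expand12_def
        by (subst clinear_Sum_any[OF clinear_scaleC[OF clinear_ident]]) (simp_all add: algebra_simps)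
    qed
    ultimately show ?thesis
      unfolding g_def by (simp add: algebra_simps)
  qed
  have f12: "finite {s. (if s \<ge> p + int n + 1 then g s else 0) \<noteq> 0}"
    by (rule finite_subset[OF _ fin]) auto
  have f21: "finite {s. (if s \<le> p then - g s else 0) \<noteq> 0}"
    by (rule finite_subset[OF _ fin]) auto
  have "(if s \<ge> p + int n + 1 then g s else 0) - (if s \<le> p then - g s else 0) = g s" for s
    using gap[of s] by auto
  then have "Sum_any g = Sum_any (\<lambda>s. (if s \<ge> p + int n + 1 then g s else 0) - (if s \<le> p then - g s else 0))"
    by simp
  also have "\<dots> = expand12 (- int n - 1) f p q - expand21 (- int n - 1) f p q"
    unfolding 12 21 by (rule Sum_any_diff[OF f12 f21])
  finally show ?thesis by (simp add: g_def)
qed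

text \<open>A nonnegative power is a polynomial, so the two expansions are the same finite sum read
  from opposite ends, via i to n - i.\<close>

lemma expand_diff_nonneg: "expand12 (int n) f p q = expand21 (int n) f p q"
proof -
  have *: "expand12 (int n) g p q =
      (\<Sum>i\<le>n. ((- 1) ^ i * (of_nat n gchoose i)) *\<^sub>C g (p - int n + int i) (q - int i))" for p q
      and g :: "int \<Rightarrow> int \<Rightarrow> 'a"
    unfolding expand12_def of_int_of_nat_eq
    by (rule Sum_any_eq_sum) (auto simp flip: binomial_gbinomial)
  have "expand12 (int n) f p q =
      (\<Sum>i\<le>n. ((- 1) ^ (n - i) * (of_nat n gchoose (n - i))) *\<^sub>C f (p - int n + int (n - i)) (q - int (n - i)))"
    unfolding * by (rule sum.reindex_bij_witness[of _ "\<lambda>i. n - i" "\<lambda>i. n - i"]) auto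
  also have "\<dots> = (\<Sum>i\<le>n. ((- 1) ^ n * ((- 1) ^ i * (of_nat n gchoose i))) *\<^sub>C f (p - int i) (q - int n + int i))"
  proof (rule sum.cong[OF refl])
    fix i assume "i \<in> {..n}"
    then have i: "i \<le> n" by simp
    then have "n = (n - i) + i" by simp
    then have "(- 1) ^ n = (- 1) ^ (n - i) * (- 1 :: complex) ^ i" by (metis power_add)
    then have "(- 1) ^ n * (- 1) ^ i = (- 1 :: complex) ^ (n - i)"
      by (simp add: mult.assoc minus_one_power_cancel flip: power_mult_distrib)
    moreover have "(of_nat n gchoose (n - i)) = (of_nat n gchoose i :: complex)"
      using i by (metis gbinomial_of_nat_symmetric)
    ultimately show "((- 1) ^ (n - i) * (of_nat n gchoose (n - i))) *\<^sub>C f (p - int n + int (n - i)) (q - int (n - i)) =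
      ((- 1) ^ n * ((- 1) ^ i * (of_nat n gchoose i))) *\<^sub>C f (p - int i) (q - int n + int i)"
      using i by (simp add: of_nat_diff algebra_simps flip: mult.assoc)
  qed
  also have "\<dots> = expand21 (int n) f p q"
    unfolding expand21_def * by (simp add: complex_vector.scale_sum_right)
  finally show ?thesis .
qed

text \<open>Pulling out (x_1 - x_2)^k turns both expansions into those of (x_1 - x_2)^(r - k) f with
  the same f, which is truncated in both variables because it comes from G and from H. Their
  difference is a derivative of the delta function times f, that is, a combination of Taylor
  coefficients of f. The index of \<open>taylor\<close> is raised by k because f contains the extra
  factor x_0^k. This is the passage from locality to the Jacobi identity.\<close>

theorem jacobi_arrays:
  fixes k :: nat
  assumes tr: "snd_trunc G" "fst_trunc H"
    and eq: "(mult_diff ^^ k) G = f" "(mult_diff ^^ k) H = f"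
  shows "expand12 r G p q - expand21 r H p q =
    Sum_any (\<lambda>i::nat. (of_int (- p - 1) gchoose i) *\<^sub>C taylor (int k - r - 1 - int i) f (p + q + 1 + int i))"
proof -
  have f: "fst_trunc f" "snd_trunc f"
    using fst_trunc_mult_diff[OF tr(2), of k] snd_trunc_mult_diff[OF tr(1), of k] eq by simp_all
  have 1: "expand12 r G p q - expand21 r H p q = expand12 (r - int k) f p q - expand21 (r - int k) f p q"
    using expand12_mult_diff_pow[OF tr(1), of "r - int k" k p q]
      expand21_mult_diff_pow[OF tr(2), of "r - int k" k p q] eq by simp
  show ?thesis
  proof (cases "r - int k < 0")
    case False
    then have "taylor (int k - r - 1 - int i) f m = 0" for i m by (simp add: taylor_def)
    moreover have "r - int k = int (nat (r - int k))" using False by simp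
    ultimately show ?thesis unfolding 1 using expand_diff_nonneg[of "nat (r - int k)" f p q] by simp
  next
    case True
    define n where "n = nat (int k - r - 1)"
    have n: "r - int k = - int n - 1" "int k - r - 1 = int n" using True by (simp_all add: n_def)
    define m where "m = p + q + 1 + int n"
    define A where "A = {s. f s (m - s) \<noteq> 0}"
    have A: "finite A" unfolding A_def by (rule box_line_finite[OF f])
    have t: "taylor (int n - int i) f (p + q + 1 + int i) =
        (\<Sum>s\<in>A. (of_int s gchoose (n - i)) *\<^sub>C f s (m - s))" if "i \<le> n" for i
    proof -
      have "nat (int n - int i) = n - i" by simp
      moreover have "p + q + 1 + int i + (int n - int i) = m" by (simp add: m_def)
      ultimately show ?thesis
        using that unfolding taylor_def by (subst Sum_any_eq_sum[OF A]) (auto simp: A_def)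
    qed
    have "Sum_any (\<lambda>i::nat. (of_int (- p - 1) gchoose i) *\<^sub>C taylor (int n - int i) f (p + q + 1 + int i)) =
        (\<Sum>i\<le>n. (of_int (- p - 1) gchoose i) *\<^sub>C taylor (int n - int i) f (p + q + 1 + int i))"
      by (rule Sum_any_eq_sum) (auto simp: taylor_def)
    also have "\<dots> = (\<Sum>i\<le>n. \<Sum>s\<in>A. ((of_int (- p - 1) gchoose i) * (of_int s gchoose (n - i))) *\<^sub>C f s (m - s))"
      by (rule sum.cong) (simp_all add: t complex_vector.scale_sum_right)
    also have "\<dots> = (\<Sum>s\<in>A. (\<Sum>i\<le>n. (of_int (- p - 1) gchoose i) * (of_int s gchoose (n - i))) *\<^sub>C f s (m - s))"
      by (subst sum.swap) (simp add: complex_vector.scale_sum_left)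
    \<comment> \<open>Vandermonde's identity for the arguments -p - 1 and s.\<close>
    also have "\<dots> = (\<Sum>s\<in>A. (of_int (s - p - 1) gchoose n) *\<^sub>C f s (m - s))"
      by (rule sum.cong[OF refl], subst gbinomial_Vandermonde[unfolded atLeast0AtMost])
        (simp add: algebra_simps)
    also have "\<dots> = Sum_any (\<lambda>s. (of_int (s - p - 1) gchoose n) *\<^sub>C f s (p + q + int n + 1 - s))"
      by (subst Sum_any_eq_sum[OF A]) (auto simp: A_def m_def algebra_simps)
    also have "\<dots> = expand12 r G p q - expand21 r H p q"
      unfolding 1 n by (rule expand_diff_neg[OF f, symmetric])
    finally show ?thesis unfolding n ..
  qed
qed

lemma sum_drop_low:
  fixes g :: "nat \<Rightarrow> 'v::comm_monoid_add"
  assumes "\<And>a. a < l \<Longrightarrow> g a = 0" "\<And>a. a > M \<Longrightarrow> g a = 0"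
  shows "(\<Sum>a\<le>M. g a) = (\<Sum>a\<le>M. g (a + l))"
proof -
  have "(\<Sum>a\<le>M. g a) = (\<Sum>a\<le>M + l. g a)"
    by (rule sum.mono_neutral_left) (auto simp: assms)
  also have "\<dots> = (\<Sum>a\<in>{l..M + l}. g a)"
    by (rule sum.mono_neutral_right) (auto simp: assms)
  also have "\<dots> = (\<Sum>a\<le>M. g (a + l))"
    by (rule sum.reindex_bij_witness[of _ "\<lambda>a. a + l" "\<lambda>a. a - l"]) auto
  finally show ?thesis .
qed

text \<open>The factor x_1^a x_2^b becomes (x_2 + x_0)^a x_2^b; Vandermonde's identity for a + s
  plays the role of the binomial expansion.\<close>

lemma taylor_shift_shift:
  assumes "fst_trunc f" "snd_trunc f"
  shows "Sum_any (\<lambda>p. (of_int p gchoose J) *\<^sub>C f (p - int a) (n + int J - p - int b)) =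
    (\<Sum>l\<le>J. (of_nat a gchoose l) *\<^sub>C taylor (int J - int l) f (n + int l - int a - int b))"
proof -
  define m where "m = n + int J - int a - int b"
  define A where "A = {s. f s (m - s) \<noteq> 0}"
  have A: "finite A" unfolding A_def by (rule box_line_finite[OF assms])
  have t: "taylor (int J - int l) f (n + int l - int a - int b) =
      (\<Sum>s\<in>A. (of_int s gchoose (J - l)) *\<^sub>C f s (m - s))" if "l \<le> J" for l
  proof -
    have "nat (int J - int l) = J - l" by simp
    moreover have "n + int l - int a - int b + (int J - int l) = m" by (simp add: m_def)
    ultimately show ?thesis
      using that unfolding taylor_def by (subst Sum_any_eq_sum[OF A]) (auto simp: A_def)
  qed
  have "Sum_any (\<lambda>p. (of_int p gchoose J) *\<^sub>C f (p - int a) (n + int J - p - int b)) =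
    Sum_any (\<lambda>p. (of_nat a + of_int p gchoose J) *\<^sub>C f p (m - p))"
    by (subst Sum_any_int_shift[of _ "int a"]) (simp add: m_def algebra_simps)
  also have "\<dots> = (\<Sum>s\<in>A. (of_nat a + of_int s gchoose J) *\<^sub>C f s (m - s))"
    by (rule Sum_any_eq_sum[OF A]) (simp add: A_def)
  also have "\<dots> = (\<Sum>s\<in>A. \<Sum>l\<le>J. (of_nat a gchoose l) *\<^sub>C (of_int s gchoose (J - l)) *\<^sub>C f s (m - s))"
    by (subst gbinomial_Vandermonde[symmetric]) (simp add: atLeast0AtMost complex_vector.scale_sum_left)
  also have "\<dots> = (\<Sum>l\<le>J. (of_nat a gchoose l) *\<^sub>C (\<Sum>s\<in>A. (of_int s gchoose (J - l)) *\<^sub>C f s (m - s)))"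
    by (subst sum.swap) (simp add: complex_vector.scale_sum_right)
  also have "\<dots> = (\<Sum>l\<le>J. (of_nat a gchoose l) *\<^sub>C taylor (int J - int l) f (n + int l - int a - int b))"
    by (rule sum.cong) (simp_all add: t)
  finally show ?thesis .
qed

text \<open>Substituting \<open>x\<^sub>1 = x\<^sub>2 + x\<^sub>0\<close> in \<open>e\<^bsup>\<lambda>x\<^sub>1 + \<mu>x\<^sub>2\<^esup>\<close> gives \<open>e\<^bsup>\<lambda>x\<^sub>0\<^esup> e\<^bsup>(\<lambda>+\<mu>)x\<^sub>2\<^esup>\<close>.\<close>

lemma taylor_exp:
  assumes tr: "fst_trunc f" "snd_trunc f"
  shows "taylor j (act2 (fps_exp lam) (fps_exp mu) f) n =
    act (fps_exp lam) (\<lambda>j. act (fps_exp (lam + mu)) (taylor j f) n) j"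
proof (cases "j < 0")
  case False
  define J where "J = nat j"
  have j: "j = int J" using False by (simp add: J_def)
  obtain N1 N2 where N1: "\<And>p q. p < N1 \<Longrightarrow> f p q = 0" and N2: "\<And>p q. q < N2 \<Longrightarrow> f p q = 0"
    using tr unfolding fst_trunc_def snd_trunc_def by blast
  define N where "N = min N1 N2"
  have N: "f p q = 0" if "p < N \<or> q < N" for p q using that N1 N2 by (auto simp: N_def)
  \<comment> \<open>The array vanishes once either exponent is below N, and the two exponents have
    sum n + j - a - b; so no term with a or b beyond n + j - 2N survives.\<close>
  define M where "M = nat (n + j - 2 * N)"
  define e where "e c i = fps_nth (fps_exp c :: complex fps) i" for c i
  define T where "T l = taylor (int J - int l) f" for l
  have T0: "T l m = 0" if "m < 2 * N - j + int l" for l m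
  proof -
    have "f p (m + (int J - int l) - p) = 0" for p
      by (rule N) (use that j in linarith)
    then show ?thesis by (simp add: T_def taylor_def)
  qed
  have f0: "f (p - int a) (n + int J - p - int b) = 0" if "a > M \<or> b > M" for p a b
    by (rule N) (use that j in \<open>auto simp: M_def\<close>)
  define A where "A = {N..n + j - N}"
  have outA: "f (p - int a) (n + int J - p - int b) = 0" if "p \<notin> A" for p a b
    by (rule N) (use that j in \<open>auto simp: A_def\<close>)
  have inner: "act2 (fps_exp lam) (fps_exp mu) f p (n + int J - p) =
      (\<Sum>a\<le>M. \<Sum>b\<le>M. (e lam a * e mu b) *\<^sub>C f (p - int a) (n + int J - p - int b))" for p
    by (subst act2_eq_sum[of M]) (simp_all add: f0 e_def)
  have "taylor j (act2 (fps_exp lam) (fps_exp mu) f) n =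
      Sum_any (\<lambda>p. (of_int p gchoose J) *\<^sub>C (\<Sum>a\<le>M. \<Sum>b\<le>M. (e lam a * e mu b) *\<^sub>C f (p - int a) (n + int J - p - int b)))"
    unfolding taylor_def j inner by simp
  also have "\<dots> = (\<Sum>p\<in>A. (of_int p gchoose J) *\<^sub>C (\<Sum>a\<le>M. \<Sum>b\<le>M. (e lam a * e mu b) *\<^sub>C f (p - int a) (n + int J - p - int b)))"
    by (rule Sum_any_eq_sum) (simp_all add: outA A_def[symmetric], simp add: A_def)
  also have "\<dots> = (\<Sum>a\<le>M. \<Sum>b\<le>M. (e lam a * e mu b) *\<^sub>C (\<Sum>p\<in>A. (of_int p gchoose J) *\<^sub>C f (p - int a) (n + int J - p - int b)))"
    unfolding complex_vector.scale_sum_right complex_vector.scale_scale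
    by (subst sum.swap, rule sum.cong[OF refl], subst sum.swap) (simp add: mult_ac)
  also have "\<dots> = (\<Sum>a\<le>M. \<Sum>b\<le>M. (e lam a * e mu b) *\<^sub>C (\<Sum>l\<le>J. (of_nat a gchoose l) *\<^sub>C T l (n + int l - int a - int b)))"
  proof -
    have "(\<Sum>p\<in>A. (of_int p gchoose J) *\<^sub>C f (p - int a) (n + int J - p - int b)) =
      (\<Sum>l\<le>J. (of_nat a gchoose l) *\<^sub>C T l (n + int l - int a - int b))" for a b
      unfolding T_def taylor_shift_shift[OF tr, symmetric]
      by (rule Sum_any_eq_sum[symmetric]) (simp_all add: outA, simp add: A_def)
    then show ?thesis by simp
  qed
  also have "\<dots> = (\<Sum>l\<le>J. \<Sum>a\<le>M. (e lam a * (of_nat a gchoose l)) *\<^sub>C (\<Sum>b\<le>M. e mu b *\<^sub>C T l (n + int l - int a - int b)))"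
    unfolding complex_vector.scale_sum_right complex_vector.scale_scale
    by (subst (2) sum.swap, subst sum.swap) (simp add: mult_ac)
  also have "\<dots> = (\<Sum>l\<le>J. e lam l *\<^sub>C act (fps_exp (lam + mu)) (T l) n)"
  proof (rule sum.cong[OF refl])
    fix l assume "l \<in> {..J}"
    have lt: "lower_trunc (T l)" unfolding T_def by (rule lower_trunc_taylor[OF tr])
    define h where "h m = (\<Sum>b\<le>M. e mu b *\<^sub>C T l (m - int b))" for m
    have h0: "h m = 0" if "m < 2 * N - j + int l" for m
    proof -
      have "T l (m - int b) = 0" for b by (rule T0) (use that in linarith)
      then show ?thesis by (simp add: h_def)
    qed
    \<comment> \<open>Terms with a < l carry a vanishing binomial coefficient. After the shift by l,
      the coefficient (a + l choose l)/(a + l)! factors as 1/(l! a!), which separates the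
      exponential in x_0 from the one in x_2.\<close>
    have "(\<Sum>a\<le>M. (e lam a * (of_nat a gchoose l)) *\<^sub>C h (n + int l - int a)) =
        (\<Sum>a\<le>M. (e lam (a + l) * (of_nat (a + l) gchoose l)) *\<^sub>C h (n + int l - int (a + l)))"
      by (rule sum_drop_low) (auto simp: M_def j intro!: h0 simp flip: binomial_gbinomial)
    also have "\<dots> = (\<Sum>a\<le>M. (e lam l * e lam a) *\<^sub>C h (n - int a))"
    proof (rule sum.cong[OF refl])
      fix a
      have "(of_nat (a + l) gchoose l) = (fact (a + l) / (fact l * fact a) :: complex)"
        unfolding binomial_gbinomial[symmetric] by (subst binomial_fact) simp_all
      then have "e lam (a + l) * (of_nat (a + l) gchoose l) = e lam l * e lam a"
        by (simp add: e_def power_add)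
      then show "(e lam (a + l) * (of_nat (a + l) gchoose l)) *\<^sub>C h (n + int l - int (a + l)) =
          (e lam l * e lam a) *\<^sub>C h (n - int a)" by simp
    qed
    also have "\<dots> = e lam l *\<^sub>C act (fps_exp lam) (act (fps_exp mu) (T l)) n"
    proof -
      have "act (fps_exp mu) (T l) (n - int a) = h (n - int a)" for a
        unfolding h_def e_def by (rule act_eq_sum) (rule T0, auto simp: M_def j)
      moreover have "h (n - int a) = 0" if "a > M" for a
        by (rule h0) (use that in \<open>auto simp: M_def j\<close>)
      ultimately have "act (fps_exp lam) (act (fps_exp mu) (T l)) n = (\<Sum>a\<le>M. e lam a *\<^sub>C h (n - int a))"
        by (subst act_eq_sum[of M]) (simp_all add: e_def)
      then show ?thesis by (simp add: complex_vector.scale_sum_right)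
    qed
    finally show "(\<Sum>a\<le>M. (e lam a * (of_nat a gchoose l)) *\<^sub>C (\<Sum>b\<le>M. e mu b *\<^sub>C T l (n + int l - int a - int b))) =
        e lam l *\<^sub>C act (fps_exp (lam + mu)) (T l) n"
      by (simp add: h_def act_mult[OF lt] fps_exp_add_mult)
  qed
  also have "\<dots> = act (fps_exp lam) (\<lambda>j. act (fps_exp (lam + mu)) (taylor j f) n) j"
    unfolding T_def e_def j by (rule act_eq_sum[symmetric]) (simp add: taylor_def act_def)
  finally show ?thesis .
next
  case True
  then show ?thesis by (simp add: taylor_def act_def)
qed


section \<open>The substitution x_1 = x_2 + x_0 in the presence of a third variable\<close>

definition mult_diff13 :: "(int \<Rightarrow> int \<Rightarrow> int \<Rightarrow> 'v::ab_group_add) \<Rightarrow> int \<Rightarrow> int \<Rightarrow> int \<Rightarrow> 'v"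
  where "mult_diff13 H = (\<lambda>p q s. H (p - 1) q s - H p q (s - 1))"

definition mult_diff23 :: "(int \<Rightarrow> int \<Rightarrow> int \<Rightarrow> 'v::ab_group_add) \<Rightarrow> int \<Rightarrow> int \<Rightarrow> int \<Rightarrow> 'v"
  where "mult_diff23 H = (\<lambda>p q s. H p (q - 1) s - H p q (s - 1))"

definition mult_diff12 :: "(int \<Rightarrow> int \<Rightarrow> int \<Rightarrow> 'v::ab_group_add) \<Rightarrow> int \<Rightarrow> int \<Rightarrow> int \<Rightarrow> 'v"
  where "mult_diff12 H = (\<lambda>p q s. H (p - 1) q s - H p (q - 1) s)"

lemma mult_diff13_pow: "(mult_diff13 ^^ m) H = (\<lambda>p q s. (mult_diff ^^ m) (\<lambda>p s. H p q s) p s)"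
  by (induction m) (simp_all add: mult_diff13_def mult_diff_def)

lemma mult_diff23_pow: "(mult_diff23 ^^ m) H = (\<lambda>p q s. (mult_diff ^^ m) (\<lambda>q s. H p q s) q s)"
  by (induction m) (simp_all add: mult_diff23_def mult_diff_def)

lemma mult_diff12_pow: "(mult_diff12 ^^ m) H = (\<lambda>p q s. (mult_diff ^^ m) (\<lambda>p q. H p q s) p q)"
  by (induction m) (simp_all add: mult_diff12_def mult_diff_def)

lemma funpow_commute:
  assumes "\<And>x. f (g x) = g (f x)"
  shows "(f ^^ m) ((g ^^ n) x) = (g ^^ n) ((f ^^ m) x)"
proof -
  have "f ((g ^^ n) x) = (g ^^ n) (f x)" for x by (induction n) (simp_all add: assms)
  then show ?thesis by (induction m) simp_all
qed

text \<open>After the substitution x_1 - x_3 equals (x_2 - x_3) + x_0, and the summand x_0 lowers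
  the Taylor index by one. This is the recursion behind \<open>taylor_kernel\<close>.\<close>

lemma taylor_mult_diff13:
  assumes "\<And>s. fst_trunc (\<lambda>p q. H p q s)" "\<And>s. snd_trunc (\<lambda>p q. H p q s)"
  shows "(\<lambda>n s. taylor j (\<lambda>p q. mult_diff13 H p q s) n) =
    (\<lambda>n s. mult_diff (\<lambda>n s. taylor j (\<lambda>p q. H p q s) n) n s + taylor (j - 1) (\<lambda>p q. H p q s) n)"
proof (intro ext)
  fix n s
  show "taylor j (\<lambda>p q. mult_diff13 H p q s) n =
    mult_diff (\<lambda>n s. taylor j (\<lambda>p q. H p q s) n) n s + taylor (j - 1) (\<lambda>p q. H p q s) n"
    unfolding mult_diff13_def mult_diff_def
    by (subst taylor_diff)
      (use trunc_shift[of "\<lambda>p q. H p q s"] assms taylor_fst_shift[of "\<lambda>p q. H p q s"] in simp_all)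
qed

lemma taylor_mult_diff23_pow:
  assumes "\<And>s. fst_trunc (\<lambda>p q. H p q s)" "\<And>s. snd_trunc (\<lambda>p q. H p q s)"
  shows "(\<lambda>n s. taylor j (\<lambda>p q. (mult_diff23 ^^ m) H p q s) n) =
    (mult_diff ^^ m) (\<lambda>n s. taylor j (\<lambda>p q. H p q s) n)
    \<and> (\<forall>s. fst_trunc (\<lambda>p q. (mult_diff23 ^^ m) H p q s) \<and> snd_trunc (\<lambda>p q. (mult_diff23 ^^ m) H p q s))"
proof (induction m)
  case (Suc m)
  define K where "K = (mult_diff23 ^^ m) H"
  have K: "fst_trunc (\<lambda>p q. K p q s)" "snd_trunc (\<lambda>p q. K p q s)" for s
    using Suc by (auto simp: K_def)
  have "(\<lambda>n s. taylor j (\<lambda>p q. mult_diff23 K p q s) n) = mult_diff (\<lambda>n s. taylor j (\<lambda>p q. K p q s) n)"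
  proof (intro ext)
    fix n s
    show "taylor j (\<lambda>p q. mult_diff23 K p q s) n = mult_diff (\<lambda>n s. taylor j (\<lambda>p q. K p q s) n) n s"
      unfolding mult_diff23_def mult_diff_def
      by (subst taylor_diff)
        (use trunc_shift[of "\<lambda>p q. K p q s"] K taylor_snd_shift[of j "\<lambda>p q. K p q s"] in simp_all)
  qed
  moreover have "fst_trunc (\<lambda>p q. mult_diff23 K p q s) \<and> snd_trunc (\<lambda>p q. mult_diff23 K p q s)" for s
  proof
    obtain N N' where N: "\<And>p q. p < N \<Longrightarrow> K p q s = 0" and N': "\<And>p q. p < N' \<Longrightarrow> K p q (s - 1) = 0"
      using K(1)[of s] K(1)[of "s - 1"] unfolding fst_trunc_def by blast
    show "fst_trunc (\<lambda>p q. mult_diff23 K p q s)"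
      unfolding fst_trunc_def by (rule exI[of _ "min N N'"]) (simp add: mult_diff23_def N N')
  next
    obtain N N' where N: "\<And>p q. q < N \<Longrightarrow> K p q s = 0" and N': "\<And>p q. q < N' \<Longrightarrow> K p q (s - 1) = 0"
      using K(2)[of s] K(2)[of "s - 1"] unfolding snd_trunc_def by blast
    show "snd_trunc (\<lambda>p q. mult_diff23 K p q s)"
      unfolding snd_trunc_def by (rule exI[of _ "min N N'"]) (simp add: mult_diff23_def N N')
  qed
  ultimately show ?case using Suc by (simp add: K_def)
qed (simp add: assms)

lemma trunc_mult_diff13:
  assumes "\<And>s. fst_trunc (\<lambda>p q. K p q s)" "\<And>s. snd_trunc (\<lambda>p q. K p q s)"
  shows "fst_trunc (\<lambda>p q. mult_diff13 K p q s)" "snd_trunc (\<lambda>p q. mult_diff13 K p q s)"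
proof -
  obtain N N' where N: "\<And>p q. p < N \<Longrightarrow> K p q s = 0" and N': "\<And>p q. p < N' \<Longrightarrow> K p q (s - 1) = 0"
    using assms(1)[of s] assms(1)[of "s - 1"] unfolding fst_trunc_def by blast
  show "fst_trunc (\<lambda>p q. mult_diff13 K p q s)"
    unfolding fst_trunc_def by (rule exI[of _ "min N N'"]) (simp add: mult_diff13_def N N')
next
  obtain N N' where N: "\<And>p q. q < N \<Longrightarrow> K p q s = 0" and N': "\<And>p q. q < N' \<Longrightarrow> K p q (s - 1) = 0"
    using assms(2)[of s] assms(2)[of "s - 1"] unfolding snd_trunc_def by blast
  show "snd_trunc (\<lambda>p q. mult_diff13 K p q s)"
    unfolding snd_trunc_def by (rule exI[of _ "min N N'"]) (simp add: mult_diff13_def N N')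
qed

lemma mult_diff_pow_zero_add:
  assumes "(mult_diff ^^ k) G = (\<lambda>p q. 0)" "(mult_diff ^^ l) H = (\<lambda>p q. 0)"
  shows "(mult_diff ^^ (k + l)) (\<lambda>p q. G p q - H p q) = (\<lambda>p q. 0)"
  using mult_diff_pow_zero_mono[OF assms(1), of "k + l"] mult_diff_pow_zero_mono[OF assms(2), of "k + l"]
  by (simp add: mult_diff_pow_diff)

text \<open>Substituting \<open>x\<^sub>1 = x\<^sub>2 + x\<^sub>0\<close> in \<open>(x\<^sub>1 - x\<^sub>3)\<^sup>m H = 0\<close>: each coefficient in \<open>x\<^sub>0\<close> is annihilated
  by a power of \<open>x\<^sub>2 - x\<^sub>3\<close>, by induction on \<open>m\<close> and on the coefficient.\<close>

lemma taylor_kernel: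
  "\<exists>M. \<forall>H. (\<forall>s. fst_trunc (\<lambda>p q. H p q s) \<and> snd_trunc (\<lambda>p q. H p q s)) \<longrightarrow>
    (mult_diff13 ^^ m) H = (\<lambda>p q s. 0 :: 'v::complex_vector) \<longrightarrow>
    (mult_diff ^^ M) (\<lambda>n s. taylor j (\<lambda>p q. H p q s) n) = (\<lambda>n s. 0)"
proof (induction m arbitrary: j)
  case 0
  show ?case by (rule exI[of _ 0]) (simp add: taylor_def)
next
  case (Suc m)
  let ?P = "\<lambda>j M. \<forall>H :: int \<Rightarrow> int \<Rightarrow> int \<Rightarrow> 'v. (\<forall>s. fst_trunc (\<lambda>p q. H p q s) \<and> snd_trunc (\<lambda>p q. H p q s)) \<longrightarrow>
    (mult_diff13 ^^ Suc m) H = (\<lambda>p q s. 0) \<longrightarrow>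
    (mult_diff ^^ M) (\<lambda>n s. taylor j (\<lambda>p q. H p q s) n) = (\<lambda>n s. 0)"
  have "\<exists>M. ?P (int J - 1) M" for J
  proof (induction J)
    case 0
    show ?case by (rule exI[of _ 0]) (simp add: taylor_def)
  next
    case (Suc J)
    then obtain M2 where M2: "?P (int J - 1) M2" by blast
    from Suc.prems Suc.IH \<open>\<And>j. \<exists>M. \<forall>H. (\<forall>s. fst_trunc (\<lambda>p q. H p q s) \<and> snd_trunc (\<lambda>p q. H p q s)) \<longrightarrow>
      (mult_diff13 ^^ m) H = (\<lambda>p q s. 0 :: 'v) \<longrightarrow>
      (mult_diff ^^ M) (\<lambda>n s. taylor j (\<lambda>p q. H p q s) n) = (\<lambda>n s. 0)\<close>
    obtain M1 where M1: "\<And>H :: int \<Rightarrow> int \<Rightarrow> int \<Rightarrow> 'v. (\<forall>s. fst_trunc (\<lambda>p q. H p q s) \<and> snd_trunc (\<lambda>p q. H p q s)) \<Longrightarrow>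
      (mult_diff13 ^^ m) H = (\<lambda>p q s. 0) \<Longrightarrow>
      (mult_diff ^^ M1) (\<lambda>n s. taylor (int J) (\<lambda>p q. H p q s) n) = (\<lambda>n s. 0)"
      by metis
    \<comment> \<open>One factor x_2 - x_3 rewrites the coefficient \<open>C\<close> as
      \<open>A - B\<close>, where \<open>A\<close> belongs to (x_1 - x_3)H, with a smaller m, and
      \<open>B\<close> is the preceding coefficient of H; M1 and M2 further factors kill these
      two.\<close>
    have "?P (int J) (Suc (M1 + M2))"
    proof (intro allI impI)
      fix H :: "int \<Rightarrow> int \<Rightarrow> int \<Rightarrow> 'v"
      assume tr: "\<forall>s. fst_trunc (\<lambda>p q. H p q s) \<and> snd_trunc (\<lambda>p q. H p q s)"
        and H: "(mult_diff13 ^^ Suc m) H = (\<lambda>p q s. 0)"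
      define A where "A = (\<lambda>n s. taylor (int J) (\<lambda>p q. mult_diff13 H p q s) n)"
      define B where "B = (\<lambda>n s. taylor (int J - 1) (\<lambda>p q. H p q s) n)"
      define C where "C = (\<lambda>n s. taylor (int J) (\<lambda>p q. H p q s) n)"
      have A: "(mult_diff ^^ M1) A = (\<lambda>n s. 0)"
        unfolding A_def
        by (rule M1) (use tr H in \<open>simp_all add: trunc_mult_diff13 funpow_Suc_right del: funpow.simps(2)\<close>)
      have B: "(mult_diff ^^ M2) B = (\<lambda>n s. 0)"
        unfolding B_def using M2 tr H by blast
      have "mult_diff C = (\<lambda>n s. A n s - B n s)"
        using taylor_mult_diff13[of H "int J"] tr unfolding A_def B_def C_def
        by (simp add: fun_eq_iff)
      then show "(mult_diff ^^ Suc (M1 + M2)) C = (\<lambda>n s. 0)"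
        using mult_diff_pow_zero_add[OF A B] by (simp add: funpow_Suc_right del: funpow.simps(2))
    qed
    then show ?case by (simp del: funpow.simps(2)) blast
  qed
  from this[of "nat (j + 1)"] show ?case
  proof (cases "j < 0")
    case True
    then show ?thesis by (intro exI[of _ 0]) (simp add: taylor_def)
  next
    case False
    then have "int (nat (j + 1)) - 1 = j" by simp
    with \<open>\<exists>M. ?P (int (nat (j + 1)) - 1) M\<close> show ?thesis by (simp only:)
  qed
qed

section \<open>Fields and locality\<close>

text \<open>A field is given by its coefficients: \<open>A p\<close> is the coefficient of \<open>x\<^sup>p\<close>, that is,
  the mode of index \<open>-p-1\<close>.\<close>

definition is_field :: "(int \<Rightarrow> 'v::complex_vector \<Rightarrow> 'v) \<Rightarrow> bool"
  where "is_field A \<longleftrightarrow> (\<forall>p. clinear (A p)) \<and> (\<forall>v. lower_trunc (\<lambda>p. A p v))"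

definition locality ::
    "nat \<Rightarrow> complex \<Rightarrow> (int \<Rightarrow> 'v::complex_vector \<Rightarrow> 'v) \<Rightarrow> (int \<Rightarrow> 'v \<Rightarrow> 'v) \<Rightarrow> bool"
  where "locality k c A B \<longleftrightarrow>
    (\<forall>w. (mult_diff ^^ k) (\<lambda>p q. A p (B q w) - c *\<^sub>C B q (A p w)) = (\<lambda>p q. 0))"

text \<open>\<open>nth_prod k A B i\<close> is the coefficient of \<open>x\<^sub>0\<^sup>i\<close> in \<open>A(x\<^sub>2 + x\<^sub>0) B(x\<^sub>2)\<close>, that is, the product
  \<open>A\<^sub>(\<^sub>-\<^sub>i\<^sub>-\<^sub>1\<^sub>) B\<close>; here \<open>k\<close> is a locality exponent for \<open>A\<close> and \<open>B\<close>.\<close>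

definition nth_prod ::
    "nat \<Rightarrow> (int \<Rightarrow> 'v::complex_vector \<Rightarrow> 'v) \<Rightarrow> (int \<Rightarrow> 'v \<Rightarrow> 'v) \<Rightarrow> int \<Rightarrow> int \<Rightarrow> 'v \<Rightarrow> 'v"
  where "nth_prod k A B i n w = taylor (i + int k) ((mult_diff ^^ k) (\<lambda>p q. A p (B q w))) n"

lemma is_fieldD:
  assumes "is_field A"
  shows "clinear (A p)" "lower_trunc (\<lambda>p. A p v)"
  using assms by (auto simp: is_field_def)

lemma locality_mono: "locality k c A B \<Longrightarrow> k \<le> l \<Longrightarrow> locality l c A B"
  unfolding locality_def using mult_diff_pow_zero_mono by blast

lemma locality_sym:
  assumes "locality k c A B" "c * c = 1"
  shows "locality k c B A"
  unfolding locality_def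
proof
  fix w
  define F where "F p q = A p (B q w) - c *\<^sub>C B q (A p w)" for p q
  have 0: "(mult_diff ^^ k) F = (\<lambda>p q. 0)"
    using assms(1) by (simp add: locality_def F_def[abs_def])
  have "(\<lambda>p q. B p (A q w) - c *\<^sub>C A q (B p w)) = (\<lambda>p q. (- c) *\<^sub>C F q p)"
    by (simp add: F_def complex_vector.scale_right_diff_distrib assms(2) algebra_simps)
  then show "(mult_diff ^^ k) (\<lambda>p q. B p (A q w) - c *\<^sub>C A q (B p w)) = (\<lambda>p q. 0)"
    using mult_diff_pow_clinear[OF clinear_scaleC[OF clinear_ident], of k "- c" "\<lambda>p q. F q p"]
      mult_diff_pow_swap[of k F] by (simp add: 0)
qed

lemma snd_trunc_prod:
  assumes "is_field A" "is_field B"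
  shows "snd_trunc (\<lambda>p q. A p (B q w))"
proof -
  obtain N where "\<And>q. q < N \<Longrightarrow> B q w = 0"
    using is_fieldD(2)[OF assms(2), of w] by (auto simp: lower_trunc_def)
  then show ?thesis
    unfolding snd_trunc_def by (intro exI[of _ N]) (simp add: clinear_zero[OF is_fieldD(1)[OF assms(1)]])
qed

lemma fst_trunc_prod:
  assumes "is_field A" "is_field B"
  shows "fst_trunc (\<lambda>p q. A q (B p w))"
  using snd_trunc_prod[OF assms, of w] snd_trunc_swap by blast

lemma fst_trunc_clinear: "fst_trunc G \<Longrightarrow> clinear T \<Longrightarrow> fst_trunc (\<lambda>p q. T (G p q))"
  unfolding fst_trunc_def by (metis clinear_zero)

lemma snd_trunc_clinear: "snd_trunc G \<Longrightarrow> clinear T \<Longrightarrow> snd_trunc (\<lambda>p q. T (G p q))"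
  unfolding snd_trunc_def by (metis clinear_zero)

lemma fst_trunc_add:
  "fst_trunc G \<Longrightarrow> fst_trunc H \<Longrightarrow> fst_trunc (\<lambda>p q. G p q + H p q :: 'v::ab_group_add)"
  unfolding fst_trunc_def by (elim exE, rule_tac x = "min N Na" in exI) simp

lemma snd_trunc_add:
  "snd_trunc G \<Longrightarrow> snd_trunc H \<Longrightarrow> snd_trunc (\<lambda>p q. G p q + H p q :: 'v::ab_group_add)"
  unfolding snd_trunc_def by (elim exE, rule_tac x = "min N Na" in exI) simp

lemma locality_eq:
  assumes "locality k c A B"
  shows "(mult_diff ^^ k) (\<lambda>p q. A p (B q w)) = (\<lambda>p q. c *\<^sub>C (mult_diff ^^ k) (\<lambda>p q. B q (A p w)) p q)"
proof -
  have "(\<lambda>p q. (mult_diff ^^ k) (\<lambda>p q. A p (B q w)) p q - c *\<^sub>C (mult_diff ^^ k) (\<lambda>p q. B q (A p w)) p q)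
      = (\<lambda>p q. 0)"
    using spec[OF assms[unfolded locality_def], of w]
    by (simp only: mult_diff_pow_diff mult_diff_pow_clinear[OF clinear_scaleC[OF clinear_ident]])
  then show ?thesis by (simp add: fun_eq_iff)
qed

text \<open>The order A B bounds the powers of x_2 below, the order B A those of x_1. After
  multiplication by (x_1 - x_2)^k both orders agree up to the scalar c, so both bounds hold and x_1
  = x_2 + x_0 may be substituted.\<close>

lemma locality_trunc:
  assumes "is_field A" "is_field B" "locality k c A B"
  shows "fst_trunc ((mult_diff ^^ k) (\<lambda>p q. A p (B q w)))" "snd_trunc ((mult_diff ^^ k) (\<lambda>p q. A p (B q w)))"
proof -
  show "snd_trunc ((mult_diff ^^ k) (\<lambda>p q. A p (B q w)))"
    by (rule snd_trunc_mult_diff[OF snd_trunc_prod[OF assms(1,2)]])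
  show "fst_trunc ((mult_diff ^^ k) (\<lambda>p q. A p (B q w)))"
    unfolding locality_eq[OF assms(3)]
    by (rule fst_trunc_clinear[OF fst_trunc_mult_diff[OF fst_trunc_prod[OF assms(2,1)]]
          clinear_scaleC[OF clinear_ident]])
qed

lemma is_field_nth_prod:
  assumes "is_field A" "is_field B" "locality k c A B"
  shows "is_field (nth_prod k A B i)"
  unfolding is_field_def
proof (intro conjI allI)
  note tr = locality_trunc[OF assms]
  have sum: "(mult_diff ^^ k) (\<lambda>p q. A p (B q (x + y))) =
      (\<lambda>p q. (mult_diff ^^ k) (\<lambda>p q. A p (B q x)) p q + (mult_diff ^^ k) (\<lambda>p q. A p (B q y)) p q)" for x y
    by (simp add: clinear_add is_fieldD[OF assms(1)] is_fieldD[OF assms(2)] flip: mult_diff_pow_add)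
  have scale: "(mult_diff ^^ k) (\<lambda>p q. A p (B q (a *\<^sub>C x))) =
      (\<lambda>p q. a *\<^sub>C (mult_diff ^^ k) (\<lambda>p q. A p (B q x)) p q)" for a x
    by (simp add: clinear_scale is_fieldD[OF assms(1)] is_fieldD[OF assms(2)]
        flip: mult_diff_pow_clinear[OF clinear_scaleC[OF clinear_ident]])
  show "clinear (nth_prod k A B i n)" for n
    by (rule clinearI)
      (simp_all add: nth_prod_def sum scale taylor_add tr
        flip: taylor_clinear[OF tr clinear_scaleC[OF clinear_ident]])
  show "lower_trunc (\<lambda>n. nth_prod k A B i n v)" for v
    unfolding nth_prod_def by (rule lower_trunc_taylor[OF tr])
qed

text \<open>Dong's lemma. Moving C to the left past B costs (x_2 - x_3)^l and past A costs (x_1 -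
  x_3)^l; \<open>taylor_kernel\<close> converts the latter into a power of x_2 - x_3. Its exponent
  is chosen before the array, so a single M serves all vectors w, as locality demands.\<close>

lemma dong:
  assumes A: "is_field A" and B: "is_field B" and C: "is_field C"
    and AB: "locality k t A B" and AC: "locality l a A C" and BC: "locality l b B C"
  shows "\<exists>M. locality M (a * b) (nth_prod k A B i) C"
proof -
  note [simp] = clinear_zero[OF is_fieldD(1)[OF A]] clinear_zero[OF is_fieldD(1)[OF C]]
  obtain M where M: "\<And>H. (\<forall>s. fst_trunc (\<lambda>p q. H p q s) \<and> snd_trunc (\<lambda>p q. H p q s)) \<Longrightarrow>
    (mult_diff13 ^^ l) H = (\<lambda>p q s. 0 :: 'a) \<Longrightarrow>
    (mult_diff ^^ M) (\<lambda>n s. taylor (i + int k) (\<lambda>p q. H p q s) n) = (\<lambda>n s. 0)"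
    using taylor_kernel by metis
  have "locality (M + l) (a * b) (nth_prod k A B i) C"
    unfolding locality_def
  proof
    fix w
    define G where "G w = (mult_diff ^^ k) (\<lambda>p q. A p (B q w))" for w
    note tr = locality_trunc[OF A B AB, folded G_def]
    \<comment> \<open>The three orders A B C, C A B and A C B, with the signs collected on the way;
      Z mediates between X and Y.\<close>
    define X where "X = (\<lambda>p q s. A p (B q (C s w)))"
    define Y where "Y = (\<lambda>p q s. (a * b) *\<^sub>C C s (A p (B q w)))"
    define Z where "Z = (\<lambda>p q s. b *\<^sub>C A p (C s (B q w)))"
    define H where "H = (\<lambda>p q s. G (C s w) p q - (a * b) *\<^sub>C C s (G w p q))"
    have lin: "clinear (\<lambda>v. (a * b) *\<^sub>C C s v)" for s
      by (rule clinear_scaleC[OF is_fieldD(1)[OF C]])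
    have H: "H = (mult_diff12 ^^ k) (\<lambda>p q s. X p q s - Y p q s)"
      unfolding H_def G_def X_def Y_def mult_diff12_pow mult_diff_pow_diff
        mult_diff_pow_clinear[OF lin] ..
    have XZ: "(mult_diff23 ^^ l) (\<lambda>p q s. X p q s - Z p q s) = (\<lambda>p q s. 0)"
    proof -
      have "(\<lambda>q s. X p q s - Z p q s) = (\<lambda>q s. A p (B q (C s w) - b *\<^sub>C C s (B q w)))" for p
        by (simp add: X_def Z_def clinear_diff clinear_scale is_fieldD[OF A])
      then show ?thesis
        unfolding mult_diff23_pow using BC
        by (simp add: mult_diff_pow_clinear[OF is_fieldD(1)[OF A]] locality_def)
    qed
    have ZY: "(mult_diff13 ^^ l) (\<lambda>p q s. Z p q s - Y p q s) = (\<lambda>p q s. 0)"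
    proof -
      have "(\<lambda>p s. Z p q s - Y p q s) = (\<lambda>p s. b *\<^sub>C (A p (C s (B q w)) - a *\<^sub>C C s (A p (B q w))))" for q
        by (simp add: Y_def Z_def complex_vector.scale_right_diff_distrib mult.commute)
      then show ?thesis
        unfolding mult_diff13_pow using AC
        by (simp add: mult_diff_pow_clinear[OF clinear_scaleC[OF clinear_ident]] locality_def)
    qed
    have zero: "(mult_diff12 ^^ m) (\<lambda>p q s. 0 :: 'a) = (\<lambda>p q s. 0)"
      "(mult_diff13 ^^ m) (\<lambda>p q s. 0 :: 'a) = (\<lambda>p q s. 0)"
      "(mult_diff23 ^^ m) (\<lambda>p q s. 0 :: 'a) = (\<lambda>p q s. 0)" for m
      by (simp_all add: mult_diff12_pow mult_diff13_pow mult_diff23_pow)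
    have add: "(mult_diff13 ^^ m) (\<lambda>p q s. F p q s + F' p q s) =
        (\<lambda>p q s. (mult_diff13 ^^ m) F p q s + (mult_diff13 ^^ m) F' p q s)"
      "(mult_diff23 ^^ m) (\<lambda>p q s. F p q s + F' p q s) =
        (\<lambda>p q s. (mult_diff23 ^^ m) F p q s + (mult_diff23 ^^ m) F' p q s)" for m and F F' :: "int \<Rightarrow> int \<Rightarrow> int \<Rightarrow> 'a"
      by (simp_all add: mult_diff13_pow mult_diff23_pow mult_diff_pow_add)
    have c1: "(mult_diff13 ^^ m) ((mult_diff23 ^^ n) F) = (mult_diff23 ^^ n) ((mult_diff13 ^^ m) F)"
      for m n and F :: "int \<Rightarrow> int \<Rightarrow> int \<Rightarrow> 'a"
      by (rule funpow_commute) (simp add: mult_diff13_def mult_diff23_def fun_eq_iff algebra_simps)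
    have c2: "(mult_diff13 ^^ m) ((mult_diff12 ^^ n) F) = (mult_diff12 ^^ n) ((mult_diff13 ^^ m) F)"
      for m n and F :: "int \<Rightarrow> int \<Rightarrow> int \<Rightarrow> 'a"
      by (rule funpow_commute) (simp add: mult_diff13_def mult_diff12_def fun_eq_iff algebra_simps)
    have c3: "(mult_diff23 ^^ m) ((mult_diff12 ^^ n) F) = (mult_diff12 ^^ n) ((mult_diff23 ^^ m) F)"
      for m n and F :: "int \<Rightarrow> int \<Rightarrow> int \<Rightarrow> 'a"
      by (rule funpow_commute) (simp add: mult_diff23_def mult_diff12_def fun_eq_iff algebra_simps)
    have "(\<lambda>p q s. X p q s - Y p q s) = (\<lambda>p q s. (X p q s - Z p q s) + (Z p q s - Y p q s))"
      by simp
    then have "(mult_diff13 ^^ l) ((mult_diff23 ^^ l) (\<lambda>p q s. X p q s - Y p q s)) = (\<lambda>p q s. 0)"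
      by (simp only: add XZ zero) (simp add: c1 ZY zero)
    then have 0: "(mult_diff13 ^^ l) ((mult_diff23 ^^ l) H) = (\<lambda>p q s. 0)"
      by (simp add: H c2 c3 zero)
    have Htr: "fst_trunc (\<lambda>p q. H p q s)" "snd_trunc (\<lambda>p q. H p q s)" for s
    proof -
      obtain N N' where "\<And>p q. p < N \<Longrightarrow> G (C s w) p q = 0" "\<And>p q. p < N' \<Longrightarrow> G w p q = 0"
        using tr(1) unfolding fst_trunc_def by blast
      then show "fst_trunc (\<lambda>p q. H p q s)"
        unfolding fst_trunc_def by (intro exI[of _ "min N N'"]) (simp add: H_def)
      obtain N N' where "\<And>p q. q < N \<Longrightarrow> G (C s w) p q = 0" "\<And>p q. q < N' \<Longrightarrow> G w p q = 0"
        using tr(2) unfolding snd_trunc_def by blast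
      then show "snd_trunc (\<lambda>p q. H p q s)"
        unfolding snd_trunc_def by (intro exI[of _ "min N N'"]) (simp add: H_def)
    qed
    have "(mult_diff ^^ M) (\<lambda>n s. taylor (i + int k) (\<lambda>p q. (mult_diff23 ^^ l) H p q s) n) = (\<lambda>n s. 0)"
      by (rule M) (use taylor_mult_diff23_pow[OF Htr, of 0 l] 0 in auto)
    then have "(mult_diff ^^ (M + l)) (\<lambda>n s. taylor (i + int k) (\<lambda>p q. H p q s) n) = (\<lambda>n s. 0)"
      using taylor_mult_diff23_pow[OF Htr, of "i + int k" l] by (simp add: mult_diff_pow_plus)
    moreover have "taylor (i + int k) (\<lambda>p q. H p q s) n =
        nth_prod k A B i n (C s w) - (a * b) *\<^sub>C C s (nth_prod k A B i n w)" for n s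
      unfolding H_def nth_prod_def G_def[symmetric]
      by (subst taylor_diff)
        (simp_all add: tr fst_trunc_clinear[OF tr(1) lin] snd_trunc_clinear[OF tr(2) lin]
          flip: taylor_clinear[OF tr lin])
    ultimately show "(mult_diff ^^ (M + l)) (\<lambda>n s. nth_prod k A B i n (C s w) -
        (a * b) *\<^sub>C C s (nth_prod k A B i n w)) = (\<lambda>n s. 0)" by simp
  qed
  then show ?thesis by blast
qed

lemma mult_diff_pow_neg_snd:
  assumes "\<And>p q. q < 0 \<Longrightarrow> G p q = 0"
  shows "q < 0 \<Longrightarrow> (mult_diff ^^ k) G p q = 0" "(mult_diff ^^ k) G p 0 = G (p - int k) 0"
proof -
  show *: "q < 0 \<Longrightarrow> (mult_diff ^^ k) G p q = 0" for p q k
    by (induction k arbitrary: p q) (simp_all add: assms mult_diff_def)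
  show "(mult_diff ^^ k) G p 0 = G (p - int k) 0"
    by (induction k arbitrary: p) (simp_all add: * mult_diff_def algebra_simps)
qed

lemma mult_diff_pow_neg_fst:
  assumes "\<And>p q. p < 0 \<Longrightarrow> G p q = 0"
  shows "p < 0 \<Longrightarrow> (mult_diff ^^ k) G p q = 0"
  by (induction k arbitrary: p q) (simp_all add: assms mult_diff_def)

text \<open>On the vacuum (x_1 - x_2)^k A(x_1)B(x_2) has no negative powers of either variable, so
  x_2 may be set to zero. What remains is x_1^k A(x_1) applied to the state of B, and the index
  shift by k cancels x_1^k.\<close>

lemma nth_prod_state:
  assumes A: "is_field A" and B: "is_field B" and AB: "locality k c A B"
    and vA: "\<And>p. p < 0 \<Longrightarrow> A p vac = 0" and vB: "\<And>p. p < 0 \<Longrightarrow> B p vac = 0"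
  shows "n < 0 \<Longrightarrow> nth_prod k A B i n vac = 0" "nth_prod k A B i 0 vac = A i (B 0 vac)"
proof -
  define f where "f = (mult_diff ^^ k) (\<lambda>p q. A p (B q vac))"
  have q0: "f p q = 0" if "q < 0" for p q
    unfolding f_def
    by (rule mult_diff_pow_neg_snd(1)) (simp_all add: that vB clinear_zero is_fieldD(1)[OF A])
  have p0: "f p q = 0" if "p < 0" for p q
    unfolding f_def locality_eq[OF AB]
    by (subst mult_diff_pow_neg_fst) (simp_all add: that vA clinear_zero is_fieldD(1)[OF B])
  have f0: "f p 0 = A (p - int k) (B 0 vac)" for p
    unfolding f_def
    by (rule mult_diff_pow_neg_snd(2)) (simp_all add: vB clinear_zero is_fieldD(1)[OF A])
  define J where "J = i + int k"
  have z: "(of_int p gchoose nat J) *\<^sub>C f p (n + J - p) = 0" if "n \<le> 0" "0 \<le> J" "n < 0 \<or> p \<noteq> J" for p n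
  proof (cases "p < 0 \<or> n + J - p < 0")
    case True
    then show ?thesis using p0 q0 by auto
  next
    case False
    then have "nat p < nat J" "of_int p = (of_nat (nat p) :: complex)" using that by auto
    then show ?thesis by (simp flip: binomial_gbinomial)
  qed
  show "nth_prod k A B i n vac = 0" if "n < 0"
  proof (cases "J < 0")
    case False
    then have "(of_int p gchoose nat J) *\<^sub>C f p (n + J - p) = 0" for p
      by (intro z) (use that in auto)
    then have "taylor J f n = 0" unfolding taylor_def by (simp only: Sum_any.neutral if_cancel)
    then show ?thesis by (simp add: nth_prod_def f_def J_def)
  qed (simp add: nth_prod_def taylor_def J_def)
  show "nth_prod k A B i 0 vac = A i (B 0 vac)"
  proof (cases "J < 0")
    case True
    then show ?thesis using p0[of J 0] f0[of J] by (simp add: nth_prod_def taylor_def J_def)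
  next
    case False
    have "nth_prod k A B i 0 vac = Sum_any (\<lambda>p. (of_int p gchoose nat J) *\<^sub>C f p (0 + J - p))"
      using False by (simp add: nth_prod_def taylor_def flip: f_def J_def)
    also have "\<dots> = (\<Sum>p\<in>{J}. (of_int p gchoose nat J) *\<^sub>C f p (0 + J - p))"
      by (rule Sum_any_eq_sum) (use z[of 0] False in auto)
    also have "\<dots> = f J 0"
    proof -
      have "of_int J = (of_nat (nat J) :: complex)" using False by simp
      then show ?thesis by (simp flip: binomial_gbinomial)
    qed
    finally show ?thesis using f0[of J] by (simp add: J_def)
  qed
qed

text \<open>Commuting D through both fields applies d/dx_1 + d/dx_2, which annihilates (x_1 - x_2)^k
  and becomes d/dx_2 in the variables x_0, x_2.\<close>

lemma nth_prod_deriv: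
  assumes A: "is_field A" and B: "is_field B" and AB: "locality k c A B" and D: "clinear D"
    and dA: "\<And>p v. D (A p v) = A p (D v) + of_int (p + 1) *\<^sub>C A (p + 1) v"
    and dB: "\<And>p v. D (B p v) = B p (D v) + of_int (p + 1) *\<^sub>C B (p + 1) v"
  shows "D (nth_prod k A B i n w) = nth_prod k A B i n (D w) + of_int (n + 1) *\<^sub>C nth_prod k A B i (n + 1) w"
proof -
  define G where "G j w = (mult_diff ^^ j) (\<lambda>p q. A p (B q w))" for j w
  have dG: "D (G j w p q) = G j (D w) p q + (of_int (p + 1) *\<^sub>C G j w (p + 1) q + of_int (q + 1) *\<^sub>C G j w p (q + 1))" for j p q
  proof (induction j arbitrary: p q)
    case 0
    then show ?case
      by (simp add: G_def dA dB clinear_add clinear_scale is_fieldD(1)[OF A])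
  next
    case (Suc j)
    have G: "G (Suc j) w p q = G j w (p - 1) q - G j w p (q - 1)" for w p q
      by (simp add: G_def mult_diff_def)
    show ?case
      unfolding G clinear_diff[OF D] Suc
      by (simp add: complex_vector.scale_right_diff_distrib complex_vector.scale_left_distrib
          complex_vector.scale_left_diff_distrib algebra_simps)
  qed
  define f where "f = G k w"
  define J where "J = i + int k"
  have tr: "fst_trunc (G k w)" "snd_trunc (G k w)" for w
    using locality_trunc[OF A B AB] by (simp_all add: G_def)
  have np: "nth_prod k A B i n w = taylor J (G k w) n" for n w
    by (simp add: nth_prod_def G_def J_def)
  have fin: "finite {p. f p (m - p) \<noteq> 0}" for m
    unfolding f_def by (rule box_line_finite[OF tr])
  have tr1: "fst_trunc (\<lambda>p q. of_int (p + 1) *\<^sub>C f (p + 1) q)" "snd_trunc (\<lambda>p q. of_int (p + 1) *\<^sub>C f (p + 1) q)"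
    "fst_trunc (\<lambda>p q. of_int (q + 1) *\<^sub>C f p (q + 1))" "snd_trunc (\<lambda>p q. of_int (q + 1) *\<^sub>C f p (q + 1))"
  proof -
    obtain N N' where N: "\<And>p q. p < N \<Longrightarrow> f p q = 0" "\<And>p q. q < N' \<Longrightarrow> f p q = 0"
      using tr unfolding fst_trunc_def snd_trunc_def f_def by blast
    show "fst_trunc (\<lambda>p q. of_int (p + 1) *\<^sub>C f (p + 1) q)" "fst_trunc (\<lambda>p q. of_int (q + 1) *\<^sub>C f p (q + 1))"
      unfolding fst_trunc_def by (rule exI[of _ "N - 1"], simp add: N)+
    show "snd_trunc (\<lambda>p q. of_int (p + 1) *\<^sub>C f (p + 1) q)" "snd_trunc (\<lambda>p q. of_int (q + 1) *\<^sub>C f p (q + 1))"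
      unfolding snd_trunc_def by (rule exI[of _ "N' - 1"], simp add: N)+
  qed
  have "taylor J (\<lambda>p q. of_int (p + 1) *\<^sub>C f (p + 1) q + of_int (q + 1) *\<^sub>C f p (q + 1)) n =
      of_int (n + 1) *\<^sub>C taylor J f (n + 1)"
  proof (cases "J < 0")
    case False
    define b where "b p = (of_int p gchoose nat J :: complex)" for p
    define S where "S = {p. f p (n + J + 1 - p) \<noteq> 0}"
    have S: "finite S" unfolding S_def by (rule fin)
    have "taylor J (\<lambda>p q. of_int (p + 1) *\<^sub>C f (p + 1) q) n =
        Sum_any (\<lambda>p. (b p * of_int (p + 1)) *\<^sub>C f (p + 1) (n + J - p))"
      using False by (simp add: taylor_def b_def)
    also have "\<dots> = Sum_any (\<lambda>p. (b (p - 1) * of_int p) *\<^sub>C f p (n + J + 1 - p))"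
      by (subst Sum_any_int_shift[of _ "-1"]) (simp add: algebra_simps)
    also have "\<dots> = (\<Sum>p\<in>S. (b (p - 1) * of_int p) *\<^sub>C f p (n + J + 1 - p))"
      by (rule Sum_any_eq_sum[OF S]) (simp add: S_def)
    finally have 1: "taylor J (\<lambda>p q. of_int (p + 1) *\<^sub>C f (p + 1) q) n =
        (\<Sum>p\<in>S. (b (p - 1) * of_int p) *\<^sub>C f p (n + J + 1 - p))" .
    have "taylor J (\<lambda>p q. of_int (q + 1) *\<^sub>C f p (q + 1)) n =
        Sum_any (\<lambda>p. (b p * of_int (n + J - p + 1)) *\<^sub>C f p (n + J + 1 - p))"
      using False by (simp add: taylor_def b_def algebra_simps)
    also have "\<dots> = (\<Sum>p\<in>S. (b p * of_int (n + J - p + 1)) *\<^sub>C f p (n + J + 1 - p))"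
      by (rule Sum_any_eq_sum[OF S]) (simp add: S_def)
    finally have 2: "taylor J (\<lambda>p q. of_int (q + 1) *\<^sub>C f p (q + 1)) n =
        (\<Sum>p\<in>S. (b p * of_int (n + J - p + 1)) *\<^sub>C f p (n + J + 1 - p))" .
    have "taylor J f (n + 1) = Sum_any (\<lambda>p. b p *\<^sub>C f p (n + J + 1 - p))"
      using False by (simp add: taylor_def b_def algebra_simps)
    also have "\<dots> = (\<Sum>p\<in>S. b p *\<^sub>C f p (n + J + 1 - p))"
      by (rule Sum_any_eq_sum[OF S]) (simp add: S_def)
    finally have 3: "taylor J f (n + 1) = (\<Sum>p\<in>S. b p *\<^sub>C f p (n + J + 1 - p))" .
    \<comment> \<open>Absorption turns the first summand into (p - J) b(p), after which p and J
      cancel against the second.\<close>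
    have "b (p - 1) * of_int p + b p * of_int (n + J - p + 1) = of_int (n + 1) * b p" for p
    proof -
      have "b (p - 1) * of_int p = (of_int p - of_nat (nat J)) * b p"
        using gbinomial_absorb_comp[of "of_int p :: complex" "nat J"] by (simp add: b_def)
      then show ?thesis using False by (simp add: algebra_simps)
    qed
    then have "(b (p - 1) * of_int p) *\<^sub>C v + (b p * of_int (n + J - p + 1)) *\<^sub>C v =
        (of_int (n + 1) * b p) *\<^sub>C v" for p and v :: 'a
      by (simp only: complex_vector.scale_left_distrib[symmetric])
    then show ?thesis
      by (subst taylor_add[OF tr1])
        (simp only: 1 2 3 sum.distrib[symmetric] complex_vector.scale_sum_right complex_vector.scale_scale)
  qed (simp add: taylor_def)
  then have "taylor J (\<lambda>p q. D (f p q)) n = taylor J (G k (D w)) n + of_int (n + 1) *\<^sub>C taylor J f (n + 1)"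
    unfolding f_def dG
    by (subst taylor_add) (use tr tr1 in \<open>simp_all add: f_def fst_trunc_add snd_trunc_add\<close>)
  then show ?thesis
    unfolding np by (simp add: taylor_clinear[OF tr D] f_def)
qed

text \<open>Meant for U = exp(sJ_1). The factor exp(lam x_1 + mu x_2) picked up by the two fields
  commutes with (x_1 - x_2)^k, and \<open>taylor_exp\<close> rewrites it in x_0 and x_2.\<close>

lemma nth_prod_exp:
  assumes A: "is_field A" and B: "is_field B" and AB: "locality k c A B" and U: "clinear U"
    and A': "is_field A'" and B': "is_field B'" and AB': "locality k c A' B'"
    and uA: "\<And>p v. U (A p v) = act (fps_exp lam) (\<lambda>p. A' p (U v)) p"
    and uB: "\<And>p v. U (B p v) = act (fps_exp mu) (\<lambda>p. B' p (U v)) p"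
  shows "U (nth_prod k A B i n w) =
    act (fps_exp lam) (\<lambda>i. act (fps_exp (lam + mu)) (\<lambda>n. nth_prod k A' B' i n (U w)) n) i"
proof -
  note tr = locality_trunc[OF A B AB] and tr' = locality_trunc[OF A' B' AB']
  let ?G = "\<lambda>p q. A' p (B' q (U w))"
  have lt: "lower_trunc (\<lambda>p. ?G p q)" for q by (rule is_fieldD(2)[OF A'])
  have st: "\<exists>N. \<forall>p. \<forall>q<N. ?G p q = 0"
    using snd_trunc_prod[OF A' B', of "U w"] by (auto simp: snd_trunc_def)
  have "U (A p (B q w)) = act2 (fps_exp lam) (fps_exp mu) ?G p q" for p q
    unfolding uA uB
    by (simp add: act_clinear[OF is_fieldD(1)[OF A'] is_fieldD(2)[OF B']] act2_act(1)[OF lt st])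
  then have "(\<lambda>p q. U ((mult_diff ^^ k) (\<lambda>p q. A p (B q w)) p q)) =
      act2 (fps_exp lam) (fps_exp mu) ((mult_diff ^^ k) ?G)"
    by (simp add: mult_diff_pow_act2[OF act2_act(2)[OF lt st]] flip: mult_diff_pow_clinear[OF U])
  then have "U (nth_prod k A B i n w) = taylor (i + int k) (act2 (fps_exp lam) (fps_exp mu) ((mult_diff ^^ k) ?G)) n"
    by (simp add: nth_prod_def taylor_clinear[OF tr U])
  also have "\<dots> = act (fps_exp lam) (\<lambda>j. act (fps_exp (lam + mu)) (taylor j ((mult_diff ^^ k) ?G)) n) (i + int k)"
    by (rule taylor_exp[OF tr'])
  also have "\<dots> = act (fps_exp lam) (\<lambda>i. act (fps_exp (lam + mu)) (\<lambda>n. nth_prod k A' B' i n (U w)) n) i"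
    by (simp add: act_def nth_prod_def algebra_simps)
  finally show ?thesis .
qed

lemma act_finsum:
  assumes "finite S" "\<And>j. j \<in> S \<Longrightarrow> lower_trunc (X j)"
  shows "act g (\<lambda>n. \<Sum>j\<in>S. c j *\<^sub>C X j n) n = (\<Sum>j\<in>S. c j *\<^sub>C act g (X j) n)"
    and "lower_trunc (\<lambda>n. \<Sum>j\<in>S. c j *\<^sub>C X j n)"
proof -
  have "act g (\<lambda>n. \<Sum>j\<in>S. c j *\<^sub>C X j n) n = (\<Sum>j\<in>S. c j *\<^sub>C act g (X j) n) \<and>
    lower_trunc (\<lambda>n. \<Sum>j\<in>S. c j *\<^sub>C X j n)"
    using assms
  proof (induction S)
    case empty
    then show ?case by (simp add: act_def lower_trunc_def)
  next
    case (insert j S)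
    have 1: "lower_trunc (\<lambda>n. c j *\<^sub>C X j n)"
      using insert.prems[of j] by (auto simp: lower_trunc_def)
    have 2: "lower_trunc (\<lambda>n. \<Sum>j\<in>S. c j *\<^sub>C X j n)" using insert by simp
    have 3: "lower_trunc (\<lambda>n. c j *\<^sub>C X j n + (\<Sum>j\<in>S. c j *\<^sub>C X j n))"
    proof -
      obtain N N' where "\<forall>n<N. c j *\<^sub>C X j n = 0" "\<forall>n<N'. (\<Sum>j\<in>S. c j *\<^sub>C X j n) = 0"
        using 1 2 unfolding lower_trunc_def by blast
      then show ?thesis unfolding lower_trunc_def by (intro exI[of _ "min N N'"]) simp
    qed
    show ?case
      using insert 3 act_add[OF 1 2] by (simp add: act_scaleC)
  qed
  then show "act g (\<lambda>n. \<Sum>j\<in>S. c j *\<^sub>C X j n) n = (\<Sum>j\<in>S. c j *\<^sub>C act g (X j) n)"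
    "lower_trunc (\<lambda>n. \<Sum>j\<in>S. c j *\<^sub>C X j n)" by auto
qed

lemma act_swap:
  assumes "\<And>i. lower_trunc (X i)" "\<exists>N. \<forall>i<N. \<forall>n. X i n = 0"
  shows "act f (\<lambda>i. act g (X i) n) i = act g (\<lambda>n. act f (\<lambda>i. X i n) i) n"
proof -
  obtain N where N: "\<And>i n. i < N \<Longrightarrow> X i n = 0" using assms(2) by blast
  define M where "M = nat (i - N)"
  have z: "X (i - int j) n = 0" if "j > M" for j n
    by (rule N) (use that in \<open>simp add: M_def\<close>)
  have "act f (\<lambda>i. X i n) i = (\<Sum>j\<le>M. fps_nth f j *\<^sub>C X (i - int j) n)" for n
    by (rule act_eq_sum) (simp add: z)
  moreover have "act g (X (i - int j)) n = 0" if "j > M" for j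
    by (simp add: act_def z that)
  ultimately show ?thesis
    by (subst act_eq_sum[of M]) (simp_all add: act_finsum(1) assms(1))
qed

section \<open>Free fermions\<close>

definition charge :: "gen \<Rightarrow> int" where "charge g = (case g of Y_gen \<Rightarrow> 1 | Ystar_gen \<Rightarrow> - 1)"

definition opposite :: "gen \<Rightarrow> gen"
  where "opposite g = (case g of Y_gen \<Rightarrow> Ystar_gen | Ystar_gen \<Rightarrow> Y_gen)"

definition koszul :: "int \<Rightarrow> int \<Rightarrow> complex"
  where "koszul c d = (if odd c \<and> odd d then - 1 else 1)"

lemma koszul_simps [simp]:
  "koszul c d * koszul c d = 1" "koszul 0 d = 1" "koszul c 0 = 1"
  "koszul (charge g) (charge h) = - 1"
  by (auto simp: koszul_def charge_def split: gen.split)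

lemma koszul_add: "koszul (c + d) e = koszul c e * koszul d e"
  by (simp add: koszul_def)

lemma koszul_commute: "koszul c d = koszul d c"
  by (auto simp: koszul_def)

text \<open>A grading given by its projections rather than by subspaces: on V_A the projections come
  out of a universal property, on the Fock space out of a basis, and both are treated alike.\<close>

locale graded =
  fixes P :: "int \<Rightarrow> 'v::complex_vector \<Rightarrow> 'v"
  assumes P_linear: "clinear (P c)"
    and P_P: "P c (P d v) = (if c = d then P d v else 0)"
    and P_finite: "finite {c. P c v \<noteq> 0}"
    and P_sum: "Sum_any (\<lambda>c. P c v) = v"
begin

definition homog :: "int \<Rightarrow> 'v \<Rightarrow> bool" where "homog c v \<longleftrightarrow> P c v = v"

lemma homog_P: "homog c (P c v)"
  by (simp add: homog_def P_P)

lemma P_homog: "homog c v \<Longrightarrow> P d v = (if d = c then v else 0)"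
  unfolding homog_def using P_P[of d c v] by simp

lemma P_zero [simp]: "P c 0 = 0" by (rule clinear_zero[OF P_linear])

lemma homog_zero [simp]: "homog c 0" by (simp add: homog_def)

lemma homog_add: "homog c u \<Longrightarrow> homog c v \<Longrightarrow> homog c (u + v)"
  by (simp add: homog_def clinear_add[OF P_linear])

lemma homog_scale: "homog c u \<Longrightarrow> homog c (a *\<^sub>C u)"
  by (simp add: homog_def clinear_scale[OF P_linear])

lemma homog_sum: "(\<And>i. i \<in> S \<Longrightarrow> homog c (f i)) \<Longrightarrow> homog c (sum f S)"
  by (simp add: homog_def clinear_sum[OF P_linear])

lemma homog_act: "(\<And>p. homog c (a p)) \<Longrightarrow> homog c (act f a p)"
  unfolding act_def Sum_any.expand_set by (intro homog_sum homog_scale)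

lemma sum_P: "v = (\<Sum>c | P c v \<noteq> 0. P c v)"
  using P_sum[of v] by (simp add: Sum_any.expand_set)

lemma linear_eq_on_homog:
  assumes "clinear f" "clinear g" "\<And>c v. homog c v \<Longrightarrow> f v = g v"
  shows "f v = g v"
  by (subst (1 2) sum_P[of v])
    (simp only: clinear_sum[OF assms(1)] clinear_sum[OF assms(2)] assms(3)[OF homog_P])

text \<open>For operators whose formula depends on the charge of the argument, such as
  multiplication by an exponential with charge-dependent exponent.\<close>

definition on_components :: "(int \<Rightarrow> 'v \<Rightarrow> 'w::complex_vector) \<Rightarrow> 'v \<Rightarrow> 'w"
  where "on_components F v = Sum_any (\<lambda>c. F c (P c v))"

lemma on_components_finite: "(\<And>c. clinear (F c)) \<Longrightarrow> finite {c. F c (P c v) \<noteq> 0}"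
  by (rule finite_subset[OF _ P_finite[of v]]) (auto simp: clinear_zero)

lemma clinear_on_components: "(\<And>c. clinear (F c)) \<Longrightarrow> clinear (on_components F)"
  unfolding on_components_def[abs_def]
  by (rule clinear_Sum_any_fun) (simp_all add: clinear_comp[OF _ P_linear] on_components_finite)

lemma on_components_homog:
  assumes "homog c v" "\<And>d. F d 0 = 0"
  shows "on_components F v = F c v"
proof -
  have "on_components F v = (\<Sum>d\<in>{c}. F d (P d v))"
    unfolding on_components_def
    by (rule Sum_any_eq_sum) (simp_all add: P_homog[OF assms(1)] assms(2))
  then show ?thesis by (simp add: P_homog[OF assms(1)])
qed

end

text \<open>Indices are powers of the variable, not mode numbers: negative ones annihilate the
  vacuum, and p + q + 1 = 0 is the support of the delta function.\<close>

locale fermion = graded P for P :: "int \<Rightarrow> 'v::complex_vector \<Rightarrow> 'v" +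
  fixes psi :: "gen \<Rightarrow> int \<Rightarrow> 'v \<Rightarrow> 'v" and vac :: 'v
  assumes psi_field: "is_field (psi g)"
    and psi_homog: "homog c v \<Longrightarrow> homog (c + charge g) (psi g p v)"
    and anticomm: "psi g p (psi h q v) + psi h q (psi g p v) = (if g \<noteq> h \<and> p + q + 1 = 0 then v else 0)"
    and vac_homog: "homog 0 vac"
    and psi_vac: "p < 0 \<Longrightarrow> psi g p vac = 0"
    and generated: "complex_vector.subspace W \<Longrightarrow> vac \<in> W \<Longrightarrow>
      (\<And>g p v. v \<in> W \<Longrightarrow> psi g p v \<in> W) \<Longrightarrow> W = UNIV"
begin

lemmas psi_linear = is_fieldD(1)[OF psi_field]
lemmas psi_trunc = is_fieldD(2)[OF psi_field]

lemma psi_zero [simp]: "psi g p 0 = 0" by (rule clinear_zero[OF psi_linear])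

lemma gen_induct:
  assumes "Q vac" "\<And>u v. Q u \<Longrightarrow> Q v \<Longrightarrow> Q (u + v)" "\<And>a u. Q u \<Longrightarrow> Q (a *\<^sub>C u)"
    "\<And>g p u. Q u \<Longrightarrow> Q (psi g p u)"
  shows "Q v"
proof -
  have "{v. Q v} = UNIV"
  proof (rule generated)
    have "Q (0 *\<^sub>C vac)" by (rule assms(3)[OF assms(1)])
    then show "complex_vector.subspace {v. Q v}"
      by (intro complex_vector.subspaceI) (simp_all add: assms)
  qed (simp_all add: assms)
  then show ?thesis by blast
qed

lemma P_psi: "P d (psi g p v) = psi g p (P (d - charge g) v)"
proof (rule linear_eq_on_homog[of "\<lambda>v. P d (psi g p v)" "\<lambda>v. psi g p (P (d - charge g) v)"])
  show "P d (psi g p v) = psi g p (P (d - charge g) v)" if "homog c v" for c v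
    using P_homog[OF psi_homog[OF that, of g p], of d] P_homog[OF that, of "d - charge g"] by auto
qed (intro clinear_comp[OF P_linear psi_linear] clinear_comp[OF psi_linear P_linear])+

text \<open>The predicate depends on the charge, while induction over the generated subspace needs a
  statement about arbitrary vectors; hence the induction runs over all charge components
  simultaneously.\<close>

lemma homog_induct [consumes 1]:
  assumes "homog c u"
    and "Q 0 vac" "\<And>c. Q c 0"
    and add: "\<And>c u v. homog c u \<Longrightarrow> homog c v \<Longrightarrow> Q c u \<Longrightarrow> Q c v \<Longrightarrow> Q c (u + v)"
    and scale: "\<And>c a u. homog c u \<Longrightarrow> Q c u \<Longrightarrow> Q c (a *\<^sub>C u)"
    and psi: "\<And>c g p u. homog c u \<Longrightarrow> Q c u \<Longrightarrow> Q (c + charge g) (psi g p u)"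
  shows "Q c u"
proof -
  have "\<forall>d. Q d (P d v)" for v
  proof (induction v rule: gen_induct)
    show "\<forall>d. Q d (P d vac)"
      using assms(2,3) by (simp add: P_homog[OF vac_homog])
    show "\<forall>d. Q d (P d (u + v))" if "\<forall>d. Q d (P d u)" "\<forall>d. Q d (P d v)" for u v
      using that add homog_P by (simp add: clinear_add[OF P_linear])
    show "\<forall>d. Q d (P d (a *\<^sub>C u))" if "\<forall>d. Q d (P d u)" for a u
      using that scale homog_P by (simp add: clinear_scale[OF P_linear])
    show "\<forall>d. Q d (P d (psi g p u))" if IH: "\<forall>d. Q d (P d u)" for g p u
    proof
      fix d
      show "Q d (P d (psi g p u))"
        using psi[OF homog_P spec[OF IH, of "d - charge g"], of g p] by (simp add: P_psi)
    qed
  qed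
  then have "Q c (P c u)" by blast
  then show ?thesis using assms(1) by (simp add: homog_def)
qed

text \<open>One half of a normally ordered quadratic expression: for t \<ge> 1 the factor on the
  right annihilates the vacuum, so each sum is finite. The translation operator, J_1 and the number
  operator are all built from such halves and share one commutator computation.\<close>

definition quad :: "gen \<Rightarrow> (nat \<Rightarrow> complex) \<Rightarrow> int \<Rightarrow> int \<Rightarrow> 'v \<Rightarrow> 'v"
  where "quad g a s t v =
    Sum_any (\<lambda>n. a n *\<^sub>C psi g (int n + s) (psi (opposite g) (- int n - t) v))"

lemma quad_finite: "finite {n::nat. a n *\<^sub>C psi g (int n + s) (psi h (- int n - t) v) \<noteq> 0}"
proof -
  obtain N where N: "\<And>p. p < N \<Longrightarrow> psi h p v = 0"
    using psi_trunc[of h v] by (auto simp: lower_trunc_def)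
  have "{n::nat. a n *\<^sub>C psi g (int n + s) (psi h (- int n - t) v) \<noteq> 0} \<subseteq> {..nat (- N - t)}"
  proof (intro subsetI)
    fix n :: nat assume "n \<in> {n. a n *\<^sub>C psi g (int n + s) (psi h (- int n - t) v) \<noteq> 0}"
    then have "\<not> - int n - t < N" using N by auto
    then show "n \<in> {..nat (- N - t)}" by simp
  qed
  then show ?thesis by (rule finite_subset) simp
qed

lemma clinear_quad: "clinear (quad g a s t)"
  unfolding quad_def[abs_def]
  by (rule clinear_Sum_any_fun)
    (intro clinear_scaleC clinear_comp[OF psi_linear] psi_linear quad_finite)+

lemma quad_vac: "t \<ge> 1 \<Longrightarrow> quad g a s t vac = 0"
  by (simp add: quad_def psi_vac)

lemma opposite_simps [simp]: "opposite g \<noteq> g" "g \<noteq> opposite g" "opposite g \<noteq> h \<longleftrightarrow> h = g"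
  by (cases g; cases h; simp add: opposite_def)+

text \<open>Two anticommutations make the commutator of a quadratic expression with a fermion linear
  in the fermions. For given p at most one summand n contributes; the case distinctions ask whether
  that n is a natural number.\<close>

lemma quad_psi:
  "quad g a s t (psi h p v) = psi h p (quad g a s t v) +
    (if h = g then (if p + 1 - t \<ge> 0 then a (nat (p + 1 - t)) *\<^sub>C psi h (p + 1 - t + s) v else 0)
     else - (if - p - 1 - s \<ge> 0 then a (nat (- p - 1 - s)) *\<^sub>C psi h (p + 1 + s - t) v else 0))"
proof -
  let ?h = "opposite g"
  let ?R = "\<lambda>n. if h = g then (if int n = p + 1 - t then a n *\<^sub>C psi h (p + 1 - t + s) v else 0)
     else - (if int n = - p - 1 - s then a n *\<^sub>C psi h (p + 1 + s - t) v else 0)"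
  have comm: "psi g i (psi ?h j (psi h p v)) = psi h p (psi g i (psi ?h j v)) +
      ((if h = g \<and> j + p + 1 = 0 then psi g i v else 0) -
       (if h \<noteq> g \<and> i + p + 1 = 0 then psi ?h j v else 0))" for i j
  proof -
    have "psi ?h j (psi h p v) = (if h = g \<and> j + p + 1 = 0 then v else 0) - psi h p (psi ?h j v)"
      using anticomm[of ?h j h p v] by (simp add: eq_diff_eq)
    then have 1: "psi g i (psi ?h j (psi h p v)) =
        (if h = g \<and> j + p + 1 = 0 then psi g i v else 0) - psi g i (psi h p (psi ?h j v))"
      by (simp add: clinear_diff[OF psi_linear] if_distrib[of "psi g i"] cong: if_cong)
    have "psi g i (psi h p (psi ?h j v)) =
        (if h \<noteq> g \<and> i + p + 1 = 0 then psi ?h j v else 0) - psi h p (psi g i (psi ?h j v))"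
      using anticomm[of g i h p "psi ?h j v"] by (auto simp: eq_diff_eq)
    with 1 show ?thesis by simp
  qed
  have summand: "a n *\<^sub>C psi g (int n + s) (psi ?h (- int n - t) (psi h p v)) =
      psi h p (a n *\<^sub>C psi g (int n + s) (psi ?h (- int n - t) v)) + ?R n" for n
  proof (cases "h = g")
    case True
    show ?thesis
    proof (cases "int n = p + 1 - t")
      case n: True
      then have p: "p = int n + t - 1" by simp
      show ?thesis
        unfolding comm using True
        by (simp add: p clinear_scale[OF psi_linear] complex_vector.scale_right_distrib algebra_simps)
    next
      case False
      then show ?thesis
        unfolding comm using True by (simp add: clinear_scale[OF psi_linear] algebra_simps)
    qed
  next
    case False
    then have h: "?h = h" using opposite_simps(3)[of g h] by blast
    show ?thesis
    proof (cases "int n = - p - 1 - s")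
      case n: True
      then have p: "p = - int n - 1 - s" by simp
      show ?thesis
        unfolding comm unfolding h using False
        by (simp add: p clinear_scale[OF psi_linear] complex_vector.scale_right_diff_distrib algebra_simps)
    next
      case n: False
      then show ?thesis
        unfolding comm unfolding h using False by (simp add: clinear_scale[OF psi_linear] algebra_simps)
    qed
  qed
  have finR: "finite {n. ?R n \<noteq> 0}"
    by (rule finite_subset[of _ "{nat (p + 1 - t), nat (- p - 1 - s)}"]) (auto split: if_splits)
  have fin: "finite {n. psi h p (a n *\<^sub>C psi g (int n + s) (psi ?h (- int n - t) v)) \<noteq> 0}"
    by (rule finite_subset[OF _ quad_finite[of a g s ?h t v]]) auto
  have "quad g a s t (psi h p v) = psi h p (quad g a s t v) + Sum_any ?R"
    unfolding quad_def summand clinear_Sum_any[OF psi_linear quad_finite]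
    by (rule Sum_any.distrib[OF fin finR])
  also have "Sum_any ?R = (\<Sum>n\<in>{if h = g then nat (p + 1 - t) else nat (- p - 1 - s)}. ?R n)"
    by (rule Sum_any_eq_sum) (auto split: if_splits)
  also have "\<dots> = (if h = g then (if p + 1 - t \<ge> 0 then a (nat (p + 1 - t)) *\<^sub>C psi h (p + 1 - t + s) v else 0)
     else - (if - p - 1 - s \<ge> 0 then a (nat (- p - 1 - s)) *\<^sub>C psi h (p + 1 + s - t) v else 0))"
    by auto
  finally show ?thesis .
qed

text \<open>The translation operator: its commutator with psi(x) is the derivative of
  psi(x).\<close>

definition deriv :: "'v \<Rightarrow> 'v"
  where "deriv v = quad Y_gen (\<lambda>n. of_nat (n + 1)) 1 1 v + quad Ystar_gen (\<lambda>n. of_nat (n + 1)) 1 1 v"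

text \<open>The mode \<open>J\<^sub>1\<close> of the current \<open>:\<psi>\<psi>\<^sup>*:\<close>.\<close>

definition shift_op :: "'v \<Rightarrow> 'v"
  where "shift_op v = quad Y_gen (\<lambda>n. 1) 0 2 v - quad Ystar_gen (\<lambda>n. 1) 0 2 v +
    psi Y_gen (- 1) (psi Ystar_gen (- 1) v)"

text \<open>Counts the creation operators applied to the vacuum; it serves the irreducibility
  proof.\<close>

definition number_op :: "'v \<Rightarrow> 'v"
  where "number_op v = quad Y_gen (\<lambda>n. 1) 0 1 v + quad Ystar_gen (\<lambda>n. 1) 0 1 v"

lemma clinear_deriv: "clinear deriv"
  unfolding deriv_def[abs_def] by (intro clinear_plus clinear_quad)

lemma clinear_shift_op: "clinear shift_op"
  unfolding shift_op_def[abs_def]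
  by (intro clinear_plus clinear_minus clinear_quad clinear_comp[OF psi_linear] psi_linear)

lemma clinear_number_op: "clinear number_op"
  unfolding number_op_def[abs_def] by (intro clinear_plus clinear_quad)

lemma vac_ops: "deriv vac = 0" "shift_op vac = 0" "number_op vac = 0"
  by (simp_all add: deriv_def shift_op_def number_op_def quad_vac psi_vac)

lemma deriv_psi: "deriv (psi g p v) = psi g p (deriv v) + of_int (p + 1) *\<^sub>C psi g (p + 1) v"
proof -
  have *: "of_int (p + 1) *\<^sub>C psi g (p + 1) v =
      (if 0 \<le> p then (of_nat (nat p + 1) :: complex) *\<^sub>C psi g (p + 1) v else 0) +
      - (if 2 + p \<le> 0 then (of_nat (nat (- p - 2) + 1) :: complex) *\<^sub>C psi g (p + 1) v else 0)"
  proof -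
    consider "0 \<le> p" | "2 + p \<le> 0" | "p = - 1" by linarith
    then show ?thesis
    proof cases
      case 1
      then have "(of_int (p + 1) :: complex) = of_nat (nat p + 1)" by (simp add: of_nat_nat)
      then show ?thesis using 1 by (simp only:) simp
    next
      case 2
      then obtain m where "p = - int m - 2" by (intro that[of "nat (- p - 2)"]) simp
      then show ?thesis by (simp flip: complex_vector.scale_minus_left)
    qed simp
  qed
  show ?thesis
    unfolding deriv_def quad_psi clinear_add[OF psi_linear] *
    by (cases g) (simp_all add: algebra_simps)
qed

lemma number_op_psi:
  "number_op (psi g p v) = psi g p (number_op v) + (if p \<ge> 0 then psi g p v else - psi g p v)"
  unfolding number_op_def quad_psi clinear_add[OF psi_linear]
  by (cases g) (auto simp: algebra_simps)

lemma shift_op_psi: "shift_op (psi g p v) = psi g p (shift_op v) + of_int (charge g) *\<^sub>C psi g (p - 1) v"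
proof -
  \<comment> \<open>J_1 pairs indices with sum -2. The pair (-1, -1) consists of two annihilation
    operators and lies in neither half; its commutator supplies precisely the case p = 0 that both
    halves miss.\<close>
  have "psi Y_gen (- 1) (psi Ystar_gen (- 1) (psi g p v)) = psi g p (psi Y_gen (- 1) (psi Ystar_gen (- 1) v)) +
      (if p = 0 then of_int (charge g) *\<^sub>C psi g (- 1) v else 0)"
  proof (cases g)
    case Y_gen
    have 1: "psi Ystar_gen (- 1) (psi Y_gen p v) = (if p = 0 then v else 0) - psi Y_gen p (psi Ystar_gen (- 1) v)"
      using anticomm[of Ystar_gen "- 1" Y_gen p v] by (auto simp: eq_diff_eq)
    have 2: "psi Y_gen (- 1) (psi Y_gen p w) = - psi Y_gen p (psi Y_gen (- 1) w)" for w
      using anticomm[of Y_gen "- 1" Y_gen p w] by (simp add: eq_neg_iff_add_eq_0)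
    show ?thesis
      unfolding Y_gen 1 clinear_diff[OF psi_linear] 2 by (simp add: charge_def)
  next
    case Ystar_gen
    have 1: "psi Ystar_gen (- 1) (psi Ystar_gen p w) = - psi Ystar_gen p (psi Ystar_gen (- 1) w)" for w
      using anticomm[of Ystar_gen "- 1" Ystar_gen p w] by (simp add: eq_neg_iff_add_eq_0)
    have 2: "psi Y_gen (- 1) (psi Ystar_gen p w) = (if p = 0 then w else 0) - psi Ystar_gen p (psi Y_gen (- 1) w)" for w
      using anticomm[of Y_gen "- 1" Ystar_gen p w] by (auto simp: eq_diff_eq)
    show ?thesis
      unfolding Ystar_gen 1 clinear_neg[OF psi_linear] 2
      by (simp add: charge_def complex_vector.scale_minus_left)
  qed
  then show ?thesis
    unfolding shift_op_def quad_psi clinear_add[OF psi_linear] clinear_diff[OF psi_linear]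
    by (cases g; cases "p = 0") (auto simp: charge_def algebra_simps complex_vector.scale_minus_left)
qed

end

section \<open>Linear combinations of fields, and the identity field\<close>

lemma locality_add:
  assumes "locality k c A B" "locality k c A' B" "is_field B"
  shows "locality k c (\<lambda>p v. A p v + A' p v) B"
  unfolding locality_def
proof
  fix w
  have "(\<lambda>p q. (A p (B q w) + A' p (B q w)) - c *\<^sub>C B q (A p w + A' p w)) =
    (\<lambda>p q. (A p (B q w) - c *\<^sub>C B q (A p w)) + (A' p (B q w) - c *\<^sub>C B q (A' p w)))"
    by (simp add: clinear_add[OF is_fieldD(1)[OF assms(3)]] complex_vector.scale_right_distrib algebra_simps)
  then show "(mult_diff ^^ k) (\<lambda>p q. (A p (B q w) + A' p (B q w)) - c *\<^sub>C B q (A p w + A' p w)) = (\<lambda>p q. 0)"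
    using assms(1,2) by (simp add: mult_diff_pow_add locality_def)
qed

lemma locality_scale:
  assumes "locality k c A B" "is_field B"
  shows "locality k c (\<lambda>p v. a *\<^sub>C A p v) B"
  unfolding locality_def
proof
  fix w
  have "(\<lambda>p q. a *\<^sub>C A p (B q w) - c *\<^sub>C B q (a *\<^sub>C A p w)) =
    (\<lambda>p q. a *\<^sub>C (A p (B q w) - c *\<^sub>C B q (A p w)))"
    by (simp add: clinear_scale[OF is_fieldD(1)[OF assms(2)]] complex_vector.scale_right_diff_distrib mult.commute)
  then show "(mult_diff ^^ k) (\<lambda>p q. a *\<^sub>C A p (B q w) - c *\<^sub>C B q (a *\<^sub>C A p w)) = (\<lambda>p q. 0)"
    using assms(1) mult_diff_pow_clinear[OF clinear_scaleC[OF clinear_ident], of k a "\<lambda>p q. A p (B q w) - c *\<^sub>C B q (A p w)"]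
    by (simp only: locality_def complex_vector.scale_zero_right)
qed

lemma is_field_add: "is_field A \<Longrightarrow> is_field B \<Longrightarrow> is_field (\<lambda>p v. A p v + B p v)"
  unfolding is_field_def
proof (intro conjI allI)
  assume A: "(\<forall>p. clinear (A p)) \<and> (\<forall>v. lower_trunc (\<lambda>p. A p v))"
    and B: "(\<forall>p. clinear (B p)) \<and> (\<forall>v. lower_trunc (\<lambda>p. B p v))"
  show "clinear (\<lambda>v. A p v + B p v)" for p using A B by (intro clinear_plus) auto
  show "lower_trunc (\<lambda>p. A p v + B p v)" for v
  proof -
    obtain N N' where "\<forall>p<N. A p v = 0" "\<forall>p<N'. B p v = 0"
      using A B unfolding lower_trunc_def by blast
    then show ?thesis unfolding lower_trunc_def by (intro exI[of _ "min N N'"]) simp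
  qed
qed

lemma is_field_scale: "is_field A \<Longrightarrow> is_field (\<lambda>p v. a *\<^sub>C A p v)"
  unfolding is_field_def lower_trunc_def
  by (intro conjI allI clinear_scaleC) (auto, metis complex_vector.scale_zero_right)

lemma is_field_zero: "is_field (\<lambda>p v. 0)"
  by (simp add: is_field_def clinear_const_zero lower_trunc_def)

definition id_field :: "int \<Rightarrow> 'v::complex_vector \<Rightarrow> 'v"
  where "id_field p v = (if p = 0 then v else 0)"

lemma is_field_id: "is_field id_field"
  unfolding is_field_def lower_trunc_def id_field_def
  by (intro conjI allI clinearI exI[of _ 0]) auto

section \<open>The vertex algebra of free fermions\<close>

context fermion
begin

text \<open>Fields of charge \<open>c\<close> that are translation covariant, create a state from the vacuum and
  are local with respect to the generating fields.\<close>

definition vertex_field :: "int \<Rightarrow> (int \<Rightarrow> 'v \<Rightarrow> 'v) \<Rightarrow> bool"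
  where "vertex_field c A \<longleftrightarrow> is_field A \<and> (\<forall>p d v. homog d v \<longrightarrow> homog (c + d) (A p v)) \<and>
    (\<forall>g. \<exists>k. locality k (koszul c (charge g)) A (psi g)) \<and>
    (\<forall>p v. deriv (A p v) = A p (deriv v) + of_int (p + 1) *\<^sub>C A (p + 1) v) \<and>
    (\<forall>p<0. A p vac = 0)"

lemma vertex_fieldD:
  assumes "vertex_field c A"
  shows "is_field A" "homog d v \<Longrightarrow> homog (c + d) (A p v)"
    "\<exists>k. locality k (koszul c (charge g)) A (psi g)"
    "deriv (A p v) = A p (deriv v) + of_int (p + 1) *\<^sub>C A (p + 1) v"
    "p < 0 \<Longrightarrow> A p vac = 0"
  using assms unfolding vertex_field_def by blast+

lemma vertex_field_zero: "vertex_field c (\<lambda>p v. 0)"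
  by (simp add: vertex_field_def is_field_zero locality_def clinear_zero[OF clinear_deriv])

lemma vertex_field_id: "vertex_field 0 id_field"
  unfolding vertex_field_def
proof (intro conjI allI impI is_field_id)
  show "homog (0 + d) (id_field p v)" if "homog d v" for p d v
    using that by (simp add: id_field_def)
  show "\<exists>k. locality k (koszul 0 (charge g)) id_field (psi g)" for g
  proof
    show "locality 0 (koszul 0 (charge g)) id_field (psi g)"
      by (simp add: locality_def id_field_def fun_eq_iff)
  qed
  show "deriv (id_field p v) = id_field p (deriv v) + of_int (p + 1) *\<^sub>C id_field (p + 1) v" for p v
  proof (cases "p = -1")
    case False
    then show ?thesis by (simp add: id_field_def clinear_zero[OF clinear_deriv])
  qed (simp add: id_field_def clinear_zero[OF clinear_deriv])
  show "id_field p vac = 0" if "p < 0" for p using that by (simp add: id_field_def)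
qed

lemma psi_locality: "locality 1 (- 1) (psi g) (psi h)"
  by (simp add: locality_def mult_diff_def fun_eq_iff anticomm)

lemma vertex_field_psi: "vertex_field (charge g) (psi g)"
  unfolding vertex_field_def
proof (intro conjI allI impI psi_field)
  show "homog (charge g + d) (psi g p v)" if "homog d v" for p d v
    using psi_homog[OF that, of g p] by (simp add: add.commute)
  show "\<exists>k. locality k (koszul (charge g) (charge h)) (psi g) (psi h)" for h
    using psi_locality[of g h] by auto
qed (simp_all add: deriv_psi psi_vac)

lemma common_locality:
  assumes "\<exists>k. locality k a A C" "\<exists>k. locality k b B D"
  shows "\<exists>k. locality k a A C \<and> locality k b B D"
proof -
  obtain k l where "locality k a A C" "locality l b B D" using assms by blast
  then show ?thesis
    by (intro exI[of _ "max k l"]) (auto intro: locality_mono)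
qed

lemma vertex_field_add:
  assumes "vertex_field c A" "vertex_field c B"
  shows "vertex_field c (\<lambda>p v. A p v + B p v)"
  unfolding vertex_field_def
proof (intro conjI allI impI)
  show "\<exists>k. locality k (koszul c (charge g)) (\<lambda>p v. A p v + B p v) (psi g)" for g
  proof -
    obtain k where "locality k (koszul c (charge g)) A (psi g)" "locality k (koszul c (charge g)) B (psi g)"
      using common_locality[OF vertex_fieldD(3)[OF assms(1)] vertex_fieldD(3)[OF assms(2)], of g g] by blast
    then show ?thesis by (intro exI[of _ k] locality_add psi_field)
  qed
  show "deriv (A p v + B p v) = A p (deriv v) + B p (deriv v) + of_int (p + 1) *\<^sub>C (A (p + 1) v + B (p + 1) v)" for p v
    by (simp only: clinear_add[OF clinear_deriv] vertex_fieldD(4)[OF assms(1)]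
        vertex_fieldD(4)[OF assms(2)] complex_vector.scale_right_distrib add_ac)
  show "is_field (\<lambda>p v. A p v + B p v)"
    by (rule is_field_add[OF vertex_fieldD(1)[OF assms(1)] vertex_fieldD(1)[OF assms(2)]])
  show "homog (c + d) (A p v + B p v)" if "homog d v" for p d v
    by (rule homog_add[OF vertex_fieldD(2)[OF assms(1) that] vertex_fieldD(2)[OF assms(2) that]])
  show "A p vac + B p vac = 0" if "p < 0" for p
    using vertex_fieldD(5)[OF assms(1) that] vertex_fieldD(5)[OF assms(2) that] by simp
qed

lemma vertex_field_scale:
  assumes "vertex_field c A"
  shows "vertex_field c (\<lambda>p v. a *\<^sub>C A p v)"
  unfolding vertex_field_def
proof (intro conjI allI impI)
  show "\<exists>k. locality k (koszul c (charge g)) (\<lambda>p v. a *\<^sub>C A p v) (psi g)" for g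
  proof -
    obtain k where "locality k (koszul c (charge g)) A (psi g)" using vertex_fieldD(3)[OF assms, of g] by blast
    then show ?thesis by (intro exI[of _ k] locality_scale psi_field)
  qed
  show "deriv (a *\<^sub>C A p v) = a *\<^sub>C A p (deriv v) + of_int (p + 1) *\<^sub>C a *\<^sub>C A (p + 1) v" for p v
    by (simp only: clinear_scale[OF clinear_deriv] vertex_fieldD(4)[OF assms]
        complex_vector.scale_right_distrib complex_vector.scale_scale mult.commute[of a])
  show "is_field (\<lambda>p v. a *\<^sub>C A p v)"
    by (rule is_field_scale[OF vertex_fieldD(1)[OF assms]])
  show "homog (c + d) (a *\<^sub>C A p v)" if "homog d v" for p d v
    by (rule homog_scale[OF vertex_fieldD(2)[OF assms that]])
  show "a *\<^sub>C A p vac = 0" if "p < 0" for p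
    using vertex_fieldD(5)[OF assms that] by simp
qed

lemma vertex_field_nth_prod:
  assumes A: "vertex_field c A" and B: "vertex_field d B" and AB: "locality k t A B"
  shows "vertex_field (c + d) (nth_prod k A B i)"
  unfolding vertex_field_def
proof (intro conjI allI impI)
  note f = vertex_fieldD(1)[OF A] vertex_fieldD(1)[OF B]
  show "is_field (nth_prod k A B i)" by (rule is_field_nth_prod[OF f AB])
  show "\<exists>k'. locality k' (koszul (c + d) (charge g)) (nth_prod k A B i) (psi g)" for g
  proof -
    obtain l where "locality l (koszul c (charge g)) A (psi g)" "locality l (koszul d (charge g)) B (psi g)"
      using common_locality[OF vertex_fieldD(3)[OF A] vertex_fieldD(3)[OF B], of g g] by blast
    from dong[OF f psi_field AB this] show ?thesis by (simp only: koszul_add)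
  qed
  show "deriv (nth_prod k A B i p v) =
      nth_prod k A B i p (deriv v) + of_int (p + 1) *\<^sub>C nth_prod k A B i (p + 1) v" for p v
    by (rule nth_prod_deriv[OF f AB clinear_deriv vertex_fieldD(4)[OF A] vertex_fieldD(4)[OF B]])
  show "nth_prod k A B i p vac = 0" if "p < 0" for p
    by (rule nth_prod_state(1)[OF f AB vertex_fieldD(5)[OF A] vertex_fieldD(5)[OF B] that])
  show "homog (c + d + e) (nth_prod k A B i p v)" if v: "homog e v" for e p v
  proof -
    have "homog (c + d + e) ((mult_diff ^^ j) (\<lambda>p q. A p (B q v)) p q)" for j p q
    proof (induction j arbitrary: p q)
      case 0
      then show ?case using vertex_fieldD(2)[OF A vertex_fieldD(2)[OF B v]] by (simp add: add.assoc)
    next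
      case (Suc j)
      have "homog (c + d + e) (u - u')" if "homog (c + d + e) u" "homog (c + d + e) u'" for u u'
        using that by (simp add: homog_def clinear_diff[OF P_linear])
      with Suc show ?case by (simp add: mult_diff_def)
    qed
    then show ?thesis
      unfolding nth_prod_def taylor_def Sum_any.expand_set
      by (auto intro!: homog_sum homog_scale)
  qed
qed

text \<open>Goddard's uniqueness argument. Translation covariance propagates A_0 vac = 0 to all of
  A(x) vac. Locality moves A past psi(x_2) up to a power of x_1 - x_2, which can be cancelled thanks
  to truncation in x_2; so the common kernel of the coefficients of A is stable under the generators
  and contains the vacuum.\<close>

lemma vertex_field_unique:
  assumes A: "vertex_field c A" and 0: "A 0 vac = 0"
  shows "A = (\<lambda>p v. 0)"
proof -
  note f = vertex_fieldD(1)[OF A]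
  have nat: "A (int n) vac = 0" for n
  proof (induction n)
    case (Suc n)
    have "of_int (int n + 1) *\<^sub>C A (int n + 1) vac = 0"
      using vertex_fieldD(4)[OF A, of "int n" vac]
      by (simp add: Suc vac_ops clinear_zero[OF is_fieldD(1)[OF f]] clinear_zero[OF clinear_deriv])
    moreover have "(of_int (int n + 1) :: complex) \<noteq> 0"
      using of_nat_neq_0[of n, where ?'a = complex] by (simp add: add.commute)
    ultimately show ?case by (simp add: add.commute)
  qed (simp add: 0)
  have "\<forall>p. A p v = 0" for v
  proof (induction v rule: gen_induct)
    show "\<forall>p. A p vac = 0"
    proof
      fix p show "A p vac = 0"
        using nat[of "nat p"] vertex_fieldD(5)[OF A, of p] by (cases "p < 0") auto
    qed
    show "\<forall>p. A p (psi g r u) = 0" if "\<forall>p. A p u = 0" for g r u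
    proof -
      obtain k where k: "locality k (koszul c (charge g)) A (psi g)" using vertex_fieldD(3)[OF A, of g] by blast
      have "(\<lambda>p q. A p (psi g q u)) = (\<lambda>p q. 0)"
      proof (rule mult_diff_pow_inj[OF snd_trunc_prod[OF f psi_field]])
        show "(mult_diff ^^ k) (\<lambda>p q. A p (psi g q u)) = (\<lambda>p q. 0)"
          using spec[OF k[unfolded locality_def], of u] that by simp
      qed
      then show ?thesis by (simp add: fun_eq_iff)
    qed
  qed (simp_all add: clinear_add clinear_scale is_fieldD(1)[OF f])
  then show ?thesis by (simp add: fun_eq_iff)
qed

lemma vertex_field_eqI:
  assumes "vertex_field c A" "vertex_field c B" "A 0 vac = B 0 vac"
  shows "A = B"
proof -
  have "vertex_field c (\<lambda>p v. A p v + (- 1) *\<^sub>C B p v)"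
    by (intro vertex_field_add vertex_field_scale assms)
  from vertex_field_unique[OF this] show ?thesis using assms(3) by (simp add: fun_eq_iff)
qed

lemma psi_vertex_locality:
  assumes "vertex_field c A"
  shows "\<exists>k. locality k (koszul (charge g) c) (psi g) A"
proof -
  obtain k where "locality k (koszul c (charge g)) A (psi g)" using vertex_fieldD(3)[OF assms, of g] by blast
  from locality_sym[OF this] show ?thesis by (auto simp: koszul_commute[of "charge g"])
qed

text \<open>If A creates u, then the coefficient of x_0^p in psi(x_2 + x_0)A(x_2) creates psi_p u,
  and Dong's lemma keeps it within the vertex fields.\<close>

lemma vertex_field_ex:
  assumes "homog c u"
  shows "\<exists>A. vertex_field c A \<and> A 0 vac = u"
  using assms
proof (induction rule: homog_induct)
  show "\<exists>A. vertex_field 0 A \<and> A 0 vac = vac"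
    using vertex_field_id by (auto simp: id_field_def)
  show "\<exists>A. vertex_field c A \<and> A 0 vac = 0" for c
    using vertex_field_zero by blast
  show "\<exists>A. vertex_field c A \<and> A 0 vac = u + v"
    if IH: "\<exists>A. vertex_field c A \<and> A 0 vac = u" "\<exists>A. vertex_field c A \<and> A 0 vac = v" for c u v
  proof -
    obtain A B where "vertex_field c A" "A 0 vac = u" "vertex_field c B" "B 0 vac = v" using IH by blast
    then show ?thesis by (intro exI[of _ "\<lambda>p w. A p w + B p w"]) (simp add: vertex_field_add)
  qed
  show "\<exists>A. vertex_field c A \<and> A 0 vac = a *\<^sub>C u" if IH: "\<exists>A. vertex_field c A \<and> A 0 vac = u" for c a u
  proof -
    obtain A where "vertex_field c A" "A 0 vac = u" using IH by blast
    then show ?thesis by (intro exI[of _ "\<lambda>p w. a *\<^sub>C A p w"]) (simp add: vertex_field_scale)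
  qed
  show "\<exists>A. vertex_field (c + charge g) A \<and> A 0 vac = psi g p u"
    if IH: "\<exists>A. vertex_field c A \<and> A 0 vac = u" for c g p u
  proof -
    obtain A where A: "vertex_field c A" "A 0 vac = u" using IH by blast
    obtain k where k: "locality k (koszul (charge g) c) (psi g) A" using psi_vertex_locality[OF A(1)] by blast
    have "vertex_field (c + charge g) (nth_prod k (psi g) A p)"
      using vertex_field_nth_prod[OF vertex_field_psi A(1) k] by (simp add: add.commute)
    moreover have "nth_prod k (psi g) A p 0 vac = psi g p u"
      unfolding A(2)[symmetric]
      by (rule nth_prod_state(2)[OF psi_field vertex_fieldD(1)[OF A(1)] k psi_vac vertex_fieldD(5)[OF A(1)]])
    ultimately show ?thesis by blast
  qed
qed

text \<open>The state-field correspondence. A vector has many expressions in the generators, but the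
  field depends only on the state it creates, so the description is meaningful for u of charge
  c.\<close>

definition field_of :: "int \<Rightarrow> 'v \<Rightarrow> int \<Rightarrow> 'v \<Rightarrow> 'v"
  where "field_of c u = (THE A. vertex_field c A \<and> A 0 vac = u)"

lemma field_of:
  assumes "homog c u"
  shows "vertex_field c (field_of c u)" "field_of c u 0 vac = u"
proof -
  have "\<exists>A. vertex_field c A \<and> A 0 vac = u" by (rule vertex_field_ex[OF assms])
  then have "\<exists>!A. vertex_field c A \<and> A 0 vac = u" using vertex_field_eqI by blast
  from theI'[OF this] have "vertex_field c (field_of c u) \<and> field_of c u 0 vac = u"
    by (simp only: field_of_def)
  then show "vertex_field c (field_of c u)" "field_of c u 0 vac = u" by auto
qed

lemma field_of_eqI: "vertex_field c A \<Longrightarrow> A 0 vac = u \<Longrightarrow> field_of c u = A"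
  unfolding field_of_def by (rule the_equality) (auto intro: vertex_field_eqI)

lemmas field_of_field = vertex_fieldD(1)[OF field_of(1)]
lemmas field_of_linear = is_fieldD(1)[OF field_of_field]
lemmas field_of_trunc = is_fieldD(2)[OF field_of_field]

lemma field_of_homog: "homog c u \<Longrightarrow> homog d v \<Longrightarrow> homog (c + d) (field_of c u p v)"
  by (rule vertex_fieldD(2)[OF field_of(1)])

lemma field_of_add: "homog c u \<Longrightarrow> homog c v \<Longrightarrow> field_of c (u + v) = (\<lambda>p w. field_of c u p w + field_of c v p w)"
  by (rule field_of_eqI) (simp_all add: vertex_field_add field_of)

lemma field_of_scale: "homog c u \<Longrightarrow> field_of c (a *\<^sub>C u) = (\<lambda>p w. a *\<^sub>C field_of c u p w)"
  by (rule field_of_eqI) (simp_all add: vertex_field_scale field_of)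

lemma field_of_zero [simp]: "field_of c 0 = (\<lambda>p w. 0)"
  by (rule field_of_eqI) (simp_all add: vertex_field_zero)

lemma field_of_vac: "field_of 0 vac = id_field"
  by (rule field_of_eqI) (simp_all add: vertex_field_id id_field_def)

lemma field_of_psi: "field_of (charge g) (psi g 0 vac) = psi g"
  by (rule field_of_eqI) (simp_all add: vertex_field_psi)

lemma field_of_creation: "homog c u \<Longrightarrow> p < 0 \<Longrightarrow> field_of c u p vac = 0"
  by (rule vertex_fieldD(5)[OF field_of(1)])

text \<open>Associativity for free: both sides are vertex fields creating the same state.\<close>

lemma field_of_nth:
  assumes u: "homog c u" and v: "homog d v" and k: "locality k t (field_of c u) (field_of d v)"
  shows "field_of (c + d) (field_of c u i v) = nth_prod k (field_of c u) (field_of d v) i"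
proof (rule field_of_eqI)
  show "vertex_field (c + d) (nth_prod k (field_of c u) (field_of d v) i)"
    by (rule vertex_field_nth_prod[OF field_of(1)[OF u] field_of(1)[OF v] k])
  show "nth_prod k (field_of c u) (field_of d v) i 0 vac = field_of c u i v"
    using nth_prod_state(2)[OF field_of_field[OF u] field_of_field[OF v] k
        field_of_creation[OF u] field_of_creation[OF v]] field_of(2)[OF v] by simp
qed

lemma field_of_psi_nth:
  assumes v: "homog d v" and k: "locality k t (psi g) (field_of d v)"
  shows "field_of (d + charge g) (psi g i v) = nth_prod k (psi g) (field_of d v) i"
proof -
  have "homog (charge g) (psi g 0 vac)" using psi_homog[OF vac_homog, of g 0] by simp
  from field_of_nth[OF this v] k show ?thesis by (simp add: field_of_psi add.commute)
qed

text \<open>Vertex fields are by definition local against the generators only; Dong's lemma, along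
  the construction of u, extends this to all pairs.\<close>

lemma field_of_locality:
  assumes "homog c u" "vertex_field d B"
  shows "\<exists>k. locality k (koszul c d) (field_of c u) B"
  using assms(1)
proof (induction rule: homog_induct)
  have "locality 0 1 id_field B"
    using clinear_zero[OF is_fieldD(1)[OF vertex_fieldD(1)[OF assms(2)]]]
    by (simp add: locality_def id_field_def fun_eq_iff)
  then show "\<exists>k. locality k (koszul 0 d) (field_of 0 vac) B" by (auto simp: field_of_vac)
  show "\<exists>k. locality k (koszul c d) (field_of c 0) B" for c
    by (simp add: locality_def clinear_zero[OF is_fieldD(1)[OF vertex_fieldD(1)[OF assms(2)]]])
  show "\<exists>k. locality k (koszul c d) (field_of c (u + v)) B"
    if h: "homog c u" "homog c v" "\<exists>k. locality k (koszul c d) (field_of c u) B"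
      "\<exists>k. locality k (koszul c d) (field_of c v) B" for c u v
  proof -
    obtain k where "locality k (koszul c d) (field_of c u) B" "locality k (koszul c d) (field_of c v) B"
      using common_locality[OF h(3,4)] by blast
    then show ?thesis
      unfolding field_of_add[OF h(1,2)] by (intro exI[of _ k] locality_add vertex_fieldD(1)[OF assms(2)])
  qed
  show "\<exists>k. locality k (koszul c d) (field_of c (a *\<^sub>C u)) B"
    if h: "homog c u" "\<exists>k. locality k (koszul c d) (field_of c u) B" for c a u
  proof -
    obtain k where "locality k (koszul c d) (field_of c u) B" using h(2) by blast
    then show ?thesis
      unfolding field_of_scale[OF h(1)] by (intro exI[of _ k] locality_scale vertex_fieldD(1)[OF assms(2)])
  qed
  show "\<exists>k. locality k (koszul (c + charge g) d) (field_of (c + charge g) (psi g p u)) B"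
    if u: "homog c u" and IH: "\<exists>k. locality k (koszul c d) (field_of c u) B" for c g p u
  proof -
    obtain k where k: "locality k (koszul (charge g) c) (psi g) (field_of c u)"
      using psi_vertex_locality[OF field_of(1)[OF u]] by blast
    obtain l where l: "locality l (koszul (charge g) d) (psi g) B" "locality l (koszul c d) (field_of c u) B"
      using common_locality[OF psi_vertex_locality[OF assms(2)] IH] by blast
    show ?thesis
      unfolding field_of_psi_nth[OF u k]
      using dong[OF psi_field field_of_field[OF u] vertex_fieldD(1)[OF assms(2)] k l, of p]
      by (simp add: koszul_add mult.commute)
  qed
qed

section \<open>The exponentials of J_1\<close>

lemma shift_op_pow_linear: "clinear (shift_op ^^ n)"
proof (induction n)
  case (Suc n)
  then show ?case using clinear_comp[OF clinear_shift_op] by (simp add: comp_def)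
qed (simp add: clinear_ident id_def)

lemma shift_op_pow_psi:
  "(shift_op ^^ n) (psi g p v) =
    (\<Sum>i\<le>n. (of_nat (n choose i) * of_int (charge g) ^ i) *\<^sub>C psi g (p - int i) ((shift_op ^^ (n - i)) v))"
proof (induction n arbitrary: v)
  case (Suc n)
  let ?c = "of_int (charge g) :: complex"
  let ?f = "\<lambda>n i. (of_nat (n choose i) * ?c ^ i)"
  let ?X = "\<lambda>i m. psi g (p - int i) ((shift_op ^^ m) v)"
  have "(shift_op ^^ Suc n) (psi g p v) = shift_op ((shift_op ^^ n) (psi g p v))" by simp
  also have "\<dots> = (\<Sum>i\<le>n. ?f n i *\<^sub>C (?X i (Suc (n - i)) + ?c *\<^sub>C ?X (Suc i) (n - i)))"
    unfolding Suc by (simp add: clinear_sum[OF clinear_shift_op] clinear_scale[OF clinear_shift_op] shift_op_psi algebra_simps)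
  also have "\<dots> = (\<Sum>i\<le>n. ?f n i *\<^sub>C ?X i (Suc (n - i))) + (\<Sum>i\<le>n. (of_nat (n choose i) * ?c ^ Suc i) *\<^sub>C ?X (Suc i) (n - i))"
    by (simp add: complex_vector.scale_right_distrib sum.distrib mult_ac)
  also have "(\<Sum>i\<le>n. ?f n i *\<^sub>C ?X i (Suc (n - i))) = (\<Sum>i\<le>Suc n. ?f n i *\<^sub>C ?X i (Suc n - i))"
    by (simp add: Suc_diff_le)
  also have "\<dots> = ?X 0 (Suc n) + (\<Sum>i\<le>n. ?f n (Suc i) *\<^sub>C ?X (Suc i) (n - i))"
    by (subst sum.atMost_Suc_shift) simp
  finally have "(shift_op ^^ Suc n) (psi g p v) = ?X 0 (Suc n) +
      (\<Sum>i\<le>n. (?f n (Suc i) + of_nat (n choose i) * ?c ^ Suc i) *\<^sub>C ?X (Suc i) (n - i))"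
    by (simp add: sum.distrib complex_vector.scale_left_distrib add.assoc)
  also have "\<dots> = (\<Sum>i\<le>Suc n. ?f (Suc n) i *\<^sub>C ?X i (Suc n - i))"
    by (subst sum.atMost_Suc_shift) (simp add: algebra_simps)
  finally show ?case .
qed simp

lemma shift_op_psi_bound:
  assumes "\<And>m. m > K \<Longrightarrow> (shift_op ^^ m) v = 0"
  obtains M where "M \<ge> K" "\<And>i m. i > M \<or> m > M \<Longrightarrow> psi g (p - int i) ((shift_op ^^ m) v) = 0"
proof -
  have "\<exists>M. \<forall>i>M. psi g (p - int i) ((shift_op ^^ m) v) = 0" for m
    using lower_trunc_bound[OF psi_trunc[of g "(shift_op ^^ m) v"], of p] by metis
  then obtain F where F: "\<And>m i. i > F m \<Longrightarrow> psi g (p - int i) ((shift_op ^^ m) v) = 0" by metis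
  define M where "M = Max (insert K (F ` {..K}))"
  have K: "K \<le> M" unfolding M_def by (rule Max_ge) auto
  have FM: "F m \<le> M" if "m \<le> K" for m unfolding M_def by (rule Max_ge) (use that in auto)
  show thesis
  proof (rule that[OF K])
    fix i m assume *: "i > M \<or> m > M"
    show "psi g (p - int i) ((shift_op ^^ m) v) = 0"
    proof (cases "m > K")
      case True
      then show ?thesis by (simp add: assms)
    next
      case False
      then have "i > F m" using * FM[of m] K by linarith
      then show ?thesis by (rule F)
    qed
  qed
qed

text \<open>This makes exp(sJ_1) a finite sum on every vector. In the Leibniz expansion of the n-th
  power with n > 2M, each term has i > M, where the fermion index is too low, or n - i > M, where
  the power kills u.\<close>

lemma shift_op_nilpotent: "\<exists>K. \<forall>n>K. (shift_op ^^ n) v = 0"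
proof (induction v rule: gen_induct)
  have "(shift_op ^^ Suc n) vac = 0" for n
    by (simp add: funpow_Suc_right vac_ops clinear_zero[OF shift_op_pow_linear] del: funpow.simps(2))
  then show "\<exists>K. \<forall>n>K. (shift_op ^^ n) vac = 0" by (metis Suc_pred less_nat_zero_code neq0_conv)
  show "\<exists>K. \<forall>n>K. (shift_op ^^ n) (u + v) = 0"
    if IH: "\<exists>K. \<forall>n>K. (shift_op ^^ n) u = 0" "\<exists>K. \<forall>n>K. (shift_op ^^ n) v = 0" for u v
  proof -
    obtain K L where "\<forall>n>K. (shift_op ^^ n) u = 0" "\<forall>n>L. (shift_op ^^ n) v = 0" using IH by blast
    then show ?thesis
      by (intro exI[of _ "max K L"]) (simp add: clinear_add[OF shift_op_pow_linear])
  qed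
  show "\<exists>K. \<forall>n>K. (shift_op ^^ n) (a *\<^sub>C u) = 0" if "\<exists>K. \<forall>n>K. (shift_op ^^ n) u = 0" for a u
    using that by (auto simp: clinear_scale[OF shift_op_pow_linear])
  show "\<exists>K. \<forall>n>K. (shift_op ^^ n) (psi g p u) = 0" if IH: "\<exists>K. \<forall>n>K. (shift_op ^^ n) u = 0" for g p u
  proof -
    obtain K where K: "\<And>n. n > K \<Longrightarrow> (shift_op ^^ n) u = 0" using IH by blast
    obtain M where M: "\<And>i m. i > M \<or> m > M \<Longrightarrow> psi g (p - int i) ((shift_op ^^ m) u) = 0"
      using shift_op_psi_bound[OF K] by metis
    have "(shift_op ^^ n) (psi g p u) = 0" if "n > 2 * M" for n
      unfolding shift_op_pow_psi
    proof (rule sum.neutral, rule ballI)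
      fix i assume "i \<in> {..n}"
      then have "i > M \<or> n - i > M" using that by auto
      then show "(of_nat (n choose i) * of_int (charge g) ^ i) *\<^sub>C psi g (p - int i) ((shift_op ^^ (n - i)) u) = 0"
        by (simp add: M)
    qed
    then show ?thesis by blast
  qed
qed

definition shift_exp :: "complex \<Rightarrow> 'v \<Rightarrow> 'v"
  where "shift_exp s v = Sum_any (\<lambda>n. (s ^ n / fact n) *\<^sub>C (shift_op ^^ n) v)"

lemma shift_exp_eq:
  assumes "\<And>n. n > K \<Longrightarrow> (shift_op ^^ n) v = 0"
  shows "shift_exp s v = (\<Sum>n\<le>K. (s ^ n / fact n) *\<^sub>C (shift_op ^^ n) v)"
  unfolding shift_exp_def by (rule Sum_any_eq_sum) (auto simp: assms)

lemma clinear_shift_exp: "clinear (shift_exp s)"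
  unfolding shift_exp_def[abs_def]
proof (rule clinear_Sum_any_fun)
  show "clinear (\<lambda>v. (s ^ n / fact n) *\<^sub>C (shift_op ^^ n) v)" for n
    by (rule clinear_scaleC[OF shift_op_pow_linear])
  show "finite {n. (s ^ n / fact n) *\<^sub>C (shift_op ^^ n) v \<noteq> 0}" for v
  proof -
    obtain K where "\<And>n. n > K \<Longrightarrow> (shift_op ^^ n) v = 0" using shift_op_nilpotent by blast
    then have "{n. (s ^ n / fact n) *\<^sub>C (shift_op ^^ n) v \<noteq> 0} \<subseteq> {..K}"
      by (auto simp: not_less[symmetric])
    then show ?thesis by (rule finite_subset) simp
  qed
qed

lemma shift_exp_vac: "shift_exp s vac = vac"
proof -
  have "(shift_op ^^ n) vac = 0" if "n > 0" for n
    using that by (cases n)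
      (simp_all add: funpow_Suc_right vac_ops clinear_zero[OF shift_op_pow_linear] del: funpow.simps(2))
  then show ?thesis by (subst shift_exp_eq[of 0]) simp_all
qed

lemma shift_exp_psi:
  "shift_exp s (psi g p v) = act (fps_exp (s * of_int (charge g))) (\<lambda>p. psi g p (shift_exp s v)) p"
proof -
  let ?c = "of_int (charge g) :: complex"
  obtain K where K: "\<And>n. n > K \<Longrightarrow> (shift_op ^^ n) v = 0" using shift_op_nilpotent by blast
  obtain M where "M \<ge> K" and M: "\<And>i m. i > M \<or> m > M \<Longrightarrow> psi g (p - int i) ((shift_op ^^ m) v) = 0"
    using shift_op_psi_bound[OF K] by metis
  let ?X = "\<lambda>i m. psi g (p - int i) ((shift_op ^^ m) v)"
  \<comment> \<open>The double sum lives on the square i, m \<le> M, which is contained in the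
    triangle i + m \<le> 2M; summing over the triangle gives the powers of J_1, summing over the
    square gives the product of two exponentials.\<close>
  let ?N = "2 * M"
  have "shift_exp s (psi g p v) = (\<Sum>n\<le>?N. (s ^ n / fact n) *\<^sub>C (shift_op ^^ n) (psi g p v))"
  proof (rule shift_exp_eq)
    fix n assume n: "n > ?N"
    show "(shift_op ^^ n) (psi g p v) = 0"
      unfolding shift_op_pow_psi
    proof (rule sum.neutral, rule ballI)
      fix i assume "i \<in> {..n}"
      then have "i > M \<or> n - i > M" using n by auto
      then show "(of_nat (n choose i) * ?c ^ i) *\<^sub>C ?X i (n - i) = 0" by (simp add: M)
    qed
  qed
  also have "\<dots> = (\<Sum>n\<le>?N. \<Sum>i\<le>n. (((s * ?c) ^ i / fact i) * (s ^ (n - i) / fact (n - i))) *\<^sub>C ?X i (n - i))"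
  proof (rule sum.cong[OF refl])
    fix n
    have "(s ^ n / fact n) * (of_nat (n choose i) * ?c ^ i) = ((s * ?c) ^ i / fact i) * (s ^ (n - i) / fact (n - i))"
      if "i \<le> n" for i
    proof -
      have "s ^ n = s ^ i * s ^ (n - i)" using that by (simp flip: power_add)
      then show ?thesis using that by (simp add: binomial_fact power_mult_distrib)
    qed
    then show "(s ^ n / fact n) *\<^sub>C (shift_op ^^ n) (psi g p v) =
        (\<Sum>i\<le>n. (((s * ?c) ^ i / fact i) * (s ^ (n - i) / fact (n - i))) *\<^sub>C ?X i (n - i))"
      unfolding shift_op_pow_psi complex_vector.scale_sum_right complex_vector.scale_scale
      by (intro sum.cong) simp_all
  qed
  also have "\<dots> = (\<Sum>(i, m)\<in>{(i, m). i + m \<le> ?N}. (((s * ?c) ^ i / fact i) * (s ^ m / fact m)) *\<^sub>C ?X i m)"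
    by (rule sum.triangle_reindex_eq[symmetric])
  also have "\<dots> = (\<Sum>(i, m)\<in>{..M} \<times> {..M}. (((s * ?c) ^ i / fact i) * (s ^ m / fact m)) *\<^sub>C ?X i m)"
  proof (rule sum.mono_neutral_right)
    show "finite {(i, m). i + m \<le> ?N}"
      by (rule finite_subset[of _ "{..?N} \<times> {..?N}"]) auto
    show "\<forall>x\<in>{(i, m). i + m \<le> ?N} - {..M} \<times> {..M}.
        (case x of (i, m) \<Rightarrow> (((s * ?c) ^ i / fact i) * (s ^ m / fact m)) *\<^sub>C ?X i m) = 0"
    proof
      fix x assume "x \<in> {(i, m). i + m \<le> ?N} - {..M} \<times> {..M}"
      moreover obtain i m where x: "x = (i, m)" by (cases x)
      ultimately have "i > M \<or> m > M" by auto
      then show "(case x of (i, m) \<Rightarrow> (((s * ?c) ^ i / fact i) * (s ^ m / fact m)) *\<^sub>C ?X i m) = 0"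
        by (simp add: x M)
    qed
  qed auto
  also have "\<dots> = (\<Sum>i\<le>M. ((s * ?c) ^ i / fact i) *\<^sub>C psi g (p - int i) (\<Sum>m\<le>M. (s ^ m / fact m) *\<^sub>C (shift_op ^^ m) v))"
    by (simp add: clinear_sum[OF psi_linear] clinear_scale[OF psi_linear] complex_vector.scale_sum_right
        sum.cartesian_product)
  also have "(\<Sum>m\<le>M. (s ^ m / fact m) *\<^sub>C (shift_op ^^ m) v) = shift_exp s v"
    by (rule shift_exp_eq[symmetric]) (use \<open>M \<ge> K\<close> in \<open>simp add: K\<close>)
  also have "(\<Sum>i\<le>M. ((s * ?c) ^ i / fact i) *\<^sub>C psi g (p - int i) (shift_exp s v)) =
      act (fps_exp (s * ?c)) (\<lambda>p. psi g p (shift_exp s v)) p"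
  proof -
    have "shift_exp s v = (\<Sum>n\<le>K. (s ^ n / fact n) *\<^sub>C (shift_op ^^ n) v)"
      by (rule shift_exp_eq) (rule K)
    then have "psi g (p - int i) (shift_exp s v) = 0" if "i > M" for i
      using that by (simp add: clinear_sum[OF psi_linear] clinear_scale[OF psi_linear] M that)
    then show ?thesis by (subst act_eq_sum[of M]) simp_all
  qed
  finally show ?thesis .
qed

lemma shift_exp_homog:
  assumes "homog c u"
  shows "homog c (shift_exp s u)"
  using assms
proof (induction rule: homog_induct)
  show "homog (c + charge g) (shift_exp s (psi g p u))" if "homog c (shift_exp s u)" for c g p u
    unfolding shift_exp_psi by (rule homog_act) (rule psi_homog[OF that])
qed (simp_all add: shift_exp_vac vac_homog clinear_zero[OF clinear_shift_exp] clinear_add[OF clinear_shift_exp]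
    clinear_scale[OF clinear_shift_exp] homog_add homog_scale)

lemma shift_exp_add: "shift_exp s (shift_exp t v) = shift_exp (s + t) v"
proof (induction v rule: gen_induct)
  show "shift_exp s (shift_exp t (psi g p u)) = shift_exp (s + t) (psi g p u)"
    if IH: "shift_exp s (shift_exp t u) = shift_exp (s + t) u" for g p u
    unfolding shift_exp_psi act_clinear[OF clinear_shift_exp psi_trunc] IH
    by (simp add: act_mult[OF psi_trunc] algebra_simps flip: fps_exp_add_mult)
qed (simp_all add: shift_exp_vac clinear_add[OF clinear_shift_exp] clinear_scale[OF clinear_shift_exp])

lemma shift_exp_0 [simp]: "shift_exp 0 v = v"
proof -
  have "shift_exp 0 v = (\<Sum>n\<in>{0}. (0 ^ n / fact n) *\<^sub>C (shift_op ^^ n) v)"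
    unfolding shift_exp_def by (rule Sum_any_eq_sum) (auto simp: power_0_left)
  then show ?thesis by simp
qed

lemma field_of_act:
  assumes "lower_trunc a" "\<And>i. homog c (a i)"
  shows "field_of c (act f a i) n w = act f (\<lambda>i. field_of c (a i) n w) i"
proof -
  obtain M where M: "\<And>j. j > M \<Longrightarrow> a (i - int j) = 0" using lower_trunc_bound[OF assms(1), of i] by blast
  have "field_of c (\<Sum>j\<in>S. fps_nth f j *\<^sub>C a (i - int j)) n w = (\<Sum>j\<in>S. fps_nth f j *\<^sub>C field_of c (a (i - int j)) n w)"
    if "finite S" for S :: "nat set"
    using that
    by (induction S) (simp_all add: field_of_add field_of_scale homog_sum homog_scale assms(2))
  then show ?thesis
    by (subst (1 2) act_eq_sum[of M]) (simp_all add: M)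
qed

text \<open>\<open>e\<^bsup>sJ\<^sub>1\<^esup>\<close> conjugates the field of a vector of charge \<open>c\<close> up to the factor \<open>e\<^bsup>scx\<^esup>\<close>.\<close>

lemma shift_exp_field_of:
  assumes "homog c u"
  shows "shift_exp s (field_of c u p v) =
    act (fps_exp (s * of_int c)) (\<lambda>p. field_of c (shift_exp s u) p (shift_exp s v)) p"
proof -
  note U = clinear_shift_exp[of s]
  have "\<forall>p v. shift_exp s (field_of c u p v) =
    act (fps_exp (s * of_int c)) (\<lambda>p. field_of c (shift_exp s u) p (shift_exp s v)) p"
    using assms
  proof (induction rule: homog_induct)
    show "\<forall>p v. shift_exp s (field_of 0 vac p v) =
      act (fps_exp (s * of_int 0)) (\<lambda>p. field_of 0 (shift_exp s vac) p (shift_exp s v)) p"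
      by (simp add: shift_exp_vac field_of_vac id_field_def clinear_zero[OF U])
    show "\<forall>p v. shift_exp s (field_of c 0 p v) =
      act (fps_exp (s * of_int c)) (\<lambda>p. field_of c (shift_exp s 0) p (shift_exp s v)) p" for c
      by (simp add: clinear_zero[OF U] act_def)
    show "\<forall>p v. shift_exp s (field_of c (u + u') p v) =
      act (fps_exp (s * of_int c)) (\<lambda>p. field_of c (shift_exp s (u + u')) p (shift_exp s v)) p"
      if h: "homog c u" "homog c u'" and IH:
        "\<forall>p v. shift_exp s (field_of c u p v) =
          act (fps_exp (s * of_int c)) (\<lambda>p. field_of c (shift_exp s u) p (shift_exp s v)) p"
        "\<forall>p v. shift_exp s (field_of c u' p v) =
          act (fps_exp (s * of_int c)) (\<lambda>p. field_of c (shift_exp s u') p (shift_exp s v)) p" for c u u'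
      using h IH
      by (simp add: field_of_add shift_exp_homog clinear_add[OF U] act_add field_of_trunc)
    show "\<forall>p v. shift_exp s (field_of c (a *\<^sub>C u) p v) =
      act (fps_exp (s * of_int c)) (\<lambda>p. field_of c (shift_exp s (a *\<^sub>C u)) p (shift_exp s v)) p"
      if "homog c u" and IH: "\<forall>p v. shift_exp s (field_of c u p v) =
          act (fps_exp (s * of_int c)) (\<lambda>p. field_of c (shift_exp s u) p (shift_exp s v)) p" for c a u
      using that
      by (simp add: field_of_scale shift_exp_homog clinear_scale[OF U] act_scaleC field_of_trunc)
    show "\<forall>p v. shift_exp s (field_of (c + charge g) (psi g i u) p v) =
      act (fps_exp (s * of_int (c + charge g))) (\<lambda>p. field_of (c + charge g) (shift_exp s (psi g i u)) p (shift_exp s v)) p"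
      if u: "homog c u" and IH: "\<forall>p v. shift_exp s (field_of c u p v) =
          act (fps_exp (s * of_int c)) (\<lambda>p. field_of c (shift_exp s u) p (shift_exp s v)) p" for c g i u
    proof (intro allI)
      fix p v
      let ?u = "shift_exp s u" and ?v = "shift_exp s v"
      let ?lam = "s * of_int (charge g)" and ?mu = "s * of_int c"
      have u': "homog c ?u" by (rule shift_exp_homog[OF u])
      obtain k where k: "locality k (koszul (charge g) c) (psi g) (field_of c u)"
        "locality k (koszul (charge g) c) (psi g) (field_of c ?u)"
        using common_locality[OF psi_vertex_locality[OF field_of(1)[OF u]]
            psi_vertex_locality[OF field_of(1)[OF u']]] by blast
      let ?X = "\<lambda>i. nth_prod k (psi g) (field_of c ?u) i"
      have "shift_exp s (field_of (c + charge g) (psi g i u) p v) =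
          act (fps_exp ?lam) (\<lambda>i. act (fps_exp (?lam + ?mu)) (\<lambda>p. ?X i p ?v) p) i"
        unfolding field_of_psi_nth[OF u k(1)]
        by (rule nth_prod_exp[OF psi_field field_of_field[OF u] k(1) U psi_field field_of_field[OF u'] k(2)])
          (use IH in \<open>simp_all add: shift_exp_psi\<close>)
      also have "\<dots> = act (fps_exp (?lam + ?mu)) (\<lambda>p. act (fps_exp ?lam) (\<lambda>i. ?X i p ?v) i) p"
      proof (rule act_swap)
        show "lower_trunc (\<lambda>p. ?X i p ?v)" for i
          by (rule is_fieldD(2)[OF is_field_nth_prod[OF psi_field field_of_field[OF u'] k(2)]])
        show "\<exists>N. \<forall>i<N. \<forall>p. ?X i p ?v = 0"
          by (rule exI[of _ "- int k"]) (simp add: nth_prod_def taylor_def)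
      qed
      \<comment> \<open>The remaining exponential in x_0 acts on the state: it is what turns psi_i
        applied to exp(sJ_1)u into exp(sJ_1) applied to psi_i u.\<close>
      also have "\<dots> = act (fps_exp (s * of_int (c + charge g)))
          (\<lambda>p. field_of (c + charge g) (shift_exp s (psi g i u)) p ?v) p"
        unfolding shift_exp_psi
        by (subst field_of_act) (simp_all add: psi_trunc psi_homog[OF u'] field_of_psi_nth[OF u' k(2)] algebra_simps)
      finally show "shift_exp s (field_of (c + charge g) (psi g i u) p v) =
        act (fps_exp (s * of_int (c + charge g))) (\<lambda>p. field_of (c + charge g) (shift_exp s (psi g i u)) p ?v) p" .
    qed
  qed
  then show ?thesis by blast
qed

end

section \<open>The three terms of the S-Jacobi identity in coefficients\<close>

lemma dist_mult_delta_12_0: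
  "dist_mult delta_12_0 (\<lambda>(a, b, c). if a = 0 then G b c else 0) (a, b, c) = expand12 (- a - 1) G b c"
proof -
  let ?h = "\<lambda>l::nat. (a, - a - 1 - int l, int l)"
  have "dist_mult delta_12_0 (\<lambda>(a, b, c). if a = 0 then G b c else 0) (a, b, c) =
    Sum_any (\<lambda>t. (\<lambda>(i, j, k). delta_12_0 (i, j, k) *\<^sub>C (if a - i = 0 then G (b - j) (c - k) else 0)) t)"
    by (simp add: dist_mult_def)
  also have "\<dots> = Sum_any (\<lambda>l::nat. (\<lambda>(i, j, k). delta_12_0 (i, j, k) *\<^sub>C (if a - i = 0 then G (b - j) (c - k) else 0)) (?h l))"
  proof (rule Sum_any_reindex_inj)
    show "inj ?h" by (rule injI) simp
    fix t assume t: "t \<notin> range ?h"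
    obtain i j k where ijk: "t = (i, j, k)" by (cases t)
    show "(case t of (i, j, k) \<Rightarrow> delta_12_0 (i, j, k) *\<^sub>C (if a - i = 0 then G (b - j) (c - k) else 0)) = 0"
    proof (cases "a = i \<and> 0 \<le> k \<and> j + k = - i - 1")
      case True
      then have "t = ?h (nat k)" by (simp add: ijk)
      then show ?thesis using t by blast
    qed (auto simp: ijk delta_12_0_def diff_pow_def)
  qed
  also have "\<dots> = expand12 (- a - 1) G b c"
    by (simp add: expand12_def delta_12_0_def diff_pow_def algebra_simps)
  finally show ?thesis .
qed

text \<open>Negating the upper argument of the binomial coefficient brings this term into the form
  of the right-hand side of \<open>jacobi_arrays\<close>.\<close>

lemma dist_mult_delta_10_2:
  "dist_mult delta_10_2 (\<lambda>(a, b, c). if b = 0 then H a c else 0) (a, b, c) =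
    Sum_any (\<lambda>i::nat. (of_int (- b - 1) gchoose i) *\<^sub>C H (a - int i) (b + c + 1 + int i))"
proof -
  let ?h = "\<lambda>l::nat. (int l, b, - b - 1 - int l)"
  have "dist_mult delta_10_2 (\<lambda>(a, b, c). if b = 0 then H a c else 0) (a, b, c) =
    Sum_any (\<lambda>t. (\<lambda>(i, j, k). delta_10_2 (i, j, k) *\<^sub>C (if b - j = 0 then H (a - i) (c - k) else 0)) t)"
    by (simp add: dist_mult_def)
  also have "\<dots> = Sum_any (\<lambda>l::nat. (\<lambda>(i, j, k). delta_10_2 (i, j, k) *\<^sub>C (if b - j = 0 then H (a - i) (c - k) else 0)) (?h l))"
  proof (rule Sum_any_reindex_inj)
    show "inj ?h" by (rule injI) simp
    fix t assume t: "t \<notin> range ?h"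
    obtain i j k where ijk: "t = (i, j, k)" by (cases t)
    show "(case t of (i, j, k) \<Rightarrow> delta_10_2 (i, j, k) *\<^sub>C (if b - j = 0 then H (a - i) (c - k) else 0)) = 0"
    proof (cases "b = j \<and> 0 \<le> i \<and> j + i = - k - 1")
      case True
      then have "t = ?h (nat i)" by (simp add: ijk)
      then show ?thesis using t by blast
    qed (auto simp: ijk delta_10_2_def diff_pow_def)
  qed
  also have "\<dots> = Sum_any (\<lambda>i::nat. (of_int (- b - 1) gchoose i) *\<^sub>C H (a - int i) (b + c + 1 + int i))"
  proof (rule Sum_any.cong)
    fix l :: nat
    have "(- 1) ^ l * (of_int (b + int l) gchoose l) = (of_int (- b - 1) gchoose l :: complex)"
    proof -
      have "(of_int (- b - 1) :: complex) = - of_int (b + 1)" by simp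
      then show ?thesis by (simp only: gbinomial_minus) (simp add: algebra_simps)
    qed
    then show "(\<lambda>(i, j, k). delta_10_2 (i, j, k) *\<^sub>C (if b - j = 0 then H (a - i) (c - k) else 0)) (?h l) =
      (of_int (- b - 1) gchoose l) *\<^sub>C H (a - int l) (b + c + 1 + int l)"
      by (simp add: delta_10_2_def diff_pow_def algebra_simps)
  qed
  finally show ?thesis .
qed

text \<open>The support is two-dimensional: s is the exponent taken from f(-x_0), nonnegative since
  f is a power series, and l is the expansion index in x_1. The sign of f(-x_0) cancels the
  s-dependent part of the sign of the delta function.\<close>

lemma delta_21_0_reindex:
  fixes f :: "complex fls" and a b c :: int and H :: "int \<Rightarrow> int \<Rightarrow> 'v::complex_vector"
  assumes f: "\<And>n. n < 0 \<Longrightarrow> f $$ n = 0"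
  defines "t \<equiv> \<lambda>(i, j, k). delta_21_0 (i, j, k) *\<^sub>C (fls_reflect f $$ (a - i)) *\<^sub>C H (b - j) (c - k)"
  defines "h \<equiv> \<lambda>(s::nat, l::nat). (a - int s, int l, - (a - int s) - 1 - int l)"
  shows "inj h" "\<And>x. x \<notin> range h \<Longrightarrow> t x = 0"
    "t (h (s, l)) = ((- 1) powi (- a - 1) * ((- 1) ^ l * (of_int (- a - 1 + int s) gchoose l) * f $$ int s)) *\<^sub>C
      H (b - int l) (c + a + 1 - int s + int l)"
proof -
  show "inj h" by (rule injI) (auto simp: h_def)
  show "t x = 0" if x: "x \<notin> range h" for x
  proof -
    obtain i j k where ijk: "x = (i, j, k)" by (cases x)
    show ?thesis
    proof (cases "0 \<le> j \<and> k + j = - i - 1 \<and> 0 \<le> a - i")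
      case True
      then have "x = h (nat (a - i), nat j)" by (simp add: ijk h_def)
      then show ?thesis using x by blast
    qed (auto simp: ijk t_def delta_21_0_def diff_pow_def f)
  qed
  have "(- 1) powi (- (a - int s) - 1) * (- 1) powi (int s) = ((- 1) powi (- a - 1) :: complex)"
  proof -
    have "- (a - int s) - 1 = (- a - 1) + int s" by simp
    moreover have "(- 1 :: complex) powi ((- a - 1) + int s) = (- 1) powi (- a - 1) * (- 1) powi (int s)"
      by (rule power_int_add) simp
    ultimately show ?thesis
      by (simp only: mult.assoc power_int_of_nat minus_one_power_square mult_1_right)
  qed
  then show "t (h (s, l)) = ((- 1) powi (- a - 1) * ((- 1) ^ l * (of_int (- a - 1 + int s) gchoose l) * f $$ int s)) *\<^sub>C
      H (b - int l) (c + a + 1 - int s + int l)"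
    by (simp add: t_def h_def delta_21_0_def diff_pow_def algebra_simps)
qed

definition exp_series :: "complex \<Rightarrow> complex \<Rightarrow> complex fls"
  where "exp_series e m = fps_to_fls (fps_const e * fps_exp m)"

lemma exp_series_nth: "exp_series e m $$ n = (if n < 0 then 0 else e * m ^ nat n / fact (nat n))"
  by (simp add: exp_series_def)

lemma sum_shift_up:
  fixes T :: "nat \<Rightarrow> 'v::complex_vector"
  assumes "\<And>l. l > M \<Longrightarrow> T l = 0"
  shows "(\<Sum>l\<le>M. g l *\<^sub>C T (l + i)) = (\<Sum>l\<le>M. (if i \<le> l then g (l - i) else 0) *\<^sub>C T l)"
  by (subst (2) sum_drop_low[of i]) (auto simp: assms)

lemma exp_coeff_identity:
  fixes g m e :: complex
  assumes "i \<le> l" "i \<le> s"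
  shows "((- 1) ^ (l - i) * g) * ((- m) ^ i / fact i * (m ^ (s - i) / fact (s - i)) * e) =
    (- 1) ^ l * ((of_nat s gchoose i) * g) * (e * m ^ s / fact s)"
proof -
  obtain a b where l: "l = i + a" and s: "s = i + b" using assms le_Suc_ex by metis
  have 1: "(of_nat (i + b) gchoose i) = (fact (i + b) / (fact i * fact b) :: complex)"
    unfolding binomial_gbinomial[symmetric] by (subst binomial_fact) simp_all
  have 2: "(- m) ^ i = (- 1) ^ i * m ^ i" by (rule power_minus)
  show ?thesis
    unfolding l s 1 2 by (simp add: power_add)
qed

text \<open>On the support of the delta function x_0 = x_1 - x_2, so f(-x_0) with f(x) = e exp(mx)
  may be replaced by e exp(-m x_1) exp(m x_2). In coefficients this is Vandermonde's identity for s
  + r. It moves the braiding factor into the array, where it can be compared with the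
  twists.\<close>

lemma expand21_exp:
  assumes bound: "\<And>s l. s > M \<or> l > M \<Longrightarrow> H (b - int l) (c - r - int s + int l) = 0"
  shows "Sum_any (\<lambda>(s, l). ((- 1) powi r * ((- 1) ^ l * (of_int (r + int s) gchoose l) * exp_series e m $$ int s)) *\<^sub>C
      H (b - int l) (c - r - int s + int l)) =
    expand21 r (act2 (fps_exp (- m)) (fps_exp m) (\<lambda>p q. e *\<^sub>C H p q)) b c"
proof -
  define T where "T l s = H (b - int l) (c - r - int s + int l)" for l s
  have T: "T l s = 0" if "s > M \<or> l > M" for l s unfolding T_def by (rule bound) (rule that)
  let ?A = "act2 (fps_exp (- m)) (fps_exp m) (\<lambda>p q. e *\<^sub>C H p q)"
  define x where "x i = (- m) ^ i / fact i" for i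
  define y where "y j = m ^ j / fact j" for j
  define z where "z l = (- 1) ^ l * (of_int r gchoose l :: complex)" for l
  have A: "?A (b - int l) (c - r + int l) = (\<Sum>i\<le>M. \<Sum>j\<le>M. (x i * y j * e) *\<^sub>C T (l + i) (i + j))" for l
  proof (subst act2_eq_sum[of M])
    fix i j assume "i > M \<or> j > M"
    then have "T (l + i) (i + j) = 0" by (intro T) auto
    then show "e *\<^sub>C H (b - int l - int i) (c - r + int l - int j) = 0" by (simp add: T_def algebra_simps)
  qed (simp add: x_def y_def T_def algebra_simps)
  have A0: "?A (b - int l) (c - r + int l) = 0" if "l > M" for l
  proof -
    have "T (l + i) (i + j) = 0" for i j by (rule T) (use that in auto)
    then show ?thesis unfolding A by simp
  qed
  have "expand21 r ?A b c = (- 1) powi r *\<^sub>C (\<Sum>l\<le>M. z l *\<^sub>C ?A (b - int l) (c - r + int l))"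
    unfolding expand21_def expand12_def
    by (subst Sum_any_eq_sum[of "{..M}"]) (simp_all add: A0 z_def)
  also have "(\<Sum>l\<le>M. z l *\<^sub>C ?A (b - int l) (c - r + int l)) =
      (\<Sum>i\<le>M. \<Sum>l\<le>M. z l *\<^sub>C (\<Sum>j\<le>M. (x i * y j * e) *\<^sub>C T (l + i) (j + i)))"
    unfolding A by (subst sum.swap) (simp add: complex_vector.scale_sum_right add.commute)
  also have "\<dots> = (\<Sum>i\<le>M. \<Sum>l\<le>M. (if i \<le> l then z (l - i) else 0) *\<^sub>C (\<Sum>j\<le>M. (x i * y j * e) *\<^sub>C T l (j + i)))"
    by (rule sum.cong[OF refl], rule sum_shift_up) (simp add: T)
  also have "\<dots> = (\<Sum>i\<le>M. \<Sum>l\<le>M. (if i \<le> l then z (l - i) else 0) *\<^sub>C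
      (\<Sum>s\<le>M. (if i \<le> s then x i * y (s - i) * e else 0) *\<^sub>C T l s))"
  proof -
    have "(\<Sum>j\<le>M. (x i * y j * e) *\<^sub>C T l (j + i)) = (\<Sum>s\<le>M. (if i \<le> s then x i * y (s - i) * e else 0) *\<^sub>C T l s)" for i l
      by (rule sum_shift_up) (simp add: T)
    then show ?thesis by simp
  qed
  also have "\<dots> = (\<Sum>s\<le>M. \<Sum>l\<le>M. (\<Sum>i\<le>M. (if i \<le> l then z (l - i) else 0) * (if i \<le> s then x i * y (s - i) * e else 0)) *\<^sub>C T l s)"
    unfolding complex_vector.scale_sum_right complex_vector.scale_scale complex_vector.scale_sum_left
    by (subst sum.swap, subst (2) sum.swap, subst sum.swap, subst (2) sum.swap) (rule sum.swap)
  also have "\<dots> = (\<Sum>s\<le>M. \<Sum>l\<le>M. ((- 1) ^ l * (of_int (r + int s) gchoose l) * (e * m ^ s / fact s)) *\<^sub>C T l s)"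
  proof (intro sum.cong refl)
    fix s l assume "l \<in> {..M}" "s \<in> {..M}"
    then have l: "l \<le> M" by simp
    have "(if i \<le> l then z (l - i) else 0) * (if i \<le> s then x i * y (s - i) * e else 0) =
        (if i \<le> l then (- 1) ^ l * ((of_nat s gchoose i) * (of_int r gchoose (l - i))) * (e * m ^ s / fact s) else 0)" for i
    proof (cases "i \<le> l \<and> i \<le> s")
      case True
      then have "z (l - i) * (x i * y (s - i) * e) =
          (- 1) ^ l * ((of_nat s gchoose i) * (of_int r gchoose (l - i))) * (e * m ^ s / fact s)"
        unfolding x_def y_def z_def by (intro exp_coeff_identity) auto
      then show ?thesis using True by simp
    next
      case False
      then show ?thesis by (auto simp flip: binomial_gbinomial)
    qed
    then have "(\<Sum>i\<le>M. (if i \<le> l then z (l - i) else 0) * (if i \<le> s then x i * y (s - i) * e else 0)) =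
      (\<Sum>i\<le>M. if i \<le> l then (- 1) ^ l * ((of_nat s gchoose i) * (of_int r gchoose (l - i))) * (e * m ^ s / fact s) else 0)"
      by simp
    also have "\<dots> = (\<Sum>i\<le>l. (- 1) ^ l * ((of_nat s gchoose i) * (of_int r gchoose (l - i))) * (e * m ^ s / fact s))"
      by (rule sum.mono_neutral_cong_right) (use l in auto)
    also have "\<dots> = (- 1) ^ l * (\<Sum>i\<le>l. (of_nat s gchoose i) * (of_int r gchoose (l - i))) * (e * m ^ s / fact s)"
      by (simp add: sum_distrib_left sum_distrib_right sum_divide_distrib mult.assoc)
    also have "(\<Sum>i\<le>l. (of_nat s gchoose i) * (of_int r gchoose (l - i))) = (of_int (r + int s) gchoose l :: complex)"
      using gbinomial_Vandermonde[of "of_nat s :: complex" "of_int r" l] by (simp add: atLeast0AtMost add.commute)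
    finally show "(\<Sum>i\<le>M. (if i \<le> l then z (l - i) else 0) * (if i \<le> s then x i * y (s - i) * e else 0)) *\<^sub>C T l s =
      ((- 1) ^ l * (of_int (r + int s) gchoose l) * (e * m ^ s / fact s)) *\<^sub>C T l s" by simp
  qed
  finally have "expand21 r ?A b c = (\<Sum>(s, l)\<in>{..M} \<times> {..M}. ((- 1) powi r * ((- 1) ^ l * (of_int (r + int s) gchoose l) *
      exp_series e m $$ int s)) *\<^sub>C T l s)"
    by (simp add: complex_vector.scale_sum_right exp_series_nth sum.cartesian_product case_prod_beta)
  also have "\<dots> = Sum_any (\<lambda>(s, l). ((- 1) powi r * ((- 1) ^ l * (of_int (r + int s) gchoose l) * exp_series e m $$ int s)) *\<^sub>C T l s)"
  proof (rule Sum_any_eq_sum[symmetric])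
    fix x assume x: "x \<notin> {..M} \<times> {..M}"
    obtain s l where sl: "x = (s, l)" by (cases x)
    have "T l s = 0" by (rule T) (use x sl in auto)
    then show "(case x of (s, l) \<Rightarrow> ((- 1) powi r * ((- 1) ^ l * (of_int (r + int s) gchoose l) *
        exp_series e m $$ int s)) *\<^sub>C T l s) = 0" by (simp add: sl)
  qed simp
  finally show ?thesis by (simp add: T_def)
qed

text \<open>For l > K the first argument leaves the support; for the finitely many other l the
  bounds on s have a maximum.\<close>

lemma array_bound:
  assumes tr: "fst_trunc H" "\<And>p. lower_trunc (\<lambda>q. H p q)"
  obtains M where "\<And>s l :: nat. s > M \<or> l > M \<Longrightarrow> H (b - int l) (c - int s + int l) = 0"
proof -
  obtain N where N: "\<And>p q. p < N \<Longrightarrow> H p q = 0" using tr(1) by (auto simp: fst_trunc_def)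
  have "\<exists>M. \<forall>s>M. H (b - int l) (c - int s + int l) = 0" for l
    using lower_trunc_bound[OF tr(2)[of "b - int l"], of "c + int l"] by (metis add_diff_eq diff_add_eq)
  then obtain F where F: "\<And>l s. s > F l \<Longrightarrow> H (b - int l) (c - int s + int l) = 0" by metis
  define K where "K = nat (b - N)"
  define M where "M = Max (insert K (F ` {..K}))"
  have K: "K \<le> M" unfolding M_def by (rule Max_ge) auto
  have FM: "F l \<le> M" if "l \<le> K" for l unfolding M_def by (rule Max_ge) (use that in auto)
  show thesis
  proof (rule that[of M])
    fix s l :: nat assume *: "s > M \<or> l > M"
    show "H (b - int l) (c - int s + int l) = 0"
    proof (cases "l > K")
      case True
      then show ?thesis by (intro N) (simp add: K_def)
    next
      case False
      then have "s > F l" using * FM[of l] K by linarith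
      then show ?thesis by (rule F)
    qed
  qed
qed

text \<open>The finiteness of the support lets the sum over the components of S be taken out of the
  product.\<close>

lemma dist_mult_delta_21_0:
  assumes tr: "fst_trunc H" "\<And>p. lower_trunc (\<lambda>q. H p q)"
  shows "dist_mult delta_21_0 (\<lambda>(a, b, c). (fls_reflect (exp_series e m) $$ a) *\<^sub>C H b c) (a, b, c) =
      expand21 (- a - 1) (act2 (fps_exp (- m)) (fps_exp m) (\<lambda>p q. e *\<^sub>C H p q)) b c"
    and "finite {x. (case x of (i, j, k) \<Rightarrow> delta_21_0 (i, j, k) *\<^sub>C
      (fls_reflect (exp_series e m) $$ (a - i)) *\<^sub>C H (b - j) (c - k)) \<noteq> 0}" (is "finite ?S")
proof -
  let ?f = "exp_series e m"
  have f: "\<And>n. n < 0 \<Longrightarrow> ?f $$ n = 0" by (simp add: exp_series_nth)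
  note re1 = delta_21_0_reindex(1)[where f = ?f and a = a, OF f]
    and re2 = delta_21_0_reindex(2)[where f = ?f and a = a and b = b and c = c and H = H, OF f]
    and re3 = delta_21_0_reindex(3)[where f = ?f and a = a and b = b and c = c and H = H, OF f]
  let ?t = "\<lambda>(i, j, k). delta_21_0 (i, j, k) *\<^sub>C (fls_reflect ?f $$ (a - i)) *\<^sub>C H (b - j) (c - k)"
  let ?h = "\<lambda>(s::nat, l::nat). (a - int s, int l, - (a - int s) - 1 - int l)"
  obtain M where M: "\<And>s l :: nat. s > M \<or> l > M \<Longrightarrow> H (b - int l) (c + a + 1 - int s + int l) = 0"
    using array_bound[OF tr, of b "c + a + 1"] by blast
  have "dist_mult delta_21_0 (\<lambda>(a, b, c). (fls_reflect ?f $$ a) *\<^sub>C H b c) (a, b, c) = Sum_any ?t"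
    by (simp add: dist_mult_def)
  also have "\<dots> = Sum_any (\<lambda>x. ?t (?h x))"
    by (rule Sum_any_reindex_inj) (use re1 re2 in simp_all)
  also have "\<dots> = Sum_any (\<lambda>(s, l). ((- 1) powi (- a - 1) * ((- 1) ^ l * (of_int (- a - 1 + int s) gchoose l) * ?f $$ int s)) *\<^sub>C
      H (b - int l) (c - (- a - 1) - int s + int l))"
  proof (rule Sum_any.cong)
    fix x :: "nat \<times> nat"
    obtain s l where x: "x = (s, l)" by (cases x)
    show "?t (?h x) = (case x of (s, l) \<Rightarrow> ((- 1) powi (- a - 1) * ((- 1) ^ l * (of_int (- a - 1 + int s) gchoose l) * ?f $$ int s)) *\<^sub>C
      H (b - int l) (c - (- a - 1) - int s + int l))"
    proof -
      have "?t (?h (s, l)) = ((- 1) powi (- a - 1) * ((- 1) ^ l * (of_int (- a - 1 + int s) gchoose l) * ?f $$ int s)) *\<^sub>C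
          H (b - int l) (c + a + 1 - int s + int l)" by (rule re3)
      moreover have "c + a + 1 - int s + int l = c - (- a - 1) - int s + int l" by simp
      ultimately show ?thesis unfolding x by (simp only: prod.case)
    qed
  qed
  also have "\<dots> = expand21 (- a - 1) (act2 (fps_exp (- m)) (fps_exp m) (\<lambda>p q. e *\<^sub>C H p q)) b c"
    by (rule expand21_exp[of M]) (use M in \<open>simp add: algebra_simps\<close>)
  finally show "dist_mult delta_21_0 (\<lambda>(a, b, c). (fls_reflect (exp_series e m) $$ a) *\<^sub>C H b c) (a, b, c) =
      expand21 (- a - 1) (act2 (fps_exp (- m)) (fps_exp m) (\<lambda>p q. e *\<^sub>C H p q)) b c" .
  have "?S \<subseteq> ?h ` ({..M} \<times> {..M})"
  proof
    fix x assume x: "x \<in> ?S"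
    then obtain y where y: "x = ?h y" using re2[of x] by blast
    obtain s l where sl: "y = (s, l)" by (cases y)
    have "H (b - int l) (c + a + 1 - int s + int l) \<noteq> 0"
      using x re3[of s l] unfolding y sl by auto
    then have "\<not> (s > M \<or> l > M)" using M by blast
    then have "y \<in> {..M} \<times> {..M}" by (auto simp: sl)
    then show "x \<in> ?h ` ({..M} \<times> {..M})" unfolding y by (rule imageI)
  qed
  then show "finite ?S" by (rule finite_subset) simp
qed

lemma clinear_expand12:
  assumes "\<And>p q. clinear (\<lambda>w. G w p q)" "\<And>w. snd_trunc (G w)"
  shows "clinear (\<lambda>w. expand12 r (G w) b c)"
  unfolding expand12_def
  by (rule clinear_Sum_any_fun[OF clinear_scaleC[OF assms(1)] finite_scaleC[OF finite_snd_trunc[OF assms(2)]]])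

lemma clinear_expand21:
  assumes "\<And>p q. clinear (\<lambda>w. G w p q)" "\<And>w. fst_trunc (G w)"
  shows "clinear (\<lambda>w. expand21 r (G w) b c)"
  unfolding expand21_def
  by (rule clinear_scaleC, rule clinear_expand12) (simp_all add: assms snd_trunc_swap)

lemma clinear_act2:
  assumes "\<And>p q. clinear (\<lambda>w. G w p q)" "\<And>w. bounded_below2 (G w)"
  shows "clinear (\<lambda>w. act2 f g (G w) p q)"
proof (rule clinearI)
  fix x y c
  have "G (x + y) = (\<lambda>p q. G x p q + G y p q)" by (intro ext) (rule clinear_add[OF assms(1)])
  then show "act2 f g (G (x + y)) p q = act2 f g (G x) p q + act2 f g (G y) p q"
    by (simp add: act2_add assms(2))
  have "G (c *\<^sub>C x) = (\<lambda>p q. c *\<^sub>C G x p q)" by (intro ext) (rule clinear_scale[OF assms(1)])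
  then show "act2 f g (G (c *\<^sub>C x)) p q = c *\<^sub>C act2 f g (G x) p q"
    by (simp add: act2_clinear[OF clinear_scaleC[OF clinear_ident] assms(2)])
qed

lemma fst_trunc_act2:
  assumes "fst_trunc G"
  shows "fst_trunc (act2 f g G)"
proof -
  obtain N where N: "\<And>p q. p < N \<Longrightarrow> G p q = 0" using assms by (auto simp: fst_trunc_def)
  have "act2 f g G p q = 0" if "p < N" for p q
    using N that by (simp add: act2_def)
  then show ?thesis unfolding fst_trunc_def by blast
qed

lemma lower_trunc_sum:
  assumes "finite S" "\<And>j. j \<in> S \<Longrightarrow> lower_trunc (X j)"
  shows "lower_trunc (\<lambda>n. \<Sum>j\<in>S. X j n :: 'v::complex_vector)"
  using act_finsum(2)[OF assms, where c = "\<lambda>_. 1"] by simp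

lemma dist_mult_sum:
  assumes "finite S" "\<And>s. s \<in> S \<Longrightarrow> finite {x. (case x of (i, j, k) \<Rightarrow> A (i, j, k) *\<^sub>C X s (a - i, b - j, c - k)) \<noteq> 0}"
  shows "dist_mult A (\<lambda>x. \<Sum>s\<in>S. X s x) (a, b, c) = (\<Sum>s\<in>S. dist_mult A (X s) (a, b, c))"
proof -
  let ?t = "\<lambda>s (i, j, k). A (i, j, k) *\<^sub>C X s (a - i, b - j, c - k)"
  define F where "F = (\<Union>s\<in>S. {x. ?t s x \<noteq> 0})"
  have F: "finite F" unfolding F_def using assms by auto
  have out: "?t s x = 0" if "s \<in> S" "x \<notin> F" for s x using that by (auto simp: F_def)
  have "dist_mult A (\<lambda>x. \<Sum>s\<in>S. X s x) (a, b, c) = Sum_any (\<lambda>x. \<Sum>s\<in>S. ?t s x)"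
    by (simp add: dist_mult_def case_prod_beta complex_vector.scale_sum_right)
  also have "\<dots> = (\<Sum>x\<in>F. \<Sum>s\<in>S. ?t s x)"
    by (rule Sum_any_eq_sum[OF F]) (simp add: out)
  also have "\<dots> = (\<Sum>s\<in>S. \<Sum>x\<in>F. ?t s x)" by (rule sum.swap)
  also have "\<dots> = (\<Sum>s\<in>S. dist_mult A (X s) (a, b, c))"
  proof (rule sum.cong[OF refl])
    fix s assume "s \<in> S"
    then have "Sum_any (?t s) = (\<Sum>x\<in>F. ?t s x)" by (intro Sum_any_eq_sum[OF F]) (rule out)
    then show "(\<Sum>x\<in>F. ?t s x) = dist_mult A (X s) (a, b, c)" by (simp add: dist_mult_def)
  qed
  finally show ?thesis .
qed

section \<open>Twisted vertex operators\<close>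

definition twist :: "int \<Rightarrow> int \<Rightarrow> complex"
  where "twist c r = - of_int (c * r) - of_int (c * (c - 1)) / 2"

lemma twist_right: "twist c (d + r) = twist c d - of_int (c * r)"
  by (simp add: twist_def algebra_simps)

lemma twist_left: "twist (c + d) r = twist c (d + r) + twist d r"
  by (simp add: twist_def field_simps)

lemma twist_braid:
  "twist c r - of_int (c * d) = twist c (d + r)" "twist d (c + r) + of_int (c * d) = twist d r"
  by (simp_all add: twist_def algebra_simps)

lemma twist_simps [simp]: "twist 0 r = 0" by (simp add: twist_def)

context graded
begin

lemma clinear_components:
  assumes "clinear f"
  shows "f v = (\<Sum>c | P c v \<noteq> 0. f (P c v))"
  by (subst (1) sum_P[of v]) (simp only: clinear_sum[OF assms])

lemma lower_trunc_on_components: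
  assumes "\<And>p d. clinear (F p d)" "\<And>d. lower_trunc (\<lambda>p. F p d (P d v))"
  shows "lower_trunc (\<lambda>p. on_components (F p) v)"
proof -
  have "on_components (F p) v = (\<Sum>d | P d v \<noteq> 0. F p d (P d v))" for p
    unfolding on_components_def
    by (rule Sum_any_eq_sum[OF P_finite]) (use clinear_zero[OF assms(1)] in auto)
  then show ?thesis using lower_trunc_sum[OF P_finite assms(2)] by simp
qed

end

context fermion
begin

lemma clinear_field_of: "clinear (\<lambda>u. field_of c (P c u) p w)"
  by (rule clinearI)
    (simp_all add: clinear_add[OF P_linear] clinear_scale[OF P_linear] field_of_add field_of_scale homog_P)

text \<open>The projection of u ensures that \<open>field_of c\<close> is only applied to vectors of
  charge c, where it is specified; this also makes the expression linear in u.\<close>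

definition vop_component :: "int \<Rightarrow> int \<Rightarrow> 'v \<Rightarrow> int \<Rightarrow> 'v \<Rightarrow> 'v"
  where "vop_component c r u p w =
    act (fps_exp (twist c r)) (\<lambda>p. field_of c (shift_exp (- of_int r) (P c u)) p w) p"

definition vop :: "'v \<Rightarrow> int \<Rightarrow> 'v \<Rightarrow> 'v"
  where "vop u p w = on_components (\<lambda>r w. on_components (\<lambda>c u. vop_component c r u p w) u) w"

lemma homog_shift_exp_P: "homog c (shift_exp s (P c u))"
  by (rule shift_exp_homog[OF homog_P])

lemma clinear_vop_component:
  "clinear (\<lambda>u. vop_component c r u p w)" "clinear (vop_component c r u p)"
  "lower_trunc (\<lambda>p. vop_component c r u p w)"
proof -
  have "vop_component c r u p w = act (fps_exp (twist c r)) (\<lambda>p. field_of c (P c (shift_exp (- of_int r) (P c u))) p w) p" for u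
    by (simp add: vop_component_def P_homog[OF homog_shift_exp_P])
  moreover have "clinear (\<lambda>u. act (fps_exp (twist c r)) (\<lambda>p. field_of c (P c (shift_exp (- of_int r) (P c u))) p w) p)"
  proof (rule clinear_act)
    show "clinear (\<lambda>u. field_of c (P c (shift_exp (- of_int r) (P c u))) p w)" for p
      using clinear_comp[OF clinear_field_of clinear_comp[OF clinear_shift_exp P_linear]] .
  qed (rule field_of_trunc[OF homog_P])
  ultimately show "clinear (\<lambda>u. vop_component c r u p w)" by simp
  show "clinear (vop_component c r u p)"
    unfolding vop_component_def[abs_def]
    by (rule clinear_act[OF field_of_linear[OF homog_shift_exp_P] field_of_trunc[OF homog_shift_exp_P]])
  show "lower_trunc (\<lambda>p. vop_component c r u p w)"
    unfolding vop_component_def by (rule lower_trunc_act[OF field_of_trunc[OF homog_shift_exp_P]])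
qed

lemma clinear_vop_inner: "clinear (\<lambda>w. on_components (\<lambda>c u. vop_component c r u p w) u)"
  unfolding on_components_def
  by (rule clinear_Sum_any_fun)
    (rule clinear_vop_component(2),
      rule on_components_finite[of "\<lambda>c u. vop_component c r u p _", OF clinear_vop_component(1)])

lemma clinear_vop: "clinear (vop u p)"
  unfolding vop_def[abs_def] by (rule clinear_on_components[OF clinear_vop_inner])

lemma clinear_vop_state: "clinear (\<lambda>u. vop u p w)"
proof -
  have "vop u p w = Sum_any (\<lambda>r. on_components (\<lambda>c u. vop_component c r u p (P r w)) u)" for u
    unfolding vop_def by (rule on_components_def)
  moreover have "finite {r. on_components (\<lambda>c u. vop_component c r u p (P r w)) u \<noteq> 0}" for u
    by (rule on_components_finite[of "\<lambda>r w. on_components (\<lambda>c u. vop_component c r u p w) u", OF clinear_vop_inner])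
  ultimately show ?thesis
    by (simp only:) (intro clinear_Sum_any_fun clinear_on_components clinear_vop_component(1))
qed

lemma vop_trunc: "lower_trunc (\<lambda>p. vop u p w)"
  unfolding vop_def
  by (intro lower_trunc_on_components clinear_vop_inner clinear_vop_component)

lemma is_field_vop: "is_field (vop u)"
  by (simp add: is_field_def clinear_vop vop_trunc)

lemma vop_homog:
  assumes "homog c u" "homog r w"
  shows "vop u p w = act (fps_exp (twist c r)) (\<lambda>p. field_of c (shift_exp (- of_int r) u) p w) p"
proof -
  have "vop u p w = on_components (\<lambda>c u. vop_component c r u p w) u"
    unfolding vop_def by (rule on_components_homog[OF assms(2)]) (rule clinear_zero[OF clinear_vop_inner])
  also have "\<dots> = vop_component c r u p w"
    by (rule on_components_homog[OF assms(1)]) (rule clinear_zero[OF clinear_vop_component(1)])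
  finally show ?thesis using assms(1) by (simp add: vop_component_def homog_def)
qed

lemma homog_vop:
  assumes "homog c u" "homog r w"
  shows "homog (c + r) (vop u p w)"
  unfolding vop_homog[OF assms]
  by (rule homog_act) (rule field_of_homog[OF shift_exp_homog[OF assms(1)] assms(2)])

definition swapped :: "int \<Rightarrow> int \<Rightarrow> 'v \<Rightarrow> 'v \<Rightarrow> 'v \<Rightarrow> int \<Rightarrow> int \<Rightarrow> 'v"
  where "swapped c d u v w p q =
    vop (shift_exp (of_int c) v) q (vop (shift_exp (- of_int d) u) p w)"

lemma swapped_trunc:
  "fst_trunc (swapped c d u v w)" "lower_trunc (\<lambda>q. swapped c d u v w p q)" "bounded_below2 (swapped c d u v w)"
proof -
  show f: "fst_trunc (swapped c d u v w)"
    unfolding swapped_def[abs_def] by (rule fst_trunc_prod[OF is_field_vop is_field_vop])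
  show l: "lower_trunc (\<lambda>q. swapped c d u v w p q)" for p
    unfolding swapped_def by (rule vop_trunc)
  have "bounded_below2 (\<lambda>q p. swapped c d u v w p q)"
    by (rule act2_act(2)[OF l]) (use f in \<open>auto simp: fst_trunc_def\<close>)
  then show "bounded_below2 (swapped c d u v w)"
    using bounded_below2_swap[of "swapped c d u v w"] by simp
qed

text \<open>The exponential is f(-x_0) for f(x) = exp(cdx) with x_0 replaced by x_1 - x_2.\<close>

definition braided :: "int \<Rightarrow> int \<Rightarrow> 'v \<Rightarrow> 'v \<Rightarrow> 'v \<Rightarrow> int \<Rightarrow> int \<Rightarrow> 'v"
  where "braided c d u v w = act2 (fps_exp (- of_int (c * d))) (fps_exp (of_int (c * d)))
    (\<lambda>p q. koszul c d *\<^sub>C swapped c d u v w p q)"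

text \<open>Both sides come from the untwisted product of the fields of \<open>e\<^bsup>-(d+r)J\<^sub>1\<^esup> u\<close> and
  \<open>e\<^bsup>-rJ\<^sub>1\<^esup> v\<close>, multiplied by \<open>e\<^bsup>\<kappa>\<^sub>1x\<^sub>1 + \<kappa>\<^sub>2x\<^sub>2\<^esup>\<close>.\<close>

lemma vop_jacobi_homog:
  assumes u: "homog c u" and v: "homog d v" and w: "homog r w"
  shows "expand12 n (\<lambda>p q. vop u p (vop v q w)) p q - expand21 n (braided c d u v w) p q =
    Sum_any (\<lambda>i::nat. (of_int (- p - 1) gchoose i) *\<^sub>C vop (vop u (- n - 1 - int i) v) (p + q + 1 + int i) w)"
proof -
  define u' where "u' = shift_exp (- of_int (d + r)) u"
  define v' where "v' = shift_exp (- of_int r) v"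
  have u': "homog c u'" and v': "homog d v'"
    unfolding u'_def v'_def by (rule shift_exp_homog, fact)+
  define A where "A = field_of c u'"
  define B where "B = field_of d v'"
  note A = field_of_field[OF u', folded A_def] and B = field_of_field[OF v', folded B_def]
  obtain k where k: "locality k (koszul c d) A B"
    unfolding A_def B_def using field_of_locality[OF u' field_of(1)[OF v']] by blast
  define k1 where "k1 = twist c (d + r)"
  define k2 where "k2 = twist d r"
  define F where "F = (\<lambda>p q. A p (B q w))"
  define F' where "F' = (\<lambda>p q. B q (A p w))"
  have st: "\<exists>N. \<forall>p. \<forall>q<N. A p (B q w) = 0" "\<exists>N. \<forall>q. \<forall>p<N. B q (A p w) = 0"
    using snd_trunc_prod[OF A B, of w] snd_trunc_prod[OF B A, of w] by (auto simp: snd_trunc_def)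
  have Fb: "act (fps_exp x) (\<lambda>p. act (fps_exp y) (\<lambda>q. F p q) q) p = act2 (fps_exp x) (fps_exp y) F p q"
    and Fb2: "bounded_below2 F" for x y p q
    unfolding F_def by (rule act2_act[OF is_fieldD(2)[OF A] st(1)])+
  have Fb': "act (fps_exp y) (\<lambda>q. act (fps_exp x) (\<lambda>p. F' p q) p) q = act2 (fps_exp x) (fps_exp y) F' p q" for x y p q
    unfolding F'_def act2_swap[of "fps_exp x"] by (rule act2_act(1)[OF is_fieldD(2)[OF B] st(2)])
  have Fb2': "bounded_below2 F'"
    unfolding F'_def bounded_below2_swap[of "\<lambda>p q. B q (A p w)", symmetric]
    by (rule act2_act(2)[OF is_fieldD(2)[OF B] st(2)])
  have G: "(\<lambda>p q. vop u p (vop v q w)) = act2 (fps_exp k1) (fps_exp k2) F"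
  proof (intro ext)
    fix p q
    have "vop u p (vop v q w) = act (fps_exp k1) (\<lambda>p. A p (act (fps_exp k2) (\<lambda>q. B q w) q)) p"
      unfolding vop_homog[OF u homog_vop[OF v w]] unfolding vop_homog[OF v w]
      by (simp add: A_def B_def u'_def v'_def k1_def k2_def)
    also have "\<dots> = act2 (fps_exp k1) (fps_exp k2) F p q"
      by (simp add: act_clinear[OF is_fieldD(1)[OF A] is_fieldD(2)[OF B]] Fb[symmetric]) (simp add: F_def)
    finally show "vop u p (vop v q w) = act2 (fps_exp k1) (fps_exp k2) F p q" .
  qed
  have H: "swapped c d u v w = act2 (fps_exp (twist c r)) (fps_exp (twist d (c + r))) F'"
  proof (intro ext)
    fix p q
    have "homog d (shift_exp (of_int c) v)" "homog c (shift_exp (- of_int d) u)"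
      by (rule shift_exp_homog, fact)+
    note h = this
    \<comment> \<open>The powers of exp(J_1) in S are chosen for this: together with those in the
      operators, which depend on the charge of the vector acted on, they reproduce the same two
      states in either order.\<close>
    have e: "shift_exp (- of_int (c + r)) (shift_exp (of_int c) v) = v'"
      "shift_exp (- of_int r) (shift_exp (- of_int d) u) = u'"
      by (simp_all add: shift_exp_add u'_def v'_def algebra_simps)
    have "swapped c d u v w p q =
        act (fps_exp (twist d (c + r))) (\<lambda>q. B q (act (fps_exp (twist c r)) (\<lambda>p. A p w) p)) q"
      unfolding swapped_def vop_homog[OF h(1) homog_vop[OF h(2) w]] unfolding vop_homog[OF h(2) w] e A_def B_def ..
    also have "\<dots> = act2 (fps_exp (twist c r)) (fps_exp (twist d (c + r))) F' p q"
      by (simp add: act_clinear[OF is_fieldD(1)[OF B] is_fieldD(2)[OF A]] Fb'[symmetric]) (simp add: F'_def)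
    finally show "swapped c d u v w p q = act2 (fps_exp (twist c r)) (fps_exp (twist d (c + r))) F' p q" .
  qed
  \<comment> \<open>In the swapped order the exponents are kappa(c, r) and kappa(d, c + r); the
    braiding adds -cd to the first and cd to the second, which restores the exponents of the
    original order.\<close>
  have H': "braided c d u v w = (\<lambda>p q. koszul c d *\<^sub>C act2 (fps_exp k1) (fps_exp k2) F' p q)"
  proof -
    have "braided c d u v w p q = koszul c d *\<^sub>C
        act2 (fps_exp (- of_int (c * d))) (fps_exp (of_int (c * d))) (swapped c d u v w) p q" for p q
      unfolding braided_def
      by (rule act2_clinear[OF clinear_scaleC[OF clinear_ident] swapped_trunc(3), symmetric])
    moreover have "act2 (fps_exp (- of_int (c * d))) (fps_exp (of_int (c * d))) (swapped c d u v w) =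
        act2 (fps_exp k1) (fps_exp k2) F'"
      unfolding H act2_mult[OF Fb2'] fps_exp_add_mult[symmetric] k1_def k2_def
        twist_braid(1)[of c r d, symmetric] twist_braid(2)[of d c r, symmetric]
      by (simp add: add.commute)
    ultimately show ?thesis by (simp add: fun_eq_iff)
  qed
  define f where "f = (mult_diff ^^ k) F"
  note tr = locality_trunc[OF A B k, of w, folded F_def, folded f_def]
  have eq1: "(mult_diff ^^ k) (\<lambda>p q. vop u p (vop v q w)) = act2 (fps_exp k1) (fps_exp k2) f"
    unfolding G f_def by (rule mult_diff_pow_act2[OF Fb2])
  have f': "f = (\<lambda>p q. koszul c d *\<^sub>C (mult_diff ^^ k) F' p q)"
    unfolding f_def F_def F'_def by (rule locality_eq[OF k])
  have eq2: "(mult_diff ^^ k) (braided c d u v w) = act2 (fps_exp k1) (fps_exp k2) f"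
    unfolding H' mult_diff_pow_clinear[OF clinear_scaleC[OF clinear_ident]] mult_diff_pow_act2[OF Fb2'] f'
    by (intro ext) (rule act2_clinear[OF clinear_scaleC[OF clinear_ident] bounded_below2_mult_diff[OF Fb2']])
  \<comment> \<open>The inner operator contributes kappa(c, d) in x_0, and conjugation by exp(-rJ_1)
    contributes -rc; together they give the exponent \<open>k1\<close>. The outer operator
    contributes kappa(c + d, r) = \<open>k1 + k2\<close> in x_2. These are the factors appearing in
    \<open>taylor_exp\<close>.\<close>
  have iter: "vop (vop u i v) m w = taylor (i + int k) (act2 (fps_exp k1) (fps_exp k2) f) m" for i m
  proof -
    have cd: "homog (c + d) (vop u i v)" by (rule homog_vop[OF u v])
    have u1: "homog c (shift_exp (- of_int d) u)" by (rule shift_exp_homog[OF u])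
    have Ai: "lower_trunc (\<lambda>i. A i v')" "homog (c + d) (A i v')" for i
      using is_fieldD(2)[OF A] field_of_homog[OF u' v'] by (auto simp: A_def)
    have "shift_exp (- of_int r) (vop u i v) =
        act (fps_exp (twist c d)) (\<lambda>i. act (fps_exp (- of_int r * of_int c)) (\<lambda>i. A i v') i) i"
      unfolding vop_homog[OF u v] act_clinear[OF clinear_shift_exp field_of_trunc[OF u1]]
        shift_exp_field_of[OF u1] shift_exp_add
      by (simp add: A_def u'_def v'_def algebra_simps)
    also have "\<dots> = act (fps_exp k1) (\<lambda>i. A i v') i"
      by (simp add: act_mult[OF Ai(1)] k1_def twist_right algebra_simps flip: fps_exp_add_mult)
    finally have s: "shift_exp (- of_int r) (vop u i v) = act (fps_exp k1) (\<lambda>i. A i v') i" .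
    have "vop (vop u i v) m w = act (fps_exp (k1 + k2))
        (\<lambda>m. act (fps_exp k1) (\<lambda>i. nth_prod k A B i m w) i) m"
      unfolding vop_homog[OF cd w] s field_of_act[OF Ai]
      unfolding A_def field_of_nth[OF u' v' k[unfolded A_def B_def]] B_def
      by (simp add: k1_def k2_def twist_left)
    also have "\<dots> = act (fps_exp k1) (\<lambda>i. act (fps_exp (k1 + k2)) (\<lambda>m. nth_prod k A B i m w) m) i"
    proof (rule act_swap[symmetric])
      show "lower_trunc (\<lambda>m. nth_prod k A B i m w)" for i
        by (rule is_fieldD(2)[OF is_field_nth_prod[OF A B k]])
      show "\<exists>N. \<forall>i<N. \<forall>m. nth_prod k A B i m w = 0"
        by (rule exI[of _ "- int k"]) (simp add: nth_prod_def taylor_def)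
    qed
    also have "\<dots> = act (fps_exp k1) (\<lambda>j. act (fps_exp (k1 + k2)) (taylor j f) m) (i + int k)"
      by (simp add: act_def nth_prod_def f_def F_def algebra_simps)
    also have "\<dots> = taylor (i + int k) (act2 (fps_exp k1) (fps_exp k2) f) m"
      by (rule taylor_exp[OF tr, symmetric])
    finally show ?thesis .
  qed
  have "expand12 n (\<lambda>p q. vop u p (vop v q w)) p q - expand21 n (braided c d u v w) p q =
    Sum_any (\<lambda>i::nat. (of_int (- p - 1) gchoose i) *\<^sub>C
      taylor (int k - n - 1 - int i) (act2 (fps_exp k1) (fps_exp k2) f) (p + q + 1 + int i))"
  proof (rule jacobi_arrays[OF _ _ eq1 eq2])
    show "snd_trunc (\<lambda>p q. vop u p (vop v q w))" by (rule snd_trunc_prod[OF is_field_vop is_field_vop])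
    show "fst_trunc (braided c d u v w)"
      unfolding braided_def
      by (rule fst_trunc_act2[OF fst_trunc_clinear[OF swapped_trunc(1) clinear_scaleC[OF clinear_ident]]])
  qed
  also have "\<dots> = Sum_any (\<lambda>i::nat. (of_int (- p - 1) gchoose i) *\<^sub>C vop (vop u (- n - 1 - int i) v) (p + q + 1 + int i) w)"
    unfolding iter by (simp add: algebra_simps)
  finally show ?thesis .
qed

lemma vop_jacobi_component:
  assumes u: "homog c u" and v: "homog d v"
  shows "expand12 n (\<lambda>p q. vop u p (vop v q w)) p q - expand21 n (braided c d u v w) p q =
    Sum_any (\<lambda>i::nat. (of_int (- p - 1) gchoose i) *\<^sub>C vop (vop u (- n - 1 - int i) v) (p + q + 1 + int i) w)"
proof (rule linear_eq_on_homog[of _ "\<lambda>w. Sum_any (\<lambda>i::nat. (of_int (- p - 1) gchoose i) *\<^sub>C vop (vop u (- n - 1 - int i) v) (p + q + 1 + int i) w)"])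
  have "clinear (\<lambda>w. swapped c d u v w p q)" for p q
    unfolding swapped_def by (rule clinear_comp[OF clinear_vop clinear_vop])
  then show "clinear (\<lambda>w. expand12 n (\<lambda>p q. vop u p (vop v q w)) p q - expand21 n (braided c d u v w) p q)"
    unfolding braided_def
    by (intro clinear_minus clinear_expand12 clinear_expand21 clinear_act2 clinear_scaleC clinear_comp[OF clinear_vop clinear_vop]
        snd_trunc_prod is_field_vop fst_trunc_act2 fst_trunc_clinear[OF swapped_trunc(1)] clinear_ident
        bounded_below2_clinear[OF swapped_trunc(3)])
  show "clinear (\<lambda>w. Sum_any (\<lambda>i::nat. (of_int (- p - 1) gchoose i) *\<^sub>C vop (vop u (- n - 1 - int i) v) (p + q + 1 + int i) w))"
  proof (rule clinear_Sum_any_fun)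
    show "finite {i::nat. (of_int (- p - 1) gchoose i) *\<^sub>C vop (vop u (- n - 1 - int i) v) (p + q + 1 + int i) w \<noteq> 0}" for w
    proof -
      obtain M where M: "\<And>i. i > M \<Longrightarrow> vop u (- n - 1 - int i) v = 0"
        using lower_trunc_bound[OF vop_trunc] by blast
      have "{i::nat. (of_int (- p - 1) gchoose i) *\<^sub>C vop (vop u (- n - 1 - int i) v) (p + q + 1 + int i) w \<noteq> 0} \<subseteq> {..M}"
      proof
        fix i assume i: "i \<in> {i::nat. (of_int (- p - 1) gchoose i) *\<^sub>C vop (vop u (- n - 1 - int i) v) (p + q + 1 + int i) w \<noteq> 0}"
        have "\<not> i > M"
        proof
          assume "i > M"
          then show False using i by (simp add: M clinear_zero[OF clinear_vop_state])
        qed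
        then show "i \<in> {..M}" by simp
      qed
      then show ?thesis by (rule finite_subset) simp
    qed
  qed (intro clinear_scaleC clinear_vop)
qed (rule vop_jacobi_homog[OF u v])

section \<open>The S-Jacobi identity for arbitrary vectors and the axioms of a weak quantum vertex
  algebra\<close>

definition vmode :: "'v \<Rightarrow> int \<Rightarrow> 'v \<Rightarrow> 'v" where "vmode u n w = vop u (- n - 1) w"

lemma vmode_power: "vmode u (- p - 1) w = vop u p w"
  by (simp add: vmode_def)

definition braid_list :: "'v \<Rightarrow> 'v \<Rightarrow> ('v \<times> 'v \<times> complex fls) list"
  where "braid_list u v = map (\<lambda>(c, d). (shift_exp (of_int c) (P d v), shift_exp (- of_int d) (P c u),
      exp_series (koszul c d) (of_int (c * d))))
    (List.product (sorted_list_of_set {c. P c u \<noteq> 0}) (sorted_list_of_set {d. P d v \<noteq> 0}))"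

lemma sum_list_braid_list:
  "(\<Sum>x\<leftarrow>braid_list u v. g x) = (\<Sum>c | P c u \<noteq> 0. \<Sum>d | P d v \<noteq> 0.
    g (shift_exp (of_int c) (P d v), shift_exp (- of_int d) (P c u), exp_series (koszul c d) (of_int (c * d))))"
proof -
  have "distinct (List.product (sorted_list_of_set {c. P c u \<noteq> 0}) (sorted_list_of_set {d. P d v \<noteq> 0}))"
    by (simp add: distinct_product)
  then show ?thesis
    unfolding braid_list_def
    by (simp add: sum_list_distinct_conv_sum_set comp_def P_finite sum.cartesian_product case_prod_beta)
qed

theorem vmode_S_jacobi: "S_jacobi_identity vmode u v (braid_list u v)"
  unfolding S_jacobi_identity_def
proof (intro allI)
  fix w a b c
  let ?C = "{c. P c u \<noteq> 0}" and ?D = "{d. P d v \<noteq> 0}"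
  let ?J12 = "\<lambda>u v. expand12 (- a - 1) (\<lambda>p q. vop u p (vop v q w)) b c"
  let ?J10 = "\<lambda>u v. Sum_any (\<lambda>i::nat. (of_int (- b - 1) gchoose i) *\<^sub>C vop (vop u (a - int i) v) (b + c + 1 + int i) w)"
  let ?J21 = "\<lambda>x y. expand21 (- a - 1) (braided x y (P x u) (P y v) w) b c"
  have l1: "dist_mult delta_12_0 (\<lambda>(a, b, c). if a = 0 then vmode u (- b - 1) (vmode v (- c - 1) w) else 0) (a, b, c) = ?J12 u v"
    by (simp only: dist_mult_delta_12_0 vmode_power)
  have l3: "dist_mult delta_10_2 (\<lambda>(a, b, c). if b = 0 then vmode (vmode u (- a - 1) v) (- c - 1) w else 0) (a, b, c) = ?J10 u v"
    by (simp only: dist_mult_delta_10_2 vmode_power)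
  let ?X = "\<lambda>(x, y) (a, b, c). (fls_reflect (exp_series (koszul x y) (of_int (x * y))) $$ a) *\<^sub>C swapped x y (P x u) (P y v) w b c"
  have "(\<lambda>(a, b, c). \<Sum>(v', u', f)\<leftarrow>braid_list u v. (fls_reflect f $$ a) *\<^sub>C vmode v' (- c - 1) (vmode u' (- b - 1) w)) =
      (\<lambda>z. \<Sum>xy\<in>?C \<times> ?D. ?X xy z)"
    unfolding sum_list_braid_list by (simp add: fun_eq_iff swapped_def vmode_def sum.cartesian_product case_prod_beta)
  then have "dist_mult delta_21_0 (\<lambda>(a, b, c). \<Sum>(v', u', f)\<leftarrow>braid_list u v. (fls_reflect f $$ a) *\<^sub>C
      vmode v' (- c - 1) (vmode u' (- b - 1) w)) (a, b, c) = (\<Sum>xy\<in>?C \<times> ?D. dist_mult delta_21_0 (?X xy) (a, b, c))"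
  proof (simp only:, intro dist_mult_sum)
    fix xy
    show "finite {z. (case z of (i, j, k) \<Rightarrow> delta_21_0 (i, j, k) *\<^sub>C ?X xy (a - i, b - j, c - k)) \<noteq> 0}"
      using dist_mult_delta_21_0(2)[OF swapped_trunc(1,2)] by (cases xy) simp
  qed (simp add: P_finite)
  also have "\<dots> = (\<Sum>(x, y)\<in>?C \<times> ?D. ?J21 x y)"
  proof (rule sum.cong[OF refl])
    fix xy :: "int \<times> int"
    obtain x y where xy: "xy = (x, y)" by (cases xy)
    show "dist_mult delta_21_0 (?X xy) (a, b, c) = (case xy of (x, y) \<Rightarrow> ?J21 x y)"
      unfolding xy prod.case braided_def by (rule dist_mult_delta_21_0(1)[OF swapped_trunc(1,2)])
  qed
  finally have l2: "dist_mult delta_21_0 (\<lambda>(a, b, c). \<Sum>(v', u', f)\<leftarrow>braid_list u v. (fls_reflect f $$ a) *\<^sub>C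
      vmode v' (- c - 1) (vmode u' (- b - 1) w)) (a, b, c) = (\<Sum>x\<in>?C. \<Sum>y\<in>?D. ?J21 x y)"
    by (simp add: sum.cartesian_product)
  have lin12: "clinear (\<lambda>u. ?J12 u v)" "clinear (\<lambda>v. ?J12 u v)" for u v
    by (intro clinear_expand12 clinear_vop_state clinear_comp[OF clinear_vop clinear_vop_state] snd_trunc_prod is_field_vop)+
  have fin: "finite {i::nat. (of_int (- b - 1) gchoose i) *\<^sub>C vop (vop u (a - int i) v) (b + c + 1 + int i) w \<noteq> 0}" for u v
  proof -
    obtain M where M: "\<And>i. i > M \<Longrightarrow> vop u (a - int i) v = 0"
      using lower_trunc_bound[OF vop_trunc] by blast
    have "{i::nat. (of_int (- b - 1) gchoose i) *\<^sub>C vop (vop u (a - int i) v) (b + c + 1 + int i) w \<noteq> 0} \<subseteq> {..M}"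
    proof
      fix i assume i: "i \<in> {i::nat. (of_int (- b - 1) gchoose i) *\<^sub>C vop (vop u (a - int i) v) (b + c + 1 + int i) w \<noteq> 0}"
      have "\<not> i > M"
      proof
        assume "i > M"
        then show False using i by (simp add: M clinear_zero[OF clinear_vop_state])
      qed
      then show "i \<in> {..M}" by simp
    qed
    then show ?thesis by (rule finite_subset) simp
  qed
  have lin10: "clinear (\<lambda>u. ?J10 u v)" "clinear (\<lambda>v. ?J10 u v)" for u v
    by (rule clinear_Sum_any_fun,
        intro clinear_scaleC clinear_comp[OF clinear_vop_state clinear_vop_state] clinear_comp[OF clinear_vop_state clinear_vop],
        rule fin)+
  have comp: "?J12 (P x u) (P y v) - ?J21 x y = ?J10 (P x u) (P y v)" for x y
    using vop_jacobi_component[OF homog_P[of x u] homog_P[of y v], of "- a - 1" w b c] by simp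
  have "?J12 u v = (\<Sum>x\<in>?C. \<Sum>y\<in>?D. ?J12 (P x u) (P y v))"
    by (subst clinear_components[OF lin12(1), of u], rule sum.cong[OF refl], rule clinear_components[OF lin12(2)])
  moreover have "?J10 u v = (\<Sum>x\<in>?C. \<Sum>y\<in>?D. ?J10 (P x u) (P y v))"
    by (subst clinear_components[OF lin10(1), of u], rule sum.cong[OF refl], rule clinear_components[OF lin10(2)])
  ultimately have "?J12 u v - (\<Sum>x\<in>?C. \<Sum>y\<in>?D. ?J21 x y) = ?J10 u v"
    by (simp only: sum_subtractf[symmetric] comp)
  then show "dist_mult delta_12_0 (\<lambda>(a, b, c). if a = 0 then vmode u (- b - 1) (vmode v (- c - 1) w) else 0) (a, b, c) -
      dist_mult delta_21_0 (\<lambda>(a, b, c). \<Sum>(v', u', f)\<leftarrow>braid_list u v. (fls_reflect f $$ a) *\<^sub>C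
        vmode v' (- c - 1) (vmode u' (- b - 1) w)) (a, b, c) =
      dist_mult delta_10_2 (\<lambda>(a, b, c). if b = 0 then vmode (vmode u (- a - 1) v) (- c - 1) w else 0) (a, b, c)"
    unfolding l1 l2 l3 .
qed

lemma vop_vac: "vop vac p w = (if p = 0 then w else 0)"
proof (rule linear_eq_on_homog[of "vop vac p" "\<lambda>w. if p = 0 then w else 0"])
  show "clinear (\<lambda>w. if p = 0 then w else 0)" by (rule clinearI) auto
  show "vop vac p w = (if p = 0 then w else 0)" if "homog r w" for r w
    unfolding vop_homog[OF vac_homog that]
    by (simp add: shift_exp_vac field_of_vac) (simp add: id_field_def)
qed (rule clinear_vop)

lemma vop_creation:
  assumes "p \<le> 0"
  shows "vop u p vac = (if p = 0 then u else 0)"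
proof (rule linear_eq_on_homog[of "\<lambda>u. vop u p vac" "\<lambda>u. if p = 0 then u else 0"])
  show "clinear (\<lambda>u. if p = 0 then u else 0)" by (rule clinearI) auto
  show "vop u p vac = (if p = 0 then u else 0)" if u: "homog c u" for c u
  proof -
    have "vop u p vac = act (fps_exp (twist c 0)) (\<lambda>p. field_of c u p vac) p"
      unfolding vop_homog[OF u vac_homog] by simp
    also have "\<dots> = (\<Sum>i\<le>0. fps_nth (fps_exp (twist c 0)) i *\<^sub>C field_of c u (p - int i) vac)"
      by (rule act_eq_sum) (use field_of_creation[OF u] assms in auto)
    also have "\<dots> = (if p = 0 then u else 0)"
      using field_of(2)[OF u] field_of_creation[OF u, of p] assms by auto
    finally show ?thesis .
  qed
qed (rule clinear_vop_state)

theorem vmode_weak_quantum_vertex_algebra: "weak_quantum_vertex_algebra vmode vac"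
proof (rule weak_quantum_vertex_algebra.intro)
  show "clinear (\<lambda>u. vmode u n v)" for n v unfolding vmode_def by (rule clinear_vop_state)
  show "clinear (vmode u n)" for u n unfolding vmode_def[abs_def] by (rule clinear_vop)
  show "\<exists>N. \<forall>n\<ge>N. vmode u n v = 0" for u v
  proof -
    obtain N where N: "\<And>p. p < N \<Longrightarrow> vop u p v = 0" using vop_trunc[of u v] by (auto simp: lower_trunc_def)
    show ?thesis by (rule exI[of _ "- N"]) (auto simp: vmode_def intro!: N)
  qed
  show "vmode vac n v = (if n = - 1 then v else 0)" for n v by (auto simp: vmode_def vop_vac)
  show "vmode v n vac = 0" if "n \<ge> 0" for v n using that by (simp add: vmode_def vop_creation)
  show "vmode v (- 1) vac = v" for v by (simp add: vmode_def vop_creation)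
  show "\<exists>vufs. S_jacobi_identity vmode u v vufs" for u v using vmode_S_jacobi by blast
qed

text \<open>The state psi_0 vac is fixed by exp(sJ_1), because lower coefficients of psi annihilate
  the vacuum; so the twist reduces to the exponential.\<close>

lemma vop_generator:
  assumes "homog r w"
  shows "vop (psi g 0 vac) p w = act (fps_exp (twist (charge g) r)) (\<lambda>p. psi g p w) p"
proof -
  have h: "homog (charge g) (psi g 0 vac)" using psi_homog[OF vac_homog, of g 0] by simp
  have "shift_exp s (psi g 0 vac) = psi g 0 vac" for s
  proof -
    have "shift_exp s (psi g 0 vac) = (\<Sum>i\<le>0. fps_nth (fps_exp (s * of_int (charge g))) i *\<^sub>C psi g (0 - int i) vac)"
      unfolding shift_exp_psi shift_exp_vac by (rule act_eq_sum) (simp add: psi_vac)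
    then show ?thesis by simp
  qed
  then show ?thesis unfolding vop_homog[OF h assms] by (simp add: field_of_psi)
qed

end

section \<open>The braiding\<close>

lemma tensor_add_left: "(a + a') \<otimes>\<^sub>t b = a \<otimes>\<^sub>t b + a' \<otimes>\<^sub>t b"
proof (transfer, unfold tensor_rel_def)
  fix a a' :: 'a and b :: 'b
  have "pair_gen (a + a') b - pair_gen a b - pair_gen a' b \<in> complex_vector.span bilinearity_relations"
    by (rule complex_vector.span_base) (unfold bilinearity_relations_def, blast)
  then show "pair_gen (a + a') b - (pair_gen a b + pair_gen a' b) \<in> complex_vector.span bilinearity_relations"
    by (simp add: diff_diff_eq)
qed

lemma tensor_add_right: "a \<otimes>\<^sub>t (b + b') = a \<otimes>\<^sub>t b + a \<otimes>\<^sub>t b'"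
proof (transfer, unfold tensor_rel_def)
  fix a :: 'a and b b' :: 'b
  have "pair_gen a (b + b') - pair_gen a b - pair_gen a b' \<in> complex_vector.span bilinearity_relations"
    by (rule complex_vector.span_base) (unfold bilinearity_relations_def, blast)
  then show "pair_gen a (b + b') - (pair_gen a b + pair_gen a b') \<in> complex_vector.span bilinearity_relations"
    by (simp add: diff_diff_eq)
qed

lemma tensor_scale_left: "(c *\<^sub>C a) \<otimes>\<^sub>t b = c *\<^sub>C (a \<otimes>\<^sub>t b)"
proof (transfer, unfold tensor_rel_def)
  fix c and a :: 'a and b :: 'b
  show "pair_gen (c *\<^sub>C a) b - c *\<^sub>C pair_gen a b \<in> complex_vector.span bilinearity_relations"
    by (rule complex_vector.span_base) (unfold bilinearity_relations_def, blast)
qed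

lemma tensor_scale_right: "a \<otimes>\<^sub>t (c *\<^sub>C b) = c *\<^sub>C (a \<otimes>\<^sub>t b)"
proof (transfer, unfold tensor_rel_def)
  fix c and a :: 'a and b :: 'b
  show "pair_gen a (c *\<^sub>C b) - c *\<^sub>C pair_gen a b \<in> complex_vector.span bilinearity_relations"
    by (rule complex_vector.span_base) (unfold bilinearity_relations_def, blast)
qed

lemma clinear_tensor: "clinear (\<lambda>b. a \<otimes>\<^sub>t b)" "clinear (\<lambda>a. a \<otimes>\<^sub>t b)"
  by (rule clinearI; simp add: tensor_add_left tensor_add_right tensor_scale_left tensor_scale_right)+

lemma clinear_tensor_comp:
  "clinear f \<Longrightarrow> clinear (\<lambda>x. a \<otimes>\<^sub>t f x)" "clinear g \<Longrightarrow> clinear (\<lambda>x. g x \<otimes>\<^sub>t b)"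
  by (rule clinear_comp[OF clinear_tensor(1)], assumption, rule clinear_comp[OF clinear_tensor(2)], assumption)

lemma cbilinearI: "(\<And>a. clinear (f a)) \<Longrightarrow> (\<And>b. clinear (\<lambda>a. f a b)) \<Longrightarrow> cbilinear f"
  by (simp add: cbilinear_def)

lemma poly_mapping_expand:
  "(p :: 'a \<Rightarrow>\<^sub>0 complex) =
    (\<Sum>k\<in>Poly_Mapping.keys p. Poly_Mapping.lookup p k *\<^sub>C Poly_Mapping.single k 1)"
  by (rule poly_mapping_eqI)
    (simp add: lookup_sum lookup_scaleC lookup_single scaleC_complex_def when_def
        if_distrib[of "\<lambda>x. _ * x"] in_keys_iff cong: if_cong)

lemma clinear_abs_tensor: "clinear abs_tensor"
  by (rule clinearI) (simp_all add: plus_tensor.abs_eq scaleC_tensor.abs_eq)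

lemma tensor_linear_eq:
  assumes "clinear f" "clinear g" "\<And>a b. f (a \<otimes>\<^sub>t b) = g (a \<otimes>\<^sub>t b)"
  shows "f t = g t"
proof -
  obtain p where t: "t = abs_tensor p" by (metis Quotient3_abs_rep Quotient3_tensor)
  have *: "t = (\<Sum>k\<in>Poly_Mapping.keys p. Poly_Mapping.lookup p k *\<^sub>C (fst k \<otimes>\<^sub>t snd k))"
    unfolding t
    by (subst poly_mapping_expand[of p])
      (simp only: clinear_sum[OF clinear_abs_tensor] clinear_scale[OF clinear_abs_tensor]
        tensor.abs_eq pair_gen_def prod.collapse)
  show ?thesis
    unfolding * by (simp only: clinear_sum[OF assms(1)] clinear_sum[OF assms(2)]
        clinear_scale[OF assms(1)] clinear_scale[OF assms(2)] assms(3))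
qed

lemma clinear_tensor_lift_param:
  assumes "\<And>x. cbilinear (F x)" "\<And>a b. clinear (\<lambda>x. F x a b)"
  shows "clinear (\<lambda>x. tensor_lift (F x) t)"
proof (rule clinearI)
  fix x y c
  show "tensor_lift (F (x + y)) t = tensor_lift (F x) t + tensor_lift (F y) t"
    by (rule tensor_linear_eq[of "tensor_lift (F (x + y))" "\<lambda>t. tensor_lift (F x) t + tensor_lift (F y) t"])
      (simp_all add: clinear_tensor_lift clinear_plus tensor_lift_tensor assms(1) clinear_add[OF assms(2)])
  show "tensor_lift (F (c *\<^sub>C x)) t = c *\<^sub>C tensor_lift (F x) t"
    by (rule tensor_linear_eq[of "tensor_lift (F (c *\<^sub>C x))" "\<lambda>t. c *\<^sub>C tensor_lift (F x) t"])
      (simp_all add: clinear_tensor_lift clinear_scaleC tensor_lift_tensor assms(1) clinear_scale[OF assms(2)])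
qed

lemma trilinear_lift:
  assumes "\<And>u v. clinear (X u v)" "\<And>u w. clinear (\<lambda>v. X u v w)" "\<And>v w. clinear (\<lambda>u. X u v w)"
  shows "clinear (tensor_lift (\<lambda>u. tensor_lift (X u)))"
    and "tensor_lift (\<lambda>u. tensor_lift (X u)) (u \<otimes>\<^sub>t (v \<otimes>\<^sub>t w)) = X u v w"
proof -
  have b: "cbilinear (X u)" for u by (intro cbilinearI assms)
  have bb: "cbilinear (\<lambda>u. tensor_lift (X u))"
    by (intro cbilinearI clinear_tensor_lift[OF b] clinear_tensor_lift_param[OF b] assms(3))
  show "clinear (tensor_lift (\<lambda>u. tensor_lift (X u)))" by (rule clinear_tensor_lift[OF bb])
  show "tensor_lift (\<lambda>u. tensor_lift (X u)) (u \<otimes>\<^sub>t (v \<otimes>\<^sub>t w)) = X u v w"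
    by (simp add: tensor_lift_tensor[OF bb] tensor_lift_tensor[OF b])
qed

lemma scaleC_fls_conv: "c *\<^sub>C f = fls_const c * f" for f :: "complex fls"
  by (simp add: fls_eq_iff scaleC_complex_def)

lemma scaleC_fls_fls_conv: "c *\<^sub>C F = fls_const (fls_const c) * F" for F :: "complex fls fls"
  by (rule fls_eqI) (simp add: scaleC_fls_conv)

lemma fls_scaleC_mult: "(c *\<^sub>C f) * g = c *\<^sub>C (f * g)" for f g :: "complex fls"
  by (simp add: scaleC_fls_conv mult.assoc)

lemma fls_fls_scaleC_mult: "(c *\<^sub>C f) * g = c *\<^sub>C (f * g)" for f g :: "complex fls fls"
  by (simp add: scaleC_fls_fls_conv mult.assoc)

lemma clinear_fls_maps: "clinear fls_in_x" "clinear fls_in_z" "clinear fls_in_x_plus_z" "clinear fls_reflect"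
proof -
  show "clinear fls_in_x"
    by (rule clinearI; rule fls_eqI; rule fls_eqI; simp add: fls_in_x_nth)
  show "clinear fls_in_z"
    by (rule clinearI; rule fls_eqI; rule fls_eqI; simp add: fls_in_z_nth)
  show "clinear fls_in_x_plus_z"
    by (rule clinearI; rule fls_eqI; rule fls_eqI;
        simp add: fls_in_x_plus_z_nth scaleC_complex_def algebra_simps)
  show "clinear fls_reflect"
    by (rule clinearI; rule fls_eqI; simp add: scaleC_complex_def algebra_simps)
qed

text \<open>The sort of the coefficient ring does not tie scalar multiplication to the ring product;
  the assumption \<open>mult\<close> does, and it holds in \<complex>((x)) and
  \<complex>((x))((z)).\<close>

lemma series_op:
  fixes S :: "'w::complex_vector \<Rightarrow> ('w, complex fls) tensor"
    and phi :: "complex fls \<Rightarrow> 'k::{complex_vector, comm_ring_1}"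
  assumes S: "clinear S" and phi: "clinear phi" and mult: "\<And>c x (y :: 'k). (c *\<^sub>C x) * y = c *\<^sub>C (x * y)"
  shows "clinear (series_op phi S)"
    and "S w = w' \<otimes>\<^sub>t f \<Longrightarrow> series_op phi S (w \<otimes>\<^sub>t g) = w' \<otimes>\<^sub>t (phi f * g)"
proof -
  have l1: "clinear (\<lambda>f. phi f * g)" for g
    by (rule clinearI) (simp_all add: clinear_add[OF phi] clinear_scale[OF phi] distrib_right mult)
  have l2: "clinear (\<lambda>g. phi f * g)" for f
    by (rule clinearI) (simp_all add: distrib_left mult mult.commute[of "phi f"])
  have b: "cbilinear (\<lambda>w' f. w' \<otimes>\<^sub>t (phi f * g))" for g :: 'k and w' :: 'w
    by (intro cbilinearI clinear_tensor_comp l1 clinear_ident)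
  have bb: "cbilinear (\<lambda>w g. tensor_lift (\<lambda>w' f. w' \<otimes>\<^sub>t (phi f * g)) (S w))"
    by (intro cbilinearI clinear_tensor_lift_param b clinear_tensor_comp l2 clinear_comp[OF clinear_tensor_lift[OF b] S])
  show "clinear (series_op phi S)" unfolding series_op_def by (rule clinear_tensor_lift[OF bb])
  show "S w = w' \<otimes>\<^sub>t f \<Longrightarrow> series_op phi S (w \<otimes>\<^sub>t g) = w' \<otimes>\<^sub>t (phi f * g)"
    by (simp add: series_op_def tensor_lift_tensor[OF bb] tensor_lift_tensor[OF b])
qed

lemma flip:
  fixes u v :: "'a::complex_vector"
  shows "clinear (flip :: ('a, 'a) tensor \<Rightarrow> _)" "flip (u \<otimes>\<^sub>t v) = v \<otimes>\<^sub>t u"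
proof -
  have b: "cbilinear (\<lambda>u v :: 'a. v \<otimes>\<^sub>t u)" by (intro cbilinearI clinear_tensor)
  show "clinear (flip :: ('a, 'a) tensor \<Rightarrow> _)" unfolding flip_def by (rule clinear_tensor_lift[OF b])
  show "flip (u \<otimes>\<^sub>t v) = v \<otimes>\<^sub>t u" by (simp add: flip_def tensor_lift_tensor[OF b])
qed

lemma cbilinear_tensor_fst: "clinear L \<Longrightarrow> cbilinear (\<lambda>x f. L x \<otimes>\<^sub>t f)"
  by (intro cbilinearI clinear_tensor_comp clinear_ident)

text \<open>As for the other embeddings below, only the value on pure tensors with pure image is
  recorded: the braiding sends homogeneous pure tensors to pure tensors, and these span.\<close>

lemma op21:
  assumes S: "clinear S"
  shows "clinear (op21 S)" "S (v \<otimes>\<^sub>t u) = (v' \<otimes>\<^sub>t u') \<otimes>\<^sub>t f \<Longrightarrow> op21 S (u \<otimes>\<^sub>t v) = (u' \<otimes>\<^sub>t v') \<otimes>\<^sub>t f"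
proof -
  note b = cbilinear_tensor_fst[OF flip(1)]
  show "clinear (op21 S)"
    unfolding op21_def[abs_def] by (intro clinear_comp[OF clinear_tensor_lift[OF b]] clinear_comp[OF S flip(1)])
  show "S (v \<otimes>\<^sub>t u) = (v' \<otimes>\<^sub>t u') \<otimes>\<^sub>t f \<Longrightarrow> op21 S (u \<otimes>\<^sub>t v) = (u' \<otimes>\<^sub>t v') \<otimes>\<^sub>t f"
    by (simp add: op21_def flip tensor_lift_tensor[OF b])
qed

lemma op12:
  fixes S :: "'u::complex_vector rational_op"
  assumes S: "clinear S"
  shows "clinear (op12 S)"
    "S (u \<otimes>\<^sub>t v) = (u' \<otimes>\<^sub>t v') \<otimes>\<^sub>t f \<Longrightarrow> op12 S (u \<otimes>\<^sub>t (v \<otimes>\<^sub>t w)) = (u' \<otimes>\<^sub>t (v' \<otimes>\<^sub>t w)) \<otimes>\<^sub>t f"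
proof -
  let ?X = "\<lambda>u v (w :: 'u). tensor_lift (\<lambda>ab f. tensor_lift (\<lambda>a b. a \<otimes>\<^sub>t (b \<otimes>\<^sub>t w)) ab \<otimes>\<^sub>t f) (S (u \<otimes>\<^sub>t v))"
  have b: "cbilinear (\<lambda>(a :: 'u) (b :: 'u). a \<otimes>\<^sub>t (b \<otimes>\<^sub>t w))" for w :: 'u
    by (intro cbilinearI clinear_tensor_comp clinear_tensor)
  note b2 = cbilinear_tensor_fst[OF clinear_tensor_lift[OF b]]
  have w: "clinear (\<lambda>w :: 'u. tensor_lift (\<lambda>a b. a \<otimes>\<^sub>t (b \<otimes>\<^sub>t w)) ab)" for ab :: "('u, 'u) tensor"
    by (rule clinear_tensor_lift_param[where F = "\<lambda>w a b. a \<otimes>\<^sub>t (b \<otimes>\<^sub>t w)", OF b])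
      (intro clinear_tensor_comp clinear_tensor)
  have X: "clinear (?X u v)" "clinear (\<lambda>v. ?X u v w)" "clinear (\<lambda>u. ?X u v w)" for u v w
  proof -
    show "clinear (?X u v)"
      by (rule clinear_tensor_lift_param) (rule b2, rule clinear_tensor_comp(2)[OF w])
    show "clinear (\<lambda>v. ?X u v w)"
      by (rule clinear_comp[OF clinear_tensor_lift[OF b2] clinear_comp[OF S clinear_tensor(1)]])
    show "clinear (\<lambda>u. ?X u v w)"
      by (rule clinear_comp[OF clinear_tensor_lift[OF b2] clinear_comp[OF S clinear_tensor(2)]])
  qed
  show "clinear (op12 S)" unfolding op12_def by (rule trilinear_lift(1)[OF X])
  show "S (u \<otimes>\<^sub>t v) = (u' \<otimes>\<^sub>t v') \<otimes>\<^sub>t f \<Longrightarrow> op12 S (u \<otimes>\<^sub>t (v \<otimes>\<^sub>t w)) = (u' \<otimes>\<^sub>t (v' \<otimes>\<^sub>t w)) \<otimes>\<^sub>t f"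
    unfolding op12_def trilinear_lift(2)[of ?X, OF X]
    by (simp add: tensor_lift_tensor[OF b2] tensor_lift_tensor[OF b])
qed

lemma op13:
  fixes S :: "'u::complex_vector rational_op"
  assumes S: "clinear S"
  shows "clinear (op13 S)"
    "S (u \<otimes>\<^sub>t w) = (u' \<otimes>\<^sub>t w') \<otimes>\<^sub>t f \<Longrightarrow> op13 S (u \<otimes>\<^sub>t (v \<otimes>\<^sub>t w)) = (u' \<otimes>\<^sub>t (v \<otimes>\<^sub>t w')) \<otimes>\<^sub>t f"
proof -
  let ?X = "\<lambda>u (v :: 'u) w. tensor_lift (\<lambda>ac f. tensor_lift (\<lambda>a c. a \<otimes>\<^sub>t (v \<otimes>\<^sub>t c)) ac \<otimes>\<^sub>t f) (S (u \<otimes>\<^sub>t w))"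
  have b: "cbilinear (\<lambda>(a :: 'u) (c :: 'u). a \<otimes>\<^sub>t (v \<otimes>\<^sub>t c))" for v :: 'u
    by (intro cbilinearI clinear_tensor_comp clinear_tensor)
  note b2 = cbilinear_tensor_fst[OF clinear_tensor_lift[OF b]]
  have v: "clinear (\<lambda>v :: 'u. tensor_lift (\<lambda>a c. a \<otimes>\<^sub>t (v \<otimes>\<^sub>t c)) ac)" for ac :: "('u, 'u) tensor"
    by (rule clinear_tensor_lift_param[where F = "\<lambda>v a c. a \<otimes>\<^sub>t (v \<otimes>\<^sub>t c)", OF b])
      (intro clinear_tensor_comp clinear_tensor)
  have X: "clinear (?X u v)" "clinear (\<lambda>v. ?X u v w)" "clinear (\<lambda>u. ?X u v w)" for u v w
  proof -
    show "clinear (\<lambda>v. ?X u v w)"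
      by (rule clinear_tensor_lift_param) (rule b2, rule clinear_tensor_comp(2)[OF v])
    show "clinear (?X u v)"
      by (rule clinear_comp[OF clinear_tensor_lift[OF b2] clinear_comp[OF S clinear_tensor(1)]])
    show "clinear (\<lambda>u. ?X u v w)"
      by (rule clinear_comp[OF clinear_tensor_lift[OF b2] clinear_comp[OF S clinear_tensor(2)]])
  qed
  show "clinear (op13 S)" unfolding op13_def by (rule trilinear_lift(1)[OF X])
  show "S (u \<otimes>\<^sub>t w) = (u' \<otimes>\<^sub>t w') \<otimes>\<^sub>t f \<Longrightarrow> op13 S (u \<otimes>\<^sub>t (v \<otimes>\<^sub>t w)) = (u' \<otimes>\<^sub>t (v \<otimes>\<^sub>t w')) \<otimes>\<^sub>t f"
    unfolding op13_def trilinear_lift(2)[of ?X, OF X]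
    by (simp add: tensor_lift_tensor[OF b2] tensor_lift_tensor[OF b])
qed

lemma op23:
  fixes S :: "'u::complex_vector rational_op"
  assumes S: "clinear S"
  shows "clinear (op23 S)"
    "S (v \<otimes>\<^sub>t w) = (v' \<otimes>\<^sub>t w') \<otimes>\<^sub>t f \<Longrightarrow> op23 S (u \<otimes>\<^sub>t (v \<otimes>\<^sub>t w)) = (u \<otimes>\<^sub>t (v' \<otimes>\<^sub>t w')) \<otimes>\<^sub>t f"
proof -
  have b: "cbilinear (\<lambda>(bc :: ('u, 'u) tensor) (f :: complex fls). (u \<otimes>\<^sub>t bc) \<otimes>\<^sub>t f)" for u :: 'u
    by (intro cbilinearI clinear_tensor_comp clinear_tensor clinear_ident)
  have bb: "cbilinear (\<lambda>(u :: 'u) vw. tensor_lift (\<lambda>bc f. (u \<otimes>\<^sub>t bc) \<otimes>\<^sub>t f) (S vw))"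
  proof (rule cbilinearI)
    show "clinear (\<lambda>vw. tensor_lift (\<lambda>bc f. (u \<otimes>\<^sub>t bc) \<otimes>\<^sub>t f) (S vw))" for u :: 'u
      by (rule clinear_comp[OF clinear_tensor_lift[OF b] S])
    show "clinear (\<lambda>u :: 'u. tensor_lift (\<lambda>bc f. (u \<otimes>\<^sub>t bc) \<otimes>\<^sub>t f) (S vw))" for vw
      by (rule clinear_tensor_lift_param[where F = "\<lambda>u bc f. (u \<otimes>\<^sub>t bc) \<otimes>\<^sub>t f", OF b])
        (intro clinear_tensor_comp clinear_ident)
  qed
  show "clinear (op23 S)" unfolding op23_def by (rule clinear_tensor_lift[OF bb])
  show "S (v \<otimes>\<^sub>t w) = (v' \<otimes>\<^sub>t w') \<otimes>\<^sub>t f \<Longrightarrow> op23 S (u \<otimes>\<^sub>t (v \<otimes>\<^sub>t w)) = (u \<otimes>\<^sub>t (v' \<otimes>\<^sub>t w')) \<otimes>\<^sub>t f"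
    by (simp add: op23_def tensor_lift_tensor[OF bb] tensor_lift_tensor[OF b])
qed

lemma exp_series_reflect: "fls_reflect (exp_series e m) = exp_series e (- m)"
proof (rule fls_eqI)
  fix n
  show "fls_reflect (exp_series e m) $$ n = exp_series e (- m) $$ n"
  proof (cases "n < 0")
    case False
    then obtain k where "n = int k" by (metis nonneg_int_cases not_less)
    then show ?thesis by (simp add: exp_series_nth power_minus[of m k])
  qed (simp add: exp_series_nth)
qed

lemma exp_series_cancel: "e * e = 1 \<Longrightarrow> exp_series e m * exp_series e (- m) = 1"
proof -
  assume e: "e * e = 1"
  have "exp_series e m * exp_series e (- m) = fps_to_fls ((fps_const e * fps_exp m) * (fps_const e * fps_exp (- m)))"
    by (simp add: exp_series_def fls_times_fps_to_fls)
  also have "(fps_const e * fps_exp m) * (fps_const e * fps_exp (- m)) = fps_const (e * e) * (fps_exp m * fps_exp (- m))"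
    by (simp only: fps_const_mult[symmetric] mult_ac)
  also have "\<dots> = 1" unfolding e fps_exp_add_mult[symmetric] by simp
  finally show ?thesis by simp
qed

context fermion
begin

definition braiding :: "'v rational_op"
  where "braiding = tensor_lift (\<lambda>v u. on_components (\<lambda>d v. on_components (\<lambda>c u.
    (shift_exp (of_int c) v \<otimes>\<^sub>t shift_exp (- of_int d) u) \<otimes>\<^sub>t exp_series (koszul c d) (of_int (c * d))) u) v)"

lemma cbilinear_braiding:
  "cbilinear (\<lambda>v u. on_components (\<lambda>d v. on_components (\<lambda>c u.
    (shift_exp (of_int c) v \<otimes>\<^sub>t shift_exp (- of_int d) u) \<otimes>\<^sub>t exp_series (koszul c d) (of_int (c * d))) u) v)"
proof -
  let ?F = "\<lambda>c d v u. (shift_exp (of_int c) v \<otimes>\<^sub>t shift_exp (- of_int d) u) \<otimes>\<^sub>t exp_series (koszul c d) (of_int (c * d))"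
  have u: "clinear (\<lambda>u. ?F c d v u)" and v: "clinear (\<lambda>v. ?F c d v u)" for c d u v
    by (intro clinear_tensor_comp clinear_shift_exp)+
  have v': "clinear (\<lambda>v. on_components (\<lambda>c u. ?F c d v u) u)" for d u
    unfolding on_components_def
    by (rule clinear_Sum_any_fun[OF v]) (rule on_components_finite[OF u])
  show ?thesis
  proof (intro cbilinearI)
    show "clinear (\<lambda>v. on_components (\<lambda>d v. on_components (\<lambda>c u. ?F c d v u) u) v)" for u
      by (rule clinear_on_components[OF v'])
    show "clinear (\<lambda>u. on_components (\<lambda>d v. on_components (\<lambda>c u. ?F c d v u) u) v)" for v
    proof -
      have "on_components (\<lambda>d v. on_components (\<lambda>c u. ?F c d v u) u) v =
          Sum_any (\<lambda>d. on_components (\<lambda>c u. ?F c d (P d v) u) u)" for u by (rule on_components_def)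
      moreover have "finite {d. on_components (\<lambda>c u. ?F c d (P d v) u) u \<noteq> 0}" for u
        by (rule on_components_finite[OF v'])
      ultimately show ?thesis
        by (simp only:) (intro clinear_Sum_any_fun clinear_on_components u)
    qed
  qed
qed

lemma clinear_braiding: "clinear braiding"
  unfolding braiding_def by (rule clinear_tensor_lift[OF cbilinear_braiding])

lemma braiding_homog:
  assumes "homog d v" "homog c u"
  shows "braiding (v \<otimes>\<^sub>t u) =
    (shift_exp (of_int c) v \<otimes>\<^sub>t shift_exp (- of_int d) u) \<otimes>\<^sub>t exp_series (koszul c d) (of_int (c * d))"
proof -
  have z: "shift_exp s 0 = 0" for s by (rule clinear_zero[OF clinear_shift_exp])
  have t: "0 \<otimes>\<^sub>t b = 0" "a \<otimes>\<^sub>t 0 = 0" for a b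
    by (rule clinear_zero[OF clinear_tensor(2)], rule clinear_zero[OF clinear_tensor(1)])
  have o: "on_components (\<lambda>c u. 0) u = (0 :: (('v, 'v) tensor, complex fls) tensor)" for u
    by (simp add: on_components_def)
  show ?thesis
    unfolding braiding_def tensor_lift_tensor[OF cbilinear_braiding]
    by (subst on_components_homog[OF assms(1)], simp add: z t o,
        subst on_components_homog[OF assms(2)], simp add: z t, rule refl)
qed

lemma braiding_braid_list:
  "braiding (v \<otimes>\<^sub>t u) = (\<Sum>(v', u', f)\<leftarrow>braid_list u v. (v' \<otimes>\<^sub>t u') \<otimes>\<^sub>t f)"
proof -
  have "clinear (\<lambda>v. braiding (v \<otimes>\<^sub>t u))" "clinear (\<lambda>u. braiding (v \<otimes>\<^sub>t u))" for u v
    by (rule clinear_comp[OF clinear_braiding clinear_tensor(2)], rule clinear_comp[OF clinear_braiding clinear_tensor(1)])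
  note lin = this
  have "braiding (v \<otimes>\<^sub>t u) = (\<Sum>c | P c u \<noteq> 0. \<Sum>d | P d v \<noteq> 0. braiding (P d v \<otimes>\<^sub>t P c u))"
    by (subst clinear_components[OF lin(2), of _ u], rule sum.cong[OF refl], rule clinear_components[OF lin(1)])
  then show ?thesis
    by (simp add: sum_list_braid_list braiding_homog[OF homog_P homog_P])
qed

text \<open>On homogeneous pure tensors each factor multiplies by a series depending on charges
  alone and applies powers of exp(J_1), which preserve charge. So each of the three series occurs
  unchanged on both sides, and in every slot the exponents of exp(J_1) add up to the same
  total.\<close>

lemma braiding_Yang_Baxter: "rational_quantum_Yang_Baxter_operator braiding"
  unfolding rational_quantum_Yang_Baxter_operator_def
proof (intro conjI ext clinear_braiding)
  fix t
  let ?A = "series_op fls_in_x (op12 braiding)" and ?B = "series_op fls_in_x_plus_z (op13 braiding)"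
    and ?C = "series_op fls_in_z (op23 braiding)"
  note A = series_op[OF op12(1)[OF clinear_braiding] clinear_fls_maps(1) fls_fls_scaleC_mult]
  note B = series_op[OF op13(1)[OF clinear_braiding] clinear_fls_maps(3) fls_fls_scaleC_mult]
  note C = series_op[OF op23(1)[OF clinear_braiding] clinear_fls_maps(2) fls_fls_scaleC_mult]
  have lin: "clinear (\<lambda>t. ?A (?B (?C t)))" "clinear (\<lambda>t. ?C (?B (?A t)))"
    by (intro clinear_comp[OF A(1)] clinear_comp[OF B(1)] C(1), intro clinear_comp[OF C(1)] clinear_comp[OF B(1)] A(1))
  have hom: "?A (?B (?C ((u \<otimes>\<^sub>t (v \<otimes>\<^sub>t w)) \<otimes>\<^sub>t g))) = ?C (?B (?A ((u \<otimes>\<^sub>t (v \<otimes>\<^sub>t w)) \<otimes>\<^sub>t g)))"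
    if u: "homog a u" and v: "homog b v" and w: "homog c w" for a b c u v w g
  proof -
    define U where "U = (\<lambda>n::int. shift_exp (of_int n))"
    define f where "f = (\<lambda>c d. exp_series (koszul c d) (of_int (c * d)))"
    have U: "homog n x \<Longrightarrow> homog n (U m x)" for n m x unfolding U_def by (rule shift_exp_homog)
    have UU: "U m (U n x) = U (m + n) x" for m n x by (simp add: U_def shift_exp_add)
    have br: "homog d x \<Longrightarrow> homog e y \<Longrightarrow> braiding (x \<otimes>\<^sub>t y) = (U e x \<otimes>\<^sub>t U (- d) y) \<otimes>\<^sub>t f e d" for d e x y
      using braiding_homog[of d x e y] by (simp add: U_def f_def)
    have A': "?A ((x \<otimes>\<^sub>t (y \<otimes>\<^sub>t z)) \<otimes>\<^sub>t g) = (U b x \<otimes>\<^sub>t (U (- a) y \<otimes>\<^sub>t z)) \<otimes>\<^sub>t (fls_in_x (f b a) * g)"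
      if "homog a x" "homog b y" for x y z g
      by (rule A(2)[OF op12(2)[OF clinear_braiding br[OF that]]])
    have B': "?B ((x \<otimes>\<^sub>t (y \<otimes>\<^sub>t z)) \<otimes>\<^sub>t g) = (U c x \<otimes>\<^sub>t (y \<otimes>\<^sub>t U (- a) z)) \<otimes>\<^sub>t (fls_in_x_plus_z (f c a) * g)"
      if "homog a x" "homog c z" for x y z g
      by (rule B(2)[OF op13(2)[OF clinear_braiding br[OF that]]])
    have C': "?C ((x \<otimes>\<^sub>t (y \<otimes>\<^sub>t z)) \<otimes>\<^sub>t g) = (x \<otimes>\<^sub>t (U c y \<otimes>\<^sub>t U (- b) z)) \<otimes>\<^sub>t (fls_in_z (f c b) * g)"
      if "homog b y" "homog c z" for x y z g
      by (rule C(2)[OF op23(2)[OF clinear_braiding br[OF that]]])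
    show ?thesis
      by (simp add: A' B' C' u v w U UU mult_ac add_ac)
  qed
  have "?A (?B (?C t)) = ?C (?B (?A t))"
  proof (rule tensor_linear_eq[OF lin])
    fix r g
    note l = clinear_comp[OF lin(1)] clinear_comp[OF lin(2)]
    show "?A (?B (?C (r \<otimes>\<^sub>t g))) = ?C (?B (?A (r \<otimes>\<^sub>t g)))"
    proof (rule tensor_linear_eq[of "\<lambda>r. ?A (?B (?C (r \<otimes>\<^sub>t g)))" "\<lambda>r. ?C (?B (?A (r \<otimes>\<^sub>t g)))"])
      fix u vw
      show "?A (?B (?C ((u \<otimes>\<^sub>t vw) \<otimes>\<^sub>t g))) = ?C (?B (?A ((u \<otimes>\<^sub>t vw) \<otimes>\<^sub>t g)))"
      proof (rule tensor_linear_eq[of "\<lambda>vw. ?A (?B (?C ((u \<otimes>\<^sub>t vw) \<otimes>\<^sub>t g)))" "\<lambda>vw. ?C (?B (?A ((u \<otimes>\<^sub>t vw) \<otimes>\<^sub>t g)))"])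
        fix v w
        show "?A (?B (?C ((u \<otimes>\<^sub>t (v \<otimes>\<^sub>t w)) \<otimes>\<^sub>t g))) = ?C (?B (?A ((u \<otimes>\<^sub>t (v \<otimes>\<^sub>t w)) \<otimes>\<^sub>t g)))"
        proof (rule linear_eq_on_homog[of "\<lambda>u. ?A (?B (?C ((u \<otimes>\<^sub>t (v \<otimes>\<^sub>t w)) \<otimes>\<^sub>t g)))"
              "\<lambda>u. ?C (?B (?A ((u \<otimes>\<^sub>t (v \<otimes>\<^sub>t w)) \<otimes>\<^sub>t g)))"])
          fix a u assume u: "homog a u"
          show "?A (?B (?C ((u \<otimes>\<^sub>t (v \<otimes>\<^sub>t w)) \<otimes>\<^sub>t g))) = ?C (?B (?A ((u \<otimes>\<^sub>t (v \<otimes>\<^sub>t w)) \<otimes>\<^sub>t g)))"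
          proof (rule linear_eq_on_homog[of "\<lambda>v. ?A (?B (?C ((u \<otimes>\<^sub>t (v \<otimes>\<^sub>t w)) \<otimes>\<^sub>t g)))"
                "\<lambda>v. ?C (?B (?A ((u \<otimes>\<^sub>t (v \<otimes>\<^sub>t w)) \<otimes>\<^sub>t g)))"])
            fix b v assume v: "homog b v"
            show "?A (?B (?C ((u \<otimes>\<^sub>t (v \<otimes>\<^sub>t w)) \<otimes>\<^sub>t g))) = ?C (?B (?A ((u \<otimes>\<^sub>t (v \<otimes>\<^sub>t w)) \<otimes>\<^sub>t g)))"
              by (rule linear_eq_on_homog[of "\<lambda>w. ?A (?B (?C ((u \<otimes>\<^sub>t (v \<otimes>\<^sub>t w)) \<otimes>\<^sub>t g)))"
                    "\<lambda>w. ?C (?B (?A ((u \<otimes>\<^sub>t (v \<otimes>\<^sub>t w)) \<otimes>\<^sub>t g)))"])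
                (intro l clinear_tensor_comp clinear_tensor, intro l clinear_tensor_comp clinear_tensor, rule hom[OF u v])
          qed (intro l clinear_tensor_comp clinear_tensor)+
        qed (intro l clinear_tensor_comp clinear_tensor clinear_ident)+
      qed (intro l clinear_tensor_comp clinear_tensor clinear_ident)+
    qed (intro l clinear_tensor_comp clinear_tensor clinear_ident)+
  qed
  then show "(?A \<circ> ?B \<circ> ?C) t = (?C \<circ> ?B \<circ> ?A) t" by simp
qed

text \<open>The shifts in the two slots are opposite, the exponentials are inverse after x is
  replaced by -x, and the Koszul sign squares to one.\<close>

lemma braiding_unitary: "unitary_op braiding"
  unfolding unitary_op_def
proof
  fix t
  note A = series_op[OF clinear_braiding clinear_ident fls_scaleC_mult]
  note B = series_op[OF op21(1)[OF clinear_braiding] clinear_fls_maps(4) fls_scaleC_mult]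
  let ?A = "series_op (\<lambda>f. f) braiding" and ?B = "series_op fls_reflect (op21 braiding)"
  have lin: "clinear (\<lambda>t. ?A (?B t))" by (rule clinear_comp[OF A(1) B(1)])
  note l = clinear_comp[OF lin]
  have hom: "?A (?B ((v \<otimes>\<^sub>t u) \<otimes>\<^sub>t g)) = (v \<otimes>\<^sub>t u) \<otimes>\<^sub>t g" if v: "homog d v" and u: "homog c u" for c d u v g
  proof -
    have "?B ((v \<otimes>\<^sub>t u) \<otimes>\<^sub>t g) = (shift_exp (- of_int c) v \<otimes>\<^sub>t shift_exp (of_int d) u) \<otimes>\<^sub>t
        (fls_reflect (exp_series (koszul d c) (of_int (d * c))) * g)"
      by (rule B(2)[OF op21(2)[OF clinear_braiding braiding_homog[OF u v]]])
    moreover have "?A ((shift_exp (- of_int c) v \<otimes>\<^sub>t shift_exp (of_int d) u) \<otimes>\<^sub>t h) =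
        (v \<otimes>\<^sub>t u) \<otimes>\<^sub>t (exp_series (koszul c d) (of_int (c * d)) * h)" for h
      using A(2)[OF braiding_homog[OF shift_exp_homog[OF v, of "- of_int c"] shift_exp_homog[OF u, of "of_int d"]], of h]
      by (simp add: shift_exp_add)
    moreover have "exp_series (koszul c d) (of_int (c * d)) * exp_series (koszul d c) (- of_int (d * c)) = 1"
      using exp_series_cancel[of "koszul c d" "of_int (c * d)"] by (simp add: koszul_commute[of d] mult.commute)
    ultimately show ?thesis by (simp only: exp_series_reflect mult.assoc[symmetric] mult_1_left)
  qed
  have "?A (?B t) = t"
  proof (rule tensor_linear_eq[OF lin clinear_ident])
    fix r g
    show "?A (?B (r \<otimes>\<^sub>t g)) = r \<otimes>\<^sub>t g"
    proof (rule tensor_linear_eq[of "\<lambda>r. ?A (?B (r \<otimes>\<^sub>t g))" "\<lambda>r. r \<otimes>\<^sub>t g"])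
      fix v u
      show "?A (?B ((v \<otimes>\<^sub>t u) \<otimes>\<^sub>t g)) = (v \<otimes>\<^sub>t u) \<otimes>\<^sub>t g"
      proof (rule linear_eq_on_homog[of "\<lambda>v. ?A (?B ((v \<otimes>\<^sub>t u) \<otimes>\<^sub>t g))" "\<lambda>v. (v \<otimes>\<^sub>t u) \<otimes>\<^sub>t g"])
        fix d v assume v: "homog d v"
        show "?A (?B ((v \<otimes>\<^sub>t u) \<otimes>\<^sub>t g)) = (v \<otimes>\<^sub>t u) \<otimes>\<^sub>t g"
          by (rule linear_eq_on_homog[of "\<lambda>u. ?A (?B ((v \<otimes>\<^sub>t u) \<otimes>\<^sub>t g))" "\<lambda>u. (v \<otimes>\<^sub>t u) \<otimes>\<^sub>t g"])
            (intro l clinear_tensor_comp clinear_tensor, intro clinear_tensor_comp clinear_tensor, rule hom[OF v])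
      qed (intro l clinear_tensor_comp clinear_tensor clinear_ident, intro clinear_tensor_comp clinear_tensor clinear_ident)
    qed (intro l clinear_tensor, intro clinear_tensor)
  qed
  then show "(?A \<circ> ?B) t = id t" by simp
qed

theorem vmode_quantum_vertex_algebra: "quantum_vertex_algebra vmode vac braiding"
proof (intro quantum_vertex_algebra.intro vmode_weak_quantum_vertex_algebra quantum_vertex_algebra_axioms.intro
    braiding_Yang_Baxter braiding_unitary)
  show "\<exists>vufs. braiding (v \<otimes>\<^sub>t u) = (\<Sum>(v', u', f)\<leftarrow>vufs. (v' \<otimes>\<^sub>t u') \<otimes>\<^sub>t f) \<and> S_jacobi_identity vmode u v vufs" for u v
    using braiding_braid_list vmode_S_jacobi by blast
qed

end

section \<open>Irreducibility\<close>

context fermion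
begin

fun create :: "(gen \<times> nat) list \<Rightarrow> 'v" where
  "create [] = vac"
| "create ((g, n) # ls) = psi g (int n) (create ls)"

text \<open>The strict inequality makes level 0 the zero space, so a nonzero vector sits at a
  positive level and lowering the level never gets stuck at subtraction from zero.\<close>

definition filt :: "nat \<Rightarrow> 'v set"
  where "filt m = complex_vector.span {create ls | ls. length ls < m}"

lemma filt_base: "length ls < m \<Longrightarrow> create ls \<in> filt m"
  unfolding filt_def by (rule complex_vector.span_base) blast

lemma filt_mono: "m \<le> m' \<Longrightarrow> filt m \<subseteq> filt m'"
  unfolding filt_def by (rule complex_vector.span_mono) auto

lemma filt_subspace: "complex_vector.subspace (filt m)"
  unfolding filt_def by (rule complex_vector.subspace_span)

lemmas filt_add = complex_vector.subspace_add[OF filt_subspace]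
lemmas filt_scale = complex_vector.subspace_scale[OF filt_subspace]
lemmas filt_diff = complex_vector.subspace_diff[OF filt_subspace]
lemmas filt_zero = complex_vector.subspace_0[OF filt_subspace]
lemmas filt_sum = complex_vector.subspace_sum[OF filt_subspace]

lemma filt_linear:
  assumes "clinear f" "\<And>ls. length ls < m \<Longrightarrow> f (create ls) \<in> filt m'" "v \<in> filt m"
  shows "f v \<in> filt m'"
  using assms(3) unfolding filt_def[of m]
proof (induction rule: complex_vector.span_induct_alt)
  case base
  then show ?case using filt_zero by (simp add: clinear_zero[OF assms(1)])
next
  case (step c x y)
  then obtain ls where "x = create ls" "length ls < m" by blast
  then show ?case
    using step assms(2) by (simp add: clinear_add[OF assms(1)] clinear_scale[OF assms(1)] filt_add filt_scale)
qed

lemma filt_create: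
  assumes "v \<in> filt m"
  shows "psi g (int n) v \<in> filt (Suc m)"
proof (rule filt_linear[OF psi_linear _ assms])
  fix ls :: "(gen \<times> nat) list" assume "length ls < m"
  then show "psi g (int n) (create ls) \<in> filt (Suc m)"
    using filt_base[of "(g, n) # ls" "Suc m"] by simp
qed

text \<open>An annihilation operator anticommutes to the right until it removes its partner or
  reaches the vacuum and gives zero.\<close>

lemma annihilate_create: "p < 0 \<Longrightarrow> psi g p (create ls) \<in> filt (length ls)"
proof (induction ls)
  case Nil
  then show ?case by (simp add: psi_vac filt_zero)
next
  case (Cons l ls)
  obtain h n where l: "l = (h, n)" by (cases l)
  have "psi g p (create (l # ls)) = (if g \<noteq> h \<and> p + int n + 1 = 0 then create ls else 0) - psi h (int n) (psi g p (create ls))"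
    using anticomm[of g p h "int n" "create ls"] by (simp add: l eq_diff_eq)
  moreover have "psi h (int n) (psi g p (create ls)) \<in> filt (length (l # ls))"
    using filt_create[OF Cons.IH[OF Cons.prems]] by simp
  moreover have "(if g \<noteq> h \<and> p + int n + 1 = 0 then create ls else 0) \<in> filt (length (l # ls))"
    by (auto intro!: filt_zero filt_base)
  ultimately show ?case by (simp only: filt_diff)
qed

lemma filt_annihilate:
  assumes "p < 0" "v \<in> filt m"
  shows "psi g p v \<in> filt (m - 1)"
proof (rule filt_linear[OF psi_linear _ assms(2)])
  fix ls :: "(gen \<times> nat) list" assume "length ls < m"
  then have "filt (length ls) \<subseteq> filt (m - 1)" by (intro filt_mono) simp
  then show "psi g p (create ls) \<in> filt (m - 1)" using annihilate_create[OF assms(1)] by blast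
qed

lemma filt_exhaust: "\<exists>m. v \<in> filt m"
proof (induction v rule: gen_induct)
  show "\<exists>m. vac \<in> filt m" using filt_base[of "[]" 1] by auto
  show "\<exists>m. u + v \<in> filt m" if "\<exists>m. u \<in> filt m" "\<exists>m. v \<in> filt m" for u v
  proof -
    obtain m n where "u \<in> filt m" "v \<in> filt n" using \<open>\<exists>m. u \<in> filt m\<close> \<open>\<exists>m. v \<in> filt m\<close> by blast
    then have "u \<in> filt (max m n)" "v \<in> filt (max m n)"
      using filt_mono[of m "max m n"] filt_mono[of n "max m n"] by auto
    then show ?thesis using filt_add by blast
  qed
  show "\<exists>m. a *\<^sub>C u \<in> filt m" if "\<exists>m. u \<in> filt m" for a u using that filt_scale by blast
  show "\<exists>m. psi g p u \<in> filt m" if h: "\<exists>m. u \<in> filt m" for g p u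
  proof -
    obtain m where m: "u \<in> filt m" using h by blast
    show ?thesis
    proof (cases "p < 0")
      case True
      then show ?thesis using filt_annihilate[OF True m] by blast
    next
      case False
      then have "psi g (int (nat p)) u \<in> filt (Suc m)" by (intro filt_create m)
      then show ?thesis using False by auto
    qed
  qed
qed

lemma create_homog: "\<exists>c. homog c (create ls)"
proof (induction ls)
  case Nil
  then show ?case using vac_homog by auto
next
  case (Cons l ls)
  then obtain c where "homog c (create ls)" by blast
  from psi_homog[OF this, of "fst l" "int (snd l)"] show ?case by (cases l) auto
qed

lemma filt_P:
  assumes "v \<in> filt m"
  shows "P r v \<in> filt m"
proof (rule filt_linear[OF P_linear _ assms])
  fix ls :: "(gen \<times> nat) list" assume "length ls < m"
  moreover obtain c where "homog c (create ls)" using create_homog by blast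
  ultimately show "P r (create ls) \<in> filt m"
    using P_homog[of c "create ls" r] filt_base filt_zero by simp
qed

lemma number_op_create: "number_op (create ls) = of_nat (length ls) *\<^sub>C create ls"
proof (induction ls)
  case (Cons l ls)
  then show ?case
    by (cases l) (simp add: number_op_psi clinear_scale[OF psi_linear] complex_vector.scale_left_distrib add.commute)
qed (simp add: vac_ops)

fun number_poly :: "nat \<Rightarrow> 'v \<Rightarrow> 'v" where
  "number_poly 0 v = v"
| "number_poly (Suc m) v = number_op (number_poly m v) - of_nat (Suc m) *\<^sub>C number_poly m v"

lemma clinear_number_poly: "clinear (number_poly m)"
proof (induction m)
  case 0
  then show ?case using clinear_ident by (simp add: number_poly.simps(1)[abs_def])
next
  case (Suc m)
  then show ?case
    unfolding number_poly.simps(2)[abs_def]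
    by (intro clinear_minus clinear_scaleC clinear_comp[OF clinear_number_op])
qed

lemma number_poly_eigen:
  assumes "number_op v = c *\<^sub>C v"
  shows "number_poly m v = (\<Prod>j<m. c - of_nat (Suc j)) *\<^sub>C v"
proof (induction m)
  case (Suc m)
  then show ?case
    by (simp add: clinear_scale[OF clinear_number_op] assms complex_vector.scale_left_diff_distrib algebra_simps)
qed simp

text \<open>A vector killed by all annihilation operators is an eigenvector of the number operator with
  eigenvalue \<open>0\<close>, and the polynomial \<open>(N - 1) \<cdots> (N - m)\<close> projects to that eigenspace.\<close>

lemma annihilated_vac:
  assumes "\<And>g p. p < 0 \<Longrightarrow> psi g p w = 0"
  shows "\<exists>c. w = c *\<^sub>C vac"
proof -
  obtain m where "w \<in> filt m" using filt_exhaust by blast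
  then have m: "w \<in> filt (Suc m)" using filt_mono[of m "Suc m"] by auto
  \<comment> \<open>Every summand of the number operator has an annihilation operator on the
    right.\<close>
  have "number_op w = 0 *\<^sub>C w"
    by (simp add: number_op_def quad_def assms)
  then have 1: "number_poly m w = (\<Prod>j<m. 0 - of_nat (Suc j)) *\<^sub>C w" by (rule number_poly_eigen)
  have "\<exists>c. number_poly m v = c *\<^sub>C vac" if "v \<in> filt (Suc m)" for v
    using that unfolding filt_def
  proof (induction rule: complex_vector.span_induct_alt)
    case base
    then show ?case by (intro exI[of _ 0]) (simp add: clinear_zero[OF clinear_number_poly])
  next
    case (step c x y)
    then obtain ls where x: "x = create ls" "length ls < Suc m" by blast
    have "\<exists>c. number_poly m x = c *\<^sub>C vac"
    proof (cases ls)
      case Nil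
      then show ?thesis using number_poly_eigen[OF number_op_create[of ls], of m] x by auto
    next
      case (Cons l ls')
      then have "(\<Prod>j<m. of_nat (length ls) - of_nat (Suc j)) = (0 :: complex)"
        using x(2) by (intro prod_zero) (auto intro!: bexI[of _ "length ls'"])
      then show ?thesis
        using number_poly_eigen[OF number_op_create[of ls], of m] x by (intro exI[of _ 0]) simp
    qed
    then obtain d e where "number_poly m x = d *\<^sub>C vac" "number_poly m y = e *\<^sub>C vac" using step by blast
    then show ?case
      by (intro exI[of _ "c * d + e"])
        (simp add: clinear_add[OF clinear_number_poly] clinear_scale[OF clinear_number_poly]
          complex_vector.scale_left_distrib)
  qed
  with m obtain c where "(\<Prod>j<m. 0 - of_nat (Suc j) :: complex) *\<^sub>C w = c *\<^sub>C vac" using 1 by metis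
  moreover have "(\<Prod>j<m. 0 - of_nat (Suc j) :: complex) \<noteq> 0"
    by (simp add: prod_zero_iff del: of_nat_Suc)
  from left_inverse[OF this]
  have "w = inverse (\<Prod>j<m. 0 - of_nat (Suc j)) *\<^sub>C (\<Prod>j<m. 0 - of_nat (Suc j)) *\<^sub>C w"
    by (simp only: complex_vector.scale_scale) simp
  ultimately have "w = inverse (\<Prod>j<m. 0 - of_nat (Suc j)) *\<^sub>C c *\<^sub>C vac" by (simp only:)
  then show ?thesis by (auto simp only: complex_vector.scale_scale)
qed

lemma P_vop_generator: "P d (vop (psi g 0 vac) p w) = vop (psi g 0 vac) p (P (d - charge g) w)"
proof (rule linear_eq_on_homog[of "\<lambda>w. P d (vop (psi g 0 vac) p w)" "\<lambda>w. vop (psi g 0 vac) p (P (d - charge g) w)"])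
  fix c w assume w: "homog c w"
  have "homog (charge g) (psi g 0 vac)" using psi_homog[OF vac_homog, of g 0] by simp
  from P_homog[OF homog_vop[OF this w]] P_homog[OF w, of "d - charge g"]
  show "P d (vop (psi g 0 vac) p w) = vop (psi g 0 vac) p (P (d - charge g) w)"
    by (auto simp: clinear_zero[OF clinear_vop])
qed (intro clinear_comp[OF P_linear clinear_vop] clinear_comp[OF clinear_vop P_linear])+

text \<open>Inverts the twist. Only indices p - i with i \<ge> 0 occur, so fermionic annihilation
  operators are combinations of annihilation modes of the vertex operators.\<close>

lemma psi_vop_generator:
  assumes "homog r w"
  shows "psi g p w = act (fps_exp (- twist (charge g) r)) (\<lambda>p. vop (psi g 0 vac) p w) p"
  unfolding vop_generator[OF assms] by (simp add: act_mult[OF psi_trunc] flip: fps_exp_add_mult)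

text \<open>The exponential only mixes in lower indices, which annihilate as well.\<close>

lemma filt_vop_annihilate:
  assumes "p < 0" "w \<in> filt m"
  shows "vop (psi g 0 vac) p w \<in> filt (m - 1)"
proof -
  have "vop (psi g 0 vac) p (P r w) \<in> filt (m - 1)" for r
    unfolding vop_generator[OF homog_P] act_def Sum_any.expand_set
    by (intro filt_sum filt_scale filt_annihilate filt_P assms) (use assms(1) in simp)
  then show ?thesis
    by (subst clinear_components[OF clinear_vop]) (rule filt_sum)
qed

theorem vmode_irreducible:
  assumes "vac \<noteq> 0"
  shows "irreducible_over_itself vmode"
  unfolding irreducible_over_itself_def
proof (intro conjI allI impI)
  show "(UNIV :: 'v set) \<noteq> {0}" using assms by auto
  fix W assume W: "complex_vector.subspace W \<and> (\<forall>v n. \<forall>w\<in>W. vmode v n w \<in> W)"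
  then have sub: "complex_vector.subspace W" by blast
  have st: "vop v p w \<in> W" if "w \<in> W" for v p w
  proof -
    have "vmode v (- p - 1) w \<in> W" using W that by blast
    then show ?thesis by (simp only: vmode_power)
  qed
  show "W = {0} \<or> W = UNIV"
  proof (cases "W = {0}")
    case False
    then obtain w0 where "w0 \<in> W" "w0 \<noteq> 0" using complex_vector.subspace_0[OF sub] by auto
    moreover obtain m0 where "w0 \<in> filt m0" using filt_exhaust by blast
    ultimately have ex: "\<exists>m. \<exists>w\<in>W. w \<noteq> 0 \<and> w \<in> filt m" by blast
    \<comment> \<open>A nonzero vector of lowest level in W is killed by all annihilation modes,
      since these stay in W and lower the level.\<close>
    define m where "m = (LEAST m. \<exists>w\<in>W. w \<noteq> 0 \<and> w \<in> filt m)"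
    obtain w where w: "w \<in> W" "w \<noteq> 0" "w \<in> filt m"
      using LeastI_ex[OF ex] unfolding m_def[symmetric] by blast
    have "filt 0 = {0}" by (simp add: filt_def)
    then have "m \<noteq> 0" using w by (metis singletonD)
    have zero: "vop (psi g 0 vac) p w = 0" if p: "p < 0" for g p
    proof (rule ccontr)
      assume "vop (psi g 0 vac) p w \<noteq> 0"
      with st[OF w(1)] filt_vop_annihilate[OF p w(3)]
      have "\<exists>w\<in>W. w \<noteq> 0 \<and> w \<in> filt (m - 1)" by blast
      then have "m \<le> m - 1" unfolding m_def by (rule Least_le)
      then show False using \<open>m \<noteq> 0\<close> by simp
    qed
    \<comment> \<open>W need not be graded, so its vector w may mix charges and the untwisting
      formula does not apply to it directly. The annihilation conditions do pass to each charge
      component.\<close>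
    have "\<exists>c. P r w = c *\<^sub>C vac" for r
    proof (rule annihilated_vac)
      fix g p assume p: "p < (0 :: int)"
      have "vop (psi g 0 vac) (p - int i) (P r w) = 0" for i
        using P_vop_generator[of "r + charge g" g "p - int i" w] zero[of "p - int i" g] p by simp
      then show "psi g p (P r w) = 0"
        unfolding psi_vop_generator[OF homog_P] act_def by simp
    qed
    then have "\<exists>k. \<forall>r. P r w = k r *\<^sub>C vac" by (intro choice allI)
    then obtain k where k: "\<And>r. P r w = k r *\<^sub>C vac" by blast
    have "w = (\<Sum>r | P r w \<noteq> 0. P r w)" by (rule sum_P)
    also have "\<dots> = (\<Sum>r | P r w \<noteq> 0. k r *\<^sub>C vac)" by (rule sum.cong[OF refl]) (rule k)
    also have "\<dots> = (\<Sum>r | P r w \<noteq> 0. k r) *\<^sub>C vac" by (rule complex_vector.scale_sum_left[symmetric])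
    finally obtain c where c: "w = c *\<^sub>C vac" by (rule that)
    with w(2) have "c \<noteq> 0" by force
    then have "inverse c *\<^sub>C w = vac" unfolding c by simp
    then have "vac \<in> W" using complex_vector.subspace_scale[OF sub w(1), of "inverse c"] by simp
    \<comment> \<open>The creation property: v is obtained from the vacuum by its own mode of index
      -1.\<close>
    then have "v \<in> W" for v
      using st[of vac v 0] by (simp add: vop_creation)
    then show ?thesis by blast
  qed simp
qed

end

section \<open>The defining relations\<close>

text \<open>The defining relations in terms of generating functions; the relations of \<open>V\<^sub>A\<close> are the case
  \<open>s = 1\<close>, the anticommutation relations of free fermions are the case \<open>s = 0\<close>.\<close>

definition gen_relation :: "complex \<Rightarrow> (gen \<Rightarrow> int \<Rightarrow> 'v::complex_vector \<Rightarrow> 'v) \<Rightarrow> gen \<Rightarrow> gen \<Rightarrow> bool"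
  where "gen_relation s A g h \<longleftrightarrow> (\<forall>p q v. A g p (A h q v) +
    act2 (fps_exp (- s * of_int (charge g * charge h))) (fps_exp (s * of_int (charge g * charge h)))
      (\<lambda>p q. A h q (A g p v)) p q = (if g \<noteq> h \<and> p + q + 1 = 0 then v else 0))"

lemma bounded_below2_prod:
  assumes "is_field A" "is_field B"
  shows "bounded_below2 (\<lambda>p q. A p (B q v))"
  by (rule act2_act(2)[OF is_fieldD(2)[OF assms(1)]])
    (use snd_trunc_prod[OF assms, of v] in \<open>auto simp: snd_trunc_def\<close>)

lemma bounded_below2_prod_swapped:
  assumes "is_field A" "is_field B"
  shows "bounded_below2 (\<lambda>p q. B q (A p v))"
  using bounded_below2_prod[OF assms(2,1), of v] bounded_below2_swap[of "\<lambda>p q. B q (A p v)"] by simp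

text \<open>The delta function is supported on x_1 = x_2, where exp(x(x_1 - x_2)) is 1; in
  coefficients, the product of the two exponentials is 1.\<close>

lemma act2_delta:
  "bounded_below2 (\<lambda>p q. if p + q + 1 = 0 then v else 0)"
  "act2 (fps_exp x) (fps_exp (- x)) (\<lambda>p q. if p + q + 1 = 0 then v else 0) p q = (if p + q + 1 = 0 then v else 0)"
proof -
  show "bounded_below2 (\<lambda>p q. if p + q + 1 = 0 then v else 0)"
    unfolding bounded_below2_def
  proof (intro allI)
    fix p q :: int
    show "\<exists>M. \<forall>i j::nat. (if p - int i + (q - int j) + 1 = 0 then v else 0) \<noteq> 0 \<longrightarrow> i \<le> M \<and> j \<le> M"
      by (rule exI[of _ "nat (p + q + 1)"]) auto
  qed
  define M where "M = nat (p + q + 1)"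
  define h where "h a = (if int a = p + q + 1 then v else 0)" for a
  have "act2 (fps_exp x) (fps_exp (- x)) (\<lambda>p q. if p + q + 1 = 0 then v else 0) p q =
      (\<Sum>i\<le>M. \<Sum>j\<le>M. (fps_nth (fps_exp x) i * fps_nth (fps_exp (- x)) j) *\<^sub>C
        (if p - int i + (q - int j) + 1 = 0 then v else 0))"
    by (rule act2_eq_sum) (auto simp: M_def)
  also have "\<dots> = (\<Sum>i\<le>M. \<Sum>j\<le>M. (fps_nth (fps_exp x) i * fps_nth (fps_exp (- x)) j) *\<^sub>C h (i + j))"
    by (intro sum.cong refl arg_cong[of _ _ "scaleC _"]) (auto simp: h_def)
  also have "\<dots> = (\<Sum>a\<le>M. fps_nth (fps_exp x * fps_exp (- x)) a *\<^sub>C h a)"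
    by (subst convolution_sum) (auto simp: h_def M_def fps_mult_nth atLeast0AtMost)
  also have "\<dots> = (\<Sum>a\<le>M. (if a = 0 then h 0 else 0))"
    by (rule sum.cong) (simp_all flip: fps_exp_add_mult)
  also have "\<dots> = (if p + q + 1 = 0 then v else 0)"
    by (auto simp: h_def)
  finally show "act2 (fps_exp x) (fps_exp (- x)) (\<lambda>p q. if p + q + 1 = 0 then v else 0) p q =
    (if p + q + 1 = 0 then v else 0)" .
qed

text \<open>Multiplying by the inverse exponential exchanges the roles of the two products and
  leaves the delta function unchanged.\<close>

lemma gen_relation_sym:
  assumes A: "\<And>g. is_field (A g)" and rel: "gen_relation s A g h"
  shows "gen_relation s A h g"
  unfolding gen_relation_def
proof (intro allI)
  fix p q v
  define l where "l = s * of_int (charge g * charge h)"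
  let ?G = "\<lambda>p q. A g p (A h q v)" and ?H = "\<lambda>p q. A h q (A g p v)"
  note G = bounded_below2_prod[OF A A, of g h v] and H = bounded_below2_prod_swapped[OF A A, of h g v]
  have r: "(\<lambda>p q. ?G p q + act2 (fps_exp (- l)) (fps_exp l) ?H p q) =
      (\<lambda>p q. if g \<noteq> h \<and> p + q + 1 = 0 then v else 0)"
    using rel by (simp add: gen_relation_def l_def fun_eq_iff)
  have "act2 (fps_exp l) (fps_exp (- l)) (\<lambda>p q. ?G p q + act2 (fps_exp (- l)) (fps_exp l) ?H p q) q p =
      act2 (fps_exp l) (fps_exp (- l)) ?G q p + ?H q p"
    by (subst act2_add[OF G bounded_below2_act2[OF H]]) (simp add: act2_mult[OF H] flip: fps_exp_add_mult)
  moreover have "act2 (fps_exp l) (fps_exp (- l)) (\<lambda>p q. if g \<noteq> h \<and> p + q + 1 = 0 then v else 0) q p =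
      (if g \<noteq> h \<and> q + p + 1 = 0 then v else 0)"
  proof (cases "g = h")
    case True
    then show ?thesis by (simp add: act2_def case_prod_beta)
  next
    case False
    then show ?thesis using act2_delta(2)[of l v q p] by simp
  qed
  moreover have "act2 (fps_exp l) (fps_exp (- l)) ?G q p = act2 (fps_exp (- l)) (fps_exp l) (\<lambda>p q. ?G q p) p q"
    by (rule act2_swap)
  ultimately show "A h p (A g q v) + act2 (fps_exp (- s * of_int (charge h * charge g)))
      (fps_exp (s * of_int (charge h * charge g))) (\<lambda>p q. A g q (A h p v)) p q =
      (if h \<noteq> g \<and> p + q + 1 = 0 then v else 0)"
    unfolding r by (simp add: l_def algebra_simps eq_commute[of g h])
qed

lemma exp_coeff_sum: "exp_coeff (a + b) a = (- 1) ^ a / fact a * (1 / fact b)"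
  unfolding exp_coeff_def by (simp add: binomial_fact)

text \<open>Since the coefficient vanishes for i > k, the substitution k = a + b, i = a is
  exhaustive and splits it into the coefficients of two exponentials. Both orders of the pair are
  recorded because the minus sign falls on different variables in the two kinds of relation.\<close>

lemma Sum_any_exp_coeff:
  fixes F :: "int \<Rightarrow> int \<Rightarrow> 'v::complex_vector"
  shows "Sum_any (\<lambda>(k, i). exp_coeff k i *\<^sub>C F (int k - int i) (int i)) =
    Sum_any (\<lambda>(a::nat, b::nat). ((- 1) ^ a / fact a * (1 / fact b)) *\<^sub>C F (int b) (int a))"
    and "Sum_any (\<lambda>(k, i). exp_coeff k i *\<^sub>C F (int k - int i) (int i)) =
    Sum_any (\<lambda>(b::nat, a::nat). (1 / fact b * ((- 1) ^ a / fact a)) *\<^sub>C F (int b) (int a))"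
proof -
  let ?t = "\<lambda>(k, i). exp_coeff k i *\<^sub>C F (int k - int i) (int i)"
  have zero: "?t x = 0" if "\<And>a b. x \<noteq> (a + b, a)" for x
  proof -
    obtain k i where x: "x = (k, i)" by (cases x)
    have "\<not> i \<le> k" using that[of i "k - i"] x by auto
    then show ?thesis by (simp add: x exp_coeff_def)
  qed
  have "Sum_any ?t = Sum_any (\<lambda>x. ?t ((\<lambda>(a, b). (a + b, a)) x))"
  proof (rule Sum_any_reindex_inj)
    fix x :: "nat \<times> nat" assume x: "x \<notin> range (\<lambda>(a, b). (a + b, a))"
    have "(a + b, a) \<in> range (\<lambda>(a, b). (a + b, a))" for a b by (rule range_eqI[of _ _ "(a, b)"]) simp
    then show "?t x = 0" using x by (intro zero) blast
  qed (auto intro!: injI)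
  also have "\<dots> = Sum_any (\<lambda>(a::nat, b::nat). ((- 1) ^ a / fact a * (1 / fact b)) *\<^sub>C F (int b) (int a))"
    by (rule Sum_any.cong) (simp add: case_prod_beta exp_coeff_sum)
  finally show "Sum_any ?t = Sum_any (\<lambda>(a::nat, b::nat). ((- 1) ^ a / fact a * (1 / fact b)) *\<^sub>C F (int b) (int a))" .
  have "Sum_any ?t = Sum_any (\<lambda>x. ?t ((\<lambda>(b, a). (a + b, a)) x))"
  proof (rule Sum_any_reindex_inj)
    fix x :: "nat \<times> nat" assume x: "x \<notin> range (\<lambda>(b, a). (a + b, a))"
    have "(a + b, a) \<in> range (\<lambda>(b, a). (a + b, a))" for a b by (rule range_eqI[of _ _ "(b, a)"]) simp
    then show "?t x = 0" using x by (intro zero) blast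
  qed (auto intro!: injI)
  also have "\<dots> = Sum_any (\<lambda>(b::nat, a::nat). (1 / fact b * ((- 1) ^ a / fact a)) *\<^sub>C F (int b) (int a))"
    by (rule Sum_any.cong) (simp add: case_prod_beta exp_coeff_sum mult.commute)
  finally show "Sum_any ?t = Sum_any (\<lambda>(b::nat, a::nat). (1 / fact b * ((- 1) ^ a / fact a)) *\<^sub>C F (int b) (int a))" .
qed

lemma exp_coeff_act2:
  "Sum_any (\<lambda>(k, i). exp_coeff k i *\<^sub>C B (q - (int k - int i)) (A (p - int i) v)) =
    act2 (fps_exp (- 1)) (fps_exp 1) (\<lambda>p q. B q (A p v)) p q"
  "Sum_any (\<lambda>(k, i). exp_coeff k i *\<^sub>C B (q - int i) (A (p - (int k - int i)) v)) =
    act2 (fps_exp 1) (fps_exp (- 1)) (\<lambda>p q. B q (A p v)) p q"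
  using Sum_any_exp_coeff(1)[of "\<lambda>j i. B (q - j) (A (p - i) v)"]
    Sum_any_exp_coeff(2)[of "\<lambda>j i. B (q - i) (A (p - j) v)"]
  by (simp_all add: act2_def)

lemma gen_relation_same:
  "gen_relation 1 A g g \<longleftrightarrow> (\<forall>m n v. A g (- m - 1) (A g (- n - 1) v) +
    Sum_any (\<lambda>(k, i). exp_coeff k i *\<^sub>C A g (- (n + int k - int i) - 1) (A g (- (m + int i) - 1) v)) = 0)"
proof -
  have "(\<lambda>(k, i). exp_coeff k i *\<^sub>C A g (- (n + int k - int i) - 1) (A g (- (m + int i) - 1) v)) =
    (\<lambda>(k, i). exp_coeff k i *\<^sub>C A g ((- n - 1) - (int k - int i)) (A g ((- m - 1) - int i) v))" for m n v
    by (simp add: fun_eq_iff algebra_simps)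
  moreover have "charge g * charge g = 1" by (cases g) (simp_all add: charge_def)
  moreover have "(\<forall>m n v. X (- m - 1) (- n - 1) v) \<longleftrightarrow> (\<forall>p q v. X p q v)" for X :: "int \<Rightarrow> int \<Rightarrow> 'a \<Rightarrow> bool"
    by (metis add.inverse_inverse diff_add_cancel minus_diff_eq uminus_add_conv_diff)
  ultimately show ?thesis
    unfolding gen_relation_def
    using \<open>\<And>X. (\<forall>m n v. X (- m - 1) (- n - 1) v) \<longleftrightarrow> (\<forall>p q v. X p q v)\<close>[of "\<lambda>p q v. A g p (A g q v) +
      act2 (fps_exp (- 1)) (fps_exp 1) (\<lambda>p q. A g q (A g p v)) p q = 0"]
    by (simp add: exp_coeff_act2)
qed

lemma gen_relation_mixed:
  "gen_relation 1 A Y_gen Ystar_gen \<longleftrightarrow> (\<forall>m n v. A Y_gen (- m - 1) (A Ystar_gen (- n - 1) v) +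
    Sum_any (\<lambda>(k, i). exp_coeff k i *\<^sub>C A Ystar_gen (- (n + int i) - 1) (A Y_gen (- (m + int k - int i) - 1) v)) =
    (if m + n + 1 = 0 then v else 0))"
proof -
  have "(\<lambda>(k, i). exp_coeff k i *\<^sub>C A Ystar_gen (- (n + int i) - 1) (A Y_gen (- (m + int k - int i) - 1) v)) =
    (\<lambda>(k, i). exp_coeff k i *\<^sub>C A Ystar_gen ((- n - 1) - int i) (A Y_gen ((- m - 1) - (int k - int i)) v))" for m n v
    by (simp add: fun_eq_iff algebra_simps)
  moreover have "(\<forall>m n v. X (- m - 1) (- n - 1) v) \<longleftrightarrow> (\<forall>p q v. X p q v)" for X :: "int \<Rightarrow> int \<Rightarrow> 'a \<Rightarrow> bool"
    by (metis add.inverse_inverse diff_add_cancel minus_diff_eq uminus_add_conv_diff)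
  moreover have "(- m - 1) + (- n - 1) + 1 = 0 \<longleftrightarrow> m + n + 1 = (0 :: int)" for m n by linarith
  ultimately show ?thesis
    unfolding gen_relation_def
    using \<open>\<And>X. (\<forall>m n v. X (- m - 1) (- n - 1) v) \<longleftrightarrow> (\<forall>p q v. X p q v)\<close>[of "\<lambda>p q v. A Y_gen p (A Ystar_gen q v) +
      act2 (fps_exp 1) (fps_exp (- 1)) (\<lambda>p q. A Ystar_gen q (A Y_gen p v)) p q = (if p + q + 1 = 0 then v else 0)"]
    by (simp add: exp_coeff_act2 charge_def)
qed

context graded
begin

text \<open>Used with t = -1 to make fermions out of the generators of V_A, and with t = 1 to make
  generators out of the fermions of the Fock space.\<close>

definition twisted :: "complex \<Rightarrow> (gen \<Rightarrow> int \<Rightarrow> 'v \<Rightarrow> 'v) \<Rightarrow> gen \<Rightarrow> int \<Rightarrow> 'v \<Rightarrow> 'v"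
  where "twisted t A g p w =
    on_components (\<lambda>r w. act (fps_exp (t * twist (charge g) r)) (\<lambda>p. A g p w) p) w"

context
  fixes A :: "gen \<Rightarrow> int \<Rightarrow> 'v \<Rightarrow> 'v"
  assumes field: "is_field (A g)"
    and shift: "homog c v \<Longrightarrow> homog (c + charge g) (A g p v)"
begin

lemma twisted_homog:
  assumes "homog r w"
  shows "twisted t A g p w = act (fps_exp (t * twist (charge g) r)) (\<lambda>p. A g p w) p"
  unfolding twisted_def by (rule on_components_homog[OF assms])
    (simp add: clinear_zero[OF is_fieldD(1)[OF field]] act_def)

lemma is_field_twisted: "is_field (twisted t A g)"
  unfolding is_field_def twisted_def[abs_def]
  by (intro conjI allI clinear_on_components lower_trunc_on_components clinear_act lower_trunc_act
      is_fieldD[OF field])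

lemma twisted_shift: "homog c v \<Longrightarrow> homog (c + charge g) (twisted t A g p v)"
  by (simp add: twisted_homog homog_act shift)

text \<open>Each operator changes the charge seen by the other, so exchanging their order changes
  the exponents by t times the product of the charges; this adds to s. The delta function survives
  because for opposite generators the total charge is zero and the two exponents cancel by
  \<open>twist_left\<close>.\<close>

lemma gen_relation_twisted:
  assumes rel: "gen_relation s A g h"
  shows "gen_relation (s + t) (twisted t A) g h"
  unfolding gen_relation_def
proof (intro allI)
  fix p q v
  let ?B = "twisted t A"
  define l where "l = (of_int (charge g * charge h) :: complex)"
  note bB = bounded_below2_prod_swapped[OF is_field_twisted is_field_twisted]
  let ?L = "\<lambda>v. ?B g p (?B h q v) + act2 (fps_exp (- (s + t) * l)) (fps_exp ((s + t) * l)) (\<lambda>p q. ?B h q (?B g p v)) p q"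
  have "?L v = (if g \<noteq> h \<and> p + q + 1 = 0 then v else 0)"
  proof (rule linear_eq_on_homog[of ?L])
    note lin = is_fieldD(1)[OF is_field_twisted]
    show "clinear ?L"
      by (intro clinear_plus clinear_act2 clinear_comp[OF lin lin] bB)
    show "clinear (\<lambda>v. if g \<noteq> h \<and> p + q + 1 = 0 then v else 0)" by (rule clinearI) auto
    fix r v assume v: "homog r v"
    define x where "x = t * twist (charge g) (charge h + r)"
    define y where "y = t * twist (charge h) r"
    let ?G = "\<lambda>p q. A g p (A h q v)" and ?H = "\<lambda>p q. A h q (A g p v)"
    note G = bounded_below2_prod[OF field field, of g h v] and H = bounded_below2_prod_swapped[OF field field, of h g v]
    have st: "\<exists>N. \<forall>p. \<forall>q<N. A g p (A h q v) = 0" "\<exists>N. \<forall>q. \<forall>p<N. A h q (A g p v) = 0"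
      using snd_trunc_prod[OF field[of g] field[of h], of v] snd_trunc_prod[OF field[of h] field[of g], of v]
      by (auto simp: snd_trunc_def)
    have 1: "?B g p (?B h q v) = act2 (fps_exp x) (fps_exp y) ?G p q"
      unfolding twisted_homog[OF twisted_shift[OF v]] unfolding twisted_homog[OF v]
      by (simp add: x_def y_def act_clinear[OF is_fieldD[OF field]] add.commute act2_act(1)[OF is_fieldD(2)[OF field] st(1)])
    have 2: "?B h q (?B g p v) = act2 (fps_exp (x + t * l)) (fps_exp (y - t * l)) ?H p q" for p q
    proof -
      have e: "x + t * l = t * twist (charge g) r" "y - t * l = t * twist (charge h) (r + charge g)"
        by (simp_all add: x_def y_def l_def twist_right[of _ "charge h"] twist_def algebra_simps)
      have "?B h q (?B g p v) = act (fps_exp (y - t * l)) (\<lambda>q. act (fps_exp (x + t * l)) (\<lambda>p. ?H p q) p) q"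
        unfolding twisted_homog[OF twisted_shift[OF v]] unfolding twisted_homog[OF v]
        by (simp add: e act_clinear[OF is_fieldD[OF field]])
      also have "\<dots> = act2 (fps_exp (y - t * l)) (fps_exp (x + t * l)) (\<lambda>q p. ?H p q) q p"
        by (rule act2_act(1)[OF is_fieldD(2)[OF field] st(2)])
      also have "\<dots> = act2 (fps_exp (x + t * l)) (fps_exp (y - t * l)) ?H p q"
        by (rule act2_swap)
      finally show ?thesis .
    qed
    have "?L v = act2 (fps_exp x) (fps_exp y) ?G p q +
        act2 (fps_exp x * fps_exp (- s * l)) (fps_exp y * fps_exp (s * l)) ?H p q"
      unfolding 1 2 act2_mult[OF H] by (simp add: algebra_simps flip: fps_exp_add_mult)
    also have "\<dots> = act2 (fps_exp x) (fps_exp y) (\<lambda>p q. ?G p q + act2 (fps_exp (- s * l)) (fps_exp (s * l)) ?H p q) p q"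
      by (simp only: act2_add[OF G bounded_below2_act2[OF H]] act2_mult[OF H])
    also have "(\<lambda>p q. ?G p q + act2 (fps_exp (- s * l)) (fps_exp (s * l)) ?H p q) =
        (\<lambda>p q. if g \<noteq> h \<and> p + q + 1 = 0 then v else 0)"
      using rel unfolding gen_relation_def l_def[symmetric] by blast
    also have "act2 (fps_exp x) (fps_exp y) (\<lambda>p q. if g \<noteq> h \<and> p + q + 1 = 0 then v else 0) p q =
        (if g \<noteq> h \<and> p + q + 1 = 0 then v else 0)"
    proof (cases "g = h")
      case True
      then show ?thesis by (simp add: act2_def case_prod_beta)
    next
      case False
      then have "charge g + charge h = 0" by (cases g; cases h) (simp_all add: charge_def)
      then have "x + y = 0"
        using twist_left[of "charge g" "charge h" r] by (simp add: x_def y_def flip: distrib_left)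
      then have "y = - x" by (simp add: eq_neg_iff_add_eq_0 add.commute)
      then show ?thesis using False act2_delta(2)[of x v p q] by simp
    qed
    finally show "?L v = (if g \<noteq> h \<and> p + q + 1 = 0 then v else 0)" .
  qed
  then show "?B g p (?B h q v) + act2 (fps_exp (- (s + t) * of_int (charge g * charge h)))
      (fps_exp ((s + t) * of_int (charge g * charge h))) (\<lambda>p q. ?B h q (?B g p v)) p q =
      (if g \<noteq> h \<and> p + q + 1 = 0 then v else 0)" unfolding l_def .
qed

end

end

lemma gen_relation_all:
  assumes "\<And>g. is_field (A g)" "\<And>g. gen_relation s A g g" "gen_relation s A Y_gen Ystar_gen"
  shows "gen_relation s A g h"
  using assms(2,3) gen_relation_sym[OF assms(1,3)] by (cases g; cases h) simp_all

section \<open>Linear maps out of free vector spaces\<close>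

lemma clinear_zero_on_span:
  assumes "clinear f" "\<And>x. x \<in> S \<Longrightarrow> f x = 0" "x \<in> complex_vector.span S"
  shows "f x = 0"
  using assms(3)
  by (induction rule: complex_vector.span_induct_alt)
    (simp_all add: clinear_zero[OF assms(1)] clinear_add[OF assms(1)] clinear_scale[OF assms(1)] assms(2))

definition linear_extension :: "('a \<Rightarrow> 'v) \<Rightarrow> ('a \<Rightarrow>\<^sub>0 complex) \<Rightarrow> 'v::complex_vector"
  where "linear_extension f p = (\<Sum>k\<in>Poly_Mapping.keys p. Poly_Mapping.lookup p k *\<^sub>C f k)"

lemma linear_extension_superset:
  assumes "finite A" "Poly_Mapping.keys p \<subseteq> A"
  shows "linear_extension f p = (\<Sum>k\<in>A. Poly_Mapping.lookup p k *\<^sub>C f k)"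
  unfolding linear_extension_def by (rule sum.mono_neutral_left) (use assms in \<open>auto simp: in_keys_iff\<close>)

lemma clinear_linear_extension: "clinear (linear_extension f)"
proof (rule clinearI)
  fix p q :: "'a \<Rightarrow>\<^sub>0 complex" and c :: complex
  let ?A = "Poly_Mapping.keys p \<union> Poly_Mapping.keys q"
  have "Poly_Mapping.keys (p + q) \<subseteq> ?A" by (rule keys_add)
  then show "linear_extension f (p + q) = linear_extension f p + linear_extension f q"
    by (subst (1 2 3) linear_extension_superset[of ?A])
      (auto simp: lookup_add complex_vector.scale_left_distrib sum.distrib)
  have "Poly_Mapping.keys (c *\<^sub>C p) \<subseteq> Poly_Mapping.keys p"
    by (auto simp: in_keys_iff lookup_scaleC scaleC_complex_def)
  then show "linear_extension f (c *\<^sub>C p) = c *\<^sub>C linear_extension f p"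
    by (subst (1 2) linear_extension_superset[of "Poly_Mapping.keys p"])
      (auto simp: lookup_scaleC scaleC_complex_def complex_vector.scale_sum_right)
qed

lemma linear_extension_single [simp]: "linear_extension f (Poly_Mapping.single k 1) = f k"
  by (simp add: linear_extension_def)

lemma linear_eq_on_singles:
  assumes "clinear f" "clinear g" "\<And>k. f (Poly_Mapping.single k 1) = g (Poly_Mapping.single k 1)"
  shows "f (p :: 'a \<Rightarrow>\<^sub>0 complex) = g p"
  by (subst (1 2) poly_mapping_expand[of p])
    (simp only: clinear_sum[OF assms(1)] clinear_sum[OF assms(2)] clinear_scale[OF assms(1)]
      clinear_scale[OF assms(2)] assms(3))


section \<open>The action of \<open>T\<close>\<close>

definition word_action :: "(gen \<Rightarrow> int \<Rightarrow> 'v \<Rightarrow> 'v) \<Rightarrow> (gen \<times> int) list \<Rightarrow> 'v \<Rightarrow> 'v"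
  where "word_action A = foldr (\<lambda>(g, n). A g (- n - 1))"

lemma word_action_simps [simp]:
  "word_action A [] = (\<lambda>v. v)"
  "word_action A ((g, n) # ls) v = A g (- n - 1) (word_action A ls v)"
  by (simp_all add: word_action_def fun_eq_iff)

lemma word_action_append: "word_action A (ls @ ls') v = word_action A ls (word_action A ls' v)"
  by (simp add: word_action_def)

lemma word_action_zero: "(\<And>g p. A g p 0 = 0) \<Longrightarrow> word_action A ls 0 = 0"
  by (induction ls) auto

lemma single_Word_Cons: "Poly_Mapping.single (Word ((g, n) # ls)) 1 = letter g n * Poly_Mapping.single (Word ls) 1"
  by (simp add: letter_def mult_single plus_word_def)

lemma single_Word_Nil: "Poly_Mapping.single (Word []) 1 = (1 :: T)"
  by (simp flip: zero_word_def)

lemma clinear_T_mult: "clinear (\<lambda>p :: T. t * p)" "clinear (\<lambda>t :: T. t * p)"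
  by (rule clinearI; simp add: algebra_simps T_mult_scaleC_right T_mult_scaleC_left)+

lemma clinear_abs_VT: "clinear abs_VT"
  by (rule clinearI) (simp_all add: plus_VT.abs_eq scaleC_VT.abs_eq)

lemma abs_VT_surj: "\<exists>p. x = abs_VT p"
  by (metis Quotient3_abs_rep Quotient3_VT)

lemma abs_VA_surj: "\<exists>x. v = abs_VA x"
  by (metis Quotient3_abs_rep Quotient3_VA)

lemma clinear_abs_VA: "clinear abs_VA"
  by (rule clinearI) (simp_all add: plus_VA.abs_eq scaleC_VA.abs_eq)

lemma clinear_T_act_VT_left: "clinear (\<lambda>t. T_act_VT t v)"
proof (rule clinearI)
  show "T_act_VT (s + t) v = T_act_VT s v + T_act_VT t v" for s t
    by (induction v rule: VT.abs_induct) (simp add: T_act_VT.abs_eq plus_VT.abs_eq distrib_right)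
  show "T_act_VT (c *\<^sub>C t) v = c *\<^sub>C T_act_VT t v" for c t
    by (induction v rule: VT.abs_induct) (simp add: T_act_VT.abs_eq scaleC_VT.abs_eq T_mult_scaleC_left)
qed

lemma T_act_VT_one: "T_act_VT 1 v = v"
  by (induction v rule: VT.abs_induct) (simp add: T_act_VT.abs_eq)

lemma clinear_T_act_VA: "clinear (T_act_VA t)"
proof (rule clinearI)
  show "T_act_VA t (x + y) = T_act_VA t x + T_act_VA t y" for x y
    by (induction x rule: VA.abs_induct, induction y rule: VA.abs_induct)
      (simp add: T_act_VA.abs_eq plus_VA.abs_eq clinear_add[OF clinear_T_act_VT])
  show "T_act_VA t (c *\<^sub>C x) = c *\<^sub>C T_act_VA t x" for c x
    by (induction x rule: VA.abs_induct)
      (simp add: T_act_VA.abs_eq scaleC_VA.abs_eq clinear_scale[OF clinear_T_act_VT])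
qed

text \<open>The coefficient of \<open>z\<^sup>p\<close> in the series \<open>Y(z)\<close> or \<open>Y\<^sup>*(z)\<close> acting on \<open>V\<^sub>A\<close>.\<close>

definition VA_gen :: "gen \<Rightarrow> int \<Rightarrow> VA \<Rightarrow> VA"
  where "VA_gen g p = T_act_VA (letter g (- p - 1))"

lemma VA_gen_abs: "VA_gen g p (abs_VA x) = abs_VA (VT_mode g (- p - 1) x)"
  by (simp add: VA_gen_def VT_mode_def T_act_VA.abs_eq)

lemma abs_word: "abs_VA (abs_VT (Poly_Mapping.single (Word ls) 1)) = word_action VA_gen ls VA_vac"
proof (induction ls)
  case Nil
  then show ?case by (simp add: single_Word_Nil VA_vac.abs_eq VT_vac.abs_eq)
next
  case (Cons l ls)
  obtain g n where l: "l = (g, n)" by (cases l)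
  have "VA_gen g (- n - 1) (abs_VA (abs_VT (Poly_Mapping.single (Word ls) 1))) =
      abs_VA (abs_VT (Poly_Mapping.single (Word (l # ls)) 1))"
    by (simp add: l VA_gen_abs VT_mode_def T_act_VT.abs_eq single_Word_Cons)
  then show ?case by (simp add: l Cons)
qed

lemma VA_induct:
  assumes "Q VA_vac" and add: "\<And>u v. Q u \<Longrightarrow> Q v \<Longrightarrow> Q (u + v)" and scale: "\<And>a u. Q u \<Longrightarrow> Q (a *\<^sub>C u)"
    and "\<And>g p u. Q u \<Longrightarrow> Q (VA_gen g p u)"
  shows "Q v"
proof -
  have word: "Q (word_action VA_gen ls VA_vac)" for ls
    by (induction ls) (auto simp: assms)
  obtain p where v: "v = abs_VA (abs_VT p)" using abs_VA_surj abs_VT_surj by metis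
  note lin = clinear_comp[OF clinear_abs_VA clinear_abs_VT]
  have "v = (\<Sum>k\<in>Poly_Mapping.keys p. Poly_Mapping.lookup p k *\<^sub>C word_action VA_gen (letters k) VA_vac)"
    unfolding v by (subst poly_mapping_expand[of p])
      (simp add: clinear_sum[OF lin] clinear_scale[OF lin] flip: abs_word)
  moreover have "Q (sum f K)" if "finite K" "\<And>k. Q (f k)" for f :: "word \<Rightarrow> VA" and K
    using that(1)
  proof induction
    case empty
    show ?case using scale[OF assms(1), of 0] by simp
  qed (simp add: add that(2))
  ultimately show ?thesis by (simp add: scale word)
qed

lemma is_field_VA_gen: "is_field (VA_gen g)"
  unfolding is_field_def
proof (intro conjI allI)
  show "clinear (VA_gen g p)" for p unfolding VA_gen_def by (rule clinear_T_act_VA)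
  fix v
  obtain x where v: "v = abs_VA x" using abs_VA_surj by blast
  obtain N where N: "\<forall>n\<ge>N. VT_mode g n x = 0" using VT_truncation by blast
  have "VA_gen g p v = 0" if "p < - N" for p
    unfolding v VA_gen_abs using N that by (simp add: clinear_zero[OF clinear_abs_VA])
  then show "lower_trunc (\<lambda>p. VA_gen g p v)" unfolding lower_trunc_def by blast
qed

lemma word_in_TT_plus:
  assumes "ls \<noteq> []" "0 \<le> sum_list (map snd ls)"
  shows "Poly_Mapping.single (Word ls) 1 \<in> TT_plus"
proof -
  have "Poly_Mapping.single (Word ls) 1 \<in> T_plus"
    unfolding T_plus_def using assms by (intro complex_vector.span_base) blast
  then have "1 * Poly_Mapping.single (Word ls) 1 \<in> {t * p | t p. p \<in> T_plus}" by blast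
  then show ?thesis unfolding TT_plus_def by (intro complex_vector.span_base) simp
qed

lemma word_action_VA_vac:
  assumes "ls \<noteq> []" "0 \<le> sum_list (map snd ls)"
  shows "word_action VA_gen ls VA_vac = 0"
proof -
  have "abs_VT (Poly_Mapping.single (Word ls) 1) = 0"
    using word_in_TT_plus[OF assms] by (simp add: zero_VT_def VT.abs_eq_iff VT_rel_def)
  then show ?thesis by (simp add: clinear_zero[OF clinear_abs_VA] flip: abs_word)
qed

lemma abs_VA_relation:
  assumes "r \<in> VA_relations"
  shows "abs_VA r = 0"
proof -
  have "T_act_VT 1 r \<in> VA_submodule"
    unfolding VA_submodule_def using assms by (intro complex_vector.span_base) blast
  then show ?thesis by (simp add: T_act_VT_one zero_VA_def VA.abs_eq_iff VA_rel_def)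
qed

lemma same_relation_support:
  "finite {x. (case x of (k, i) \<Rightarrow> exp_coeff k i *\<^sub>C
    VT_mode g (n + int k - int i) (VT_mode g (m + int i) v)) \<noteq> 0}"
  by (rule back_subst[of finite, OF same_relation_finite[of g n m v]]) auto

lemma mixed_relation_support:
  "finite {x. (case x of (k, i) \<Rightarrow> exp_coeff k i *\<^sub>C
    VT_mode Ystar_gen (n + int i) (VT_mode Y_gen (m + int k - int i) v)) \<noteq> 0}"
  by (rule back_subst[of finite, OF mixed_relation_finite[of n m v]]) auto

lemma VA_gen_relation: "gen_relation 1 VA_gen g h"
proof (rule gen_relation_all[OF is_field_VA_gen])
  show "gen_relation 1 VA_gen g g" for g
    unfolding gen_relation_same
  proof (intro allI)
    fix m n v
    obtain x where v: "v = abs_VA x" using abs_VA_surj by blast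
    have "abs_VA (same_relation g m n x) = 0"
      by (rule abs_VA_relation) (unfold VA_relations_def, blast)
    then show "VA_gen g (- m - 1) (VA_gen g (- n - 1) v) + Sum_any (\<lambda>(k, i). exp_coeff k i *\<^sub>C
        VA_gen g (- (n + int k - int i) - 1) (VA_gen g (- (m + int i) - 1) v)) = 0"
      unfolding same_relation_def clinear_add[OF clinear_abs_VA] v
      by (subst (asm) clinear_Sum_any[OF clinear_abs_VA])
        (use same_relation_support[of g n m x] in \<open>simp_all add: VA_gen_abs case_prod_beta clinear_scale[OF clinear_abs_VA]\<close>)
  qed
  show "gen_relation 1 VA_gen Y_gen Ystar_gen"
    unfolding gen_relation_mixed
  proof (intro allI)
    fix m n v
    obtain x where v: "v = abs_VA x" using abs_VA_surj by blast
    have "abs_VA (mixed_relation m n x) = 0"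
      by (rule abs_VA_relation) (unfold VA_relations_def, blast)
    moreover have "abs_VA (if m + n + 1 = 0 then x else 0) = (if m + n + 1 = 0 then v else 0)"
      by (simp add: v clinear_zero[OF clinear_abs_VA])
    ultimately show "VA_gen Y_gen (- m - 1) (VA_gen Ystar_gen (- n - 1) v) + Sum_any (\<lambda>(k, i). exp_coeff k i *\<^sub>C
        VA_gen Ystar_gen (- (n + int i) - 1) (VA_gen Y_gen (- (m + int k - int i) - 1) v)) =
        (if m + n + 1 = 0 then v else 0)"
      unfolding mixed_relation_def clinear_add[OF clinear_abs_VA] clinear_diff[OF clinear_abs_VA]
      by (subst (asm) clinear_Sum_any[OF clinear_abs_VA])
        (use mixed_relation_support[of n m x] in
          \<open>simp_all add: v VA_gen_abs case_prod_beta clinear_scale[OF clinear_abs_VA]\<close>)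
  qed
qed

text \<open>The universal property of V_A, obtained by descending from T through V_T:
  \<open>kill\<close> takes care of the words in the left ideal, \<open>rel\<close> of the imposed
  relations. It yields both the charge grading and the comparison with the Fock space.\<close>

lemma VA_lift:
  fixes A :: "gen \<Rightarrow> int \<Rightarrow> 'w::complex_vector \<Rightarrow> 'w"
  assumes field: "\<And>g. is_field (A g)"
    and rel: "\<And>g h. gen_relation 1 A g h"
    and kill: "\<And>ls. ls \<noteq> [] \<Longrightarrow> 0 \<le> sum_list (map snd ls) \<Longrightarrow> word_action A ls e = 0"
  obtains f where "clinear f" "f VA_vac = e" "\<And>g p v. f (VA_gen g p v) = A g p (f v)"
proof -
  note linA = is_fieldD(1)[OF field]
  define F where "F = linear_extension (\<lambda>w. word_action A (letters w) e)"
  have F: "clinear F" unfolding F_def by (rule clinear_linear_extension)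
  have F_word: "F (Poly_Mapping.single (Word ls) 1) = word_action A ls e" for ls
    by (simp add: F_def)
  have F_letter: "F (letter g n * p) = A g (- n - 1) (F p)" for g n p
  proof (rule linear_eq_on_singles[of "\<lambda>p. F (letter g n * p)" "\<lambda>p. A g (- n - 1) (F p)"])
    fix k
    have "letter g n * Poly_Mapping.single k 1 = Poly_Mapping.single (Word ((g, n) # letters k)) 1"
      by (simp add: letter_def mult_single plus_word_def)
    moreover have "Poly_Mapping.single k 1 = Poly_Mapping.single (Word (letters k)) (1 :: complex)" by simp
    ultimately show "F (letter g n * Poly_Mapping.single k 1) = A g (- n - 1) (F (Poly_Mapping.single k 1))"
      by (simp only: F_word word_action_simps)
  qed (intro clinear_comp[OF F] clinear_comp[OF linA F] clinear_T_mult)+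
  \<comment> \<open>The word in T_+ acts first and gives zero, and every further letter preserves
    zero; so the whole left ideal is killed.\<close>
  have F_base: "F (t * Poly_Mapping.single (Word ls) 1) = 0" if "ls \<noteq> []" "0 \<le> sum_list (map snd ls)" for t ls
  proof (rule linear_eq_on_singles[of "\<lambda>t. F (t * Poly_Mapping.single (Word ls) 1)" "\<lambda>t. 0"])
    fix k
    have "(Poly_Mapping.single k 1 :: T) * Poly_Mapping.single (Word ls) 1 = Poly_Mapping.single (Word (letters k @ ls)) 1"
      by (simp add: mult_single plus_word_def)
    then show "F (Poly_Mapping.single k 1 * Poly_Mapping.single (Word ls) 1) = 0"
      by (simp only: F_word word_action_append kill[OF that] word_action_zero[of A] clinear_zero[OF linA])
  qed (intro clinear_comp[OF F] clinear_T_mult clinear_const_zero)+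
  have F_kill: "F p = 0" if "p \<in> TT_plus" for p
  proof (rule clinear_zero_on_span[OF F _ that[unfolded TT_plus_def]])
    fix x assume "x \<in> {t * p | t p. p \<in> T_plus}"
    then obtain t q where x: "x = t * q" and q: "q \<in> T_plus" by blast
    show "F x = 0"
      unfolding x
      by (rule clinear_zero_on_span[OF clinear_comp[OF F clinear_T_mult(1)] _ q[unfolded T_plus_def]])
        (auto simp: F_base)
  qed
  define F1 where "F1 x = F (rep_VT x)" for x
  have F1_abs: "F1 (abs_VT p) = F p" for p
  proof -
    have "VT_rel (rep_VT (abs_VT p)) p"
      by (metis Quotient3_abs_rep Quotient3_VT VT.abs_eq_iff)
    then show ?thesis
      using F_kill[of "rep_VT (abs_VT p) - p"] clinear_diff[OF F] by (simp add: F1_def VT_rel_def)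
  qed
  have F1: "clinear F1"
  proof (rule clinearI)
    show "F1 (x + y) = F1 x + F1 y" for x y
      by (induction x rule: VT.abs_induct, induction y rule: VT.abs_induct)
        (simp add: plus_VT.abs_eq F1_abs clinear_add[OF F])
    show "F1 (c *\<^sub>C x) = c *\<^sub>C F1 x" for c x
      by (induction x rule: VT.abs_induct) (simp add: scaleC_VT.abs_eq F1_abs clinear_scale[OF F])
  qed
  have F1_mode: "F1 (VT_mode g n x) = A g (- n - 1) (F1 x)" for g n x
    by (induction x rule: VT.abs_induct) (simp add: VT_mode_def T_act_VT.abs_eq F1_abs F_letter)
  have F1_word: "F1 (T_act_VT (Poly_Mapping.single (Word ls) 1) x) = word_action A ls (F1 x)" for ls x
  proof (induction ls)
    case Nil
    then show ?case by (simp add: single_Word_Nil T_act_VT_one)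
  next
    case (Cons l ls)
    obtain g n where l: "l = (g, n)" by (cases l)
    show ?case
      by (simp add: l single_Word_Cons F1_mode[unfolded VT_mode_def] Cons flip: T_act_VT_mult)
  qed
  have F1_rel: "F1 r = 0" if r: "r \<in> VA_relations" for r
  proof -
    consider g m n v where "r = same_relation g m n v" | m n v where "r = mixed_relation m n v"
      using r unfolding VA_relations_def by blast
    then show ?thesis
    proof cases
      case 1
      have *: "A g (- m - 1) (A g (- n - 1) (F1 v)) + Sum_any (\<lambda>(k, i). exp_coeff k i *\<^sub>C
          A g (- (n + int k - int i) - 1) (A g (- (m + int i) - 1) (F1 v))) = 0"
        using rel[of g g] unfolding gen_relation_same by blast
      show ?thesis
        unfolding 1 same_relation_def clinear_add[OF F1]
        by (subst clinear_Sum_any[OF F1])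
          (use same_relation_support[of g n m v] * in
            \<open>simp_all add: F1_mode case_prod_beta clinear_scale[OF F1]\<close>)
    next
      case 2
      have *: "A Y_gen (- m - 1) (A Ystar_gen (- n - 1) (F1 v)) + Sum_any (\<lambda>(k, i). exp_coeff k i *\<^sub>C
          A Ystar_gen (- (n + int i) - 1) (A Y_gen (- (m + int k - int i) - 1) (F1 v))) =
          (if m + n + 1 = 0 then F1 v else 0)"
        using rel[of Y_gen Ystar_gen] unfolding gen_relation_mixed by blast
      have "F1 (if m + n + 1 = 0 then v else 0) = (if m + n + 1 = 0 then F1 v else 0)"
        by (simp add: clinear_zero[OF F1])
      then show ?thesis
        unfolding 2 mixed_relation_def clinear_add[OF F1] clinear_diff[OF F1]
        by (subst clinear_Sum_any[OF F1])
          (use mixed_relation_support[of n m v] * in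
            \<open>simp_all add: F1_mode case_prod_beta clinear_scale[OF F1]\<close>)
    qed
  qed
  have F1_kill: "F1 x = 0" if "x \<in> VA_submodule" for x
  proof (rule clinear_zero_on_span[OF F1 _ that[unfolded VA_submodule_def]])
    fix x assume "x \<in> {T_act_VT t r | t r. r \<in> VA_relations}"
    then obtain t r where x: "x = T_act_VT t r" and r: "r \<in> VA_relations" by blast
    have "F1 (T_act_VT t r) = 0"
    proof (rule linear_eq_on_singles[of "\<lambda>t. F1 (T_act_VT t r)" "\<lambda>t. 0"])
      fix k
      show "F1 (T_act_VT (Poly_Mapping.single k 1) r) = 0"
        using F1_word[of "letters k" r] by (simp add: F1_rel[OF r] word_action_zero[of A] clinear_zero[OF linA])
    qed (intro clinear_comp[OF F1] clinear_T_act_VT_left clinear_const_zero)+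
    then show "F1 x = 0" by (simp add: x)
  qed
  define F2 where "F2 x = F1 (rep_VA x)" for x
  have F2_abs: "F2 (abs_VA x) = F1 x" for x
  proof -
    have "VA_rel (rep_VA (abs_VA x)) x"
      by (metis Quotient3_abs_rep Quotient3_VA VA.abs_eq_iff)
    then show ?thesis
      using F1_kill[of "rep_VA (abs_VA x) - x"] clinear_diff[OF F1] by (simp add: F2_def VA_rel_def)
  qed
  show thesis
  proof (rule that[of F2])
    show "clinear F2"
    proof (rule clinearI)
      show "F2 (x + y) = F2 x + F2 y" for x y
        by (induction x rule: VA.abs_induct, induction y rule: VA.abs_induct)
          (simp add: plus_VA.abs_eq F2_abs clinear_add[OF F1])
      show "F2 (c *\<^sub>C x) = c *\<^sub>C F2 x" for c x
        by (induction x rule: VA.abs_induct) (simp add: scaleC_VA.abs_eq F2_abs clinear_scale[OF F1])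
    qed
    show "F2 VA_vac = e"
      using F_word[of "[]"] by (simp add: VA_vac.abs_eq VT_vac.abs_eq F2_abs F1_abs single_Word_Nil)
    show "F2 (VA_gen g p v) = A g p (F2 v)" for g p v
      by (induction v rule: VA.abs_induct) (simp add: VA_gen_abs F2_abs F1_mode)
  qed
qed

section \<open>The charge grading\<close>

text \<open>The space is V_A tensored with the Laurent polynomials in q, and a generator acts with
  an extra factor q^charge. The map from V_A that fixes the vacuum in degree zero then records
  charges.\<close>

lift_definition charged_gen :: "gen \<Rightarrow> int \<Rightarrow> (int \<Rightarrow>\<^sub>0 VA) \<Rightarrow> (int \<Rightarrow>\<^sub>0 VA)"
  is "\<lambda>g p f c. VA_gen g p (f (c - charge g))"
proof -
  fix g :: gen and p :: int and f :: "int \<Rightarrow> VA"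
  assume "finite {c. f c \<noteq> 0}"
  then have "finite ((\<lambda>c. c + charge g) ` {c. f c \<noteq> 0})" by simp
  moreover have "{c. VA_gen g p (f (c - charge g)) \<noteq> 0} \<subseteq> (\<lambda>c. c + charge g) ` {c. f c \<noteq> 0}"
  proof
    fix c assume "c \<in> {c. VA_gen g p (f (c - charge g)) \<noteq> 0}"
    then have "f (c - charge g) \<noteq> 0" by (auto simp: clinear_zero[OF is_fieldD(1)[OF is_field_VA_gen]])
    moreover have "c = (c - charge g) + charge g" by simp
    ultimately show "c \<in> (\<lambda>c. c + charge g) ` {c. f c \<noteq> 0}" by blast
  qed
  ultimately show "finite {c. VA_gen g p (f (c - charge g)) \<noteq> 0}" by (rule finite_subset[rotated])
qed

lemma clinear_lookup: "clinear (\<lambda>f. Poly_Mapping.lookup f k)"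
  by (rule clinearI) (simp_all add: lookup_add lookup_scaleC)

lemma VA_gen_zero [simp]: "VA_gen g p 0 = 0"
  by (rule clinear_zero[OF is_fieldD(1)[OF is_field_VA_gen]])

lemma charged_gen_single:
  "charged_gen g p (Poly_Mapping.single d v) = Poly_Mapping.single (d + charge g) (VA_gen g p v)"
  by (rule poly_mapping_eqI) (auto simp: charged_gen.rep_eq lookup_single when_def)

lemma is_field_charged_gen: "is_field (charged_gen g)"
  unfolding is_field_def
proof (intro conjI allI)
  note lin = is_fieldD(1)[OF is_field_VA_gen]
  show "clinear (charged_gen g p)" for p
    by (rule clinearI; rule poly_mapping_eqI)
      (simp_all add: charged_gen.rep_eq lookup_add lookup_scaleC clinear_add[OF lin] clinear_scale[OF lin])
  fix f :: "int \<Rightarrow>\<^sub>0 VA"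
  have "\<forall>c. \<exists>N. \<forall>p<N. VA_gen g p (Poly_Mapping.lookup f c) = 0"
    using is_fieldD(2)[OF is_field_VA_gen] by (simp add: lower_trunc_def)
  then obtain N where N: "\<And>c p. p < N c \<Longrightarrow> VA_gen g p (Poly_Mapping.lookup f c) = 0" by metis
  define M where "M = Min (insert 0 (N ` Poly_Mapping.keys f))"
  have "charged_gen g p f = 0" if p: "p < M" for p
  proof (rule poly_mapping_eqI)
    fix c
    show "Poly_Mapping.lookup (charged_gen g p f) c = Poly_Mapping.lookup 0 c"
    proof (cases "c - charge g \<in> Poly_Mapping.keys f")
      case True
      then have "M \<le> N (c - charge g)" unfolding M_def by (intro Min_le) auto
      then show ?thesis using p N[of p "c - charge g"] by (simp add: charged_gen.rep_eq)
    qed (simp add: charged_gen.rep_eq in_keys_iff)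
  qed
  then show "lower_trunc (\<lambda>p. charged_gen g p f)" unfolding lower_trunc_def by blast
qed

text \<open>The relations are homogeneous: the scalar on the right appears only for opposite
  generators, whose charges cancel.\<close>

lemma charged_gen_relation: "gen_relation 1 charged_gen g h"
  unfolding gen_relation_def
proof (intro allI poly_mapping_eqI)
  fix p q :: int and f :: "int \<Rightarrow>\<^sub>0 VA" and c :: int
  let ?v = "Poly_Mapping.lookup f (c - charge g - charge h)"
  let ?x = "fps_exp (- 1 * of_int (charge g * charge h))" and ?y = "fps_exp (1 * of_int (charge g * charge h))"
  note bb = bounded_below2_prod_swapped[OF is_field_charged_gen is_field_charged_gen, of h g f]
  have "Poly_Mapping.lookup (act2 ?x ?y (\<lambda>p q. charged_gen h q (charged_gen g p f)) p q) c =
      act2 ?x ?y (\<lambda>p q. VA_gen h q (VA_gen g p ?v)) p q"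
    by (subst act2_clinear[OF clinear_lookup bb]) (simp add: charged_gen.rep_eq algebra_simps)
  moreover have "VA_gen g p (VA_gen h q ?v) + act2 ?x ?y (\<lambda>p q. VA_gen h q (VA_gen g p ?v)) p q =
      (if g \<noteq> h \<and> p + q + 1 = 0 then ?v else 0)"
    using VA_gen_relation[of g h] unfolding gen_relation_def by blast
  moreover have "(if g \<noteq> h \<and> p + q + 1 = 0 then ?v else 0) =
      Poly_Mapping.lookup (if g \<noteq> h \<and> p + q + 1 = 0 then f else 0) c"
    by (cases g; cases h) (simp_all add: charge_def)
  ultimately show "Poly_Mapping.lookup (charged_gen g p (charged_gen h q f) +
      act2 ?x ?y (\<lambda>p q. charged_gen h q (charged_gen g p f)) p q) c =
      Poly_Mapping.lookup (if g \<noteq> h \<and> p + q + 1 = 0 then f else 0) c"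
    by (simp only: lookup_add charged_gen.rep_eq)
qed

lemma charged_word: "word_action charged_gen ls (Poly_Mapping.single 0 v) =
    Poly_Mapping.single (sum_list (map (charge \<circ> fst) ls)) (word_action VA_gen ls v)"
  by (induction ls) (auto simp: charged_gen_single add.commute)

lemma charge_map_exists:
  "\<exists>f. clinear f \<and> f VA_vac = Poly_Mapping.single 0 VA_vac \<and>
    (\<forall>g p v. f (VA_gen g p v) = charged_gen g p (f v))"
proof -
  have kill: "word_action charged_gen ls (Poly_Mapping.single 0 VA_vac) = 0"
    if "ls \<noteq> []" "0 \<le> sum_list (map snd ls)" for ls
    by (simp add: charged_word word_action_VA_vac[OF that])
  obtain f :: "VA \<Rightarrow> int \<Rightarrow>\<^sub>0 VA" where "clinear f" "f VA_vac = Poly_Mapping.single 0 VA_vac"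
    "\<And>g p v. f (VA_gen g p v) = charged_gen g p (f v)"
    by (rule VA_lift[OF is_field_charged_gen charged_gen_relation kill]) blast+
  then show ?thesis by blast
qed

definition charge_map :: "VA \<Rightarrow> int \<Rightarrow>\<^sub>0 VA"
  where "charge_map = (SOME f. clinear f \<and> f VA_vac = Poly_Mapping.single 0 VA_vac \<and>
    (\<forall>g p v. f (VA_gen g p v) = charged_gen g p (f v)))"

lemma charge_map: "clinear charge_map" "charge_map VA_vac = Poly_Mapping.single 0 VA_vac"
  "charge_map (VA_gen g p v) = charged_gen g p (charge_map v)"
  using someI_ex[OF charge_map_exists] unfolding charge_map_def by blast+

definition charge_part :: "int \<Rightarrow> VA \<Rightarrow> VA"
  where "charge_part c v = Poly_Mapping.lookup (charge_map v) c"

lemma clinear_charge_part: "clinear (charge_part c)"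
  unfolding charge_part_def[abs_def] by (rule clinear_comp[OF clinear_lookup charge_map(1)])

lemma charge_part_vac: "charge_part c VA_vac = (if c = 0 then VA_vac else 0)"
  by (simp add: charge_part_def charge_map(2) lookup_single when_def)

lemma charge_part_gen: "charge_part c (VA_gen g p v) = VA_gen g p (charge_part (c - charge g) v)"
  by (simp add: charge_part_def charge_map(3) charged_gen.rep_eq)

lemma charge_part_finite: "finite {c. charge_part c v \<noteq> 0}"
  unfolding charge_part_def by simp

interpretation VA: graded charge_part
proof (rule graded.intro)
  show "clinear (charge_part c)" for c by (rule clinear_charge_part)
  note lin = clinear_charge_part
  have "\<forall>c d. charge_part c (charge_part d v) = (if c = d then charge_part d v else 0)" for v
    by (rule VA_induct[of _ v])
      (auto simp: charge_part_vac charge_part_gen clinear_zero[OF lin] clinear_add[OF lin] clinear_scale[OF lin])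
  then show "charge_part c (charge_part d v) = (if c = d then charge_part d v else 0)" for c d v by blast
  show "finite {c. charge_part c v \<noteq> 0}" for v by (rule charge_part_finite)
  show "Sum_any (\<lambda>c. charge_part c v) = v" for v
  proof (rule VA_induct[of _ v])
    have "Sum_any (\<lambda>c. charge_part c VA_vac) = (\<Sum>c\<in>{0}. charge_part c VA_vac)"
      by (rule Sum_any_eq_sum) (simp_all add: charge_part_vac)
    then show "Sum_any (\<lambda>c. charge_part c VA_vac) = VA_vac" by (simp add: charge_part_vac)
    show "Sum_any (\<lambda>c. charge_part c (u + v)) = u + v"
      if "Sum_any (\<lambda>c. charge_part c u) = u" "Sum_any (\<lambda>c. charge_part c v) = v" for u v
      by (simp add: clinear_add[OF lin] Sum_any.distrib[OF charge_part_finite charge_part_finite] that)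
    show "Sum_any (\<lambda>c. charge_part c (a *\<^sub>C u)) = a *\<^sub>C u" if "Sum_any (\<lambda>c. charge_part c u) = u" for a u
      unfolding clinear_scale[OF lin]
      using clinear_Sum_any[OF clinear_scaleC[OF clinear_ident] charge_part_finite, of a u, symmetric]
      unfolding that .
    show "Sum_any (\<lambda>c. charge_part c (VA_gen g p u)) = VA_gen g p u"
      if "Sum_any (\<lambda>c. charge_part c u) = u" for g p u
      using clinear_Sum_any[OF is_fieldD(1)[OF is_field_VA_gen] charge_part_finite, of g p u]
        Sum_any_int_shift[of "\<lambda>c. VA_gen g p (charge_part (c - charge g) u)" "charge g"]
      unfolding charge_part_gen that by (simp only: add_diff_cancel_right')
  qed
qed

lemma VA_gen_homog: "VA.homog c v \<Longrightarrow> VA.homog (c + charge g) (VA_gen g p v)"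
  by (simp add: VA.homog_def charge_part_gen)

lemma VA_vac_homog: "VA.homog 0 VA_vac"
  by (simp add: VA.homog_def charge_part_vac)

lemma VA_gen_vac: "p < 0 \<Longrightarrow> VA_gen g p VA_vac = 0"
  using word_action_VA_vac[of "[(g, - p - 1)]"] by simp

definition VA_psi :: "gen \<Rightarrow> int \<Rightarrow> VA \<Rightarrow> VA"
  where "VA_psi = VA.twisted (- 1) VA_gen"

lemma VA_psi_homog:
  assumes "VA.homog r w"
  shows "VA_psi g p w = act (fps_exp (- twist (charge g) r)) (\<lambda>p. VA_gen g p w) p"
  unfolding VA_psi_def using VA.twisted_homog[OF is_field_VA_gen VA_gen_homog assms, of "- 1"] by simp

lemma VA_gen_psi:
  assumes "VA.homog r w"
  shows "VA_gen g p w = act (fps_exp (twist (charge g) r)) (\<lambda>p. VA_psi g p w) p"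
  unfolding VA_psi_homog[OF assms] act_mult[OF is_fieldD(2)[OF is_field_VA_gen]]
  by (simp flip: fps_exp_add_mult)

interpretation VA: fermion charge_part VA_psi VA_vac
proof
  note field = VA.is_field_twisted[OF is_field_VA_gen VA_gen_homog, of "- 1", folded VA_psi_def]
  show "is_field (VA_psi g)" for g by (rule field)
  show "VA.homog (c + charge g) (VA_psi g p v)" if "VA.homog c v" for c v g p
    unfolding VA_psi_def by (rule VA.twisted_shift[OF is_field_VA_gen VA_gen_homog that])
  show "VA_psi g p (VA_psi h q v) + VA_psi h q (VA_psi g p v) = (if g \<noteq> h \<and> p + q + 1 = 0 then v else 0)"
    for g h p q v
  proof -
    \<comment> \<open>The parameter drops from 1 to 0, where the exponentials are trivial and the
      relation is the canonical anticommutation relation.\<close>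
    have "gen_relation (1 + - 1) VA_psi g h"
      unfolding VA_psi_def by (rule VA.gen_relation_twisted[OF is_field_VA_gen VA_gen_homog VA_gen_relation])
    then show ?thesis by (simp add: gen_relation_def)
  qed
  show "VA.homog 0 VA_vac" by (rule VA_vac_homog)
  show "VA_psi g p VA_vac = 0" if "p < 0" for g p
    unfolding VA_psi_homog[OF VA_vac_homog] act_def using that by (simp add: VA_gen_vac)
  fix W :: "VA set"
  assume sub: "complex_vector.subspace W" and vac: "VA_vac \<in> W"
    and st: "\<And>g p v. v \<in> W \<Longrightarrow> VA_psi g p v \<in> W"
  note lin = clinear_charge_part
  \<comment> \<open>The claim concerns all charge components because the generators are combinations
    of fermion modes only on vectors of definite charge, with coefficients depending on that
    charge.\<close>
  have "\<forall>c. charge_part c v \<in> W" for v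
  proof (rule VA_induct[of _ v])
    show "\<forall>c. charge_part c VA_vac \<in> W"
      by (simp add: charge_part_vac vac complex_vector.subspace_0[OF sub])
    show "\<forall>c. charge_part c (u + v) \<in> W" if "\<forall>c. charge_part c u \<in> W" "\<forall>c. charge_part c v \<in> W" for u v
      using that by (simp add: clinear_add[OF lin] complex_vector.subspace_add[OF sub])
    show "\<forall>c. charge_part c (a *\<^sub>C u) \<in> W" if "\<forall>c. charge_part c u \<in> W" for a u
      using that by (simp add: clinear_scale[OF lin] complex_vector.subspace_scale[OF sub])
    show "\<forall>c. charge_part c (VA_gen g p u) \<in> W" if "\<forall>c. charge_part c u \<in> W" for g p u
      unfolding charge_part_gen VA_gen_psi[OF VA.homog_P] act_def Sum_any.expand_set
      by (intro allI complex_vector.subspace_sum[OF sub] complex_vector.subspace_scale[OF sub] st)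
        (use that in blast)
  qed
  then have "v \<in> W" for v
    by (subst VA.sum_P[of v]) (intro complex_vector.subspace_sum[OF sub], blast)
  then show "W = UNIV" by blast
qed

text \<open>The exponential contributes only its constant term, since lower coefficients kill the
  vacuum; so the twisted structure has the prescribed states as generators.\<close>

lemma VA_psi_zero_vac: "VA_psi g 0 VA_vac = VA_gen g 0 VA_vac"
proof -
  have "act f (\<lambda>p. VA_gen g p VA_vac) 0 = (\<Sum>i\<le>0. fps_nth f i *\<^sub>C VA_gen g (0 - int i) VA_vac)" for f
    by (rule act_eq_sum) (simp add: VA_gen_vac)
  then show ?thesis by (simp add: VA_psi_homog[OF VA_vac_homog])
qed

lemma VA_vop_generator: "VA.vop (VA_gen g 0 VA_vac) p w = VA_gen g p w"
proof (rule VA.linear_eq_on_homog[OF VA.clinear_vop is_fieldD(1)[OF is_field_VA_gen]])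
  show "VA.vop (VA_gen g 0 VA_vac) p w = VA_gen g p w" if "VA.homog r w" for r w
    using VA.vop_generator[OF that, of g p] by (simp add: VA_psi_zero_vac VA_gen_psi[OF that])
qed

lemma VA_vmode_generators: "VA.vmode a_tilde = Y_tilde" "VA.vmode b_tilde = Ystar_tilde"
proof -
  have ab: "a_tilde = VA_gen Y_gen 0 VA_vac" "b_tilde = VA_gen Ystar_gen 0 VA_vac"
    by (simp_all add: a_tilde_def b_tilde_def Y_tilde_def Ystar_tilde_def VA_gen_def)
  have "VA.vmode (VA_gen g 0 VA_vac) n = T_act_VA (letter g n)" for g n
    by (rule ext) (simp add: VA.vmode_def VA_vop_generator, simp add: VA_gen_def)
  then show "VA.vmode a_tilde = Y_tilde" "VA.vmode b_tilde = Ystar_tilde"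
    unfolding ab by (intro ext; simp add: Y_tilde_def Ystar_tilde_def)+
qed

section \<open>The Fock space\<close>

text \<open>A basis vector is given by its set of occupied modes.\<close>

type_synonym fock = "int fset \<Rightarrow>\<^sub>0 complex"

text \<open>Symmetric difference with one mode, so that creation and annihilation share a formula
  built from commuting involutions.\<close>

definition toggle :: "int \<Rightarrow> int fset \<Rightarrow> int fset"
  where "toggle i S = (if i |\<in>| S then S |-| {|i|} else finsert i S)"

lemma fmember_toggle: "j |\<in>| toggle i S \<longleftrightarrow> (if j = i then j |\<notin>| S else j |\<in>| S)"
  by (auto simp: toggle_def)

lemma toggle_toggle [simp]: "toggle i (toggle i S) = S"
  by (rule fset_eqI) (auto simp: fmember_toggle)

lemma toggle_commute: "toggle i (toggle j S) = toggle j (toggle i S)"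
  by (rule fset_eqI) (auto simp: fmember_toggle)

lemma sum_toggle:
  fixes f :: "int \<Rightarrow> 'a::ab_group_add"
  shows "sum f (fset (toggle i S)) = sum f (fset S) + (if i |\<in>| S then - f i else f i)"
  by (auto simp: toggle_def sum_diff1 add.commute)

text \<open>The Jordan-Wigner sign.\<close>

definition sign :: "int \<Rightarrow> int fset \<Rightarrow> complex"
  where "sign i S = (- 1) ^ card {j \<in> fset S. j < i}"

lemma sign_square [simp]: "sign i S * sign i S = 1"
  by (simp add: sign_def minus_one_power_square)

lemma sign_toggle: "sign i (toggle j S) = (if j < i then - sign i S else sign i S)"
proof (cases "j < i")
  case True
  let ?A = "{k \<in> fset S. k < i}"
  show ?thesis
  proof (cases "j |\<in>| S")
    case jS: True
    have "{k \<in> fset (toggle j S). k < i} = ?A - {j}" using jS by (auto simp: toggle_def)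
    moreover have "card ?A = Suc (card (?A - {j}))"
      by (rule card.remove) (use True jS in auto)
    ultimately show ?thesis using True by (simp add: sign_def)
  next
    case jS: False
    have "{k \<in> fset (toggle j S). k < i} = insert j ?A" using jS True by (auto simp: toggle_def)
    moreover have "card (insert j ?A) = Suc (card ?A)"
      by (rule card_insert_disjoint) (use jS in auto)
    ultimately show ?thesis using True by (simp add: sign_def)
  qed
next
  case False
  then have "{k \<in> fset (toggle j S). k < i} = {k \<in> fset S. k < i}"
    by (auto simp: toggle_def split: if_splits)
  then show ?thesis using False by (simp add: sign_def)
qed

text \<open>Annihilation (\<open>b = True\<close>) and creation (\<open>b = False\<close>) of the mode \<open>i\<close>.\<close>

definition fock_op :: "bool \<Rightarrow> int \<Rightarrow> fock \<Rightarrow> fock" where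
  "fock_op b i = linear_extension
    (\<lambda>S. if (i |\<in>| S) = b then sign i S *\<^sub>C Poly_Mapping.single (toggle i S) 1 else 0)"

lemma clinear_fock_op: "clinear (fock_op b i)"
  unfolding fock_op_def by (rule clinear_linear_extension)

lemma fock_op_single: "fock_op b i (Poly_Mapping.single S 1) =
    (if (i |\<in>| S) = b then sign i S *\<^sub>C Poly_Mapping.single (toggle i S) 1 else 0)"
  by (simp add: fock_op_def)

lemma fock_op_anticomm:
  "fock_op b i (fock_op c j v) + fock_op c j (fock_op b i v) = (if b \<noteq> c \<and> i = j then v else 0)"
proof (rule linear_eq_on_singles[of "\<lambda>v. fock_op b i (fock_op c j v) + fock_op c j (fock_op b i v)"
      "\<lambda>v. if b \<noteq> c \<and> i = j then v else 0"])
  show "clinear (\<lambda>v. fock_op b i (fock_op c j v) + fock_op c j (fock_op b i v))"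
    by (intro clinear_plus clinear_comp[OF clinear_fock_op clinear_fock_op])
  show "clinear (\<lambda>v :: fock. if b \<noteq> c \<and> i = j then v else 0)" by (rule clinearI) auto
  fix S
  note [simp] = clinear_zero[OF clinear_fock_op] clinear_scale[OF clinear_fock_op]
  show "fock_op b i (fock_op c j (Poly_Mapping.single S 1)) + fock_op c j (fock_op b i (Poly_Mapping.single S 1)) =
      (if b \<noteq> c \<and> i = j then Poly_Mapping.single S 1 else 0)"
  proof (cases "i = j")
    case True
    then show ?thesis
      by (cases "j |\<in>| S"; cases b; cases c) (simp_all add: fock_op_single fmember_toggle sign_toggle)
  next
    case False
    \<comment> \<open>Only the larger of the two modes sees the other one below it, so exactly one
      of the signs flips.\<close>
    have *: "sign j S * sign i (toggle j S) + sign i S * sign j (toggle i S) = 0"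
      using False by (cases "i < j") (simp_all add: sign_toggle)
    have "(sign j S * sign i (toggle j S)) *\<^sub>C Poly_Mapping.single (toggle i (toggle j S)) (1 :: complex) +
      (sign i S * sign j (toggle i S)) *\<^sub>C Poly_Mapping.single (toggle i (toggle j S)) 1 = 0"
      by (simp only: * complex_vector.scale_zero_left flip: complex_vector.scale_left_distrib)
    then show ?thesis
      using False by (simp add: fock_op_single fmember_toggle toggle_commute[of j i])
  qed
qed

text \<open>Occupied modes i \<ge> 0 are quanta of \<open>Y_gen\<close>, occupied i < 0 quanta of
  \<open>Ystar_gen\<close>. Coefficients p and -p - 1 of opposite generators share a mode, one
  creating what the other removes.\<close>

definition mode_index :: "gen \<Rightarrow> int \<Rightarrow> int"
  where "mode_index g p = (case g of Y_gen \<Rightarrow> p | Ystar_gen \<Rightarrow> - p - 1)"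

definition fock_psi :: "gen \<Rightarrow> int \<Rightarrow> fock \<Rightarrow> fock"
  where "fock_psi g p = fock_op (p < 0) (mode_index g p)"

definition fock_charge :: "int fset \<Rightarrow> int"
  where "fock_charge S = (\<Sum>i\<in>fset S. if 0 \<le> i then 1 else - 1)"

text \<open>Twice the conformal weight, which keeps it integral; the coefficient of x^p in a fermion
  changes it by 2p + 1.\<close>

definition fock_weight :: "int fset \<Rightarrow> int"
  where "fock_weight S = (\<Sum>i\<in>fset S. \<bar>2 * i + 1\<bar>)"

lemma fock_toggle:
  assumes "(mode_index g p |\<in>| S) = (p < 0)"
  shows "fock_charge (toggle (mode_index g p) S) = fock_charge S + charge g"
    "fock_weight (toggle (mode_index g p) S) = fock_weight S + (2 * p + 1)"
  using assms by (cases g; auto simp: fock_charge_def fock_weight_def sum_toggle mode_index_def charge_def)+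

lemma fock_psi_support:
  assumes "Poly_Mapping.lookup (fock_psi g p f) S' \<noteq> 0"
  shows "\<exists>S. Poly_Mapping.lookup f S \<noteq> 0 \<and> (mode_index g p |\<in>| S) = (p < 0) \<and> S' = toggle (mode_index g p) S"
proof (rule ccontr)
  assume *: "\<not> ?thesis"
  let ?t = "\<lambda>S. if (mode_index g p |\<in>| S) = (p < 0) then sign (mode_index g p) S *\<^sub>C
    Poly_Mapping.single (toggle (mode_index g p) S) (1::complex) else 0"
  have "Poly_Mapping.lookup (fock_psi g p f) S' =
      (\<Sum>S\<in>Poly_Mapping.keys f. Poly_Mapping.lookup (Poly_Mapping.lookup f S *\<^sub>C ?t S) S')"
    by (simp add: fock_psi_def fock_op_def linear_extension_def lookup_sum)
  also have "\<dots> = 0"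
    by (rule sum.neutral) (use * in \<open>auto simp: lookup_scaleC lookup_single when_def in_keys_iff\<close>)
  finally show False using assms by simp
qed

lemma is_field_fock_psi: "is_field (fock_psi g)"
  unfolding is_field_def
proof (intro conjI allI)
  show "clinear (fock_psi g p)" for p unfolding fock_psi_def by (rule clinear_fock_op)
  fix f :: fock
  \<comment> \<open>Every p whose mode index is i satisfies p \<ge> -|i| - 1. Below the minimum over
    the occupied modes there is nothing left to annihilate.\<close>
  define U where "U = (\<Union>S\<in>Poly_Mapping.keys f. (\<lambda>i. - \<bar>i\<bar> - 1) ` fset S)"
  have fin: "finite U" by (simp add: U_def)
  have "fock_psi g p f = 0" if p: "p < Min (insert 0 U)" for p
  proof (rule poly_mapping_eqI, rule ccontr)
    fix S' assume "Poly_Mapping.lookup (fock_psi g p f) S' \<noteq> Poly_Mapping.lookup 0 S'"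
    then obtain S where S: "Poly_Mapping.lookup f S \<noteq> 0" "(mode_index g p |\<in>| S) = (p < 0)"
      using fock_psi_support[of g p f S'] by auto
    have "Min (insert 0 U) \<le> 0" using fin by simp
    then have p0: "p < 0" using p by linarith
    have "- \<bar>mode_index g p\<bar> - 1 \<in> U" using S p0 by (auto simp: U_def in_keys_iff)
    then have "Min (insert 0 U) \<le> - \<bar>mode_index g p\<bar> - 1" using fin by (intro Min_le) auto
    moreover have "\<bar>mode_index g p\<bar> \<ge> - p - 1" by (cases g) (simp_all add: mode_index_def)
    moreover have "\<bar>mode_index g p\<bar> \<le> - p" using p0 by (cases g) (simp_all add: mode_index_def)
    ultimately show False using p by linarith
  qed
  then show "lower_trunc (\<lambda>p. fock_psi g p f)" unfolding lower_trunc_def by blast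
qed

lemma fock_psi_relation: "gen_relation 0 fock_psi g h"
proof -
  have "(p < 0) \<noteq> (q < 0) \<and> mode_index g p = mode_index h q \<longleftrightarrow> g \<noteq> h \<and> p + q + 1 = 0" for p q
    by (cases g; cases h) (auto simp: mode_index_def)
  then show ?thesis by (simp add: gen_relation_def fock_psi_def fock_op_anticomm)
qed

lift_definition fock_part :: "int \<Rightarrow> fock \<Rightarrow> fock"
  is "\<lambda>c f S. if fock_charge S = c then f S else 0"
  by (erule rev_finite_subset) auto

lemma clinear_fock_part: "clinear (fock_part c)"
  by (rule clinearI; rule poly_mapping_eqI) (simp_all add: fock_part.rep_eq lookup_add lookup_scaleC)

lemma fock_part_single:
  "fock_part c (Poly_Mapping.single S 1) = (if fock_charge S = c then Poly_Mapping.single S 1 else 0)"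
  by (rule poly_mapping_eqI) (auto simp: fock_part.rep_eq lookup_single when_def)

lemma fock_part_psi: "fock_part c (fock_psi g p v) = fock_psi g p (fock_part (c - charge g) v)"
proof (rule linear_eq_on_singles[of "\<lambda>v. fock_part c (fock_psi g p v)"])
  note lin = is_fieldD(1)[OF is_field_fock_psi]
  show "clinear (\<lambda>v. fock_part c (fock_psi g p v))" "clinear (\<lambda>v. fock_psi g p (fock_part (c - charge g) v))"
    by (intro clinear_comp[OF clinear_fock_part lin] clinear_comp[OF lin clinear_fock_part])+
  show "fock_part c (fock_psi g p (Poly_Mapping.single S 1)) =
      fock_psi g p (fock_part (c - charge g) (Poly_Mapping.single S 1))" for S
    using fock_toggle(1)[of g p S]
    by (auto simp: fock_psi_def fock_op_single fock_part_single clinear_zero[OF clinear_fock_part]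
        clinear_zero[OF clinear_fock_op] clinear_scale[OF clinear_fock_part])
qed

interpretation fock: graded fock_part
proof (rule graded.intro)
  show "clinear (fock_part c)" for c by (rule clinear_fock_part)
  show "fock_part c (fock_part d v) = (if c = d then fock_part d v else 0)" for c d v
    by (rule poly_mapping_eqI) (auto simp: fock_part.rep_eq)
  show fin: "finite {c. fock_part c v \<noteq> 0}" for v
  proof (rule finite_subset)
    show "{c. fock_part c v \<noteq> 0} \<subseteq> fock_charge ` Poly_Mapping.keys v"
    proof
      fix c assume "c \<in> {c. fock_part c v \<noteq> 0}"
      then obtain S where "Poly_Mapping.lookup (fock_part c v) S \<noteq> 0"
        by (metis (mono_tags) lookup_zero mem_Collect_eq poly_mapping_eqI)
      then show "c \<in> fock_charge ` Poly_Mapping.keys v"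
        by (auto simp: fock_part.rep_eq in_keys_iff split: if_splits)
    qed
  qed simp
  show "Sum_any (\<lambda>c. fock_part c v) = v" for v
  proof (rule poly_mapping_eqI)
    fix S
    have "Poly_Mapping.lookup (Sum_any (\<lambda>c. fock_part c v)) S =
        Sum_any (\<lambda>c. Poly_Mapping.lookup (fock_part c v) S)"
      by (rule clinear_Sum_any[OF clinear_lookup fin])
    also have "\<dots> = (\<Sum>c\<in>{fock_charge S}. Poly_Mapping.lookup (fock_part c v) S)"
      by (rule Sum_any_eq_sum) (auto simp: fock_part.rep_eq)
    finally show "Poly_Mapping.lookup (Sum_any (\<lambda>c. fock_part c v)) S = Poly_Mapping.lookup v S"
      by (simp add: fock_part.rep_eq)
  qed
qed

lemma fock_psi_homog: "fock.homog c v \<Longrightarrow> fock.homog (c + charge g) (fock_psi g p v)"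
  by (simp add: fock.homog_def fock_part_psi)

text \<open>The exponentials of the twist add terms of lower weight, so the twisted operators are
  not homogeneous for the weight and only upper bounds can be followed.\<close>

definition fock_bounded :: "int \<Rightarrow> fock set"
  where "fock_bounded d = {f. \<forall>S. Poly_Mapping.lookup f S \<noteq> 0 \<longrightarrow> fock_weight S \<le> d}"

lemma fock_bounded_subspace: "complex_vector.subspace (fock_bounded d)"
proof (rule complex_vector.subspaceI)
  show "f + h \<in> fock_bounded d" if "f \<in> fock_bounded d" "h \<in> fock_bounded d" for f h
    unfolding fock_bounded_def mem_Collect_eq
  proof (intro allI impI)
    fix S assume "Poly_Mapping.lookup (f + h) S \<noteq> 0"
    then have "Poly_Mapping.lookup f S \<noteq> 0 \<or> Poly_Mapping.lookup h S \<noteq> 0" by (auto simp: lookup_add)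
    then show "fock_weight S \<le> d" using that by (auto simp: fock_bounded_def)
  qed
qed (auto simp: fock_bounded_def lookup_scaleC)

lemma fock_bounded_psi: "f \<in> fock_bounded d \<Longrightarrow> fock_psi g p f \<in> fock_bounded (d + (2 * p + 1))"
  unfolding fock_bounded_def mem_Collect_eq
proof (intro allI impI)
  fix S' assume f: "\<forall>S. Poly_Mapping.lookup f S \<noteq> 0 \<longrightarrow> fock_weight S \<le> d"
    and "Poly_Mapping.lookup (fock_psi g p f) S' \<noteq> 0"
  then obtain S where "Poly_Mapping.lookup f S \<noteq> 0" "(mode_index g p |\<in>| S) = (p < 0)" "S' = toggle (mode_index g p) S"
    using fock_psi_support by blast
  then show "fock_weight S' \<le> d + (2 * p + 1)" using f fock_toggle(2)[of g p S] by simp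
qed

lemma fock_bounded_mono: "d \<le> d' \<Longrightarrow> fock_bounded d \<subseteq> fock_bounded d'"
  unfolding fock_bounded_def by (auto intro: order_trans)

lemma fock_bounded_part: "f \<in> fock_bounded d \<Longrightarrow> fock_part c f \<in> fock_bounded d"
  by (auto simp: fock_bounded_def fock_part.rep_eq)

lemma fock_bounded_neg:
  assumes "f \<in> fock_bounded d" "d < 0"
  shows "f = 0"
proof (rule poly_mapping_eqI, rule ccontr)
  fix S assume "Poly_Mapping.lookup f S \<noteq> Poly_Mapping.lookup 0 S"
  then have "fock_weight S \<le> d" using assms(1) by (simp add: fock_bounded_def)
  moreover have "0 \<le> fock_weight S" unfolding fock_weight_def by (rule sum_nonneg) simp
  ultimately show False using assms(2) by linarith
qed

definition fock_gen :: "gen \<Rightarrow> int \<Rightarrow> fock \<Rightarrow> fock"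
  where "fock_gen = fock.twisted 1 fock_psi"

lemma fock_bounded_gen:
  assumes "f \<in> fock_bounded d"
  shows "fock_gen g p f \<in> fock_bounded (d + (2 * p + 1))"
  unfolding fock_gen_def fock.twisted_def fock.on_components_def act_def Sum_any.expand_set
proof (intro complex_vector.subspace_sum[OF fock_bounded_subspace] complex_vector.subspace_scale[OF fock_bounded_subspace])
  fix c :: int and i :: nat
  have "fock_psi g (p - int i) (fock_part c f) \<in> fock_bounded (d + (2 * (p - int i) + 1))"
    by (intro fock_bounded_psi fock_bounded_part assms)
  then show "fock_psi g (p - int i) (fock_part c f) \<in> fock_bounded (d + (2 * p + 1))"
    using fock_bounded_mono[of "d + (2 * (p - int i) + 1)" "d + (2 * p + 1)"] by auto
qed

text \<open>A word of length r with mode sum N bounds the doubled weight of its value on the Fock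
  vacuum by -2N - r, which is negative for words in T_+; so these vanish in the model. The universal
  property then sends the vacuum of V_A to a basis vector.\<close>

theorem VA_vac_nonzero: "VA_vac \<noteq> 0"
proof
  assume vac: "VA_vac = 0"
  define e :: fock where "e = Poly_Mapping.single {||} 1"
  have field: "is_field (fock_gen g)" for g
    unfolding fock_gen_def by (rule fock.is_field_twisted[OF is_field_fock_psi fock_psi_homog])
  have rel: "gen_relation 1 fock_gen g h" for g h
    using fock.gen_relation_twisted[OF is_field_fock_psi fock_psi_homog fock_psi_relation, of 1 g h]
    by (simp add: fock_gen_def)
  have "e \<in> fock_bounded 0" by (auto simp: e_def fock_bounded_def fock_weight_def lookup_single when_def)
  then have *: "word_action fock_gen ls e \<in> fock_bounded (- 2 * sum_list (map snd ls) - int (length ls))" for ls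
  proof (induction ls)
    case (Cons l ls)
    obtain g n where l: "l = (g, n)" by (cases l)
    have e: "- 2 * sum_list (map snd ls) - int (length ls) + (2 * (- n - 1) + 1) =
        - 2 * sum_list (map snd (l # ls)) - int (length (l # ls))" by (simp add: l)
    show ?case using fock_bounded_gen[OF Cons.IH[OF Cons.prems], of g "- n - 1"] unfolding e by (simp add: l)
  qed simp
  have kill: "word_action fock_gen ls e = 0" if "ls \<noteq> []" "0 \<le> sum_list (map snd ls)" for ls
    by (rule fock_bounded_neg[OF *[of ls]]) (use that in \<open>cases ls; simp\<close>)
  obtain f where f: "clinear f" "f VA_vac = e"
    by (rule VA_lift[OF field rel kill]) blast+
  then have "e = 0" using clinear_zero[OF f(1)] vac by simp
  then have "Poly_Mapping.lookup e {||} = 0" by simp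
  then show False by (simp add: e_def)
qed

section \<open>Uniqueness of the vertex algebra structure\<close>

text \<open>Negative powers of \<open>x\<^sub>1\<close> beyond those occurring in \<open>Y(u',x\<^sub>1)w\<close> do not occur in the second term of
  the \<open>S\<close>-Jacobi identity; what remains is an associativity relation free of the unknown braiding.\<close>

lemma (in weak_quantum_vertex_algebra) associativity:
  "\<exists>B. \<forall>a b c. b < B \<longrightarrow> expand12 (- a - 1) (\<lambda>b c. Y u (- b - 1) (Y v (- c - 1) w)) b c =
    Sum_any (\<lambda>i::nat. (of_int (- b - 1) gchoose i) *\<^sub>C
      Y (Y u (- (a - int i) - 1) v) (- (b + c + 1 + int i) - 1) w)"
proof -
  obtain vufs where J: "S_jacobi_identity Y u v vufs" using S_jacobi by blast
  have "\<exists>B. \<forall>b<B. \<forall>(v', u', f)\<in>set vufs. Y u' (- b - 1) w = 0"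
  proof -
    have "\<forall>t. \<exists>N. \<forall>n\<ge>N. Y t n w = 0" using lower_truncation by blast
    then obtain N where N: "\<And>t n. n \<ge> N t \<Longrightarrow> Y t n w = 0" by metis
    define B where "B = Min (insert 0 ((\<lambda>(v', u', f). - N u') ` set vufs))"
    have "Y u' (- b - 1) w = 0" if b: "b < B" and m: "(v', u', f) \<in> set vufs" for b v' u' f
    proof (rule N)
      have "B \<le> - N u'" unfolding B_def using m by (intro Min_le) force+
      then show "N u' \<le> - b - 1" using b by linarith
    qed
    then show ?thesis by (intro exI[of _ B]) blast
  qed
  then obtain B where B: "\<And>b v' u' f. b < B \<Longrightarrow> (v', u', f) \<in> set vufs \<Longrightarrow> Y u' (- b - 1) w = 0" by blast
  have "expand12 (- a - 1) (\<lambda>b c. Y u (- b - 1) (Y v (- c - 1) w)) b c =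
    Sum_any (\<lambda>i::nat. (of_int (- b - 1) gchoose i) *\<^sub>C
      Y (Y u (- (a - int i) - 1) v) (- (b + c + 1 + int i) - 1) w)" if b: "b < B" for a b c
  proof -
    let ?F = "\<lambda>(a, b, c). \<Sum>(v', u', f)\<leftarrow>vufs. (fls_reflect f $$ a) *\<^sub>C Y v' (- c - 1) (Y u' (- b - 1) w)"
    have F: "?F (a, b, c) = 0" if "b < B" for a b c
    proof -
      have "(\<Sum>(v', u', f)\<leftarrow>vufs. (fls_reflect f $$ a) *\<^sub>C Y v' (- c - 1) (Y u' (- b - 1) w)) =
          (\<Sum>x\<leftarrow>vufs. 0)"
        by (intro arg_cong[of _ _ sum_list] map_cong refl)
          (auto simp: B[OF that] clinear_zero[OF linear_mode])
      then show ?thesis by simp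
    qed
    \<comment> \<open>Only nonnegative powers of x_1 occur in this delta function, so b - j stays
      below B.\<close>
    have D: "delta_21_0 (i, j, k) *\<^sub>C ?F (a - i, b - j, c - k) = 0" for i j k
    proof (cases "0 \<le> j")
      case True
      then show ?thesis using F[of "b - j"] b by simp
    qed (simp add: delta_21_0_def diff_pow_def)
    have "dist_mult delta_21_0 ?F (a, b, c) = Sum_any (\<lambda>x :: int \<times> int \<times> int. 0)"
      unfolding dist_mult_def prod.case
    proof (rule Sum_any.cong)
      fix x :: "int \<times> int \<times> int"
      obtain i j k where x: "x = (i, j, k)" by (cases x)
      show "(case x of (i, j, k) \<Rightarrow> delta_21_0 (i, j, k) *\<^sub>C (\<Sum>(v', u', f)\<leftarrow>vufs. (fls_reflect f $$ (a - i)) *\<^sub>C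
          Y v' (- (c - k) - 1) (Y u' (- (b - j) - 1) w))) = 0"
        using D[of i j k] by (simp only: x prod.case)
    qed
    then have 0: "dist_mult delta_21_0 ?F (a, b, c) = 0" by simp
    have "dist_mult delta_12_0 (\<lambda>(a, b, c). if a = 0 then Y u (- b - 1) (Y v (- c - 1) w) else 0) (a, b, c) -
        dist_mult delta_21_0 ?F (a, b, c) =
        dist_mult delta_10_2 (\<lambda>(a, b, c). if b = 0 then Y (Y u (- a - 1) v) (- c - 1) w else 0) (a, b, c)"
      using J unfolding S_jacobi_identity_def by blast
    then show ?thesis
      unfolding 0 dist_mult_delta_12_0[of "\<lambda>b c. Y u (- b - 1) (Y v (- c - 1) w)"]
        dist_mult_delta_10_2[of "\<lambda>a c. Y (Y u (- a - 1) v) (- c - 1) w"] by simp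
  qed
  then show ?thesis by blast
qed

lemma int_downward_induct:
  fixes R :: int
  assumes "\<And>r. r \<ge> R \<Longrightarrow> P r" "\<And>r. (\<And>s. s > r \<Longrightarrow> P s) \<Longrightarrow> P r"
  shows "P r"
proof (induction "nat (R - r)" arbitrary: r rule: less_induct)
  case less
  show ?case
  proof (cases "r \<ge> R")
    case False
    show ?thesis
    proof (rule assms(2))
      fix s assume "s > r"
      then show "P s" using False by (intro less) simp
    qed
  qed (rule assms(1))
qed

text \<open>The left-hand side of the associativity relation involves only the operators of u and v,
  on which the structures agree. Comparing the right-hand sides gives a triangular system for the
  operators of the products u_r v, solved by downward induction from large r, where u_r v =
  0.\<close>

lemma weak_quantum_vertex_algebra_unique_step:
  assumes "weak_quantum_vertex_algebra Y vac" "weak_quantum_vertex_algebra Y' vac"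
    and u: "Y u = Y' u" and v: "Y v = Y' v"
  shows "Y (Y u r v) = Y' (Y u r v)"
proof (intro ext)
  fix n w
  interpret A: weak_quantum_vertex_algebra Y vac by fact
  interpret B: weak_quantum_vertex_algebra Y' vac by fact
  define D where "D r n = Y (Y u r v) n w - Y' (Y u r v) n w" for r n
  obtain b1 where b1: "\<And>a b c. b < b1 \<Longrightarrow> expand12 (- a - 1) (\<lambda>b c. Y u (- b - 1) (Y v (- c - 1) w)) b c =
    Sum_any (\<lambda>i::nat. (of_int (- b - 1) gchoose i) *\<^sub>C
      Y (Y u (- (a - int i) - 1) v) (- (b + c + 1 + int i) - 1) w)"
    using A.associativity by blast
  obtain b2 where b2: "\<And>a b c. b < b2 \<Longrightarrow> expand12 (- a - 1) (\<lambda>b c. Y u (- b - 1) (Y v (- c - 1) w)) b c =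
    Sum_any (\<lambda>i::nat. (of_int (- b - 1) gchoose i) *\<^sub>C
      Y' (Y u (- (a - int i) - 1) v) (- (b + c + 1 + int i) - 1) w)"
    using B.associativity[of u v w] unfolding u v by blast
  obtain R where R: "\<And>r. r \<ge> R \<Longrightarrow> Y u r v = 0" using A.lower_truncation by blast
  define b where "b = min b1 b2 - 1"
  have fin: "finite {i::nat. (of_int (- b - 1) gchoose i) *\<^sub>C Z (Y u (- (a - int i) - 1) v) (m i) w \<noteq> 0}"
    if "\<And>n. Z 0 n w = 0" for Z :: "'a \<Rightarrow> int \<Rightarrow> 'a \<Rightarrow> 'a" and a m
  proof (rule finite_subset)
    show "{i::nat. (of_int (- b - 1) gchoose i) *\<^sub>C Z (Y u (- (a - int i) - 1) v) (m i) w \<noteq> 0} \<subseteq> {..nat (R + a + 1)}"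
    proof (intro subsetI, rule ccontr)
      fix i assume i: "i \<in> {i::nat. (of_int (- b - 1) gchoose i) *\<^sub>C Z (Y u (- (a - int i) - 1) v) (m i) w \<noteq> 0}"
        and "i \<notin> {..nat (R + a + 1)}"
      then have "R \<le> - (a - int i) - 1" by auto
      then show False using i that by (simp add: R)
    qed
  qed simp
  have z: "Y 0 n w = 0" "Y' 0 n w = 0" for n
    by (rule clinear_zero[OF A.linear_state], rule clinear_zero[OF B.linear_state])
  have "\<forall>n. D r n = 0"
  proof (rule int_downward_induct[of R "\<lambda>r. \<forall>n. D r n = 0"])
    show "\<forall>n. D r n = 0" if "r \<ge> R" for r by (simp add: D_def R[OF that] z)
    fix r assume IH: "\<And>s. s > r \<Longrightarrow> \<forall>n. D s n = 0"
    show "\<forall>n. D r n = 0"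
    proof
      fix n
      \<comment> \<open>With these a and c the summand i = 0 is the operator of u_r v in mode n,
        with coefficient 1, while the summands i > 0 involve u_(r+i) v and are covered by the
        induction hypothesis.\<close>
      define a where "a = - r - 1"
      define c where "c = - n - b - 2"
      let ?S = "\<lambda>Z i. (of_int (- b - 1) gchoose i :: complex) *\<^sub>C
        Z (Y u (- (a - int i) - 1) v) (- (b + c + 1 + int i) - 1) w"
      have "b < b1" "b < b2" by (simp_all add: b_def)
      then have "Sum_any (?S Y) - Sum_any (?S Y') = 0" using b1[of b a c] b2[of b a c] by simp
      then have "Sum_any (\<lambda>i. ?S Y i - ?S Y' i) = 0" by (subst Sum_any_diff[OF fin fin]) (simp_all add: z)
      also have "(\<lambda>i. ?S Y i - ?S Y' i) =
          (\<lambda>i. (of_int (- b - 1) gchoose i) *\<^sub>C D (r + int i) (n - int i))"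
        by (simp add: D_def a_def c_def fun_eq_iff algebra_simps flip: complex_vector.scale_right_diff_distrib)
      also have "Sum_any (\<lambda>i::nat. (of_int (- b - 1) gchoose i :: complex) *\<^sub>C D (r + int i) (n - int i)) =
          (\<Sum>i\<in>{0}. (of_int (- b - 1) gchoose i) *\<^sub>C D (r + int i) (n - int i))"
      proof (rule Sum_any_eq_sum)
        fix i :: nat assume "i \<notin> {0}"
        then have "D (r + int i) (n - int i) = 0" using IH[of "r + int i"] by simp
        then show "(of_int (- b - 1) gchoose i :: complex) *\<^sub>C D (r + int i) (n - int i) = 0" by simp
      qed simp
      finally show "D r n = 0" by simp
    qed
  qed
  then show "Y (Y u r v) n w = Y' (Y u r v) n w" by (simp add: D_def)
qed

text \<open>The vacuum generates V_A under the modes of the two generating states, so agreement on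
  these states spreads to every vector.\<close>

lemma VA_structure_unique:
  assumes W: "weak_quantum_vertex_algebra Y VA_vac" "weak_quantum_vertex_algebra Y' VA_vac"
    and Y: "Y a_tilde = Y_tilde" "Y b_tilde = Ystar_tilde"
    and Y': "Y' a_tilde = Y_tilde" "Y' b_tilde = Ystar_tilde"
  shows "Y = Y'"
proof
  fix v
  interpret A: weak_quantum_vertex_algebra Y VA_vac by fact
  interpret B: weak_quantum_vertex_algebra Y' VA_vac by fact
  show "Y v = Y' v"
  proof (rule VA_induct[of "\<lambda>v. Y v = Y' v" v])
    show "Y VA_vac = Y' VA_vac" by (simp add: fun_eq_iff A.vacuum B.vacuum)
    show "Y (u + v) = Y' (u + v)" if "Y u = Y' u" "Y v = Y' v" for u v
      using that by (simp add: fun_eq_iff clinear_add[OF A.linear_state] clinear_add[OF B.linear_state])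
    show "Y (a *\<^sub>C u) = Y' (a *\<^sub>C u)" if "Y u = Y' u" for a u
      using that by (simp add: fun_eq_iff clinear_scale[OF A.linear_state] clinear_scale[OF B.linear_state])
    show "Y (VA_gen g p u) = Y' (VA_gen g p u)" if "Y u = Y' u" for g p u
    proof (cases g)
      case Y_gen
      then have "VA_gen g p u = Y a_tilde (- p - 1) u" by (simp add: Y VA_gen_def Y_tilde_def)
      then show ?thesis
        using weak_quantum_vertex_algebra_unique_step[OF W _ that, of a_tilde] Y Y' by simp
    next
      case Ystar_gen
      then have "VA_gen g p u = Y b_tilde (- p - 1) u" by (simp add: Y VA_gen_def Ystar_tilde_def)
      then show ?thesis
        using weak_quantum_vertex_algebra_unique_step[OF W _ that, of b_tilde] Y Y' by simp
    qed
  qed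
qed

lemma VA_Y_eq: "VA_Y = VA.vmode"
  unfolding VA_Y_def
proof (rule the_equality)
  show *: "weak_quantum_vertex_algebra VA.vmode VA_vac \<and> VA.vmode a_tilde = Y_tilde \<and> VA.vmode b_tilde = Ystar_tilde"
    using VA.vmode_weak_quantum_vertex_algebra VA_vmode_generators by blast
  show "Y = VA.vmode"
    if "weak_quantum_vertex_algebra Y VA_vac \<and> Y a_tilde = Y_tilde \<and> Y b_tilde = Ystar_tilde" for Y
    using that * by (intro VA_structure_unique) blast+
qed

theorem theorem4p10:
  shows "(\<exists>S. quantum_vertex_algebra VA_Y VA_vac S) \<and> irreducible_over_itself VA_Y"
  unfolding VA_Y_eq
  using VA.vmode_quantum_vertex_algebra VA.vmode_irreducible[OF VA_vac_nonzero] by blast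

end
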